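(* Let $H$ be a complex pointed Hopf algebra whose group $G=G(H)$ of group-like elements is a finite real group. If $H$ is not of $-1$-type, then $H$ is infinite dimensional.
   Context: $k=\mathbb{C}$. An element $s\in G$ is real if $s$ and $s^{-1}$ are conjugate in $G$; $G$ is real if all its elements are real. $G^s$ denotes the centralizer of $s$, ${\mathcal O}_s$ its conjugacy class, ${\mathcal K}(G)$ the set of conjugacy classes. For a pointed Hopf algebra $H$ with $G=G(H)$, let ${\rm gr}(H)$ be the graded Hopf algebra of the coradical filtration, $\pi_0:{\rm gr}(H)\to kG$ the projection on degree $0$, and let the (filter) diagram be ${\rm diag}_{\rm filt}(H)=\{x\in{\rm gr}(H)\mid({\rm id}\otimes\pi_0)\Delta(x)=x\otimes1\}$, a graded braided Hopf algebra in ${}^{kG}_{kG}{\mathcal{YD}}$ with degree one part ${\rm diag}_{\rm filt}(H)_{(1)}$. The Nichols algebra of $H$ is $\mathfrak{B}({\rm diag}_{\rm filt}(H)_{(1)})$. For $s\in G$ and an irreducible representation $(\rho,V)$ of $G^s$: let $t_1=s,\dots,t_m$ be a numeration of ${\mathcal O}_s$, $g_isg_i^{-1}=t_i$; $M({\mathcal O}_s,\rho)=\bigoplus_ig_i\otimes V$ with $\delta(g_iv)=t_i\otimes g_iv$, $h\cdot(g_iv)=g_j(\gamma\cdot v)$ where $hg_i=g_j\gamma$, $\gamma\in G^s$. These are the simple YD modules over $kG$, and every YD module over $kG$ is a direct sum of such modules. $-1$-type: a ramification system with irreducible representations ${\rm RSR}(G,r,\overrightarrow\rho,u)$ amounts to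 choosing $u(C)\in C$ for each conjugacy class $C$, a set ${\mathcal K}_r(G)$ of conjugacy classes, and for each $C\in{\mathcal K}_r(G)$ a finite nonempty family of irreducible representations $\rho_C^{(i)}$ ($i\in I_C(r,u)$) of $G^{u(C)}$, with characters $\chi_C^{(i)}$; its Nichols algebra is $\mathfrak{B}(G,r,\overrightarrow\rho,u)=\mathfrak{B}\big(\bigoplus_{C\in{\mathcal K}_r(G),\,i\in I_C(r,u)}M({\mathcal O}_{u(C)},\rho_C^{(i)})\big)$. (In the paper the $\rho_C^{(i)}$ act from the right; a right representation is turned into the left one used here by letting $g$ act as $v\mapsto v\cdot g^{-1}$. This does not affect the condition below.) The RSR is of $-1$-type if for every $C\in{\mathcal K}_r(G)$ and $i\in I_C(r,u)$: $u(C)$ is real, the order of $u(C)$ is even, and $\chi_C^{(i)}(u(C))=-\chi_C^{(i)}(1)$. A Nichols algebra $R$ over $G$ is of $-1$-type if there is an RSR over $G$ of $-1$-type with $(kG,R)\cong(kG,\mathfrak{B}(G,r,\overrightarrow\rho,u))$ as graded pull-push YD Hopf algebras, i.e. there are a Hopf algebra automorphism $\phi$ of $kG$ and a graded algebra and coalgebra isomorphism $\psi$ with $\psi(b\cdot x)=\phi(b)\cdot\psi(x)$ and $\delta(\psi(x))=(\phi\otimes\psi)\delta(x)$. $H$ is of $-1$-type if its Nichols algebra is of $-1$-type. *)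

theory Defs
  imports
    "HOL-Algebra.QuotRing"
    "HOL-Algebra.Multiplicative_Group"
    "HOL-Library.Poly_Mapping"
    "Jordan_Normal_Form.VS_Connect"
begin

section \<open>Complex vector spaces: spans, free spaces, quotients, tensor products, direct sums\<close>

text \<open>Vector spaces and algebras over the complex numbers are \<^type>\<open>module\<close> records over
  \<^const>\<open>class_ring\<close>. On records that are only vector spaces the fields \<open>mult\<close> and \<open>one\<close>
  carry no meaning.\<close>

abbreviation CC :: "complex ring" where
  "CC \<equiv> class_ring"

abbreviation lspan :: "(complex, 'v, 'm) module_scheme \<Rightarrow> 'v set \<Rightarrow> 'v set" where
  "lspan V S \<equiv> module.span CC V S"

definition complex_mod :: "(complex, complex) module" where
  "complex_mod = \<lparr>carrier = UNIV, mult = (*), one = 1, zero = 0, add = (+), smult = (*)\<rparr>"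

text \<open>The monoid algebra \<open>k[G]\<close>; the group algebra and the free algebra are instances.
  As a vector space it is the free space on \<open>carrier G\<close>.\<close>

definition conv :: "('x \<Rightarrow> 'x \<Rightarrow> 'x) \<Rightarrow> ('x \<Rightarrow>\<^sub>0 complex) \<Rightarrow> ('x \<Rightarrow>\<^sub>0 complex) \<Rightarrow> ('x \<Rightarrow>\<^sub>0 complex)" where
  "conv m p q = (\<Sum>x\<in>Poly_Mapping.keys p. \<Sum>y\<in>Poly_Mapping.keys q.
     Poly_Mapping.single (m x y) (Poly_Mapping.lookup p x * Poly_Mapping.lookup q y))"

definition monoid_algebra :: "('x, 'm) monoid_scheme \<Rightarrow> (complex, 'x \<Rightarrow>\<^sub>0 complex) module" where
  "monoid_algebra G =
    \<lparr>carrier = {p. Poly_Mapping.keys p \<subseteq> carrier G},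
     mult = conv (monoid.mult G),
     one = Poly_Mapping.single (monoid.one G) 1,
     zero = 0,
     add = (+),
     smult = (\<lambda>c. Poly_Mapping.map ((*) c))\<rparr>"

definition free_space :: "'x set \<Rightarrow> (complex, 'x \<Rightarrow>\<^sub>0 complex) module" where
  "free_space S =
    \<lparr>carrier = {p. Poly_Mapping.keys p \<subseteq> S},
     mult = undefined,
     one = undefined,
     zero = 0,
     add = (+),
     smult = (\<lambda>c. Poly_Mapping.map ((*) c))\<rparr>"

text \<open>Quotient of a vector space by a subspace, or of an algebra by a two-sided ideal: the ring
  part is that of \<^const>\<open>FactRing\<close>.\<close>

definition quot_alg :: "(complex, 'x, 'm) module_scheme \<Rightarrow> 'x set \<Rightarrow> (complex, 'x set) module" where
  "quot_alg M N =
    \<lparr>carrier = a_rcosets\<^bsub>M\<^esub> N,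
     mult = rcoset_mult M N,
     one = N +>\<^bsub>M\<^esub> \<one>\<^bsub>M\<^esub>,
     zero = N,
     add = set_add M,
     smult = (\<lambda>c X. \<Union>x\<in>X. N +>\<^bsub>M\<^esub> (c \<odot>\<^bsub>M\<^esub> x))\<rparr>"

text \<open>The value at the formal linear combination \<open>p\<close> of the linear extension of \<open>f\<close>, and the value
  at a class \<open>t\<close> of such combinations, computed on an arbitrary representative. The latter is used
  only for \<open>f\<close> compatible with the relations defining \<open>t\<close>. On tensors,
  \<open>class_ext X (\<lambda>(a, b). f a b) t\<close> is what Sweedler notation writes as the sum of
  \<open>f t\<^sub>1 t\<^sub>2\<close>.\<close>

definition lin_ext :: "(complex, 'y, 'm) module_scheme \<Rightarrow> ('x \<Rightarrow> 'y) \<Rightarrow> ('x \<Rightarrow>\<^sub>0 complex) \<Rightarrow> 'y" where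
  "lin_ext X f p = finsum X (\<lambda>k. Poly_Mapping.lookup p k \<odot>\<^bsub>X\<^esub> f k) (Poly_Mapping.keys p)"

definition class_ext :: "(complex, 'y, 'm) module_scheme \<Rightarrow> ('x \<Rightarrow> 'y) \<Rightarrow> ('x \<Rightarrow>\<^sub>0 complex) set \<Rightarrow> 'y" where
  "class_ext X f t = lin_ext X f (SOME p. p \<in> t)"

type_synonym ('v, 'w) tens = "('v \<times> 'w \<Rightarrow>\<^sub>0 complex) set"

definition tensor_rels ::
  "(complex, 'v, 'm) module_scheme \<Rightarrow> (complex, 'w, 'n) module_scheme \<Rightarrow> ('v \<times> 'w \<Rightarrow>\<^sub>0 complex) set" where
  "tensor_rels V W =
     {Poly_Mapping.single (v \<oplus>\<^bsub>V\<^esub> v', w) 1 - Poly_Mapping.single (v, w) 1 - Poly_Mapping.single (v', w) 1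
       | v v' w. v \<in> carrier V \<and> v' \<in> carrier V \<and> w \<in> carrier W}
   \<union> {Poly_Mapping.single (v, w \<oplus>\<^bsub>W\<^esub> w') 1 - Poly_Mapping.single (v, w) 1 - Poly_Mapping.single (v, w') 1
       | v w w'. v \<in> carrier V \<and> w \<in> carrier W \<and> w' \<in> carrier W}
   \<union> {Poly_Mapping.single (c \<odot>\<^bsub>V\<^esub> v, w) 1 - Poly_Mapping.single (v, w) c
       | c v w. v \<in> carrier V \<and> w \<in> carrier W}
   \<union> {Poly_Mapping.single (v, c \<odot>\<^bsub>W\<^esub> w) 1 - Poly_Mapping.single (v, w) c
       | c v w. v \<in> carrier V \<and> w \<in> carrier W}"

definition tensor_null ::
  "(complex, 'v, 'm) module_scheme \<Rightarrow> (complex, 'w, 'n) module_scheme \<Rightarrow> ('v \<times> 'w \<Rightarrow>\<^sub>0 complex) set" where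
  "tensor_null V W = lspan (free_space (carrier V \<times> carrier W)) (tensor_rels V W)"

definition tensor ::
  "(complex, 'v, 'm) module_scheme \<Rightarrow> (complex, 'w, 'n) module_scheme \<Rightarrow> (complex, ('v, 'w) tens) module" where
  "tensor V W = quot_alg (free_space (carrier V \<times> carrier W)) (tensor_null V W)"

definition pure ::
  "(complex, 'v, 'm) module_scheme \<Rightarrow> (complex, 'w, 'n) module_scheme \<Rightarrow> 'v \<Rightarrow> 'w \<Rightarrow> ('v, 'w) tens" where
  "pure V W v w = tensor_null V W +>\<^bsub>free_space (carrier V \<times> carrier W)\<^esub> Poly_Mapping.single (v, w) 1"

text \<open>Only the codomain of \<open>f \<otimes> g\<close> is an argument of \<open>tensor_map\<close>. Since \<open>tensor A C\<close> for
  subspaces \<open>A\<close> and \<open>C\<close> is not literally contained in \<open>tensor V W\<close>, its image there is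
  given by \<open>tensor_span\<close>.\<close>

definition tensor_map ::
  "(complex, 'v2, 'm) module_scheme \<Rightarrow> (complex, 'w2, 'n) module_scheme \<Rightarrow>
   ('v1 \<Rightarrow> 'v2) \<Rightarrow> ('w1 \<Rightarrow> 'w2) \<Rightarrow> ('v1, 'w1) tens \<Rightarrow> ('v2, 'w2) tens" where
  "tensor_map V' W' f g t = class_ext (tensor V' W') (\<lambda>(a, b). pure V' W' (f a) (g b)) t"

definition tensor_span ::
  "(complex, 'v, 'm) module_scheme \<Rightarrow> (complex, 'w, 'n) module_scheme \<Rightarrow> 'v set \<Rightarrow> 'w set \<Rightarrow> ('v, 'w) tens set" where
  "tensor_span V W A C = lspan (tensor V W) {pure V W a c | a c. a \<in> A \<and> c \<in> C}"

definition direct_sum ::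
  "'i set \<Rightarrow> ('i \<Rightarrow> (complex, 'v, 'm) module_scheme) \<Rightarrow> (complex, 'i \<Rightarrow> 'v) module" where
  "direct_sum I M =
    \<lparr>carrier = {f \<in> (\<Pi>\<^sub>E i\<in>I. carrier (M i)). finite {i \<in> I. f i \<noteq> \<zero>\<^bsub>M i\<^esub>}},
     mult = undefined,
     one = undefined,
     zero = (\<lambda>i\<in>I. \<zero>\<^bsub>M i\<^esub>),
     add = (\<lambda>f g. \<lambda>i\<in>I. f i \<oplus>\<^bsub>M i\<^esub> g i),
     smult = (\<lambda>c f. \<lambda>i\<in>I. c \<odot>\<^bsub>M i\<^esub> f i)\<rparr>"

definition summand_in ::
  "'i set \<Rightarrow> ('i \<Rightarrow> (complex, 'v, 'm) module_scheme) \<Rightarrow> 'i \<Rightarrow> 'v \<Rightarrow> ('i \<Rightarrow> 'v)" where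
  "summand_in I M i x = (\<lambda>j\<in>I. if j = i then x else \<zero>\<^bsub>M j\<^esub>)"


section \<open>Hopf algebras\<close>

record 'h hopf = "(complex, 'h) module" +
  comult :: "'h \<Rightarrow> ('h, 'h) tens"
  counit :: "'h \<Rightarrow> complex"

definition tensor_mult :: "(complex, 'h, 'm) module_scheme \<Rightarrow> ('h, 'h) tens \<Rightarrow> ('h, 'h) tens \<Rightarrow> ('h, 'h) tens" where
  "tensor_mult H s t =
     class_ext (tensor H H) (\<lambda>(a, b). class_ext (tensor H H)
       (\<lambda>(c, d). pure H H (a \<otimes>\<^bsub>H\<^esub> c) (b \<otimes>\<^bsub>H\<^esub> d)) t) s"

definition assoc_algebra :: "(complex, 'h, 'm) module_scheme \<Rightarrow> bool" where
  "assoc_algebra H \<longleftrightarrow> vectorspace CC H \<and> ring H \<and>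
     (\<forall>c. \<forall>x\<in>carrier H. \<forall>y\<in>carrier H.
        (c \<odot>\<^bsub>H\<^esub> x) \<otimes>\<^bsub>H\<^esub> y = c \<odot>\<^bsub>H\<^esub> (x \<otimes>\<^bsub>H\<^esub> y) \<and>
        x \<otimes>\<^bsub>H\<^esub> (c \<odot>\<^bsub>H\<^esub> y) = c \<odot>\<^bsub>H\<^esub> (x \<otimes>\<^bsub>H\<^esub> y))"

definition coalgebra :: "('h, 'm) hopf_scheme \<Rightarrow> bool" where
  "coalgebra H \<longleftrightarrow> vectorspace CC H \<and>
     comult H \<in> module_hom CC H (tensor H H) \<and>
     counit H \<in> module_hom CC H complex_mod \<and>
     (\<forall>x\<in>carrier H.
        class_ext (tensor H (tensor H H)) (\<lambda>(a, b). class_ext (tensor H (tensor H H))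
          (\<lambda>(b1, b2). pure H (tensor H H) a (pure H H b1 b2)) (comult H b)) (comult H x)
      = class_ext (tensor H (tensor H H)) (\<lambda>(a, b). class_ext (tensor H (tensor H H))
          (\<lambda>(a1, a2). pure H (tensor H H) a1 (pure H H a2 b)) (comult H a)) (comult H x)) \<and>
     (\<forall>x\<in>carrier H.
        class_ext H (\<lambda>(a, b). counit H a \<odot>\<^bsub>H\<^esub> b) (comult H x) = x \<and>
        class_ext H (\<lambda>(a, b). counit H b \<odot>\<^bsub>H\<^esub> a) (comult H x) = x)"

definition bialgebra :: "('h, 'm) hopf_scheme \<Rightarrow> bool" where
  "bialgebra H \<longleftrightarrow> assoc_algebra H \<and> coalgebra H \<and>
     comult H \<one>\<^bsub>H\<^esub> = pure H H \<one>\<^bsub>H\<^esub> \<one>\<^bsub>H\<^esub> \<and> counit H \<one>\<^bsub>H\<^esub> = 1 \<and>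
     (\<forall>x\<in>carrier H. \<forall>y\<in>carrier H.
        comult H (x \<otimes>\<^bsub>H\<^esub> y) = tensor_mult H (comult H x) (comult H y) \<and>
        counit H (x \<otimes>\<^bsub>H\<^esub> y) = counit H x * counit H y)"

definition hopf_algebra :: "('h, 'm) hopf_scheme \<Rightarrow> bool" where
  "hopf_algebra H \<longleftrightarrow> bialgebra H \<and>
     (\<exists>S \<in> module_hom CC H H. \<forall>x\<in>carrier H.
        class_ext H (\<lambda>(a, b). S a \<otimes>\<^bsub>H\<^esub> b) (comult H x) = counit H x \<odot>\<^bsub>H\<^esub> \<one>\<^bsub>H\<^esub> \<and>
        class_ext H (\<lambda>(a, b). a \<otimes>\<^bsub>H\<^esub> S b) (comult H x) = counit H x \<odot>\<^bsub>H\<^esub> \<one>\<^bsub>H\<^esub>)"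

definition hopf_automorphism :: "('h, 'm) hopf_scheme \<Rightarrow> ('h \<Rightarrow> 'h) \<Rightarrow> bool" where
  "hopf_automorphism H f \<longleftrightarrow> bij_betw f (carrier H) (carrier H) \<and>
     f \<in> module_hom CC H H \<and> f \<in> Ring.ring_hom H H \<and>
     (\<forall>x\<in>carrier H. comult H (f x) = tensor_map H H f f (comult H x) \<and> counit H (f x) = counit H x)"

definition group_algebra :: "('g, 'm) monoid_scheme \<Rightarrow> ('g \<Rightarrow>\<^sub>0 complex) hopf" where
  "group_algebra G = (let A = monoid_algebra G in
     module.extend A (hopf.fields
       (lin_ext (tensor A A) (\<lambda>g. pure A A (Poly_Mapping.single g 1) (Poly_Mapping.single g 1)))
       (lin_ext complex_mod (\<lambda>g. 1))))"


section \<open>Group-like elements, coradical filtration and the diagram\<close>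

definition grouplikes :: "('h, 'm) hopf_scheme \<Rightarrow> 'h monoid" where
  "grouplikes H =
    \<lparr>carrier = {g \<in> carrier H. g \<noteq> \<zero>\<^bsub>H\<^esub> \<and> comult H g = pure H H g g},
     mult = monoid.mult H,
     one = \<one>\<^bsub>H\<^esub>\<rparr>"

definition subcoalgebra :: "'h set \<Rightarrow> ('h, 'm) hopf_scheme \<Rightarrow> bool" where
  "subcoalgebra C H \<longleftrightarrow> subspace CC C H \<and> comult H ` C \<subseteq> tensor_span H H C C"

definition simple_subcoalgebra :: "'h set \<Rightarrow> ('h, 'm) hopf_scheme \<Rightarrow> bool" where
  "simple_subcoalgebra C H \<longleftrightarrow> subcoalgebra C H \<and> C \<noteq> {\<zero>\<^bsub>H\<^esub>} \<and>
     (\<forall>D. subcoalgebra D H \<and> D \<subseteq> C \<longrightarrow> D = {\<zero>\<^bsub>H\<^esub>} \<or> D = C)"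

definition pointed :: "('h, 'm) hopf_scheme \<Rightarrow> bool" where
  "pointed H \<longleftrightarrow> (\<forall>C. simple_subcoalgebra C H \<longrightarrow>
     vectorspace.fin_dim CC (H\<lparr>carrier := C\<rparr>) \<and> vectorspace.dim CC (H\<lparr>carrier := C\<rparr>) = 1)"

definition coradical :: "('h, 'm) hopf_scheme \<Rightarrow> 'h set" where
  "coradical H = lspan H (\<Union>{C. simple_subcoalgebra C H})"

primrec corad_filt :: "('h, 'm) hopf_scheme \<Rightarrow> nat \<Rightarrow> 'h set" where
  "corad_filt H 0 = coradical H"
| "corad_filt H (Suc n) = {x \<in> carrier H. comult H x \<in>
     tensor_span H H (carrier H) (corad_filt H n) <+>\<^bsub>tensor H H\<^esub> tensor_span H H (coradical H) (carrier H)}"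

definition corad_lower :: "('h, 'm) hopf_scheme \<Rightarrow> nat \<Rightarrow> 'h set" where
  "corad_lower H n = (case n of 0 \<Rightarrow> {\<zero>\<^bsub>H\<^esub>} | Suc m \<Rightarrow> corad_filt H m)"

definition gr_comp :: "('h, 'm) hopf_scheme \<Rightarrow> nat \<Rightarrow> (complex, 'h set) module" where
  "gr_comp H n = quot_alg (H\<lparr>carrier := corad_filt H n\<rparr>) (corad_lower H n)"

definition gr_space :: "('h, 'm) hopf_scheme \<Rightarrow> (complex, nat \<Rightarrow> 'h set) module" where
  "gr_space H = direct_sum UNIV (gr_comp H)"

definition gr_class :: "('h, 'm) hopf_scheme \<Rightarrow> nat \<Rightarrow> 'h \<Rightarrow> (nat \<Rightarrow> 'h set)" where
  "gr_class H n x = summand_in UNIV (gr_comp H) n (corad_lower H n +>\<^bsub>H\<^esub> x)"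

definition gr_degree :: "('h, 'm) hopf_scheme \<Rightarrow> nat \<Rightarrow> (nat \<Rightarrow> 'h set) set" where
  "gr_degree H n = gr_class H n ` corad_filt H n"

definition gr_mult :: "('h, 'm) hopf_scheme \<Rightarrow> (nat \<Rightarrow> 'h set) \<Rightarrow> (nat \<Rightarrow> 'h set) \<Rightarrow> (nat \<Rightarrow> 'h set)" where
  "gr_mult H x y = (\<lambda>n. finsum (gr_comp H n)
     (\<lambda>i. \<Union>a\<in>x i. \<Union>b\<in>y (n - i). corad_lower H n +>\<^bsub>H\<^esub> (a \<otimes>\<^bsub>H\<^esub> b)) {..n})"

text \<open>For \<open>x\<close> in \<open>H\<^sub>n\<close> one may write \<open>\<Delta>(x)\<close> as a sum of tensors \<open>a \<otimes> b\<close> with \<open>a \<in> H\<^sub>d\<close> and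
  \<open>b \<in> H\<^bsub>n-d\<^esub>\<close>, where \<open>d \<le> n\<close> depends on the summand; the sum of the tensors of their classes
  in degrees \<open>d\<close> and \<open>n - d\<close> does not depend on the choices and is the comultiplication of the
  class of \<open>x\<close>.\<close>

definition gr_comult_hom :: "('h, 'm) hopf_scheme \<Rightarrow> nat \<Rightarrow> 'h \<Rightarrow> (nat \<Rightarrow> 'h set, nat \<Rightarrow> 'h set) tens" where
  "gr_comult_hom H n x = (SOME t. \<exists>p d. p \<in> comult H x \<and>
     (\<forall>(a, b)\<in>Poly_Mapping.keys p. d (a, b) \<le> n \<and>
        a \<in> corad_filt H (d (a, b)) \<and> b \<in> corad_filt H (n - d (a, b))) \<and>
     t = lin_ext (tensor (gr_space H) (gr_space H))
           (\<lambda>(a, b). pure (gr_space H) (gr_space H)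
              (gr_class H (d (a, b)) a) (gr_class H (n - d (a, b)) b)) p)"

definition gr_comult :: "('h, 'm) hopf_scheme \<Rightarrow> (nat \<Rightarrow> 'h set) \<Rightarrow> (nat \<Rightarrow> 'h set, nat \<Rightarrow> 'h set) tens" where
  "gr_comult H x = finsum (tensor (gr_space H) (gr_space H))
     (\<lambda>n. gr_comult_hom H n (SOME a. a \<in> x n)) {n. x n \<noteq> \<zero>\<^bsub>gr_comp H n\<^esub>}"

definition gr :: "('h, 'm) hopf_scheme \<Rightarrow> (nat \<Rightarrow> 'h set) hopf" where
  "gr H = module.extend
     (gr_space H\<lparr>mult := gr_mult H, one := gr_class H 0 \<one>\<^bsub>H\<^esub>\<rparr>)
     (hopf.fields (gr_comult H) (\<lambda>x. counit H (SOME a. a \<in> x 0)))"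

text \<open>The projection onto degree \<open>0\<close>, where \<open>gr(H)(0) = H\<^sub>0\<close> is identified with the group
  algebra \<open>kG\<close> of the group-like elements; \<open>x 0\<close> is a coset of the zero space, i.e. a
  singleton.\<close>

definition proj0 :: "('h, 'm) hopf_scheme \<Rightarrow> (nat \<Rightarrow> 'h set) \<Rightarrow> ('h \<Rightarrow>\<^sub>0 complex)" where
  "proj0 H x = (THE p. p \<in> carrier (group_algebra (grouplikes H)) \<and> lin_ext H (\<lambda>g. g) p \<in> x 0)"

definition diag_filt :: "('h, 'm) hopf_scheme \<Rightarrow> (nat \<Rightarrow> 'h set) set" where
  "diag_filt H = (let kG = group_algebra (grouplikes H) in
     {x \<in> carrier (gr H).
        tensor_map (gr H) kG (\<lambda>y. y) (proj0 H) (comult (gr H) x) = pure (gr H) kG x \<one>\<^bsub>kG\<^esub>})"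


section \<open>Yetter-Drinfeld modules, braided Hopf algebras and Nichols algebras\<close>

text \<open>Left-left Yetter-Drinfeld modules over a Hopf algebra with elements of type \<open>'b\<close>, and graded
  braided Hopf algebras in the category of these.\<close>

record ('b, 'v) yd = "(complex, 'v) module" +
  act :: "'b \<Rightarrow> 'v \<Rightarrow> 'v"
  coact :: "'v \<Rightarrow> ('b, 'v) tens"

record ('b, 'v) yd_hopf = "('b, 'v) yd" +
  bcomult :: "'v \<Rightarrow> ('v, 'v) tens"
  bcounit :: "'v \<Rightarrow> complex"
  grade :: "nat \<Rightarrow> 'v set"

text \<open>The degree one part of the diagram: \<open>kG\<close> acts by the adjoint action \<open>g \<cdot> x = g x g\<^sup>-\<^sup>1\<close>
  of \<open>gr(H)\<close> and coacts by \<open>(\<pi>\<^sub>0 \<otimes> id)\<Delta>\<close>, which takes values in the image of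
  \<open>kG \<otimes> V\<close> in \<open>kG \<otimes> gr(H)\<close>.\<close>

definition diag_one :: "('h, 'm) hopf_scheme \<Rightarrow> ('h \<Rightarrow>\<^sub>0 complex, nat \<Rightarrow> 'h set) yd" where
  "diag_one H =
    (let G = grouplikes H; kG = group_algebra G; V = gr_space H\<lparr>carrier := diag_filt H \<inter> gr_degree H 1\<rparr>
     in module.extend V (yd.fields
       (\<lambda>b x. lin_ext V
          (\<lambda>g. gr_class H 0 g \<otimes>\<^bsub>gr H\<^esub> x \<otimes>\<^bsub>gr H\<^esub> gr_class H 0 (inv\<^bsub>G\<^esub> g)) b)
       (\<lambda>x. THE t. t \<in> carrier (tensor kG V) \<and>
          tensor_map kG (gr H) (\<lambda>b. b) (\<lambda>v. v) t
            = tensor_map kG (gr H) (proj0 H) (\<lambda>v. v) (comult (gr H) x))))"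

text \<open>The tensor algebra \<open>T(V)\<close>, as the quotient of the free algebra on the set \<open>V\<close> by linearity
  of the generators.\<close>

definition free_algebra :: "'v set \<Rightarrow> (complex, 'v list \<Rightarrow>\<^sub>0 complex) module" where
  "free_algebra S = monoid_algebra \<lparr>carrier = lists S, mult = (@), one = []\<rparr>"

definition tensor_alg_null :: "(complex, 'v, 'm) module_scheme \<Rightarrow> ('v list \<Rightarrow>\<^sub>0 complex) set" where
  "tensor_alg_null V = Idl\<^bsub>free_algebra (carrier V)\<^esub>
     ({Poly_Mapping.single [v \<oplus>\<^bsub>V\<^esub> w] 1 - Poly_Mapping.single [v] 1 - Poly_Mapping.single [w] 1
        | v w. v \<in> carrier V \<and> w \<in> carrier V}
    \<union> {Poly_Mapping.single [c \<odot>\<^bsub>V\<^esub> v] 1 - Poly_Mapping.single [v] c | c v. v \<in> carrier V})"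

type_synonym 'v tens_alg = "('v list \<Rightarrow>\<^sub>0 complex) set"

definition tensor_alg :: "(complex, 'v, 'm) module_scheme \<Rightarrow> (complex, 'v tens_alg) module" where
  "tensor_alg V = quot_alg (free_algebra (carrier V)) (tensor_alg_null V)"

definition tword :: "(complex, 'v, 'm) module_scheme \<Rightarrow> 'v list \<Rightarrow> 'v tens_alg" where
  "tword V w = tensor_alg_null V +>\<^bsub>free_algebra (carrier V)\<^esub> Poly_Mapping.single w 1"

primrec tword_act ::
  "('b, 'm) hopf_scheme \<Rightarrow> ('b, 'v, 'n) yd_scheme \<Rightarrow> 'b \<Rightarrow> 'v list \<Rightarrow> 'v tens_alg" where
  "tword_act B V h [] = counit B h \<odot>\<^bsub>tensor_alg V\<^esub> \<one>\<^bsub>tensor_alg V\<^esub>"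
| "tword_act B V h (v # w) = class_ext (tensor_alg V)
     (\<lambda>(h1, h2). tword V [act V h1 v] \<otimes>\<^bsub>tensor_alg V\<^esub> tword_act B V h2 w) (comult B h)"

primrec tword_coact ::
  "('b, 'm) hopf_scheme \<Rightarrow> ('b, 'v, 'n) yd_scheme \<Rightarrow> 'v list \<Rightarrow> ('b, 'v tens_alg) tens" where
  "tword_coact B V [] = pure B (tensor_alg V) \<one>\<^bsub>B\<^esub> \<one>\<^bsub>tensor_alg V\<^esub>"
| "tword_coact B V (v # w) =
     class_ext (tensor B (tensor_alg V)) (\<lambda>(h, v0). class_ext (tensor B (tensor_alg V))
       (\<lambda>(h', w0). pure B (tensor_alg V) (h \<otimes>\<^bsub>B\<^esub> h') (tword V [v0] \<otimes>\<^bsub>tensor_alg V\<^esub> w0))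
       (tword_coact B V w)) (coact V v)"

definition tensor_alg_yd ::
  "('b, 'm) hopf_scheme \<Rightarrow> ('b, 'v, 'n) yd_scheme \<Rightarrow> ('b, 'v tens_alg) yd" where
  "tensor_alg_yd B V = module.extend (tensor_alg V) (yd.fields
     (\<lambda>h. class_ext (tensor_alg V) (tword_act B V h))
     (class_ext (tensor B (tensor_alg V)) (tword_coact B V)))"

text \<open>The product \<open>(a \<otimes> b)(c \<otimes> d) = a (b\<^bsub>(-1)\<^esub> \<cdot> c) \<otimes> b\<^bsub>(0)\<^esub> d\<close> of the braided tensor
  square of \<open>R\<close>.\<close>

definition braided_mult ::
  "('b, 'r, 'm) yd_scheme \<Rightarrow> ('r, 'r) tens \<Rightarrow> ('r, 'r) tens \<Rightarrow> ('r, 'r) tens" where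
  "braided_mult R s t =
     class_ext (tensor R R) (\<lambda>(a, b). class_ext (tensor R R) (\<lambda>(c, d). class_ext (tensor R R)
       (\<lambda>(h, b0). pure R R (a \<otimes>\<^bsub>R\<^esub> act R h c) (b0 \<otimes>\<^bsub>R\<^esub> d)) (coact R b)) t) s"

text \<open>The comultiplication of \<open>T(V)\<close>: the algebra map into the braided tensor square for which the
  elements of \<open>V\<close> are primitive.\<close>

primrec tword_comult ::
  "('b, 'm) hopf_scheme \<Rightarrow> ('b, 'v, 'n) yd_scheme \<Rightarrow> 'v list \<Rightarrow> ('v tens_alg, 'v tens_alg) tens" where
  "tword_comult B V [] = pure (tensor_alg V) (tensor_alg V) \<one>\<^bsub>tensor_alg V\<^esub> \<one>\<^bsub>tensor_alg V\<^esub>"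
| "tword_comult B V (v # w) = braided_mult (tensor_alg_yd B V)
     (pure (tensor_alg V) (tensor_alg V) (tword V [v]) \<one>\<^bsub>tensor_alg V\<^esub>
        \<oplus>\<^bsub>tensor (tensor_alg V) (tensor_alg V)\<^esub>
      pure (tensor_alg V) (tensor_alg V) \<one>\<^bsub>tensor_alg V\<^esub> (tword V [v]))
     (tword_comult B V w)"

definition tensor_hopf ::
  "('b, 'm) hopf_scheme \<Rightarrow> ('b, 'v, 'n) yd_scheme \<Rightarrow> ('b, 'v tens_alg) yd_hopf" where
  "tensor_hopf B V = yd.extend (tensor_alg_yd B V) (yd_hopf.fields
     (class_ext (tensor (tensor_alg V) (tensor_alg V)) (tword_comult B V))
     (class_ext complex_mod (\<lambda>w. if w = [] then 1 else 0))
     (\<lambda>n. lspan (tensor_alg V) {tword V w | w. w \<in> lists (carrier V) \<and> length w = n}))"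

text \<open>The ideals of \<open>T(V)\<close> generated by homogeneous elements of degree at least \<open>2\<close> which are also
  coideals and Yetter-Drinfeld submodules. The Nichols algebra is the quotient of \<open>T(V)\<close> by
  their sum, which is the largest of them.\<close>

definition nichols_ideals :: "('b, 'm) hopf_scheme \<Rightarrow> ('b, 'v, 'n) yd_scheme \<Rightarrow> 'v tens_alg set set" where
  "nichols_ideals B V = (let T = tensor_hopf B V in
     {J. (\<exists>S \<subseteq> (\<Union>n\<in>{2..}. grade T n). J = Idl\<^bsub>T\<^esub> S) \<and>
         bcomult T ` J \<subseteq> tensor_span T T J (carrier T) <+>\<^bsub>tensor T T\<^esub> tensor_span T T (carrier T) J \<and>
         (\<forall>h\<in>carrier B. act T h ` J \<subseteq> J) \<and>
         coact T ` J \<subseteq> tensor_span B T (carrier B) J})"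

definition nichols_ideal :: "('b, 'm) hopf_scheme \<Rightarrow> ('b, 'v, 'n) yd_scheme \<Rightarrow> 'v tens_alg set" where
  "nichols_ideal B V = lspan (tensor_hopf B V) (\<Union>(nichols_ideals B V))"

definition yd_hopf_quot ::
  "('b, 'm) hopf_scheme \<Rightarrow> ('b, 'r, 'n) yd_hopf_scheme \<Rightarrow> 'r set \<Rightarrow> ('b, 'r set) yd_hopf" where
  "yd_hopf_quot B R J =
    (let Q = quot_alg R J; q = (\<lambda>x. J +>\<^bsub>R\<^esub> x); rep = (\<lambda>X. SOME x. x \<in> X);
         Y = module.extend Q (yd.fields
           (\<lambda>h X. q (act R h (rep X)))
           (\<lambda>X. tensor_map B Q (\<lambda>b. b) q (coact R (rep X))))
     in yd.extend Y (yd_hopf.fields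
          (\<lambda>X. tensor_map Q Q q q (bcomult R (rep X)))
          (\<lambda>X. bcounit R (rep X))
          (\<lambda>n. q ` grade R n)))"

definition nichols ::
  "('b, 'm) hopf_scheme \<Rightarrow> ('b, 'v, 'n) yd_scheme \<Rightarrow> ('b, 'v tens_alg set) yd_hopf" where
  "nichols B V = yd_hopf_quot B (tensor_hopf B V) (nichols_ideal B V)"

definition pull_push_iso ::
  "('b, 'm) hopf_scheme \<Rightarrow> ('b, 'r, 'n) yd_hopf_scheme \<Rightarrow> ('b, 's, 'o) yd_hopf_scheme \<Rightarrow> bool" where
  "pull_push_iso B R R' \<longleftrightarrow> (\<exists>\<phi> \<psi>. hopf_automorphism B \<phi> \<and>
     bij_betw \<psi> (carrier R) (carrier R') \<and>
     \<psi> \<in> module_hom CC R R' \<and> \<psi> \<in> Ring.ring_hom R R' \<and>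
     (\<forall>n. \<psi> ` grade R n = grade R' n) \<and>
     (\<forall>x\<in>carrier R. bcomult R' (\<psi> x) = tensor_map R' R' \<psi> \<psi> (bcomult R x)) \<and>
     (\<forall>x\<in>carrier R. bcounit R' (\<psi> x) = bcounit R x) \<and>
     (\<forall>b\<in>carrier B. \<forall>x\<in>carrier R. \<psi> (act R b x) = act R' (\<phi> b) (\<psi> x)) \<and>
     (\<forall>x\<in>carrier R. coact R' (\<psi> x) = tensor_map B R' \<phi> \<psi> (coact R x)))"

definition yd_direct_sum ::
  "('b, 'm) hopf_scheme \<Rightarrow> 'i set \<Rightarrow> ('i \<Rightarrow> ('b, 'v, 'n) yd_scheme) \<Rightarrow> ('b, 'i \<Rightarrow> 'v) yd" where
  "yd_direct_sum B I M = (let V = direct_sum I M in module.extend V (yd.fields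
     (\<lambda>b f. \<lambda>i\<in>I. act (M i) b (f i))
     (\<lambda>f. finsum (tensor B V)
        (\<lambda>i. tensor_map B V (\<lambda>b. b) (summand_in I M i) (coact (M i) (f i)))
        {i \<in> I. f i \<noteq> \<zero>\<^bsub>M i\<^esub>})))"


section \<open>Conjugacy classes, representations and the simple Yetter-Drinfeld modules\<close>

definition conj_class :: "('g, 'm) monoid_scheme \<Rightarrow> 'g \<Rightarrow> 'g set" where
  "conj_class G s = {g \<otimes>\<^bsub>G\<^esub> s \<otimes>\<^bsub>G\<^esub> inv\<^bsub>G\<^esub> g | g. g \<in> carrier G}"

definition conj_classes :: "('g, 'm) monoid_scheme \<Rightarrow> 'g set set" where
  "conj_classes G = conj_class G ` carrier G"

definition centralizer :: "('g, 'm) monoid_scheme \<Rightarrow> 'g \<Rightarrow> 'g set" where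
  "centralizer G s = {g \<in> carrier G. g \<otimes>\<^bsub>G\<^esub> s = s \<otimes>\<^bsub>G\<^esub> g}"

definition real_element :: "('g, 'm) monoid_scheme \<Rightarrow> 'g \<Rightarrow> bool" where
  "real_element G s \<longleftrightarrow> inv\<^bsub>G\<^esub> s \<in> conj_class G s"

definition real_group :: "('g, 'm) monoid_scheme \<Rightarrow> bool" where
  "real_group G \<longleftrightarrow> (\<forall>s\<in>carrier G. real_element G s)"

text \<open>Irreducible complex representations of finite groups are finite-dimensional, hence up to
  isomorphism given by matrices.\<close>

definition matrix_rep :: "('g, 'm) monoid_scheme \<Rightarrow> nat \<Rightarrow> ('g \<Rightarrow> complex mat) \<Rightarrow> bool" where
  "matrix_rep G n \<rho> \<longleftrightarrow>
     (\<forall>g\<in>carrier G. \<rho> g \<in> carrier_mat n n) \<and> \<rho> \<one>\<^bsub>G\<^esub> = 1\<^sub>m n \<and>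
     (\<forall>g\<in>carrier G. \<forall>h\<in>carrier G. \<rho> (g \<otimes>\<^bsub>G\<^esub> h) = \<rho> g * \<rho> h)"

definition irreducible_rep :: "('g, 'm) monoid_scheme \<Rightarrow> nat \<Rightarrow> ('g \<Rightarrow> complex mat) \<Rightarrow> bool" where
  "irreducible_rep G n \<rho> \<longleftrightarrow> matrix_rep G n \<rho> \<and> n \<noteq> 0 \<and>
     (\<forall>W. subspace CC W (module_vec TYPE(complex) n) \<and>
          (\<forall>g\<in>carrier G. \<forall>w\<in>W. \<rho> g *\<^sub>v w \<in> W)
        \<longrightarrow> W = {0\<^sub>v n} \<or> W = carrier_vec n)"

definition character :: "('g \<Rightarrow> complex mat) \<Rightarrow> 'g \<Rightarrow> complex" where
  "character \<rho> g = (\<Sum>i<dim_row (\<rho> g). \<rho> g $$ (i, i))"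

definition conj_rep :: "('g, 'm) monoid_scheme \<Rightarrow> 'g \<Rightarrow> 'g \<Rightarrow> 'g" where
  "conj_rep G s t = (SOME g. g \<in> carrier G \<and> g \<otimes>\<^bsub>G\<^esub> s \<otimes>\<^bsub>G\<^esub> inv\<^bsub>G\<^esub> g = t)"

text \<open>The module \<open>M(O\<^sub>s, \<rho>)\<close>, the direct sum over \<open>t \<in> O\<^sub>s\<close> of \<open>g\<^sub>t \<otimes> V\<close> where \<open>g\<^sub>t = conj_rep G s t\<close>:
  the family \<open>f\<close> stands for the sum of the elements \<open>g\<^sub>t (f t)\<close>. The component at \<open>t\<close> of
  \<open>h \<cdot> f\<close> comes from that of \<open>f\<close> at \<open>t' = h\<^sup>-\<^sup>1 t h\<close>, with \<open>h g\<^bsub>t'\<^esub> = g\<^sub>t \<gamma>\<close>.\<close>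

definition simple_yd ::
  "('g, 'm) monoid_scheme \<Rightarrow> 'g \<Rightarrow> nat \<Rightarrow> ('g \<Rightarrow> complex mat) \<Rightarrow> ('g \<Rightarrow>\<^sub>0 complex, 'g \<Rightarrow> complex vec) yd" where
  "simple_yd G s n \<rho> =
    (let C = conj_class G s;
         W = (\<lambda>t. module_vec TYPE(complex) n);
         V = direct_sum C W;
         kG = group_algebra G
     in module.extend V (yd.fields
       (\<lambda>b f. lin_ext V (\<lambda>h. \<lambda>t\<in>C.
          let t' = inv\<^bsub>G\<^esub> h \<otimes>\<^bsub>G\<^esub> t \<otimes>\<^bsub>G\<^esub> h;
              \<gamma> = inv\<^bsub>G\<^esub> (conj_rep G s t) \<otimes>\<^bsub>G\<^esub> h \<otimes>\<^bsub>G\<^esub> conj_rep G s t'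
          in \<rho> \<gamma> *\<^sub>v f t') b)
       (\<lambda>f. finsum (tensor kG V)
          (\<lambda>t. pure kG V (Poly_Mapping.single t 1) (summand_in C W t (f t))) C)))"


section \<open>Ramification systems with irreducible representations and \<open>-1\<close>-type\<close>

text \<open>An RSR over \<open>G\<close> is given by the choice \<open>u\<close> of elements in the conjugacy classes, the set \<open>K\<close>
  of classes in its support, the index sets \<open>I C\<close>, and the representations \<open>\<rho> C i\<close> of degree
  \<open>n C i\<close>.\<close>

definition rsr ::
  "('g, 'm) monoid_scheme \<Rightarrow> ('g set \<Rightarrow> 'g) \<Rightarrow> 'g set set \<Rightarrow> ('g set \<Rightarrow> nat set) \<Rightarrow>
   ('g set \<Rightarrow> nat \<Rightarrow> nat) \<Rightarrow> ('g set \<Rightarrow> nat \<Rightarrow> 'g \<Rightarrow> complex mat) \<Rightarrow> bool" where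
  "rsr G u K I n \<rho> \<longleftrightarrow>
     (\<forall>C\<in>conj_classes G. u C \<in> C) \<and> K \<subseteq> conj_classes G \<and>
     (\<forall>C\<in>K. finite (I C) \<and> I C \<noteq> {} \<and>
        (\<forall>i\<in>I C. irreducible_rep (G\<lparr>carrier := centralizer G (u C)\<rparr>) (n C i) (\<rho> C i)))"

definition rsr_minus_one_type ::
  "('g, 'm) monoid_scheme \<Rightarrow> ('g set \<Rightarrow> 'g) \<Rightarrow> 'g set set \<Rightarrow> ('g set \<Rightarrow> nat set) \<Rightarrow>
   ('g set \<Rightarrow> nat \<Rightarrow> 'g \<Rightarrow> complex mat) \<Rightarrow> bool" where
  "rsr_minus_one_type G u K I \<rho> \<longleftrightarrow> (\<forall>C\<in>K. \<forall>i\<in>I C.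
     real_element G (u C) \<and> even (group.ord G (u C)) \<and>
     character (\<rho> C i) (u C) = - character (\<rho> C i) \<one>\<^bsub>G\<^esub>)"

definition rsr_nichols ::
  "('g, 'm) monoid_scheme \<Rightarrow> ('g set \<Rightarrow> 'g) \<Rightarrow> 'g set set \<Rightarrow> ('g set \<Rightarrow> nat set) \<Rightarrow>
   ('g set \<Rightarrow> nat \<Rightarrow> nat) \<Rightarrow> ('g set \<Rightarrow> nat \<Rightarrow> 'g \<Rightarrow> complex mat) \<Rightarrow>
   ('g \<Rightarrow>\<^sub>0 complex, ('g set \<times> nat \<Rightarrow> 'g \<Rightarrow> complex vec) tens_alg set) yd_hopf" where
  "rsr_nichols G u K I n \<rho> = nichols (group_algebra G)
     (yd_direct_sum (group_algebra G) (SIGMA C:K. I C) (\<lambda>(C, i). simple_yd G (u C) (n C i) (\<rho> C i)))"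

definition nichols_minus_one_type ::
  "('g, 'm) monoid_scheme \<Rightarrow> ('g \<Rightarrow>\<^sub>0 complex, 'r, 'n) yd_hopf_scheme \<Rightarrow> bool" where
  "nichols_minus_one_type G R \<longleftrightarrow> (\<exists>u K I n \<rho>. rsr G u K I n \<rho> \<and> rsr_minus_one_type G u K I \<rho> \<and>
     pull_push_iso (group_algebra G) R (rsr_nichols G u K I n \<rho>))"

definition minus_one_type :: "('h, 'm) hopf_scheme \<Rightarrow> bool" where
  "minus_one_type H \<longleftrightarrow> nichols_minus_one_type (grouplikes H)
     (nichols (group_algebra (grouplikes H)) (diag_one H))"

end

theory Submission
 imports
  Defs
  "Jordan_Normal_Form.Spectral_Radius"
begin

text \<open>The degree one part \<open>V\<close> of the diagram is graded by \<open>G\<close>, and \<open>s\<close> acts diagonalizably on the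
component \<open>V\<^bsub>s\<^esub>\<close>. If \<open>s v = q v\<close> there with \<open>v\<close> nonzero, lift \<open>v\<close> to a skew-primitive \<open>x\<close>. For \<open>q = 1\<close> the
powers of \<open>x\<close> climb strictly in the coradical filtration; for \<open>q\<^sup>2 \<noteq> 1\<close> the same happens for the powers of
\<open>x y - q\<^sup>-\<^sup>1 y x\<close>, where \<open>y\<close> is a conjugate of \<open>x\<close> of degree \<open>s\<^sup>-\<^sup>1\<close>, which exists as \<open>s\<close> is real.
So in finite dimension \<open>s\<close> acts by \<open>-1\<close> (and has even order, as \<open>s\<^sup>k = 1\<close> gives \<open>(-1)\<^sup>k = 1\<close>), and complete
reducibility turns \<open>V\<close> into the module of a ramification system of \<open>-1\<close>-type.\<close>

text \<open>Nothing is computed inside a Nichols algebra: its construction is functorial, so the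
  \<open>-1\<close>-type needs only a linear bijection of Yetter-Drinfeld modules, and the growth is
  seen in \<open>H\<close> itself. Finite dimension gives enough functionals to test the filtration:
  with \<open>J\<close> the functionals vanishing on the group-likes, \<open>x\<close> lies in
  \<open>F (Suc n)\<close> iff its left slice by every \<open>f \<in> J\<close> lies in
  \<open>F n\<close>. A slice acts on products with a skew-primitive as a twisted derivation, so a
  power whose derivatives do not drop cannot drop either. The difficulty is that the lift
  \<open>x\<close> is skew-primitive only modulo the tensor square of the coradical and that a
  functional detecting it has no symmetry; hence congruences throughout and an averaged functional
  that is an eigenvector for translation by \<open>s\<close>. The commutator has its origin in root
  systems: \<open>s\<close> acts on \<open>y\<close>, and \<open>s^-1\<close> on \<open>x\<close>,
  by \<open>q^-1\<close>, so the braided plane of \<open>x\<close> and \<open>y\<close> has both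
  Cartan entries equal to \<open>-2\<close>. This is affine type A1, and the element is its
  imaginary root vector. Its second derivative carries the factor \<open>1 - q^-2\<close>, which
  vanishes for \<open>q = -1\<close>.\<close>

abbreviation (input) car :: "('a, 'm) partial_object_scheme => 'a set" where "car == carrier"
abbreviation (input) vsp :: "(complex, 'v, 'm) module_scheme => bool" where "vsp == vectorspace CC"
abbreviation (input) ssp :: "'v set => (complex, 'v, 'm) module_scheme => bool" where "ssp == subspace CC"
abbreviation (input) sng :: "'x => 'y::zero => 'x \<Rightarrow>\<^sub>0 'y" where "sng == Poly_Mapping.single"
abbreviation (input) kys :: "('x \<Rightarrow>\<^sub>0 'y::zero) => 'x set" where "kys == Poly_Mapping.keys"
abbreviation (input) lkp :: "('x \<Rightarrow>\<^sub>0 'y::zero) => 'x => 'y" where "lkp == Poly_Mapping.lookup"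
abbreviation (input) pmap :: "('a::zero => 'b::zero) => ('x \<Rightarrow>\<^sub>0 'a) => 'x \<Rightarrow>\<^sub>0 'b" where "pmap == Poly_Mapping.map"
abbreviation (input) add_in ("_ \<oplus>[_] _" [65, 0, 66] 65) where "x \<oplus>[V] y == x \<oplus>\<^bsub>V\<^esub> y"
abbreviation (input) smult_in ("_ \<odot>[_] _" [70, 0, 71] 70) where "x \<odot>[V] y == x \<odot>\<^bsub>V\<^esub> y"
abbreviation (input) mult_in ("_ \<otimes>[_] _" [70, 0, 71] 70) where "x \<otimes>[V] y == x \<otimes>\<^bsub>V\<^esub> y"
abbreviation (input) zero_in ("\<zero>[_]") where "\<zero>[V] == \<zero>\<^bsub>V\<^esub>"
abbreviation (input) one_in ("\<one>[_]") where "\<one>[V] == \<one>\<^bsub>V\<^esub>"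

section \<open>Linear algebra on records\<close>

abbreviation lhom :: "(complex, 'v, 'm) module_scheme => (complex, 'w, 'n) module_scheme => ('v => 'w) set" where
 "lhom V W \<equiv> module_hom CC V W"

text \<open>Inverses come from the scalar \<open>-1\<close>:
  \<open>v + (-1) v = (1 + -1) v = 0\<close>. The conditions thus speak only of the operations that
  the record fields name, and subtraction is written with the scalar \<open>-1\<close>
  throughout.\<close>

lemma vectorspaceI:
 fixes V :: "(complex, 'v, 'm) module_scheme"
 assumes "!!x y. x : car V ==> y : car V ==> x \<oplus>[V] y : car V"
  and "\<zero>[V] : car V"
  and "!!c x. x : car V ==> c \<odot>[V] x : car V"
  and "!!x y z. x : car V ==> y : car V ==> z : car V ==>
   (x \<oplus>[V] y) \<oplus>[V] z = x \<oplus>[V] (y \<oplus>[V] z)"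
  and "!!x y. x : car V ==> y : car V ==> x \<oplus>[V] y = y \<oplus>[V] x"
  and "!!x. x : car V ==> x \<oplus>[V] \<zero>[V] = x"
  and "!!x. x : car V ==> 0 \<odot>[V] x = \<zero>[V]"
  and "!!x. x : car V ==> 1 \<odot>[V] x = x"
  and "!!a b x. x : car V ==> (a * b) \<odot>[V] x = a \<odot>[V] (b \<odot>[V] x)"
  and "!!a b x. x : car V ==> (a + b) \<odot>[V] x = a \<odot>[V] x \<oplus>[V] b \<odot>[V] x"
  and "!!a x y. x : car V ==> y : car V ==>
   a \<odot>[V] (x \<oplus>[V] y) = a \<odot>[V] x \<oplus>[V] a \<odot>[V] y"
 shows "vsp V"
proof(rule vs_criteria)
 show "\<forall>v\<in>car V. \<exists>w\<in>car V. v \<oplus>[V] w = \<zero>[V]"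
 proof
  fix v assume v: "v : car V"
  have "v \<oplus>[V] (-1) \<odot>[V] v = (1 + -1) \<odot>[V] v" by(simp only: assms(8,10) v)
  then show "\<exists>w\<in>car V. v \<oplus>[V] w = \<zero>[V]" using assms(3,7) v by force
 qed
qed (use assms class_field in auto)

context
 fixes V :: "(complex, 'v, 'm) module_scheme" (structure)
 assumes V: "vsp V"
begin

interpretation vectorspace CC V by(rule V)

lemma vs_abelian_group: "abelian_group V" by unfold_locales
lemma vs_module: "module CC V" by unfold_locales

lemma vs_add [simp, intro]: "x : car V ==> y : car V ==> x \<oplus> y : car V" by simp
lemma vs_zero [simp, intro]: "\<zero> : car V" by simp
lemma vs_smult [simp, intro]: "x : car V ==> c \<odot> x : car V" by simp
lemma vs_assoc: "x : car V ==> y : car V ==> z : car V ==>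
 (x \<oplus> y) \<oplus> z = x \<oplus> (y \<oplus> z)" by(rule M.a_assoc)
lemma vs_comm: "x : car V ==> y : car V ==> x \<oplus> y = y \<oplus> x" by(rule M.a_comm)
lemma vs_lcomm: "x : car V ==> y : car V ==> z : car V ==>
 x \<oplus> (y \<oplus> z) = y \<oplus> (x \<oplus> z)" by(rule M.a_lcomm)
lemma vs_r_zero [simp]: "x : car V ==> x \<oplus> \<zero> = x" by simp
lemma vs_l_zero [simp]: "x : car V ==> \<zero> \<oplus> x = x" by simp
lemma vs_smult_0 [simp]: "x : car V ==> 0 \<odot> x = \<zero>" using lmult_0 by simp
lemma vs_smult_zero [simp]: "c \<odot> \<zero> = \<zero>" using rmult_0 by simp
lemma vs_smult_1 [simp]: "x : car V ==> 1 \<odot> x = x" using smult_one by simp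
lemma vs_smult_smult [simp]: "x : car V ==> a \<odot> (b \<odot> x) = (a * b) \<odot> x"
 using smult_assoc1 by simp
lemma vs_smult_l: "x : car V ==> (a + b) \<odot> x = a \<odot> x \<oplus> b \<odot> x"
 using smult_l_distr by simp
lemma vs_smult_r: "x : car V ==> y : car V ==>
 a \<odot> (x \<oplus> y) = a \<odot> x \<oplus> a \<odot> y"
 using smult_r_distr by simp

lemma vs_add_neg [simp]: "x : car V ==> x \<oplus> (-1) \<odot> x = \<zero>"
 using vs_smult_l[of x 1 "-1"] by simp
lemma vs_neg_add [simp]: "x : car V ==> (-1) \<odot> x \<oplus> x = \<zero>"
 using vs_smult_l[of x "-1" 1] by simp
lemma vs_a_inv: "x : car V ==> \<ominus> x = (-1) \<odot> x"
 by(rule M.minus_equality) simp_all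
lemma vs_diff_zero_iff: "x : car V ==> y : car V ==> x \<oplus> (-1) \<odot> y = \<zero> \<longleftrightarrow> x = y"
 by(metis vs_add_neg M.r_neg M.add.inv_equality vs_a_inv M.add.inv_inv vs_smult)
lemma vs_add_diff: "x : car V ==> y : car V ==> y \<oplus> (x \<oplus> (-1) \<odot> y) = x"
 by(simp add: vs_lcomm[of y x])

lemma fsum_closed [simp]: "f : A \<rightarrow> car V ==> finsum V f A : car V" by simp
lemma fsum_insert: "finite A ==> a \<notin> A ==> f : A \<rightarrow> car V ==> f a : car V ==>
 finsum V f (insert a A) = f a \<oplus> finsum V f A" by simp
lemma vs_finsum_empty [simp]: "finsum V f {} = \<zero>" by simp
lemma fsum_add: "f : A \<rightarrow> car V ==> g : A \<rightarrow> car V ==>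
 finsum V (%x. f x \<oplus> g x) A = finsum V f A \<oplus> finsum V g A"
 by(rule M.finsum_addf)
lemma fsum_smult: "finite A ==> f : A \<rightarrow> car V ==>
 finsum V (%x. c \<odot> f x) A = c \<odot> finsum V f A"
 using finsum_smult_ldistr[of A c f] by simp
lemma fsum_cong: "A = B ==> g : B \<rightarrow> car V ==> (!!x. x : B ==> f x = g x) ==> finsum V f A = finsum V g B"
 by(rule M.finsum_cong') auto
lemma fsum_zero: "(!!x. x : A ==> f x = \<zero>) ==> finsum V f A = \<zero>"
 using M.finsum_cong'[of A A "%_. \<zero>" f] by(simp add: M.finsum_zero)
lemma fsum_mono: "finite B ==> A <= B ==> f : A \<rightarrow> car V ==> (!!x. x : B - A ==> f x = \<zero>) ==>
 finsum V f B = finsum V f A"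
 using M.add.finprod_mono_neutral_cong_left[of B A f f] by(fastforce simp: Pi_iff)
lemma fsum_single: "finite A ==> a : A ==> f a : car V ==> (!!x. x : A ==> x ~= a ==> f x = \<zero>) ==>
 finsum V f A = f a"
 using fsum_mono[of A "{a}" f] fsum_insert[of "{}" a f] by auto
lemma vs_finsum_reindex: "inj_on h A ==> f : h ` A \<rightarrow> car V ==>
 finsum V f (h ` A) = finsum V (%x. f (h x)) A"
 by(rule M.finsum_reindex) auto
lemma vs_finsum_swap: "finite A ==> finite B ==> (!!i j. i : A ==> j : B ==> f i j : car V) ==>
 finsum V (%i. finsum V (f i) B) A = finsum V (%j. finsum V (%i. f i j) A) B"
proof(induction A rule: finite_induct)
 case empty
 then show ?case by(simp add: fsum_zero)
next
 case (insert a A)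
 have "finsum V (%i. finsum V (f i) B) (insert a A) = finsum V (f a) B \<oplus> finsum V (%i. finsum V (f i) B) A"
  by(rule fsum_insert) (use insert in auto)
 also have "... = finsum V (%j. f a j \<oplus> finsum V (%i. f i j) A) B"
  using insert by(subst fsum_add) (auto intro!: fsum_closed)
 also have "... = finsum V (%j. finsum V (%i. f i j) (insert a A)) B"
  by(rule fsum_cong) (use insert in \<open>auto intro!: fsum_closed simp: fsum_insert\<close>)
 finally show ?case .
qed

lemma subspaceI:
 assumes "S <= car V" "\<zero> : S" "!!x y. x : S ==> y : S ==> x \<oplus> y : S"
  "!!c x. x : S ==> c \<odot> x : S"
 shows "ssp S V"
 unfolding subspace_def submodule_def using assms V vs_module by auto

lemma carrier_subsp [simp]: "ssp (car V) V"
 by(rule subspaceI) auto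

lemma zero_subsp [simp]: "ssp {\<zero>} V"
 by(rule subspaceI) auto

lemma lspan_subsp: "S <= car V ==> ssp (lspan V S) V"
 by(rule span_is_subspace)
lemma lspan_sup: "S <= car V ==> S <= lspan V S"
 by(rule in_own_span)
lemma lspan_least: "ssp N V ==> S <= N ==> lspan V S <= N"
 by(rule span_is_subset) (auto simp: subspace_def)
lemma lspan_closed: "S <= car V ==> lspan V S <= car V"
 by(rule span_is_subset2)

end

lemma subspD:
 assumes "ssp S V"
 shows "S <= car V" "\<zero>[V] : S" "!!x y. x : S ==> y : S ==> x \<oplus>[V] y : S"
  "!!c x. x : S ==> c \<odot>[V] x : S" "vsp V" "!!x. x : S ==> x : car V"
 using assms unfolding subspace_def submodule_def by auto

lemma subsp_fsum:
 assumes "ssp S V" "finite A" "f : A \<rightarrow> S"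
 shows "finsum V f A : S"
 using assms(2,3)
proof(induction A rule: finite_induct)
 case empty
 then show ?case using subspD[OF assms(1)] by simp
next
 case (insert a A)
 then have "finsum V f (insert a A) = f a \<oplus>[V] finsum V f A"
  using subspD(1,5)[OF assms(1)] by(intro fsum_insert) auto
 then show ?case using insert subspD(3)[OF assms(1)] by auto
qed

lemma subsp_vs: "ssp S V ==> vsp (V\<lparr>carrier := S\<rparr>)"
 using subspD(5) vectorspace.subspace_is_vs by blast

text \<open>The vectors \<open>z\<close> for which adding any multiple of \<open>z\<close> preserves
  \<open>P\<close> form a subspace containing \<open>S\<close>, hence contain the span; starting
  from the zero vector gives \<open>P x\<close>. The scalar sits in the step, so no finite linear
  combinations have to be handled.\<close>

lemma lspan_induct [consumes 3, case_names zero add]: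
 assumes V: "vsp V" and S: "S <= car V" and x: "x : lspan V S"
  and 0: "P \<zero>[V]"
  and add: "!!c s y. s : S ==> y : car V ==> P y ==> P (c \<odot>[V] s \<oplus>[V] y)"
 shows "P x"
proof -
 define Q where "Q z \<longleftrightarrow> z : car V & (\<forall>c. \<forall>y\<in>car V. P y --> P (c \<odot>[V] z \<oplus>[V] y))" for z
 have "ssp {z. Q z} V"
 proof(rule subspaceI[OF V])
  show "{z. Q z} <= car V" by(auto simp: Q_def)
  show "\<zero>[V] : {z. Q z}" using V by(auto simp: Q_def)
  fix z w assume zw: "z : {z. Q z}" "w : {z. Q z}"
  have "c \<odot>[V] (z \<oplus>[V] w) \<oplus>[V] y = c \<odot>[V] z \<oplus>[V] (c \<odot>[V] w \<oplus>[V] y)" if "y : car V" for c y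
   using that zw V by(auto simp: Q_def vs_smult_r vs_assoc)
  then show "z \<oplus>[V] w : {z. Q z}" using zw V by(auto simp: Q_def)
 next
  fix c z assume "z : {z. Q z}"
  then show "c \<odot>[V] z : {z. Q z}" using V by(auto simp: Q_def)
 qed
 moreover have "S <= {z. Q z}" using S add by(auto simp: Q_def)
 ultimately have "Q x" using lspan_least[OF V] x by blast
 then show ?thesis using 0 V unfolding Q_def
  by(metis vs_smult_1 vs_r_zero vs_zero)
qed

lemma lhomI:
 assumes "!!x. x : car V ==> f x : car W"
  "!!x y. x : car V ==> y : car V ==> f (x \<oplus>[V] y) = f x \<oplus>[W] f y"
  "!!c x. x : car V ==> f (c \<odot>[V] x) = c \<odot>[W] f x"
 shows "f : lhom V W"
 using assms unfolding module_hom_def by auto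

lemma lhomD:
 assumes "f : lhom V W"
 shows "!!x. x : car V ==> f x : car W"
  "!!x y. x : car V ==> y : car V ==> f (x \<oplus>[V] y) = f x \<oplus>[W] f y"
  "!!c x. x : car V ==> f (c \<odot>[V] x) = c \<odot>[W] f x"
 using assms unfolding module_hom_def by auto

lemma lhom_zero: "f : lhom V W ==> vsp V ==> vsp W ==> f \<zero>[V] = \<zero>[W]"
 by(metis lhomD(1,3) vs_smult_0 vs_zero)

lemma lhom_comp: "f : lhom U V ==> g : lhom V W ==> (%x. g (f x)) : lhom U W"
 by(rule lhomI) (simp_all add: lhomD)

lemma lhom_id: "(%x. x) : lhom V V"
 by(rule lhomI) simp_all

lemma lhom_cong: "f : lhom V W ==> vsp V ==> (!!x. x : car V ==> g x = f x) ==> g : lhom V W"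
 by(rule lhomI) (simp_all add: lhomD)

lemma lhom_add: "f : lhom V W ==> g : lhom V W ==> vsp W ==> (%x. f x \<oplus>[W] g x) : lhom V W"
 by(rule lhomI) (simp_all add: lhomD vs_smult_r vs_assoc vs_lcomm)

lemma lhom_smult: "f : lhom V W ==> vsp W ==> (%x. c \<odot>[W] f x) : lhom V W"
 by(rule lhomI) (simp_all add: lhomD vs_smult_r mult.commute)

lemma lhom_0: "vsp W ==> (%x. \<zero>[W]) : lhom V W"
 by(rule lhomI) simp_all

lemma lhom_finsum:
 assumes "finite A" "!!a. a : A ==> f a : lhom V W" "vsp W"
 shows "(%x. finsum W (%a. f a x) A) : lhom V W"
proof(rule lhomI)
 show "finsum W (%a. f a x) A : car W" if "x : car V" for x
  using assms that by(auto intro!: fsum_closed dest: lhomD(1))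
next
 fix x y assume xy: "x : car V" "y : car V"
 have "finsum W (%a. f a (x \<oplus>[V] y)) A = finsum W (%a. f a x \<oplus>[W] f a y) A"
  using assms xy by(intro fsum_cong) (auto dest: lhomD)
 also have "... = finsum W (%a. f a x) A \<oplus>[W] finsum W (%a. f a y) A"
  using assms xy by(intro fsum_add) (auto dest: lhomD)
 finally show "finsum W (%a. f a (x \<oplus>[V] y)) A = ..." .
next
 fix c x assume x: "x : car V"
 have "finsum W (%a. f a (c \<odot>[V] x)) A = finsum W (%a. c \<odot>[W] f a x) A"
  using assms x by(intro fsum_cong) (auto dest: lhomD)
 also have "... = c \<odot>[W] finsum W (%a. f a x) A"
  using assms x by(intro fsum_smult) (auto dest: lhomD)
 finally show "finsum W (%a. f a (c \<odot>[V] x)) A = ..." .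
qed

lemma lhom_fsum:
 assumes f: "f : lhom V W" and VW: "vsp V" "vsp W"
  and A: "finite A" and g: "g : A \<rightarrow> car V"
 shows "f (finsum V g A) = finsum W (%a. f (g a)) A"
 using A g
proof(induction A rule: finite_induct)
 case empty
 then show ?case using lhom_zero[OF f VW] VW by simp
next
 case (insert a A)
 then show ?case using VW lhomD[OF f]
  by(subst (1 2) fsum_insert) (auto simp: fsum_closed Pi_iff)
qed

lemma lhom_eqI:
 assumes "f : lhom V W" "g : lhom V W" "vsp V" "vsp W" "S <= car V"
  "!!s. s : S ==> f s = g s" "x : lspan V S"
 shows "f x = g x"
 using assms(3,5,7)
proof(induction rule: lspan_induct)
 case zero
 then show ?case using assms(1-4) by(simp add: lhom_zero[of _ V W])
next
 case (add c s y)
 then show ?case using assms(5,6) vs_smult[OF assms(3)] lhomD[OF assms(1)] lhomD[OF assms(2)] by(auto simp: subset_iff)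
qed

lemma lspan_img:
 assumes f: "f : lhom V W" and VW: "vsp V" "vsp W"
  and S: "S <= car V" and N: "ssp N W" and fS: "f ` S <= N"
 shows "f ` lspan V S <= N"
proof
 fix y assume "y : f ` lspan V S"
 then obtain x where x: "x : lspan V S" and y: "y = f x" by blast
 have "f x : N" using VW(1) S x
 proof(induction rule: lspan_induct)
  case zero
  then show ?case using lhom_zero[OF f VW] subspD[OF N] by simp
 next
  case (add c s y)
  then show ?case using lhomD[OF f] subspD[OF N] fS S VW by(auto simp: subset_iff image_subset_iff)
 qed
 then show "y : N" by(simp add: y)
qed

lemma lspan_mono: "vsp V ==> T <= car V ==> S <= T ==> lspan V S <= lspan V T"
 by(meson lspan_least lspan_subsp lspan_sup order_trans)

lemma img_lspan:
 assumes f: "f : lhom V W" and VW: "vsp V" "vsp W" and S: "S <= car V"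
 shows "f ` lspan V S = lspan W (f ` S)"
proof
 have fS: "f ` S <= car W" using S lhomD(1)[OF f] by auto
 show "f ` lspan V S <= lspan W (f ` S)"
  by(rule lspan_img[OF f VW S lspan_subsp[OF VW(2) fS] lspan_sup[OF VW(2) fS]])
 note sp = subspD[OF lspan_subsp[OF VW(1) S]]
 have "ssp (f ` lspan V S) W"
 proof(rule subspaceI[OF VW(2)])
  show "f ` lspan V S <= car W" using sp(1) lhomD(1)[OF f] by auto
  show "\<zero>[W] : f ` lspan V S" using sp(2) lhom_zero[OF f VW] by(metis imageI)
 next
  fix x y assume "x : f ` lspan V S" "y : f ` lspan V S"
  then show "x \<oplus>[W] y : f ` lspan V S"
   by(auto simp: lhomD(2)[OF f, symmetric] sp)
 next
  fix c x assume "x : f ` lspan V S"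
  then show "c \<odot>[W] x : f ` lspan V S"
   by(auto simp: lhomD(3)[OF f, symmetric] sp)
 qed
 then show "lspan W (f ` S) <= f ` lspan V S"
  by(rule lspan_least[OF VW(2)]) (use lspan_sup[OF VW(1) S] in auto)
qed

lemma ker_subsp:
 assumes f: "f : lhom V W" and VW: "vsp V" "vsp W"
 shows "ssp {x : car V. f x = \<zero>[W]} V"
 by(rule subspaceI) (use VW lhomD[OF f] lhom_zero[OF f VW] in auto)

lemma preim_subsp:
 assumes f: "f : lhom V W" and VW: "vsp V" "vsp W" and N: "ssp N W"
 shows "ssp {x : car V. f x : N} V"
 by(rule subspaceI) (use VW lhomD[OF f] lhom_zero[OF f VW] subspD[OF N] in auto)

lemma subspace_Int:
 "ssp A V ==> ssp C V ==> ssp (A \<inter> C) V"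
 by(rule subspaceI) (auto dest: subspD)

section \<open>Free spaces\<close>

lemma lookup_map_mult [simp]: "lkp (pmap ((*) c) p) k = c * lkp p k" for c :: complex
 by(simp add: map.rep_eq when_def)

lemma keys_map_mult: "kys (pmap ((*) c) p) <= kys p" for c :: complex
 by(auto simp: in_keys_iff)

lemma free_space_simps [simp]:
 "car (free_space S) = {p. kys p <= S}"
 "\<zero>[free_space S] = 0"
 "p \<oplus>[free_space S] q = p + q"
 "c \<odot>[free_space S] p = pmap ((*) c) p"
 by(simp_all add: free_space_def)

text \<open>Stated for an arbitrary record with these four fields because the same space of formal
  combinations carries several record types: free space, monoid algebra, group algebra.\<close>

lemma poly_vs:
 fixes V :: "(complex, 'x \<Rightarrow>\<^sub>0 complex, 'm) module_scheme"
 assumes [simp]: "car V = {p. kys p <= S}" "\<zero>[V] = 0"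
  "!!p q. p \<oplus>[V] q = p + q" "!!c p. c \<odot>[V] p = pmap ((*) c) p"
 shows "vsp V"
proof(rule vectorspaceI)
 fix x y assume "x : car V" "y : car V"
 then show "x \<oplus>[V] y : car V" using Poly_Mapping.keys_add[of x y] by auto
next
 fix c x assume "x : car V"
 then show "c \<odot>[V] x : car V" using keys_map_mult[of c x] by auto
qed (auto intro!: poly_mapping_eqI simp: lookup_add algebra_simps)

lemma free_vs [simp]: "vsp (free_space S)"
 by(rule poly_vs) simp_all

text \<open>The support of \<open>p + q\<close> may be smaller than the union of the two supports;
  summing over a common finite superset makes additivity of \<open>lin_ext\<close> a statement about
  one index set.\<close>

lemma lin_ext_finsum:
 assumes X: "vsp X" and A: "finite A" "kys p <= A" and f: "f : kys p \<rightarrow> car X"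
  and f': "f : A \<rightarrow> car X"
 shows "lin_ext X f p = finsum X (%k. lkp p k \<odot>[X] f k) A"
 unfolding lin_ext_def
 by(rule fsum_mono[symmetric, OF X]) (use X A f f' in \<open>auto simp: Pi_iff in_keys_iff\<close>)

context
 fixes X :: "(complex, 'y, 'm) module_scheme" (structure) and S :: "'x set" and f :: "'x => 'y"
 assumes X: "vsp X" and f: "f : S \<rightarrow> car X"
begin

lemma lin_ext_closed: "kys p <= S ==> lin_ext X f p : car X"
 unfolding lin_ext_def using X f by(intro fsum_closed) (auto simp: Pi_iff)

lemma lin_ext_add:
 assumes "kys p <= S" "kys q <= S"
 shows "lin_ext X f (p + q) = lin_ext X f p \<oplus> lin_ext X f q"
proof -
 define A where "A = kys p \<union> kys q"
 have A: "finite A" "kys p <= A" "kys q <= A" "kys (p + q) <= A" "A <= S"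
  using assms Poly_Mapping.keys_add[of p q] by(auto simp: A_def)
 have fA: "f : A \<rightarrow> car X" using f A(5) by auto
 have *: "lin_ext X f r = finsum X (%k. lkp r k \<odot> f k) A" if "kys r <= A" for r
  by(rule lin_ext_finsum[OF X A(1)]) (use that fA in auto)
 have "finsum X (%k. lkp (p + q) k \<odot> f k) A =
  finsum X (%k. lkp p k \<odot> f k \<oplus> lkp q k \<odot> f k) A"
  by(rule fsum_cong[OF X]) (use X fA in \<open>auto simp: lookup_add vs_smult_l Pi_iff\<close>)
 also have "... = finsum X (%k. lkp p k \<odot> f k) A \<oplus> finsum X (%k. lkp q k \<odot> f k) A"
  by(rule fsum_add[OF X]) (use X fA in \<open>auto simp: Pi_iff\<close>)
 finally show ?thesis using * A by simp
qed

lemma lin_ext_map: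
 assumes "kys p <= S"
 shows "lin_ext X f (pmap ((*) c) p) = c \<odot> lin_ext X f p"
proof -
 have fp: "f : kys p \<rightarrow> car X" using f assms by auto
 have "lin_ext X f (pmap ((*) c) p) =
  finsum X (%k. lkp (pmap ((*) c) p) k \<odot> f k) (kys p)"
  by(rule lin_ext_finsum[OF X]) (use fp keys_map_mult[of c p] in auto)
 also have "... = finsum X (%k. c \<odot> (lkp p k \<odot> f k)) (kys p)"
  by(rule fsum_cong[OF X]) (use X fp in \<open>auto simp: Pi_iff\<close>)
 also have "... = c \<odot> lin_ext X f p"
  unfolding lin_ext_def by(rule fsum_smult[OF X]) (use X fp in \<open>auto simp: Pi_iff\<close>)
 finally show ?thesis .
qed

lemma lin_ext_single: "k : S ==> lin_ext X f (sng k c) = c \<odot> f k"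
 using lin_ext_finsum[OF X, of "{k}" "sng k c" f] f X
  fsum_insert[OF X, of "{}" k "%i. lkp (sng k c) i \<odot> f i"]
 by(auto simp: Pi_iff)

lemma lin_ext_lhom: "lin_ext X f : lhom (free_space S) X"
 by(rule lhomI) (use lin_ext_closed lin_ext_add lin_ext_map in auto)

end

lemma lin_ext_cong:
 assumes "vsp X" "!!k. k : kys p ==> g k : car X" "!!k. k : kys p ==> f k = g k"
 shows "lin_ext X f p = lin_ext X g p"
 unfolding lin_ext_def by(rule fsum_cong) (use assms in auto)

lemma lhom_lin_ext:
 assumes "g : lhom X Y" "vsp X" "vsp Y" "f : kys p \<rightarrow> car X"
 shows "g (lin_ext X f p) = lin_ext Y (%k. g (f k)) p"
proof -
 have "g (lin_ext X f p) = finsum Y (%a. g (lkp p a \<odot>[X] f a)) (kys p)"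
  unfolding lin_ext_def by(rule lhom_fsum) (use assms in \<open>auto simp: Pi_iff\<close>)
 also have "... = lin_ext Y (%k. g (f k)) p"
  unfolding lin_ext_def by(rule fsum_cong) (use assms lhomD[OF assms(1)] in \<open>auto simp: Pi_iff\<close>)
 finally show ?thesis .
qed

lemma poly_mapping_eq_sum: "p = (\<Sum>k\<in>kys p. sng k (lkp p k))"
 for p :: "'x \<Rightarrow>\<^sub>0 complex"
 by(rule poly_mapping_eqI)
  (auto simp: lookup_sum lookup_single when_def in_keys_iff sum.delta' not_in_keys_iff_lookup_eq_zero)

lemma free_space_span:
 assumes p: "kys p <= S" and V: "vsp V"
  and [simp]: "car V = {p. kys p <= S}" "\<zero>[V] = 0"
  "!!p q. p \<oplus>[V] q = p + q" "!!c p. c \<odot>[V] p = pmap ((*) c) p"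
 shows "p : lspan V ((%k. sng k 1) ` S)"
proof -
 let ?S = "(%k. sng k (1::complex)) ` S"
 have S: "?S <= car V" by auto
 note sp = subspD[OF lspan_subsp[OF V S]]
 have 1: "sng k c : lspan V ?S" if "k : S" for k c
  using sp(4)[of "sng k 1" c] lspan_sup[OF V S] that by auto
 have "(\<Sum>k\<in>A. sng k (lkp p k)) : lspan V ?S" if "finite A" "A <= S" for A
  using that
 proof(induction A rule: finite_induct)
  case empty
  then show ?case using sp(2) by simp
 next
  case (insert x F)
  then show ?case using sp(3) 1 by simp
 qed
 then have "(\<Sum>k\<in>kys p. sng k (lkp p k)) : lspan V ?S" using p by auto
 then show ?thesis using poly_mapping_eq_sum[of p] by simp
qed

lemma lhom_eq_on_free:
 assumes "f : lhom V W" "g : lhom V W" "vsp V" "vsp W"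
  "!!k. k : S ==> f (sng k 1) = g (sng k 1)" "kys p <= S"
  "car V = {p. kys p <= S}" "\<zero>[V] = 0"
  "!!p q. p \<oplus>[V] q = p + q" "!!c p. c \<odot>[V] p = pmap ((*) c) p"
 shows "f p = g p"
 by(rule lhom_eqI[OF assms(1-4), where S="(%k. sng k 1) ` S"])
  (use assms free_space_span[of p S V] in auto)

section \<open>Quotients\<close>

lemma quot_alg_simps [simp]:
 "car (quot_alg M N) = a_rcosets\<^bsub>M\<^esub> N"
 "\<zero>[quot_alg M N] = N"
 "X \<oplus>[quot_alg M N] Y = X <+>\<^bsub>M\<^esub> Y"
 "X \<otimes>[quot_alg M N] Y = rcoset_mult M N X Y"
 "\<one>[quot_alg M N] = N +>\<^bsub>M\<^esub> \<one>[M]"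
 "c \<odot>[quot_alg M N] X = (\<Union>x\<in>X. N +>\<^bsub>M\<^esub> (c \<odot>[M] x))"
 by(simp_all add: quot_alg_def)

lemma mem_rcoset: "y : N +>\<^bsub>M\<^esub> x \<longleftrightarrow> (\<exists>n\<in>N. y = n \<oplus>[M] x)"
 unfolding a_r_coset_def' by auto

lemma mem_quot: "X : car (quot_alg M N) \<longleftrightarrow> (\<exists>x\<in>car M. X = N +>\<^bsub>M\<^esub> x)"
 by(auto simp: A_RCOSETS_def')

declare quot_alg_simps(1) [simp del]

context
 fixes M :: "(complex, 'v, 'm) module_scheme" (structure) and N
 assumes N: "ssp N M"
begin

lemma rcoset_eq_iff:
 assumes "x : car M" "y : car M"
 shows "N +> x = N +> y \<longleftrightarrow> x \<oplus> (-1) \<odot> y : N"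
proof
 note M = subspD(5)[OF N]
 note D = subspD[OF N]
 assume "N +> x = N +> y"
 moreover have "x : N +> x" using D(2) M assms by(auto simp: mem_rcoset intro!: bexI[of _ "\<zero>"])
 ultimately obtain n where "n : N" "x = n \<oplus> y" by(auto simp: mem_rcoset)
 then show "x \<oplus> (-1) \<odot> y : N" using D(6) M assms by(simp add: vs_assoc)
next
 note M = subspD(5)[OF N]
 note D = subspD[OF N]
 have *: "N +> x <= N +> y" if "x \<oplus> (-1) \<odot> y : N" "x : car M" "y : car M" for x y
 proof
  fix z assume "z : N +> x"
  then obtain n where n: "n : N" "z = n \<oplus> x" by(auto simp: mem_rcoset)
  then have "z = (n \<oplus> (x \<oplus> (-1) \<odot> y)) \<oplus> y"
   using that M D(6) by(simp add: vs_assoc)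
  then show "z : N +> y" using n that D(3) by(auto simp: mem_rcoset)
 qed
 assume xy: "x \<oplus> (-1) \<odot> y : N"
 have "(-1) \<odot> (x \<oplus> (-1) \<odot> y) : N" using D(4) xy by blast
 then have "y \<oplus> (-1) \<odot> x : N" using M assms by(simp add: vs_smult_r vs_comm)
 then show "N +> x = N +> y" using * xy assms by blast
qed

lemma rcoset_self: "x : car M ==> x : N +> x"
 using subspD[OF N] by(auto simp: mem_rcoset intro!: bexI[of _ "\<zero>"])

lemma rcoset_rep:
 assumes "X : car (quot_alg M N)" "x : X"
 shows "x : car M" "X = N +> x"
proof -
 note D = subspD[OF N]
 obtain y where y: "y : car M" "X = N +> y" using assms by(auto simp: mem_quot)
 obtain n where n: "n : N" "x = n \<oplus> y" using assms y by(auto simp: mem_rcoset)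
 show x: "x : car M" using n y D by auto
 have "x \<oplus> (-1) \<odot> y = n" using n y D(5,6) by(simp add: vs_assoc)
 then show "X = N +> x" using rcoset_eq_iff[OF x y(1)] n y by auto
qed

lemma rcoset_zero_iff: "x : car M ==> N +> x = N \<longleftrightarrow> x : N"
proof -
 note D = subspD[OF N]
 assume x: "x : car M"
 have "N +> \<zero> = N" using D by(force simp: mem_rcoset)
 then show ?thesis using rcoset_eq_iff[OF x, of "\<zero>"] D x by auto
qed

lemma rcoset_add:
 assumes "x : car M" "y : car M"
 shows "(N +> x) <+> (N +> y) = N +> (x \<oplus> y)"
proof -
 note D = subspD[OF N]
 interpret M: abelian_group M by(rule vs_abelian_group[OF D(5)])
 have "additive_subgroup N M"
  by(rule additive_subgroupI, rule group.subgroupI[OF M.a_group])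
   (use D in \<open>auto simp: vs_a_inv a_inv_def[symmetric]\<close>)
 then interpret abelian_subgroup N M by(rule abelian_subgroupI3[OF _ vs_abelian_group[OF D(5)]])
 show ?thesis by(rule a_rcos_sum) (use assms in auto)
qed

text \<open>Two representatives differ by an element of \<open>N\<close>, so the union in the scalar
  multiplication of \<open>quot_alg\<close> runs over cosets that all coincide.\<close>

lemma rcoset_smult:
 assumes "x : car M"
 shows "(\<Union>y\<in>N +> x. N +> (c \<odot> y)) = N +> (c \<odot> x)"
proof -
 note D = subspD[OF N]
 have "N +> (c \<odot> y) = N +> (c \<odot> x)" if y: "y : N +> x" for y
 proof -
  obtain n where n: "n : N" "y = n \<oplus> x" using y by(auto simp: mem_rcoset)
  have "c \<odot> y \<oplus> (-1) \<odot> (c \<odot> x) = c \<odot> (y \<oplus> (-1) \<odot> x)"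
   using assms n D(5,6) by(simp add: vs_smult_r)
  also have "y \<oplus> (-1) \<odot> x = n" using assms n D(5,6) by(simp add: vs_assoc)
  finally show ?thesis using assms n D(4,5,6) by(subst rcoset_eq_iff) auto
 qed
 then show ?thesis using rcoset_self[OF assms] by blast
qed

lemma quot_vectorspace [simp]: "vsp (quot_alg M N)"
proof -
 note D = subspD[OF N]
 have z: "N = N +> \<zero>" using rcoset_zero_iff[of "\<zero>"] D by auto
 have z': "N +> x <+> N = N +> x" if "x : car M" for x
  using rcoset_add[of x "\<zero>"] D(5) that z by simp
 have z'': "\<exists>x\<in>car M. N = N +> x" using z D(5) vs_zero by blast
 have ex: "P X" if "X : car (quot_alg M N)" "!!x. x : car M ==> P (N +> x)" for P X
  using that by(auto simp: mem_quot)
 have c: "N +> x : car (quot_alg M N)" if "x : car M" for x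
  using that by(auto simp: mem_quot)
 show ?thesis
 proof(rule vectorspaceI)
  show "\<zero>[quot_alg M N] : car (quot_alg M N)" using z'' by(simp add: mem_quot)
 next
  fix x y assume "x : car (quot_alg M N)" "y : car (quot_alg M N)"
  then show "x \<oplus>[quot_alg M N] y : car (quot_alg M N)" "x \<oplus>[quot_alg M N] y = y \<oplus>[quot_alg M N] x"
   "a \<odot>[quot_alg M N] (x \<oplus>[quot_alg M N] y) = a \<odot>[quot_alg M N] x \<oplus>[quot_alg M N] a \<odot>[quot_alg M N] y" for a
   by(elim ex, simp add: rcoset_add rcoset_smult c D(5) vs_comm vs_smult_r)+
 next
  fix x assume x: "x : car (quot_alg M N)"
  then show "a \<odot>[quot_alg M N] x : car (quot_alg M N)"
   "x \<oplus>[quot_alg M N] \<zero>[quot_alg M N] = x" "0 \<odot>[quot_alg M N] x = \<zero>[quot_alg M N]"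
   "1 \<odot>[quot_alg M N] x = x"
   "(a * b) \<odot>[quot_alg M N] x = a \<odot>[quot_alg M N] (b \<odot>[quot_alg M N] x)"
   "(a + b) \<odot>[quot_alg M N] x = a \<odot>[quot_alg M N] x \<oplus>[quot_alg M N] b \<odot>[quot_alg M N] x" for a b
   by(elim ex, simp add: rcoset_add rcoset_smult c D(5) z' z[symmetric] vs_smult_l)+
 next
  fix x y w assume "x : car (quot_alg M N)" "y : car (quot_alg M N)" "w : car (quot_alg M N)"
  then show "(x \<oplus>[quot_alg M N] y) \<oplus>[quot_alg M N] w = x \<oplus>[quot_alg M N] (y \<oplus>[quot_alg M N] w)"
   by(elim ex, simp add: rcoset_add D(5) vs_assoc)
 qed
qed

lemma quot_lhom: "(%x. N +> x) : lhom M (quot_alg M N)"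
 by(rule lhomI) (auto simp: mem_quot rcoset_add rcoset_smult)

end

lemma vs_smult_neg:
 assumes "vsp V" "x : car V"
 shows "c \<odot>[V] x \<oplus>[V] (- c) \<odot>[V] x = \<zero>[V]"
 using vs_smult_l[OF assms, of c "-c"] assms by simp

lemma vs_sum_neg:
 assumes "vsp V" "x : car V" "y : car V"
 shows "x \<oplus>[V] (y \<oplus>[V] ((-1) \<odot>[V] x \<oplus>[V] (-1) \<odot>[V] y)) = \<zero>[V]"
 using vs_add_neg[of V "x \<oplus>[V] y"] assms by(simp add: vs_assoc vs_smult_r)

section \<open>Tensor products\<close>

lemma complex_mod_simps [simp]:
 "carrier complex_mod = UNIV" "\<zero>[complex_mod] = 0" "x \<oplus>[complex_mod] y = x + y" "c \<odot>[complex_mod] x = c * x"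
 by(simp_all add: complex_mod_def)

lemma cm_vs [simp]: "vectorspace CC complex_mod"
 by(rule vectorspaceI) (auto simp: algebra_simps)

lemma complex_mod_finsum [simp]: "finite A ==> finsum complex_mod f A = sum f A"
 by(induction A rule: finite_induct) (simp_all add: fsum_insert)

lemma keys_diff_subset:
 "kys a <= S ==> kys b <= S ==> kys (a - b) <= S"
 for a b :: "'x \<Rightarrow>\<^sub>0 complex"
 by(simp add: in_keys_iff lookup_minus subset_iff) metis

lemma tensor_rels_keys:
 assumes "vsp V" "vsp W" "r : tensor_rels V W"
 shows "kys r <= car V \<times> car W"
 using assms(3) unfolding tensor_rels_def
 by(elim UnE CollectE exE conjE; hypsubst) (intro keys_diff_subset; simp add: assms(1,2))+

lemma tnull_subsp [simp]:
 "vsp V ==> vsp W ==> ssp (tensor_null V W) (free_space (car V \<times> car W))"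
 unfolding tensor_null_def
 by(rule lspan_subsp[OF free_vs]) (use tensor_rels_keys in auto)

lemma tensor_vs [simp]: "vsp V ==> vsp W ==> vsp (tensor V W)"
 unfolding tensor_def by(rule quot_vectorspace) simp

text \<open>A tensor product sees only carrier, addition and scalars. Records that add a product, an
  action or a comultiplication to the same space therefore share literally the same tensors, which
  is used to switch between them.\<close>

lemma tensor_cong:
 assumes "car V = car V'" "add V = add V'" "module.smult V = module.smult V'"
  "car W = car W'" "add W = add W'" "module.smult W = module.smult W'"
 shows "tensor V W = tensor V' W'" "pure V W = pure V' W'" "tensor_null V W = tensor_null V' W'"
proof -
 have r: "tensor_rels V W = tensor_rels V' W'" unfolding tensor_rels_def using assms by simp
 then show n: "tensor_null V W = tensor_null V' W'" unfolding tensor_null_def using assms by simp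
 show "tensor V W = tensor V' W'" unfolding tensor_def n using assms by simp
 show "pure V W = pure V' W'" unfolding pure_def[abs_def] n using assms by simp
qed

definition bilin :: "(complex, 'v, 'm) module_scheme => (complex, 'w, 'n) module_scheme =>
 (complex, 'y, 'o) module_scheme => ('v => 'w => 'y) => bool" where
 "bilin V W X f \<longleftrightarrow> (\<forall>v\<in>car V. f v : lhom W X) & (\<forall>w\<in>car W. (%v. f v w) : lhom V X)"

lemma bilinI:
 "(!!v. v : car V ==> f v : lhom W X) ==> (!!w. w : car W ==> (%v. f v w) : lhom V X) ==> bilin V W X f"
 by(simp add: bilin_def)

lemma bilinD:
 assumes "bilin V W X f"
 shows "!!v. v : car V ==> f v : lhom W X" "!!w. w : car W ==> (%v. f v w) : lhom V X"
  "!!v w. v : car V ==> w : car W ==> f v w : car X"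
  "!!v w w'. v : car V ==> w : car W ==> w' : car W ==> f v (w \<oplus>[W] w') = f v w \<oplus>[X] f v w'"
  "!!v v' w. v : car V ==> v' : car V ==> w : car W ==> f (v \<oplus>[V] v') w = f v w \<oplus>[X] f v' w"
  "!!c v w. v : car V ==> w : car W ==> f v (c \<odot>[W] w) = c \<odot>[X] f v w"
  "!!c v w. v : car V ==> w : car W ==> f (c \<odot>[V] v) w = c \<odot>[X] f v w"
proof -
 have *: "!!v. v : car V ==> f v : lhom W X" "!!w. w : car W ==> (%v. f v w) : lhom V X"
  using assms by(simp_all add: bilin_def)
 then show "!!v. v : car V ==> f v : lhom W X" "!!w. w : car W ==> (%v. f v w) : lhom V X"
  by(simp_all only: *)
 show "!!v w. v : car V ==> w : car W ==> f v w : car X"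
  "!!v w w'. v : car V ==> w : car W ==> w' : car W ==> f v (w \<oplus>[W] w') = f v w \<oplus>[X] f v w'"
  "!!c v w. v : car V ==> w : car W ==> f v (c \<odot>[W] w) = c \<odot>[X] f v w"
  using lhomD[OF *(1)] by auto
 show "!!v v' w. v : car V ==> v' : car V ==> w : car W ==> f (v \<oplus>[V] v') w = f v w \<oplus>[X] f v' w"
  "!!c v w. v : car V ==> w : car W ==> f (c \<odot>[V] v) w = c \<odot>[X] f v w"
  using lhomD[OF *(2)] by auto
qed

lemma bilin_lhom: "bilin V W X f ==> g : lhom X Y ==> bilin V W Y (%v w. g (f v w))"
 by(rule bilinI; rule lhom_comp[where g=g]) (simp_all add: bilinD)

lemma bilin_precomp: "bilin V W X f ==> g : lhom V' V ==> h : lhom W' W ==> bilin V' W' X (%v w. f (g v) (h w))"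
proof(rule bilinI)
 assume f: "bilin V W X f" and g: "g : lhom V' V" and h: "h : lhom W' W"
 show "(%w. f (g v) (h w)) : lhom W' X" if "v : car V'" for v
  by(rule lhom_comp[OF h bilinD(1)[OF f lhomD(1)[OF g that]]])
 show "(%v. f (g v) (h w)) : lhom V' X" if "w : car W'" for w
  by(rule lhom_comp[OF g bilinD(2)[OF f lhomD(1)[OF h that]]])
qed

context
 fixes V :: "(complex, 'v, 'm) module_scheme" and W :: "(complex, 'w, 'n) module_scheme"
 assumes V: "vsp V" and W: "vsp W"
begin

lemma pure_closed [simp]: "v : car V ==> w : car W ==> pure V W v w : car (tensor V W)"
 unfolding pure_def tensor_def mem_quot by(rule bexI[of _ "sng (v, w) 1"]) auto

lemma tensor_rel_eq:
 assumes "kys p <= car V \<times> car W" "kys q <= car V \<times> car W"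
  "p - q : tensor_rels V W"
 shows "tensor_null V W +>\<^bsub>free_space (car V \<times> car W)\<^esub> p = tensor_null V W +>\<^bsub>free_space (car V \<times> car W)\<^esub> q"
proof -
 let ?F = "free_space (car V \<times> car W)"
 have *: "p + pmap ((*) (-1)) q = p - q"
  by(rule poly_mapping_eqI) (simp add: lookup_add lookup_minus)
 have "tensor_rels V W <= tensor_null V W"
  unfolding tensor_null_def
  by(rule lspan_sup) (use tensor_rels_keys[OF V W] in auto)
 then show ?thesis using rcoset_eq_iff[OF tnull_subsp[OF V W], of p q] assms * by auto
qed

lemma tcoset_lhom:
 "(%p. tensor_null V W +>\<^bsub>free_space (car V \<times> car W)\<^esub> p) : lhom (free_space (car V \<times> car W)) (tensor V W)"
 unfolding tensor_def by(rule quot_lhom[OF tnull_subsp[OF V W]])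

lemma bilin_pure: "bilin V W (tensor V W) (pure V W)"
proof -
 let ?F = "free_space (car V \<times> car W)"
 note q = lhomD[OF tcoset_lhom, simplified]
 have add: "tensor_null V W +>\<^bsub>?F\<^esub> p = pure V W a b \<oplus>[tensor V W] pure V W a' b'"
  if "p - sng (a, b) 1 - sng (a', b') 1 : tensor_rels V W"
   "kys p <= car V \<times> car W" "a : car V" "a' : car V" "b : car W" "b' : car W" for p a b a' b'
 proof -
  have "kys (sng (a, b) 1 + sng (a', b') (1::complex)) <= car V \<times> car W"
   using Poly_Mapping.keys_add[of "sng (a, b) (1::complex)" "sng (a', b') 1"] that by auto
  then have "tensor_null V W +>\<^bsub>?F\<^esub> p =
    tensor_null V W +>\<^bsub>?F\<^esub> (sng (a, b) 1 + sng (a', b') 1)"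
   using that by(intro tensor_rel_eq) (simp_all add: diff_diff_eq)
  then show ?thesis using q(2)[of "sng (a, b) 1" "sng (a', b') 1"] that
   by(simp add: pure_def)
 qed
 have sm: "tensor_null V W +>\<^bsub>?F\<^esub> p = c \<odot>[tensor V W] pure V W a b"
  if "p - sng (a, b) c : tensor_rels V W"
   "kys p <= car V \<times> car W" "a : car V" "b : car W" for p a b c
 proof -
  have "tensor_null V W +>\<^bsub>?F\<^esub> p = tensor_null V W +>\<^bsub>?F\<^esub> sng (a, b) c"
   using that by(intro tensor_rel_eq) simp_all
  moreover have "pmap ((*) c) (sng (a, b) 1) = sng (a, b) c"
   by(rule poly_mapping_eqI) (simp add: lookup_single when_def)
  ultimately show ?thesis using q(3)[of "sng (a, b) 1" c] that
   by(simp add: pure_def)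
 qed
 show ?thesis
 proof(intro bilinI lhomI)
  fix v w w' assume "v : car V" "w : car W" "w' : car W"
  then show "pure V W v (w \<oplus>[W] w') = pure V W v w \<oplus>[tensor V W] pure V W v w'"
   using W by(subst pure_def, intro add) (auto simp: tensor_rels_def)
 next
  fix v c w assume "v : car V" "w : car W"
  then show "pure V W v (c \<odot>[W] w) = c \<odot>[tensor V W] pure V W v w"
   using W by(subst pure_def, intro sm) (auto simp: tensor_rels_def)
 next
  fix v v' w assume "v : car V" "w : car W" "v' : car V"
  then show "pure V W (v \<oplus>[V] v') w = pure V W v w \<oplus>[tensor V W] pure V W v' w"
   using V by(subst pure_def, intro add) (auto simp: tensor_rels_def)
 next
  fix v c w assume "v : car V" "w : car W"
  then show "pure V W (c \<odot>[V] v) w = c \<odot>[tensor V W] pure V W v w"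
   using V by(subst pure_def, intro sm) (auto simp: tensor_rels_def)
 qed simp_all
qed

lemmas pure_add_left = bilinD(5)[OF bilin_pure] and pure_add_right = bilinD(4)[OF bilin_pure]
 and pure_smult_left = bilinD(7)[OF bilin_pure] and pure_smult_right = bilinD(6)[OF bilin_pure]
 and pure_lhomr = bilinD(1)[OF bilin_pure] and pure_lhoml = bilinD(2)[OF bilin_pure]

lemma pure_zero_left [simp]: "w : car W ==> pure V W \<zero>[V] w = \<zero>[tensor V W]"
 using lhom_zero[OF pure_lhoml V] V W by simp

lemma pure_zero_right [simp]: "v : car V ==> pure V W v \<zero>[W] = \<zero>[tensor V W]"
 using lhom_zero[OF pure_lhomr W] V W by simp

lemma pure_span: "car (tensor V W) = lspan (tensor V W) {pure V W v w | v w. v : car V & w : car W}"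
 (is "_ = lspan _ ?P")
proof
 let ?F = "free_space (car V \<times> car W)"
 let ?q = "%p. tensor_null V W +>\<^bsub>?F\<^esub> p"
 have P: "?P <= car (tensor V W)" by auto
 show "lspan (tensor V W) ?P <= car (tensor V W)" by(rule lspan_closed[OF _ P]) (simp add: V W)
 show "car (tensor V W) <= lspan (tensor V W) ?P"
 proof
  fix t assume "t : car (tensor V W)"
  then obtain p where p: "kys p <= car V \<times> car W" "t = ?q p"
   unfolding tensor_def by(auto simp: mem_quot)
  have "p : lspan ?F ((%k. sng k 1) ` (car V \<times> car W))"
   by(rule free_space_span) (use p in auto)
  moreover have "?q ` lspan ?F ((%k. sng k 1) ` (car V \<times> car W)) <= lspan (tensor V W) ?P"
   by(rule lspan_img[OF tcoset_lhom _ _ _ lspan_subsp[OF _ P]])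
    (use V W lspan_sup[OF _ P] in \<open>auto simp: pure_def\<close>)
  ultimately show "t : lspan (tensor V W) ?P" using p by auto
 qed
qed

text \<open>A scalar in front of a pure tensor is absorbed in its left factor, so the step carries
  no coefficient.\<close>

lemma tensor_induct [consumes 1, case_names zero add]:
 assumes "t : car (tensor V W)" "P \<zero>[tensor V W]"
  "!!v w t. v : car V ==> w : car W ==> t : car (tensor V W) ==> P t ==> P (pure V W v w \<oplus>[tensor V W] t)"
 shows "P t"
proof -
 have T: "vsp (tensor V W)" using V W by simp
 have S: "{pure V W v w | v w. v : car V & w : car W} <= car (tensor V W)" by auto
 show ?thesis
  using T S assms(1)[unfolded pure_span]
 proof(induction rule: lspan_induct)
  case zero
  then show ?case by(rule assms)
 next
  case (add c s y)
  then obtain v w where "s = pure V W v w" "v : car V" "w : car W" by auto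
  then show ?case using assms(3)[of "c \<odot>[V] v" w y] add V by(simp add: pure_smult_left)
 qed
qed

lemma tensor_eqI:
 assumes "f : lhom (tensor V W) X" "g : lhom (tensor V W) X" "vsp X" "t : car (tensor V W)"
  "!!v w. v : car V ==> w : car W ==> f (pure V W v w) = g (pure V W v w)"
 shows "f t = g t"
 using assms(4)
proof(induction rule: tensor_induct)
 case zero
 then show ?case using lhom_zero[OF assms(1)] lhom_zero[OF assms(2)] V W assms(3) by simp
next
 case (add v w t)
 then show ?case using lhomD(2)[OF assms(1)] lhomD(2)[OF assms(2)] assms(5) by simp
qed

lemma tensor_image_subset:
 assumes f: "f : lhom (tensor V W) X" and X: "ssp N X" and t: "t : car (tensor V W)"
  and p: "!!v w. v : car V ==> w : car W ==> f (pure V W v w) : N"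
 shows "f t : N"
 using t
proof(induction rule: tensor_induct)
 case zero
 then show ?case using lhom_zero[OF f] V W subspD[OF X] by simp
next
 case (add v w t)
 then show ?case using lhomD(2)[OF f] subspD(3)[OF X] p by simp
qed

context
 fixes X :: "(complex, 'y, 'o) module_scheme" and f
 assumes X: "vsp X" and f: "bilin V W X f"
begin

text \<open>Bilinearity says exactly that the four families of defining relations are in the kernel
  of the linear extension; a kernel is a subspace, so it contains their span. This makes
  \<open>class_ext\<close> independent of the representative picked by \<open>SOME\<close>.\<close>

lemma lin_ext_tensor_null:
 assumes "p : tensor_null V W"
 shows "lin_ext X (%(a, b). f a b) p = \<zero>[X]"
proof -
 let ?F = "free_space (car V \<times> car W)"
 have fc: "(%(a, b). f a b) : car V \<times> car W \<rightarrow> car X" using bilinD(3)[OF f] by auto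
 note l = lin_ext_lhom[OF X fc]
 have diff: "lin_ext X (%(a, b). f a b) (a - b) = lin_ext X (%(a, b). f a b) a \<oplus>[X] (-1) \<odot>[X] lin_ext X (%(a, b). f a b) b"
  if "kys a <= car V \<times> car W" "kys b <= car V \<times> car W" for a b
 proof -
  have *: "a - b = a + pmap ((*) (-1)) b" by(rule poly_mapping_eqI) (simp add: lookup_add lookup_minus)
  have "kys (pmap ((*) (-1)) b) <= car V \<times> car W"
   using keys_map_mult[of "-1" b] that by blast
  from lin_ext_add[OF X fc that(1) this] lin_ext_map[OF X fc that(2), of "-1"] show ?thesis by(simp only: *)
 qed
 have sub: "tensor_rels V W <= {p : car ?F. lin_ext X (%(a, b). f a b) p = \<zero>[X]}"
 proof
  fix r assume r: "r : tensor_rels V W"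
  have "lin_ext X (%(a, b). f a b) r = \<zero>[X]"
   using r unfolding tensor_rels_def
   by(elim UnE CollectE exE conjE; hypsubst)
    (simp_all add: diff keys_diff_subset lin_ext_single[OF X fc] bilinD[OF f] V W X vs_assoc vs_smult_neg vs_sum_neg)
  then show "r : {p : car ?F. lin_ext X (%(a, b). f a b) p = \<zero>[X]}"
   using tensor_rels_keys[OF V W r] by simp
 qed
 have "tensor_null V W <= {p : car ?F. lin_ext X (%(a, b). f a b) p = \<zero>[X]}"
  unfolding tensor_null_def
  by(rule lspan_least[OF _ ker_subsp[OF l] sub]) (simp_all add: X)
 then show ?thesis using assms by auto
qed

lemma class_ext_coset:
 assumes "kys p <= car V \<times> car W"
 shows "class_ext X (%(a, b). f a b) (tensor_null V W +>\<^bsub>free_space (car V \<times> car W)\<^esub> p) = lin_ext X (%(a, b). f a b) p"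
proof -
 let ?F = "free_space (car V \<times> car W)"
 let ?c = "tensor_null V W +>\<^bsub>?F\<^esub> p"
 have fc: "(%(a, b). f a b) : car V \<times> car W \<rightarrow> car X" using bilinD(3)[OF f] by auto
 have "p : ?c" using rcoset_self[OF tnull_subsp[OF V W]] assms by simp
 then have "(SOME q. q : ?c) : ?c" by(rule someI)
 then obtain n where n: "n : tensor_null V W" "(SOME q. q : ?c) = n + p" by(auto simp: mem_rcoset)
 have "lin_ext X (%(a, b). f a b) (n + p) = lin_ext X (%(a, b). f a b) n \<oplus>[X] lin_ext X (%(a, b). f a b) p"
  by(rule lin_ext_add[OF X fc]) (use n(1) subspD(1)[OF tnull_subsp[OF V W]] assms in auto)
 then show ?thesis unfolding class_ext_def n(2)
  using lin_ext_tensor_null[OF n(1)] lin_ext_closed[OF X fc assms] X by simp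
qed

lemma class_ext_rep:
 assumes "t : car (tensor V W)" "p : t"
 shows "class_ext X (%(a, b). f a b) t = lin_ext X (%(a, b). f a b) p"
 using rcoset_rep[OF tnull_subsp[OF V W] assms[unfolded tensor_def]] class_ext_coset[of p] by auto

lemma cext_lhom: "class_ext X (%(a, b). f a b) : lhom (tensor V W) X"
proof -
 let ?F = "free_space (car V \<times> car W)"
 let ?q = "%p. tensor_null V W +>\<^bsub>?F\<^esub> p"
 have fc: "(%(a, b). f a b) : car V \<times> car W \<rightarrow> car X" using bilinD(3)[OF f] by auto
 note l = lin_ext_lhom[OF X fc]
 note q = lhomD(2,3)[OF tcoset_lhom, symmetric]
 have ex: "P t" if "t : car (tensor V W)" "!!p. p : car ?F ==> P (?q p)" for t P
  using that unfolding tensor_def by(auto simp: mem_quot)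
 have c: "class_ext X (%(a, b). f a b) (?q p) = lin_ext X (%(a, b). f a b) p" if "p : car ?F" for p
  using class_ext_coset that by simp
 show ?thesis
 proof(rule lhomI)
  fix t assume "t : car (tensor V W)"
  then show "class_ext X (%(a, b). f a b) t : car X"
   by(rule ex) (simp only: c lhomD(1)[OF l])
 next
  fix t u assume tu: "t : car (tensor V W)" "u : car (tensor V W)"
  show "class_ext X (%(a, b). f a b) (t \<oplus>[tensor V W] u) = class_ext X (%(a, b). f a b) t \<oplus>[X] class_ext X (%(a, b). f a b) u"
   by(rule ex[OF tu(1)], rule ex[OF tu(2)])
    (simp only: c q vs_add[OF free_vs] lhomD(2)[OF l])
 next
  fix k t assume t: "t : car (tensor V W)"
  show "class_ext X (%(a, b). f a b) (k \<odot>[tensor V W] t) = k \<odot>[X] class_ext X (%(a, b). f a b) t"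
   by(rule ex[OF t]) (simp only: c q vs_smult[OF free_vs] lhomD(3)[OF l])
 qed
qed

lemma cext_pure:
 assumes "v : car V" "w : car W"
 shows "class_ext X (%(a, b). f a b) (pure V W v w) = f v w"
proof -
 have fc: "(%(a, b). f a b) : car V \<times> car W \<rightarrow> car X" using bilinD(3)[OF f] by auto
 show ?thesis unfolding pure_def
  by(subst class_ext_coset) (use assms X bilinD(3)[OF f] in \<open>auto simp: lin_ext_single[OF X fc]\<close>)
qed

lemmas cext_closed = lhomD(1)[OF cext_lhom]
 and class_ext_add = lhomD(2)[OF cext_lhom]

end

lemma tensor_some_rep:
 assumes "t : car (tensor V W)"
 shows "(SOME p. p : t) : t" "kys (SOME p. p : t) <= car V \<times> car W"
proof -
 have "\<exists>p. p : t" using assms rcoset_self[OF tnull_subsp[OF V W]]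
  unfolding tensor_def by(auto simp: mem_quot)
 then show *: "(SOME p. p : t) : t" by(rule someI_ex)
 show "kys (SOME p. p : t) <= car V \<times> car W"
  using rcoset_rep(1)[OF tnull_subsp[OF V W] _ *] assms unfolding tensor_def by simp
qed

text \<open>The representative picked by \<open>SOME\<close> is supported on pairs of carrier
  elements, so agreement there decides the value, whatever the functions do elsewhere.\<close>

lemma cext_cong:
 assumes "t : car (tensor V W)" "vsp X" "!!a b. a : car V ==> b : car W ==> g a b : car X"
  "!!a b. a : car V ==> b : car W ==> f a b = g a b"
 shows "class_ext X (%(a, b). f a b) t = class_ext X (%(a, b). g a b) t"
 unfolding class_ext_def
 by(rule lin_ext_cong) (use assms tensor_some_rep(2)[OF assms(1)] in auto)

lemma lhom_cext:
 assumes "g : lhom X Y" "vsp X" "vsp Y" "t : car (tensor V W)"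
  "!!a b. a : car V ==> b : car W ==> f a b : car X"
 shows "g (class_ext X (%(a, b). f a b) t) = class_ext Y (%(a, b). g (f a b)) t"
 unfolding class_ext_def
 by(subst lhom_lin_ext[OF assms(1-3)])
  (use assms tensor_some_rep(2)[OF assms(4)] in \<open>auto simp: case_prod_unfold subset_iff\<close>)

text \<open>With \<open>t\<close> fixed its chosen representative is fixed as well, so as a function
  of the parameter the value is one finite sum of linear maps. Nested Sweedler sums are shown to be
  linear in an inner variable this way.\<close>

lemma cext_param:
 assumes "vsp X" "t : car (tensor V W)"
  "!!a b. a : car V ==> b : car W ==> (%u. f u a b) : lhom U X"
 shows "(%u. class_ext X (%(a, b). f u a b) t) : lhom U X"
 unfolding class_ext_def lin_ext_def case_prod_unfold
 by(rule lhom_finsum[OF _ lhom_smult]) (use assms tensor_some_rep(2)[OF assms(2)] in \<open>auto simp: subset_iff\<close>)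

end

lemma bilin_tensor_map:
 assumes "vsp V'" "vsp W'" "f : lhom V V'" "g : lhom W W'"
 shows "bilin V W (tensor V' W') (%a b. pure V' W' (f a) (g b))"
 by(rule bilin_precomp[OF bilin_pure]) (use assms in auto)

context
 fixes V :: "(complex, 'v, 'm) module_scheme" and W :: "(complex, 'w, 'n) module_scheme"
  and V' :: "(complex, 'v2, 'm2) module_scheme" and W' :: "(complex, 'w2, 'n2) module_scheme" and f g
 assumes V: "vsp V" and W: "vsp W" and V': "vsp V'" and W': "vsp W'"
  and f: "f : lhom V V'" and g: "g : lhom W W'"
begin

lemma tmap_lhom: "tensor_map V' W' f g : lhom (tensor V W) (tensor V' W')"
 unfolding tensor_map_def[abs_def]
 by(rule cext_lhom[OF V W _ bilin_tensor_map[OF V' W' f g]]) (simp add: V' W')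

lemma tmap_pure: "v : car V ==> w : car W ==> tensor_map V' W' f g (pure V W v w) = pure V' W' (f v) (g w)"
 unfolding tensor_map_def
 by(rule cext_pure[OF V W _ bilin_tensor_map[OF V' W' f g]]) (simp_all add: V' W')

text \<open>Both sides are linear in \<open>t\<close> and agree on pure tensors. This is the
  substitution rule for Sweedler sums; functoriality of \<open>tensor_map\<close> is a special
  case.\<close>

lemma cext_tmap:
 assumes "vsp X" "bilin V' W' X h" "t : car (tensor V W)"
 shows "class_ext X (%(a, b). h a b) (tensor_map V' W' f g t) = class_ext X (%(a, b). h (f a) (g b)) t"
proof(rule tensor_eqI[OF V W _ _ assms(1,3)])
 show "(%t. class_ext X (%(a, b). h a b) (tensor_map V' W' f g t)) : lhom (tensor V W) X"
  by(rule lhom_comp[OF tmap_lhom cext_lhom[OF V' W' assms(1,2)]])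
 show "class_ext X (%(a, b). h (f a) (g b)) : lhom (tensor V W) X"
  by(rule cext_lhom[OF V W assms(1) bilin_precomp[OF assms(2) f g]])
 show "class_ext X (%(a, b). h a b) (tensor_map V' W' f g (pure V W v w)) = class_ext X (%(a, b). h (f a) (g b)) (pure V W v w)"
  if "v : car V" "w : car W" for v w
  using that cext_pure[OF V' W' assms(1,2)] cext_pure[OF V W assms(1) bilin_precomp[OF assms(2) f g]]
   lhomD(1)[OF f] lhomD(1)[OF g]
  by(simp add: tmap_pure)
qed

end

lemma tensor_map_comp:
 assumes "vsp V" "vsp W" "vsp V'" "vsp W'" "vsp V''" "vsp W''"
  "f : lhom V V'" "g : lhom W W'" "f' : lhom V' V''" "g' : lhom W' W''" "t : car (tensor V W)"
 shows "tensor_map V'' W'' f' g' (tensor_map V' W' f g t) = tensor_map V'' W'' (%x. f' (f x)) (%x. g' (g x)) t"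
 unfolding tensor_map_def[of V'' W'']
 by(rule cext_tmap) (use assms in \<open>auto intro: bilin_tensor_map\<close>)

lemma tensor_map_id:
 assumes "vsp V" "vsp W" "t : car (tensor V W)"
  "!!v. v : car V ==> f v = v" "!!w. w : car W ==> g w = w"
 shows "tensor_map V W f g t = t"
proof -
 have f: "f : lhom V V" and g: "g : lhom W W" using assms by(auto intro: lhom_cong[OF lhom_id])
 show ?thesis
  by(rule tensor_eqI[OF assms(1,2) tmap_lhom lhom_id])
  (use assms f g in \<open>auto simp: tmap_pure[of V W]\<close>)
qed

lemma tensor_map_cong:
 assumes "vsp V" "vsp W" "vsp V'" "vsp W'" "t : car (tensor V W)"
  "f : lhom V V'" "g : lhom W W'"
  "!!v. v : car V ==> f' v = f v" "!!w. w : car W ==> g' w = g w"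
 shows "tensor_map V' W' f' g' t = tensor_map V' W' f g t"
 unfolding tensor_map_def
 by(rule cext_cong) (use assms lhomD(1)[OF assms(6)] lhomD(1)[OF assms(7)] in auto)

lemma tspan_subsp:
 assumes "vsp V" "vsp W" "A <= car V" "C <= car W"
 shows "ssp (tensor_span V W A C) (tensor V W)"
 unfolding tensor_span_def by(rule lspan_subsp) (use assms in \<open>auto simp: subset_iff\<close>)

lemma tspan_mem:
 assumes "vsp V" "vsp W" "A <= car V" "C <= car W" "a : A" "c : C"
 shows "pure V W a c : tensor_span V W A C"
proof -
 have "{pure V W a c | a c. a : A & c : C} <= tensor_span V W A C"
  unfolding tensor_span_def by(rule lspan_sup) (use assms in \<open>auto simp: subset_iff\<close>)
 then show ?thesis using assms by auto
qed

lemma tspan_img: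
 assumes VW: "vsp V" "vsp W" "A <= car V" "C <= car W"
  and f: "f : lhom (tensor V W) X" and N: "ssp N X"
  and fN: "!!a c. a : A ==> c : C ==> f (pure V W a c) : N" and t: "t : tensor_span V W A C"
 shows "f t : N"
proof -
 have "f ` tensor_span V W A C <= N"
  unfolding tensor_span_def by(rule lspan_img[OF f]) (use assms subspD(5)[OF N] in \<open>auto simp: subset_iff\<close>)
 then show ?thesis using t by auto
qed

lemma tspan_least:
 assumes VW: "vsp V" "vsp W" and N: "ssp N (tensor V W)"
  and fN: "!!a c. a : A ==> c : C ==> pure V W a c : N" and t: "t : tensor_span V W A C"
 shows "t : N"
proof -
 have "tensor_span V W A C <= N"
  unfolding tensor_span_def by(rule lspan_least) (use assms in auto)
 then show ?thesis using t by auto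
qed

lemma tmap_span:
 assumes "vsp V" "vsp W" "vsp V'" "vsp W'" "f : lhom V V'" "g : lhom W W'"
  "A <= car V" "C <= car W"
 shows "tensor_map V' W' f g ` tensor_span V W A C = tensor_span V' W' (f ` A) (g ` C)"
proof -
 have "tensor_map V' W' f g ` tensor_span V W A C = lspan (tensor V' W') (tensor_map V' W' f g ` {pure V W a c | a c. a : A & c : C})"
  unfolding tensor_span_def by(rule img_lspan[OF tmap_lhom]) (use assms in \<open>auto simp: subset_iff\<close>)
 also have "tensor_map V' W' f g ` {pure V W a c | a c. a : A & c : C} = {pure V' W' a c | a c. a : f ` A & c : g ` C}"
 proof -
  have *: "tensor_map V' W' f g (pure V W a c) = pure V' W' (f a) (g c)" if "a : A" "c : C" for a c
   using assms that by(intro tmap_pure[of V W]) auto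
  show ?thesis
  proof(intro subset_antisym subsetI)
   fix x assume "x : tensor_map V' W' f g ` {pure V W a c | a c. a : A & c : C}"
   then show "x : {pure V' W' a c | a c. a : f ` A & c : g ` C}" using * by blast
  next
   fix x assume "x : {pure V' W' a c | a c. a : f ` A & c : g ` C}"
   then obtain a c where ac: "a : A" "c : C" "x = pure V' W' (f a) (g c)" by blast
   show "x : tensor_map V' W' f g ` {pure V W a c | a c. a : A & c : C}"
    by(rule image_eqI[of _ _ "pure V W a c"]) (use ac * in auto)
  qed
 qed
 finally show ?thesis unfolding tensor_span_def .
qed

lemma subspace_set_add:
 assumes "ssp A V" "ssp C V"
 shows "ssp (A <+>\<^bsub>V\<^esub> C) V"
proof -
 note A = subspD[OF assms(1)] and C = subspD[OF assms(2)]
 have mem: "x : A <+>\<^bsub>V\<^esub> C \<longleftrightarrow> (\<exists>a\<in>A. \<exists>c\<in>C. x = a \<oplus>[V] c)" for x by(auto simp: set_add_def')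
 show ?thesis
 proof(rule subspaceI)
  show "vsp V" by(rule A)
  show "A <+>\<^bsub>V\<^esub> C <= car V" using A C by(auto simp: mem)
  show "\<zero>[V] : A <+>\<^bsub>V\<^esub> C" using A(2,5) C(2) by(force simp: mem)
 next
  fix x y assume "x : A <+>\<^bsub>V\<^esub> C" "y : A <+>\<^bsub>V\<^esub> C"
  then obtain a c a' c' where *: "a : A" "c : C" "a' : A" "c' : C" "x = a \<oplus>[V] c" "y = a' \<oplus>[V] c'"
   by(auto simp: mem)
  then have "x \<oplus>[V] y = (a \<oplus>[V] a') \<oplus>[V] (c \<oplus>[V] c')" using A(5,6) C(6) by(simp add: vs_assoc vs_lcomm)
  then show "x \<oplus>[V] y : A <+>\<^bsub>V\<^esub> C" unfolding mem using A(3)[OF *(1,3)] C(3)[OF *(2,4)] by blast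
 next
  fix k x assume "x : A <+>\<^bsub>V\<^esub> C"
  then obtain a c where *: "a : A" "c : C" "x = a \<oplus>[V] c" by(auto simp: mem)
  then have "k \<odot>[V] x = k \<odot>[V] a \<oplus>[V] k \<odot>[V] c" using A(5,6) C(6) by(simp add: vs_smult_r)
  then show "k \<odot>[V] x : A <+>\<^bsub>V\<^esub> C" unfolding mem using A(4)[OF *(1)] C(4)[OF *(2)] by blast
 qed
qed

lemma mem_set_add: "x : A <+>\<^bsub>V\<^esub> C \<longleftrightarrow> (\<exists>a\<in>A. \<exists>c\<in>C. x = a \<oplus>[V] c)"
 by(auto simp: set_add_def')

section \<open>Dual bases\<close>

text \<open>The map \<open>f \<otimes> id\<close> followed by the identification of
  \<open>k \<otimes> W\<close> with \<open>W\<close>; \<open>rslice\<close> is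
  \<open>id \<otimes> f\<close>. Applied to comultiplications they become the actions of the dual
  algebra.\<close>

definition lslice :: "(complex, 'w, 'n) module_scheme => ('v => complex) => ('v, 'w) tens => 'w" where
 "lslice W f = class_ext W (%(a, b). f a \<odot>[W] b)"

definition rslice :: "(complex, 'v, 'n) module_scheme => ('w => complex) => ('v, 'w) tens => 'v" where
 "rslice V f = class_ext V (%(a, b). f b \<odot>[V] a)"

lemma bilin_lslice: "vsp W ==> f : lhom V complex_mod ==> bilin V W W (%a b. f a \<odot>[W] b)"
 by(intro bilinI lhomI) (simp_all add: lhomD vs_smult_l vs_smult_r mult.commute)

lemma bilin_rslice: "vsp V ==> f : lhom W complex_mod ==> bilin V W V (%a b. f b \<odot>[V] a)"
 by(intro bilinI lhomI) (simp_all add: lhomD vs_smult_l vs_smult_r mult.commute)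

context
 fixes V :: "(complex, 'v, 'm) module_scheme" and W :: "(complex, 'w, 'n) module_scheme"
 assumes V: "vsp V" and W: "vsp W"
begin

lemma lslice_lhom: "f : lhom V complex_mod ==> lslice W f : lhom (tensor V W) W"
 unfolding lslice_def by(rule cext_lhom[OF V W W bilin_lslice[OF W]])
lemma lslice_pure [simp]: "f : lhom V complex_mod ==> v : car V ==> w : car W ==> lslice W f (pure V W v w) = f v \<odot>[W] w"
 unfolding lslice_def by(rule cext_pure[OF V W W bilin_lslice[OF W]])
lemma rslice_lhom: "f : lhom W complex_mod ==> rslice V f : lhom (tensor V W) V"
 unfolding rslice_def by(rule cext_lhom[OF V W V bilin_rslice[OF V]])
lemma rslice_pure [simp]: "f : lhom W complex_mod ==> v : car V ==> w : car W ==> rslice V f (pure V W v w) = f w \<odot>[V] v"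
 unfolding rslice_def by(rule cext_pure[OF V W V bilin_rslice[OF V]])

end

text \<open>The coordinate functionals are indexed by the basis vectors themselves, so that a subset
  of the basis, such as the group-likes, selects its functionals without a numbering.\<close>

definition dual_basis :: "(complex, 'v, 'm) module_scheme => 'v set => ('v => 'v => complex) => bool" where
 "dual_basis V B d \<longleftrightarrow> finite B & B <= car V & (\<forall>b\<in>B. d b : lhom V complex_mod) &
  (\<forall>b\<in>B. \<forall>c\<in>B. d b c = (if b = c then 1 else 0)) &
  (\<forall>v\<in>car V. finsum V (%b. d b v \<odot>[V] b) B = v)"

lemma dual_basisD:
 assumes "dual_basis V B d"
 shows "finite B" "B <= car V" "!!b. b : B ==> d b : lhom V complex_mod"
  "!!b c. b : B ==> c : B ==> d b c = (if b = c then 1 else 0)"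
  "!!v. v : car V ==> finsum V (%b. d b v \<odot>[V] b) B = v" "!!b. b : B ==> b : car V"
 using assms unfolding dual_basis_def by auto

text \<open>On \<open>v \<otimes> w\<close> the sum moves the coordinates of \<open>v\<close> back
  to the left factor. Every tensor gets a normal form whose right factors are slices.\<close>

lemma tensor_expand_left:
 assumes V: "vsp V" and W: "vsp W" and B: "dual_basis V B d" and t: "t : car (tensor V W)"
 shows "finsum (tensor V W) (%b. pure V W b (lslice W (d b) t)) B = t"
proof -
 note D = dual_basisD[OF B]
 show ?thesis
 proof(rule tensor_eqI[OF V W _ lhom_id _ t])
  show "(%t. finsum (tensor V W) (%b. pure V W b (lslice W (d b) t)) B) : lhom (tensor V W) (tensor V W)"
   by(rule lhom_finsum[OF D(1) lhom_comp[OF lslice_lhom[OF V W] pure_lhomr[OF V W]]])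
    (use D V W in auto)
  show "finsum (tensor V W) (%b. pure V W b (lslice W (d b) (pure V W v w))) B = pure V W v w"
   if vw: "v : car V" "w : car W" for v w
  proof -
   have "finsum (tensor V W) (%b. pure V W b (lslice W (d b) (pure V W v w))) B =
    finsum (tensor V W) (%b. pure V W (d b v \<odot>[V] b) w) B"
    by(rule fsum_cong) (use V W vw D in \<open>auto simp: pure_smult_left pure_smult_right\<close>)
   also have "... = pure V W (finsum V (%b. d b v \<odot>[V] b) B) w"
    by(rule lhom_fsum[OF pure_lhoml[OF V W vw(2)], symmetric]) (use V W vw D in auto)
   finally show ?thesis using D(5) vw by simp
  qed
 qed (use V W in simp)
qed

context
 fixes V :: "(complex, 'v, 'm) module_scheme"
 assumes V: "vsp V" and fd: "vectorspace.fin_dim CC V"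
begin

interpretation vectorspace CC V by(rule V)

text \<open>Independent sets have at most \<open>dim\<close> elements, so one that is maximal
  between \<open>A\<close> and \<open>S\<close> exists; maximality forces every vector of
  \<open>S\<close> into its span.\<close>

lemma li_extend:
 assumes A: "lin_indpt A" "A <= S" and S: "ssp S V"
 shows "\<exists>B. A <= B & B <= S & finite B & lin_indpt B & lspan V B = S"
proof -
 define P where "P B \<longleftrightarrow> A <= B & B <= S & lin_indpt B" for B
 have SV: "S <= car V" using subspD(1)[OF S] .
 have "\<exists>B. finite B & maximal B P"
 proof(rule maximal_exists)
  show "finite B & card B <= dim" if "P B" for B
   using li_le_dim[OF fd, of B] that SV unfolding P_def by auto
  show "P A" using A by(simp add: P_def)
 qed
 then obtain B where B: "finite B" "maximal B P" by auto
 then have PB: "A <= B" "B <= S" "lin_indpt B" by(auto simp: maximal_def P_def)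
 have "S <= lspan V B"
 proof
  fix v assume v: "v : S"
  show "v : lspan V B"
  proof(cases "v : B")
   case True
   then show ?thesis using lspan_sup[OF V, of B] PB SV by auto
  next
   case False
   have "lin_dep (B \<union> {v})"
   proof(rule ccontr)
    assume "lin_indpt (B \<union> {v})"
    then have "P (B \<union> {v})" using PB v by(auto simp: P_def)
    then show False using B(2) False unfolding maximal_def by blast
   qed
   then show ?thesis using lin_dep_iff_in_span[of B v] PB SV v False by auto
  qed
 qed
 moreover have "lspan V B <= S" by(rule lspan_least[OF V S PB(2)])
 ultimately show ?thesis using PB B(1) by blast
qed

lemma dual_basis_of_basis:
 assumes B: "finite B" "lin_indpt B" "B <= car V" "lspan V B = car V"
 shows "\<exists>d. dual_basis V B d"
proof -
 have bas: "basis B" using B by(auto simp: basis_def)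
 \<comment> \<open>Extensional functions make the family of coefficients unique as a function, so
   that \<open>THE\<close> can name it.\<close>
 have uniq: "\<exists>!a. a : B \<rightarrow>\<^sub>E UNIV & lincomb a B = v" if "v : car V" for v
  using basis_criterion[OF B(1,3)] bas that by simp
 define c where "c v = (THE a. a : B \<rightarrow>\<^sub>E UNIV & lincomb a B = v)" for v
 have c: "c v : B \<rightarrow>\<^sub>E UNIV" "lincomb (c v) B = v" if "v : car V" for v
  using theI'[OF uniq[OF that]] by(auto simp: c_def)
 have cu: "c v = a" if "a : B \<rightarrow>\<^sub>E UNIV" "lincomb a B = v" "v : car V" for a v
  using uniq[OF that(3)] c[OF that(3)] that by auto
 have BV: "!!b. b : B ==> b : car V" using B(3) by auto
 have cadd: "c (v \<oplus>[V] w) = (\<lambda>b\<in>B. c v b + c w b)" if vw: "v : car V" "w : car V" for v w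
 proof(rule cu)
  have "lincomb (\<lambda>b\<in>B. c v b + c w b) B = finsum V (%b. c v b \<odot>[V] b \<oplus>[V] c w b \<odot>[V] b) B"
   unfolding lincomb_def by(rule fsum_cong[OF V]) (use V BV in \<open>auto simp: vs_smult_l\<close>)
  also have "... = lincomb (c v) B \<oplus>[V] lincomb (c w) B"
   unfolding lincomb_def by(rule fsum_add[OF V]) (use V BV in auto)
  finally show "lincomb (\<lambda>b\<in>B. c v b + c w b) B = v \<oplus>[V] w" using c vw by simp
 qed (use vw V in auto)
 have csm: "c (k \<odot>[V] v) = (\<lambda>b\<in>B. k * c v b)" if v: "v : car V" for k v
 proof(rule cu)
  have "lincomb (\<lambda>b\<in>B. k * c v b) B = finsum V (%b. k \<odot>[V] (c v b \<odot>[V] b)) B"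
   unfolding lincomb_def by(rule fsum_cong[OF V]) (use V BV in auto)
  also have "... = k \<odot>[V] lincomb (c v) B"
   unfolding lincomb_def by(rule fsum_smult[OF V]) (use V BV B in auto)
  finally show "lincomb (\<lambda>b\<in>B. k * c v b) B = k \<odot>[V] v" using c v by simp
 qed (use v V in auto)
 have cb: "c b = (\<lambda>x\<in>B. if x = b then 1 else 0)" if b: "b : B" for b
 proof(rule cu)
  have "lincomb (\<lambda>x\<in>B. if x = b then 1 else 0) B = (\<lambda>x\<in>B. if x = b then 1 else 0) b \<odot>[V] b"
   unfolding lincomb_def by(rule fsum_single[OF V]) (use V BV B b in auto)
  then show "lincomb (\<lambda>x\<in>B. if x = b then 1 else 0) B = b" using V BV b by simp
 qed (use b BV in auto)
 have "dual_basis V B (%b v. c v b)"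
  unfolding dual_basis_def
 proof(intro conjI ballI)
  show "(%v. c v b) : lhom V complex_mod" if "b : B" for b
   by(rule lhomI) (use that in \<open>auto simp: cadd csm\<close>)
  show "finsum V (%b. c v b \<odot>[V] b) B = v" if "v : car V" for v
   using c(2)[OF that] by(simp add: lincomb_def)
 qed (use B cb in auto)
 then show ?thesis by blast
qed

text \<open>The chain \<open>A \<subseteq> C \<subseteq> B\<close> is obtained by extending twice,
  to a basis of \<open>S\<close> and to one of \<open>V\<close>. One choice thus yields prescribed
  basis vectors in \<open>A\<close>, a projection onto \<open>S\<close> by cutting off outside
  \<open>C\<close>, and functionals that vanish on \<open>S\<close>.\<close>

lemma dual_basis_exists:
 assumes A: "lin_indpt A" "A <= S" and S: "ssp S V"
 shows "\<exists>B C d. dual_basis V B d & A <= C & C <= B & C <= S & (\<forall>v\<in>S. \<forall>b\<in>B - C. d b v = 0)"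
proof -
 obtain C where C: "A <= C" "C <= S" "finite C" "lin_indpt C" "lspan V C = S" using li_extend[OF A S] by auto
 have SV: "S <= car V" using subspD(1)[OF S] .
 obtain B where B: "C <= B" "B <= car V" "finite B" "lin_indpt B" "lspan V B = car V"
  using li_extend[OF C(4) _ carrier_subsp[OF V]] C SV by auto
 obtain d where d: "dual_basis V B d" using dual_basis_of_basis[OF B(3,4,2,5)] by blast
 note D = dual_basisD[OF d]
 have "d b v = 0" if "v : S" "b : B - C" for b v
 proof -
  have "S <= {v : car V. d b v = \<zero>[complex_mod]}"
   unfolding C(5)[symmetric]
   by(rule lspan_least[OF V ker_subsp[OF D(3) V]]) (use that C B D(4) SV in auto)
  then show ?thesis using that by auto
 qed
 then show ?thesis using d C B by blast
qed

end

section \<open>Monoid algebras and their quotients\<close>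

lemma poly_induct [consumes 1, case_names zero single add]:
 fixes p :: "'x \<Rightarrow>\<^sub>0 complex"
 assumes "kys p <= S" "P 0" "!!k c. k : S ==> P (sng k c)"
  "!!p q. kys p <= S ==> kys q <= S ==> P p ==> P q ==> P (p + q)"
 shows "P p"
proof -
 have "kys (\<Sum>k\<in>A. sng k (lkp p k)) <= S &
  P (\<Sum>k\<in>A. sng k (lkp p k))" if "finite A" "A <= S" for A
  using that
 proof(induction A rule: finite_induct)
  case empty
  then show ?case using assms(2) by simp
 next
  case (insert x F)
  have k: "kys (sng x (lkp p x)) <= S" using insert by simp
  have "kys (sng x (lkp p x) + (\<Sum>k\<in>F. sng k (lkp p k))) <= S"
   using insert k Poly_Mapping.keys_add by(meson insert_subset Un_least order_trans)
  then show ?case using insert assms(3,4) k by simp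
 qed
 from this[of "kys p"] show ?thesis using assms(1) poly_mapping_eq_sum[of p] by simp
qed

lemma conv_superset:
 assumes "finite A" "kys p <= A" "finite B" "kys q <= B"
 shows "conv m p q = (\<Sum>x\<in>A. \<Sum>y\<in>B. sng (m x y) (lkp p x * lkp q y))"
proof -
 have "(\<Sum>x\<in>A. \<Sum>y\<in>B. sng (m x y) (lkp p x * lkp q y)) =
  (\<Sum>x\<in>A. \<Sum>y\<in>kys q. sng (m x y) (lkp p x * lkp q y))"
  by(intro sum.cong sum.mono_neutral_right) (use assms in \<open>auto simp: in_keys_iff\<close>)
 also have "... = conv m p q"
  unfolding conv_def by(rule sum.mono_neutral_right) (use assms in \<open>auto simp: in_keys_iff\<close>)
 finally show ?thesis by simp
qed

lemma conv_add_left: "conv m (p + p') q = conv m p q + conv m p' q"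
proof -
 have k: "kys (p + p') <= kys p \<union> kys p'" by(rule Poly_Mapping.keys_add)
 have *: "conv m r q = (\<Sum>x\<in>kys p \<union> kys p'. \<Sum>y\<in>kys q.
   sng (m x y) (lkp r x * lkp q y))"
  if "kys r <= kys p \<union> kys p'" for r
  by(rule conv_superset) (use that in auto)
 show ?thesis by(simp add: *[OF k] *[of p] *[of p'] lookup_add distrib_right single_add sum.distrib)
qed

lemma conv_add_right: "conv m p (q + q') = conv m p q + conv m p q'"
proof -
 have k: "kys (q + q') <= kys q \<union> kys q'" by(rule Poly_Mapping.keys_add)
 have *: "conv m p r = (\<Sum>x\<in>kys p. \<Sum>y\<in>kys q \<union> kys q'.
   sng (m x y) (lkp p x * lkp r y))"
  if "kys r <= kys q \<union> kys q'" for r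
  by(rule conv_superset) (use that in auto)
 show ?thesis by(simp add: *[OF k] *[of q] *[of q'] lookup_add distrib_left single_add sum.distrib)
qed

lemma conv_zero [simp]: "conv m 0 q = 0" "conv m p 0 = 0"
 by(simp_all add: conv_def)

lemma conv_single [simp]: "conv m (sng x a) (sng y b) = sng (m x y) (a * b)"
 using conv_superset[of "{x}" "sng x a" "{y}" "sng y b" m] by simp

lemma map_mult_single [simp]: "pmap ((*) c) (sng k a) = sng k (c * a)" for c :: complex
 by(rule poly_mapping_eqI) (simp add: lookup_single when_def)

lemma map_mult_add: "pmap ((*) c) (p + q) = pmap ((*) c) p + pmap ((*) c) q" for c :: complex
 by(rule poly_mapping_eqI) (simp add: lookup_add algebra_simps)

lemma map_mult_zero [simp]: "pmap ((*) c) 0 = 0" for c :: complex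
 by(rule poly_mapping_eqI) simp

lemma conv_map_left: "conv m (pmap ((*) c) p) q = pmap ((*) c) (conv m p q)"
proof -
 have p: "kys p <= UNIV" and q: "kys q <= UNIV" by auto
 from p show ?thesis
 proof(induction p rule: poly_induct)
  case (single k a)
  from q show ?case
   by(induction q rule: poly_induct) (simp_all add: conv_add_right map_mult_add mult.assoc)
 qed (simp_all add: conv_add_left map_mult_add)
qed

lemma conv_map_right: "conv m p (pmap ((*) c) q) = pmap ((*) c) (conv m p q)"
proof -
 have p: "kys p <= UNIV" and q: "kys q <= UNIV" by auto
 from p show ?thesis
 proof(induction p rule: poly_induct)
  case (single k a)
  from q show ?case
   by(induction q rule: poly_induct) (simp_all add: conv_add_right map_mult_add mult.left_commute)
 qed (simp_all add: conv_add_left map_mult_add)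
qed

lemma conv_keys:
 assumes "!!x y. x : S ==> y : S ==> m x y : S" "kys p <= S" "kys q <= S"
 shows "kys (conv m p q) <= S"
 using assms(2)
proof(induction p rule: poly_induct)
 case (single k a)
 from assms(3) show ?case
 proof(induction q rule: poly_induct)
  case (add p q)
  then show ?case using Poly_Mapping.keys_add by(metis conv_add_right Un_least order_trans)
 qed (use assms(1) single in auto)
next
 case (add p q)
 then show ?case using Poly_Mapping.keys_add by(metis conv_add_left Un_least order_trans)
qed simp

lemma conv_assoc:
 assumes m: "!!x y z. x : S ==> y : S ==> z : S ==> m (m x y) z = m x (m y z)"
  and p: "kys p <= S" and q: "kys q <= S" and r: "kys r <= S"
 shows "conv m (conv m p q) r = conv m p (conv m q r)"
 using p
proof(induction p rule: poly_induct)
 case (single k a)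
 note k = single
 from q show ?case
 proof(induction q rule: poly_induct)
  case (single l b)
  from r show ?case
   by(induction r rule: poly_induct) (simp_all add: conv_add_right m k single mult.assoc)
 qed (simp_all add: conv_add_left conv_add_right)
qed (simp_all add: conv_add_left)

lemma conv_one_left:
 "(!!x. x : S ==> m e x = x) ==> kys p <= S ==> conv m (sng e 1) p = p"
 by(rotate_tac 1, induction p rule: poly_induct) (simp_all add: conv_add_right)

lemma conv_one_right:
 "(!!x. x : S ==> m x e = x) ==> kys p <= S ==> conv m p (sng e 1) = p"
 by(rotate_tac 1, induction p rule: poly_induct) (simp_all add: conv_add_left)

lemma monoid_algebra_simps [simp]:
 "car (monoid_algebra G) = {p. kys p <= car G}"
 "p \<otimes>[monoid_algebra G] q = conv (monoid.mult G) p q"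
 "\<one>[monoid_algebra G] = sng \<one>[G] 1"
 "\<zero>[monoid_algebra G] = 0"
 "p \<oplus>[monoid_algebra G] q = p + q"
 "c \<odot>[monoid_algebra G] p = pmap ((*) c) p"
 by(simp_all add: monoid_algebra_def)

lemma monoid_algebra_vectorspace [simp]: "vsp (monoid_algebra G)"
 by(rule poly_vs) simp_all

lemma assoc_algebraI:
 assumes V: "vsp A" and b: "bilin A A A (monoid.mult A)" and o: "\<one>[A] : car A"
  and a: "!!x y z. x : car A ==> y : car A ==> z : car A ==> (x \<otimes>[A] y) \<otimes>[A] z = x \<otimes>[A] (y \<otimes>[A] z)"
  and l: "!!x. x : car A ==> \<one>[A] \<otimes>[A] x = x" and r: "!!x. x : car A ==> x \<otimes>[A] \<one>[A] = x"
 shows "assoc_algebra A"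
proof -
 have "ring A"
  by(rule ringI[OF vs_abelian_group[OF V]]) (use assms in \<open>auto intro!: monoidI bilinD[OF b]\<close>)
 then show ?thesis unfolding assoc_algebra_def using V by(simp add: bilinD[OF b])
qed

lemma algD:
 assumes "assoc_algebra A"
 shows "vsp A" "ring A" "bilin A A A (monoid.mult A)" "\<one>[A] : car A"
  "!!x y. x : car A ==> y : car A ==> x \<otimes>[A] y : car A"
  "!!x y z. x : car A ==> y : car A ==> z : car A ==> (x \<otimes>[A] y) \<otimes>[A] z = x \<otimes>[A] (y \<otimes>[A] z)"
  "!!x. x : car A ==> \<one>[A] \<otimes>[A] x = x" "!!x. x : car A ==> x \<otimes>[A] \<one>[A] = x"
proof -
 show V: "vsp A" and R: "ring A" using assms by(simp_all add: assoc_algebra_def)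
 interpret ring A by(rule R)
 show "bilin A A A (monoid.mult A)"
  by(intro bilinI lhomI) (use assms in \<open>auto simp: assoc_algebra_def l_distr r_distr\<close>)
 show "\<one>[A] : car A" "!!x y. x : car A ==> y : car A ==> x \<otimes>[A] y : car A"
  "!!x y z. x : car A ==> y : car A ==> z : car A ==> (x \<otimes>[A] y) \<otimes>[A] z = x \<otimes>[A] (y \<otimes>[A] z)"
  "!!x. x : car A ==> \<one>[A] \<otimes>[A] x = x" "!!x. x : car A ==> x \<otimes>[A] \<one>[A] = x"
  by(auto simp: m_assoc)
qed

lemma mon_alg:
 assumes "monoid G"
 shows "assoc_algebra (monoid_algebra G)"
proof -
 interpret monoid G by fact
 show ?thesis
 proof(rule assoc_algebraI)
  show "bilin (monoid_algebra G) (monoid_algebra G) (monoid_algebra G) (monoid.mult (monoid_algebra G))"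
   by(intro bilinI lhomI) (simp_all add: conv_keys conv_add_left conv_add_right conv_map_left conv_map_right)
 qed (auto simp: conv_assoc[where S="car G"] m_assoc conv_one_left[where S="car G"] conv_one_right[where S="car G"])
qed

lemma subspace_subgroup:
 assumes "ssp N M"
 shows "subgroup N (add_monoid M)"
proof -
 note D = subspD[OF assms]
 interpret M: abelian_group M by(rule vs_abelian_group[OF D(5)])
 show ?thesis
  by(rule group.subgroupI[OF M.a_group]) (use D in \<open>auto simp: vs_a_inv a_inv_def[symmetric]\<close>)
qed

lemma ideal_of_subspace:
 assumes A: "assoc_algebra A" and N: "ssp N A"
  and "!!a x. a : N ==> x : car A ==> x \<otimes>[A] a : N" "!!a x. a : N ==> x : car A ==> a \<otimes>[A] x : N"
 shows "ideal N A"
 by(rule idealI[OF algD(2)[OF A] subspace_subgroup[OF N]]) (use assms in auto)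

text \<open>A scalar \<open>c\<close> acts as multiplication by the multiple \<open>c\<close> of the
  unit, so a ring ideal is closed under scalars.\<close>

lemma ideal_subspace:
 assumes A: "assoc_algebra A" and I: "ideal I A"
 shows "ssp I A"
proof -
 interpret ideal I A by(rule I)
 note AD = algD[OF A]
 show ?thesis
 proof(rule subspaceI[OF AD(1)])
  fix c x assume x: "x : I"
  have "c \<odot>[A] x = (c \<odot>[A] \<one>[A]) \<otimes>[A] x" using A AD(4,7) x a_subset by(auto simp: assoc_algebra_def)
  then show "c \<odot>[A] x : I" using I_l_closed[OF x, of "c \<odot>[A] \<one>[A]"] AD(1,4) by simp
 qed (use a_subset in auto)
qed

lemma quot_mult:
 assumes "ideal I A" "x : car A" "y : car A"
 shows "(I +>\<^bsub>A\<^esub> x) \<otimes>[quot_alg A I] (I +>\<^bsub>A\<^esub> y) = I +>\<^bsub>A\<^esub> (x \<otimes>[A] y)"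
 using ideal.rcoset_mult_add[OF assms] by simp

lemma quot_assoc_algebra:
 assumes A: "assoc_algebra A" and I: "ideal I A"
 shows "assoc_algebra (quot_alg A I)"
proof -
 note AD = algD[OF A]
 note S = ideal_subspace[OF A I]
 note q = lhomD[OF quot_lhom[OF S]]
 note m = quot_mult[OF I]
 have ex: "P X" if "X : car (quot_alg A I)" "!!x. x : car A ==> P (I +>\<^bsub>A\<^esub> x)" for P X
  using that by(auto simp: mem_quot)
 have one: "\<one>[quot_alg A I] = I +>\<^bsub>A\<^esub> \<one>[A]" by simp
 have b: "bilin A A A (monoid.mult A)" by(rule AD)
 show ?thesis
 proof(rule assoc_algebraI)
  show "vsp (quot_alg A I)" using S by simp
  show "bilin (quot_alg A I) (quot_alg A I) (quot_alg A I) (monoid.mult (quot_alg A I))"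
  proof(intro bilinI lhomI)
   fix v w assume vw: "v : car (quot_alg A I)" "w : car (quot_alg A I)"
   show "v \<otimes>[quot_alg A I] w : car (quot_alg A I)"
    by(rule ex[OF vw(1)], rule ex[OF vw(2)], simp only: m q(1) AD(5))
   then show "v \<otimes>[quot_alg A I] w : car (quot_alg A I)" .
   show "v \<otimes>[quot_alg A I] (c \<odot>[quot_alg A I] w) = c \<odot>[quot_alg A I] (v \<otimes>[quot_alg A I] w)" for c
    by(rule ex[OF vw(1)], rule ex[OF vw(2)], simp only: m q(3)[symmetric] AD(5) vs_smult[OF AD(1)] bilinD[OF b])
   show "(c \<odot>[quot_alg A I] v) \<otimes>[quot_alg A I] w = c \<odot>[quot_alg A I] (v \<otimes>[quot_alg A I] w)" for c
    by(rule ex[OF vw(1)], rule ex[OF vw(2)], simp only: m q(3)[symmetric] AD(5) vs_smult[OF AD(1)] bilinD[OF b])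
   fix u assume u: "u : car (quot_alg A I)"
   show "v \<otimes>[quot_alg A I] (w \<oplus>[quot_alg A I] u) = v \<otimes>[quot_alg A I] w \<oplus>[quot_alg A I] v \<otimes>[quot_alg A I] u"
    by(rule ex[OF vw(1)], rule ex[OF vw(2)], rule ex[OF u], simp only: m q(2)[symmetric] AD(5) vs_add[OF AD(1)] bilinD[OF b])
  next
   fix u v w assume vw: "u : car (quot_alg A I)" "v : car (quot_alg A I)" "w : car (quot_alg A I)"
   show "(v \<oplus>[quot_alg A I] w) \<otimes>[quot_alg A I] u = v \<otimes>[quot_alg A I] u \<oplus>[quot_alg A I] w \<otimes>[quot_alg A I] u"
    by(rule ex[OF vw(1)], rule ex[OF vw(2)], rule ex[OF vw(3)], simp only: m q(2)[symmetric] AD(5) vs_add[OF AD(1)] bilinD[OF b])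
  qed
  show "\<one>[quot_alg A I] : car (quot_alg A I)" unfolding one by(rule q(1)[OF AD(4)])
 next
  fix x y z assume xyz: "x : car (quot_alg A I)" "y : car (quot_alg A I)" "z : car (quot_alg A I)"
  show "(x \<otimes>[quot_alg A I] y) \<otimes>[quot_alg A I] z = x \<otimes>[quot_alg A I] (y \<otimes>[quot_alg A I] z)"
   by(rule ex[OF xyz(1)], rule ex[OF xyz(2)], rule ex[OF xyz(3)], simp only: m AD(5,6))
 next
  fix x assume x: "x : car (quot_alg A I)"
  show "\<one>[quot_alg A I] \<otimes>[quot_alg A I] x = x" "x \<otimes>[quot_alg A I] \<one>[quot_alg A I] = x"
   by(rule ex[OF x], simp only: one m AD(4,5,7,8))+
 qed
qed

lemma ideal_vimage:
 assumes A: "assoc_algebra A" and C: "assoc_algebra C" and h: "h : lhom A C"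
  and hm: "!!x y. x : car A ==> y : car A ==> h (x \<otimes>[A] y) = h x \<otimes>[C] h y"
  and I: "ideal I C"
 shows "ideal {x : car A. h x : I} A"
proof(rule ideal_of_subspace[OF A])
 show "ssp {x : car A. h x : I} A"
  by(rule preim_subsp[OF h algD(1)[OF A] algD(1)[OF C] ideal_subspace[OF C I]])
qed (use hm lhomD(1)[OF h] algD(5)[OF A] ideal.I_l_closed[OF I] ideal.I_r_closed[OF I] in auto)

section \<open>The tensor algebra\<close>

context
 fixes F :: "(complex, 'x \<Rightarrow>\<^sub>0 complex, 'm) module_scheme" and S N and X :: "(complex, 'y, 'o) module_scheme" and f
 assumes F: "car F = {p. kys p <= S}" "!!p q. p \<oplus>[F] q = p + q"
   "!!c p. c \<odot>[F] p = pmap ((*) c) p"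
  and N: "ssp N F" and X: "vsp X" and f: "f : S \<rightarrow> car X"
  and ker: "!!n. n : N ==> lin_ext X f n = \<zero>[X]"
begin

text \<open>The argument for tensors once more, now for any subspace \<open>N\<close> of formal
  combinations that the extension kills; it serves the tensor algebra, whose null space is an ideal
  and not just a span of relations.\<close>

lemma class_ext_quot_coset:
 assumes "kys p <= S"
 shows "class_ext X f (N +>\<^bsub>F\<^esub> p) = lin_ext X f p"
proof -
 have "p : N +>\<^bsub>F\<^esub> p" using rcoset_self[OF N] assms F by simp
 then have "(SOME q. q : N +>\<^bsub>F\<^esub> p) : N +>\<^bsub>F\<^esub> p" by(rule someI)
 then obtain n where n: "n : N" "(SOME q. q : N +>\<^bsub>F\<^esub> p) = n + p" by(auto simp: mem_rcoset F)
 have "lin_ext X f (n + p) = lin_ext X f n \<oplus>[X] lin_ext X f p"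
  by(rule lin_ext_add[OF X f]) (use n(1) subspD(1)[OF N] F assms in auto)
 then show ?thesis unfolding class_ext_def n(2)
  using ker[OF n(1)] lin_ext_closed[OF X f assms] X by simp
qed

lemma class_ext_quot_lhom: "class_ext X f : lhom (quot_alg F N) X"
proof -
 note q = lhomD(2,3)[OF quot_lhom[OF N], symmetric]
 have ex: "P t" if "t : car (quot_alg F N)" "!!p. p : car F ==> P (N +>\<^bsub>F\<^esub> p)" for t P
  using that by(auto simp: mem_quot)
 have c: "class_ext X f (N +>\<^bsub>F\<^esub> p) = lin_ext X f p" if "p : car F" for p
  using class_ext_quot_coset that F by simp
 have l: "lin_ext X f : lhom F X"
  using lin_ext_lhom[OF X f] by(simp add: module_hom_def F)
 note FV = subspD(5)[OF N]
 show ?thesis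
 proof(rule lhomI)
  fix t assume "t : car (quot_alg F N)"
  then show "class_ext X f t : car X"
   by(rule ex) (simp only: c lhomD(1)[OF l])
 next
  fix t u assume tu: "t : car (quot_alg F N)" "u : car (quot_alg F N)"
  show "class_ext X f (t \<oplus>[quot_alg F N] u) = class_ext X f t \<oplus>[X] class_ext X f u"
   by(rule ex[OF tu(1)], rule ex[OF tu(2)])
    (simp only: c q vs_add[OF FV] lhomD(2)[OF l])
 next
  fix k t assume t: "t : car (quot_alg F N)"
  show "class_ext X f (k \<odot>[quot_alg F N] t) = k \<odot>[X] class_ext X f t"
   by(rule ex[OF t]) (simp only: c q vs_smult[OF FV] lhomD(3)[OF l])
 qed
qed

end

lemma free_simps [simp]:
 "car (free_algebra S) = {p. kys p <= lists S}"
 "p \<otimes>[free_algebra S] q = conv (@) p q"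
 "\<one>[free_algebra S] = sng [] 1"
 "\<zero>[free_algebra S] = 0"
 "p \<oplus>[free_algebra S] q = p + q"
 "c \<odot>[free_algebra S] p = pmap ((*) c) p"
 by(simp_all add: free_algebra_def)

lemma free_alg: "assoc_algebra (free_algebra S)"
 unfolding free_algebra_def by(rule mon_alg) (rule monoidI, auto)

text \<open>Linearity in the letter at every position of words of every length at once: such a
  \<open>phi\<close> amounts to one linear map on each tensor power, that is, to a linear map on the
  tensor algebra.\<close>

definition mlin :: "(complex, 'v, 'm) module_scheme => (complex, 'y, 'o) module_scheme => ('v list => 'y) => bool" where
 "mlin V X phi \<longleftrightarrow> (\<forall>w\<in>lists (car V). phi w : car X) &
  (\<forall>u\<in>lists (car V). \<forall>w\<in>lists (car V). (%v. phi (u @ v # w)) : lhom V X)"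

context
 fixes V :: "(complex, 'v, 'm) module_scheme"
 assumes V: "vsp V"
begin

definition talg_rels :: "('v list \<Rightarrow>\<^sub>0 complex) set" where
 "talg_rels = {sng [v \<oplus>[V] w] 1 - sng [v] 1 - sng [w] 1
    | v w. v : car V & w : car V}
  \<union> {sng [c \<odot>[V] v] 1 - sng [v] c | c v. v : car V}"

lemma talg_rels_carrier: "talg_rels <= car (free_algebra (car V))"
proof
 fix r assume "r : talg_rels"
 then show "r : car (free_algebra (car V))"
  unfolding talg_rels_def free_simps mem_Collect_eq
  by(elim UnE CollectE exE conjE; hypsubst) (intro keys_diff_subset; simp add: V)+
qed

lemma talg_null_alt: "tensor_alg_null V = Idl\<^bsub>free_algebra (car V)\<^esub> talg_rels"
 unfolding tensor_alg_null_def talg_rels_def ..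

lemma talg_null_ideal: "ideal (tensor_alg_null V) (free_algebra (car V))"
 unfolding talg_null_alt
 by(rule ring.genideal_ideal[OF algD(2)[OF free_alg] talg_rels_carrier])

lemma talg_rels_null: "talg_rels <= tensor_alg_null V"
 unfolding talg_null_alt
 by(rule ring.genideal_self[OF algD(2)[OF free_alg] talg_rels_carrier])

lemma talg_null_subsp: "ssp (tensor_alg_null V) (free_algebra (car V))"
 by(rule ideal_subspace[OF free_alg talg_null_ideal])

lemma talg_assoc_algebra: "assoc_algebra (tensor_alg V)"
 unfolding tensor_alg_def by(rule quot_assoc_algebra[OF free_alg talg_null_ideal])

lemma talg_vectorspace [simp]: "vsp (tensor_alg V)"
 by(rule algD(1)[OF talg_assoc_algebra])

lemma talg_coset_lhom:
 "(%p. tensor_alg_null V +>\<^bsub>free_algebra (car V)\<^esub> p) : lhom (free_algebra (car V)) (tensor_alg V)"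
 unfolding tensor_alg_def by(rule quot_lhom[OF talg_null_subsp])

lemma tword_closed [simp]: "w : lists (car V) ==> tword V w : car (tensor_alg V)"
 unfolding tword_def by(rule lhomD(1)[OF talg_coset_lhom]) simp

lemma tword_mult: "u : lists (car V) ==> w : lists (car V) ==> tword V u \<otimes>[tensor_alg V] tword V w = tword V (u @ w)"
 unfolding tword_def tensor_alg_def by(subst quot_mult[OF talg_null_ideal]) auto

lemma talg_one: "\<one>[tensor_alg V] = tword V []"
 unfolding tword_def tensor_alg_def by simp

lemma tword_lhom: "(%v. tword V [v]) : lhom V (tensor_alg V)"
proof -
 let ?F = "free_algebra (car V)"
 let ?q = "%p. tensor_alg_null V +>\<^bsub>?F\<^esub> p"
 note q = lhomD[OF talg_coset_lhom, simplified]
 have eq: "?q p = ?q r" if "p - r : talg_rels" "kys p <= lists (car V)" "kys r <= lists (car V)" for p r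
 proof -
  have "p + pmap ((*) (-1)) r = p - r"
   by(rule poly_mapping_eqI) (simp add: lookup_add lookup_minus)
  then show ?thesis using rcoset_eq_iff[OF talg_null_subsp, of p r] that talg_rels_null by auto
 qed
 show ?thesis
 proof(rule lhomI)
  fix x y assume xy: "x : car V" "y : car V"
  have k: "kys (sng [x] 1 + sng [y] (1::complex)) <= lists (car V)"
   using Poly_Mapping.keys_add[of "sng [x] (1::complex)" "sng [y] 1"] xy by auto
  have "?q (sng [x \<oplus>[V] y] 1) = ?q (sng [x] 1 + sng [y] 1)"
  proof(rule eq[OF _ _ k])
   show "sng [x \<oplus>[V] y] 1 - (sng [x] 1 + sng [y] 1) : talg_rels"
    unfolding talg_rels_def diff_diff_eq[symmetric] using xy by blast
  qed (use xy V in simp)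
  then show "tword V [x \<oplus>[V] y] = tword V [x] \<oplus>[tensor_alg V] tword V [y]"
   unfolding tword_def using q(2)[of "sng [x] 1" "sng [y] 1"] xy by simp
 next
  fix c x assume x: "x : car V"
  have "?q (sng [c \<odot>[V] x] 1) = ?q (sng [x] c)"
   by(rule eq) (use x V in \<open>auto simp: talg_rels_def\<close>)
  then show "tword V [c \<odot>[V] x] = c \<odot>[tensor_alg V] tword V [x]"
   unfolding tword_def using q(3)[of "sng [x] 1" c] x by simp
 qed simp
qed

lemma talg_span: "car (tensor_alg V) = lspan (tensor_alg V) (tword V ` lists (car V))"
proof
 let ?F = "free_algebra (car V)"
 have P: "tword V ` lists (car V) <= car (tensor_alg V)" by(rule image_subsetI) (rule tword_closed)
 show "lspan (tensor_alg V) (tword V ` lists (car V)) <= car (tensor_alg V)" by(rule lspan_closed[OF _ P]) simp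
 show "car (tensor_alg V) <= lspan (tensor_alg V) (tword V ` lists (car V))"
 proof
  fix t assume "t : car (tensor_alg V)"
  then obtain p where p: "kys p <= lists (car V)" "t = tensor_alg_null V +>\<^bsub>?F\<^esub> p"
   unfolding tensor_alg_def by(auto simp: mem_quot)
  have FV: "vsp ?F" by(rule algD(1)[OF free_alg])
  have "p : lspan ?F ((%k. sng k 1) ` lists (car V))"
   by(rule free_space_span[OF p(1) FV]) simp_all
  moreover have "(%p. tensor_alg_null V +>\<^bsub>?F\<^esub> p) ` lspan ?F ((%k. sng k 1) ` lists (car V)) <=
    lspan (tensor_alg V) (tword V ` lists (car V))"
   by(rule lspan_img[OF talg_coset_lhom FV _ _ lspan_subsp[OF _ P]])
    (use lspan_sup[OF _ P] in \<open>auto simp: tword_def\<close>)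
  ultimately show "t : lspan (tensor_alg V) (tword V ` lists (car V))" using p by auto
 qed
qed

lemma talg_eqI:
 assumes "f : lhom (tensor_alg V) X" "g : lhom (tensor_alg V) X" "vsp X" "t : car (tensor_alg V)"
  "!!w. w : lists (car V) ==> f (tword V w) = g (tword V w)"
 shows "f t = g t"
 by(rule lhom_eqI[OF assms(1,2) _ assms(3), where S="tword V ` lists (car V)"])
  (use assms(4,5) talg_span in \<open>auto simp del: in_lists_conv_set intro!: tword_closed\<close>)

lemma talg_some_rep:
 assumes "t : car (tensor_alg V)"
 shows "kys (SOME p. p : t) <= lists (car V)"
proof -
 have "\<exists>p. p : t" using assms rcoset_self[OF talg_null_subsp]
  unfolding tensor_alg_def by(auto simp: mem_quot)
 then have *: "(SOME p. p : t) : t" by(rule someI_ex)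
 show ?thesis
  using rcoset_rep(1)[OF talg_null_subsp _ *] assms unfolding tensor_alg_def by simp
qed

lemma talg_class_ext_param:
 assumes "vsp X" "t : car (tensor_alg V)"
  "!!w. w : lists (car V) ==> (%u. f u w) : lhom U X"
 shows "(%u. class_ext X (f u) t) : lhom U X"
 unfolding class_ext_def lin_ext_def
 by(rule lhom_finsum[OF _ lhom_smult]) (use assms talg_some_rep[OF assms(2)] in auto)

context
 fixes X :: "(complex, 'y, 'o) module_scheme" and phi
 assumes X: "vsp X" and phi: "mlin V X phi"
begin

lemma mlin_funcset: "phi : lists (car V) \<rightarrow> car X"
 using phi unfolding mlin_def by auto

text \<open>The null space is a two-sided ideal, whereas the kernel of \<open>lin_ext X phi\<close>
  is only a subspace. The elements that stay in the kernel after multiplication from both sides do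
  form an ideal; the generating relations belong to it because \<open>phi\<close> is linear at every
  position of a word.\<close>

lemma mlin_null:
 assumes "n : tensor_alg_null V"
 shows "lin_ext X phi n = \<zero>[X]"
proof -
 let ?F = "free_algebra (car V)"
 let ?L = "lists (car V)"
 note fc = mlin_funcset
 note AF = algD[OF free_alg[of "car V"]]
 note FA = bilinD[OF AF(3)]
 define I where "I = {p : car ?F. \<forall>a\<in>car ?F. \<forall>b\<in>car ?F. lin_ext X phi (conv (@) (conv (@) a p) b) = \<zero>[X]}"
 have l: "lin_ext X phi : lhom ?F X"
  using lin_ext_lhom[OF X fc] by(simp add: module_hom_def)
 note lD = lhomD[OF l]
 have lin: "(%p. lin_ext X phi (conv (@) (conv (@) a p) b)) : lhom ?F X" if "a : car ?F" "b : car ?F" for a b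
  using lhom_comp[OF lhom_comp[OF FA(1)[OF that(1)] FA(2)[OF that(2)]] l] by simp
 have lina: "(%a. lin_ext X phi (conv (@) (conv (@) a p) b)) : lhom ?F X" if "p : car ?F" "b : car ?F" for p b
  using lhom_comp[OF lhom_comp[OF FA(2)[OF that(1)] FA(2)[OF that(2)]] l] by simp
 have linb: "(%b. lin_ext X phi (conv (@) (conv (@) a p) b)) : lhom ?F X" if "a : car ?F" "p : car ?F" for a p
  using lhom_comp[OF FA(1)[OF AF(5)[OF that]] l] by simp
 have Isub: "ssp I ?F"
  unfolding I_def
 proof(rule subspaceI[OF AF(1)], goal_cases)
  case 2 then show ?case using lhom_zero[OF lin AF(1) X] AF(1) vs_zero[OF AF(1)] by auto
 next
  case (3 x y) then show ?case using lhomD(2)[OF lin] AF(1) X vs_add[OF AF(1), of x y] by(auto simp del: free_simps)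
 next
  case (4 c x) then show ?case using lhomD(3)[OF lin] AF(1) X vs_smult[OF AF(1), of x c] by(auto simp del: free_simps)
 qed auto
 have assoc: "conv (@) (conv (@) a b) c = conv (@) a (conv (@) b c)" if "a : car ?F" "b : car ?F" "c : car ?F" for a b c
  using AF(6)[OF that] by simp
 have cl: "conv (@) a b : car ?F" if "a : car ?F" "b : car ?F" for a b
  using AF(5)[OF that] by simp
 have I: "ideal I ?F"
 proof(rule ideal_of_subspace[OF free_alg Isub])
  fix p x assume p: "p : I" and x: "x : car ?F"
  then have pF: "p : car ?F" by(simp add: I_def)
  have "lin_ext X phi (conv (@) (conv (@) a (conv (@) x p)) b) = \<zero>[X]" if "a : car ?F" "b : car ?F" for a b
   using p that cl[OF that(1) x] by(simp only: I_def assoc[OF that(1) x pF, symmetric] mem_Collect_eq)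
  then show "x \<otimes>[?F] p : I" using cl[OF x pF] by(simp add: I_def del: free_simps(1))
  have "lin_ext X phi (conv (@) (conv (@) a (conv (@) p x)) b) = \<zero>[X]" if "a : car ?F" "b : car ?F" for a b
  proof -
   have "conv (@) (conv (@) a (conv (@) p x)) b = conv (@) (conv (@) a p) (conv (@) x b)"
    by(simp only: assoc cl that x pF)
   then show ?thesis using p that(1) cl[OF x that(2)] by(simp only: I_def mem_Collect_eq)
  qed
  then show "p \<otimes>[?F] x : I" using cl[OF pF x] by(simp add: I_def del: free_simps(1))
 qed
 have "talg_rels <= I"
 proof
  fix r assume r: "r : talg_rels"
  have rF: "r : car ?F" using r talg_rels_carrier by auto
  have z: "lin_ext X phi (conv (@) (conv (@) (sng u 1) r) (sng w 1)) = \<zero>[X]"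
   if u: "u : ?L" and w: "w : ?L" for u w
  proof -
   have c: "sng u 1 : car ?F" "sng w 1 : car ?F" using u w by auto
   note L = lhomD[OF lin[OF c]]
   have d: "lin_ext X phi (conv (@) (conv (@) (sng u 1) (a - b)) (sng w 1)) =
    lin_ext X phi (conv (@) (conv (@) (sng u 1) a) (sng w 1)) \<oplus>[X]
    (-1) \<odot>[X] lin_ext X phi (conv (@) (conv (@) (sng u 1) b) (sng w 1))"
    if ab: "a : car ?F" "b : car ?F" for a b
   proof -
    have *: "a - b = a \<oplus>[?F] (-1) \<odot>[?F] b" unfolding free_simps by(rule poly_mapping_eqI) (simp add: lookup_add lookup_minus)
    show ?thesis unfolding * using L(2)[OF ab(1) vs_smult[OF AF(1) ab(2), of "-1"]] L(3)[OF ab(2), of "-1"] by simp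
   qed
   have s: "lin_ext X phi (sng (u @ v # w) k) = k \<odot>[X] phi (u @ v # w)"
    if "v : car V" for v k using that u w by(simp add: lin_ext_single[OF X fc])
   have m: "(%v. phi (u @ v # w)) : lhom V X" using phi u w by(simp add: mlin_def)
   have phic: "phi (u @ v # w) : car X" if "v : car V" for v using lhomD(1)[OF m that] .
   have e: "sng [v] k : car ?F" if "v : car V" for v k using that by simp
   show ?thesis using r unfolding talg_rels_def
   proof(elim UnE CollectE exE conjE)
    fix v v' assume *: "r = sng [v \<oplus>[V] v'] 1 - sng [v] 1 - sng [v'] 1"
     and vv: "v : car V" "v' : car V"
    have "sng [v \<oplus>[V] v'] 1 - sng [v] 1 : car ?F"
     unfolding free_simps mem_Collect_eq using vv V by(intro keys_diff_subset) auto
    then show ?thesis unfolding * using vv V X lhomD(2)[OF m vv]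
     by(simp add: d e s phic vs_assoc vs_sum_neg del: free_simps)
   next
    fix k v assume *: "r = sng [k \<odot>[V] v] 1 - sng [v] k" and v: "v : car V"
    show ?thesis unfolding * using v V X lhomD(3)[OF m v]
     by(simp add: d e s phic vs_smult_neg del: free_simps)
   qed
  qed
  \<comment> \<open>Linearity passes from words to arbitrary factors, one side at a time.\<close>
  have 1: "lin_ext X phi (conv (@) (conv (@) (sng u 1) r) b) = \<zero>[X]" if "u : ?L" "b : car ?F" for u b
   by(rule lhom_eq_on_free[OF linb lhom_0, where S="?L"]) (use that rF z X AF(1) in auto)
  have "lin_ext X phi (conv (@) (conv (@) a r) b) = \<zero>[X]" if "a : car ?F" "b : car ?F" for a b
   by(rule lhom_eq_on_free[OF lina lhom_0, where S="?L"]) (use that rF 1 X AF(1) in auto)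
  then show "r : I" using rF by(simp add: I_def)
 qed
 then have "tensor_alg_null V <= I"
  unfolding talg_null_alt by(rule ring.genideal_minimal[OF AF(2) I])
 then have nI: "n : I" using assms by auto
 \<comment> \<open>Multiplication by the empty word on both sides recovers \<open>n\<close>
   itself.\<close>
 have o: "sng [] 1 : car ?F" by simp
 have e: "conv (@) (conv (@) (sng [] 1) n) (sng [] 1) = n"
  using nI AF(7,8)[of n] by(simp add: I_def)
 have "lin_ext X phi (conv (@) (conv (@) (sng [] 1) n) (sng [] 1)) = \<zero>[X]"
  using nI o unfolding I_def by blast
 then show ?thesis unfolding e .
qed

lemma talg_ext_lhom: "class_ext X phi : lhom (tensor_alg V) X"
 unfolding tensor_alg_def
 by(rule class_ext_quot_lhom[OF _ _ _ talg_null_subsp X mlin_funcset mlin_null]) simp_all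

lemma talg_ext_tword: "w : lists (car V) ==> class_ext X phi (tword V w) = phi w"
 unfolding tword_def
 by(subst class_ext_quot_coset[OF _ _ _ talg_null_subsp X mlin_funcset mlin_null])
  (use X mlin_funcset in \<open>auto simp: lin_ext_single[OF X mlin_funcset] Pi_iff simp del: in_lists_conv_set\<close>)

end

lemma tword_mlin: "mlin V (tensor_alg V) (tword V)"
 unfolding mlin_def
proof(intro conjI ballI)
 fix u w assume uw: "u : lists (car V)" "w : lists (car V)"
 note b = bilinD[OF algD(3)[OF talg_assoc_algebra]]
 have "(%v. (tword V u \<otimes>[tensor_alg V] tword V [v]) \<otimes>[tensor_alg V] tword V w) : lhom V (tensor_alg V)"
  by(rule lhom_comp[OF lhom_comp[OF tword_lhom b(1)] b(2)]) (use uw in auto)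
 then show "(%v. tword V (u @ v # w)) : lhom V (tensor_alg V)"
  by(rule lhom_cong) (use V uw in \<open>auto simp: tword_mult\<close>)
qed simp

end

section \<open>The braided Hopf algebra structure of the tensor algebra\<close>

lemma vectorspace_cong:
 assumes V: "vsp V" and e: "car V' = car V" "\<zero>[V'] = \<zero>[V]" "add V' = add V" "module.smult V' = module.smult V"
 shows "vsp V'"
 by(rule vectorspaceI) (simp_all add: e V vs_assoc vs_comm[OF V] vs_smult_l vs_smult_r)

lemma assoc_algebra_cong:
 assumes V: "assoc_algebra V" and e: "car V' = car V" "\<zero>[V'] = \<zero>[V]" "add V' = add V" "module.smult V' = module.smult V"
  and m: "monoid.mult V' = monoid.mult V" "\<one>[V'] = \<one>[V]"
 shows "assoc_algebra V'"
proof -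
 note D = algD[OF V]
 have "bilin V' V' V' (monoid.mult V')"
  using D(3) by(simp add: bilin_def module_hom_def e m)
 then show ?thesis
  by(intro assoc_algebraI vectorspace_cong[OF D(1) e]) (simp_all add: e m D)
qed

lemma tensor_alg_yd_simps [simp]:
 "car (tensor_alg_yd B V) = car (tensor_alg V)"
 "monoid.mult (tensor_alg_yd B V) = monoid.mult (tensor_alg V)"
 "\<one>[tensor_alg_yd B V] = \<one>[tensor_alg V]"
 "\<zero>[tensor_alg_yd B V] = \<zero>[tensor_alg V]"
 "add (tensor_alg_yd B V) = add (tensor_alg V)"
 "module.smult (tensor_alg_yd B V) = module.smult (tensor_alg V)"
 "act (tensor_alg_yd B V) = (%h. class_ext (tensor_alg V) (tword_act B V h))"
 "coact (tensor_alg_yd B V) = class_ext (tensor B (tensor_alg V)) (tword_coact B V)"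
 by(simp_all add: tensor_alg_yd_def module.defs yd.defs)

lemma tensor_hopf_simps [simp]:
 "car (tensor_hopf B V) = car (tensor_alg V)"
 "monoid.mult (tensor_hopf B V) = monoid.mult (tensor_alg V)"
 "\<one>[tensor_hopf B V] = \<one>[tensor_alg V]"
 "\<zero>[tensor_hopf B V] = \<zero>[tensor_alg V]"
 "add (tensor_hopf B V) = add (tensor_alg V)"
 "module.smult (tensor_hopf B V) = module.smult (tensor_alg V)"
 "act (tensor_hopf B V) = (%h. class_ext (tensor_alg V) (tword_act B V h))"
 "coact (tensor_hopf B V) = class_ext (tensor B (tensor_alg V)) (tword_coact B V)"
 "bcomult (tensor_hopf B V) = class_ext (tensor (tensor_alg V) (tensor_alg V)) (tword_comult B V)"
 "bcounit (tensor_hopf B V) = class_ext complex_mod (%w. if w = [] then 1 else 0)"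
 "grade (tensor_hopf B V) n = lspan (tensor_alg V) {tword V w | w. w : lists (car V) & length w = n}"
 by(simp_all add: tensor_hopf_def yd.defs yd_hopf.defs tensor_alg_yd_def module.defs)

lemma tensor_yd_hopf_eqs [simp]:
 "tensor (tensor_alg_yd B V) X = tensor (tensor_alg V) X" "tensor X (tensor_alg_yd B V) = tensor X (tensor_alg V)"
 "tensor (tensor_hopf B V) X = tensor (tensor_alg V) X" "tensor X (tensor_hopf B V) = tensor X (tensor_alg V)"
 "pure (tensor_alg_yd B V) X = pure (tensor_alg V) X" "pure X (tensor_alg_yd B V) = pure X (tensor_alg V)"
 "pure (tensor_hopf B V) X = pure (tensor_alg V) X" "pure X (tensor_hopf B V) = pure X (tensor_alg V)"
 by(intro tensor_cong; simp)+

lemma lhom_tensor_hopf_eqs [simp]: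
 "lhom (tensor_hopf B V) X = lhom (tensor_alg V) X" "lhom X (tensor_hopf B V) = lhom X (tensor_alg V)"
 by(simp_all add: module_hom_def)

text \<open>The linearity of the structure maps is what gives the recursive formulas on words a
  well-defined linear extension; \<open>yd_pre\<close> collects the same for the module.\<close>

locale hopf_pre =
 fixes B :: "('b, 'm) hopf_scheme"
 assumes Bv: "vsp B" and B_mult: "bilin B B B (monoid.mult B)" and B_one: "\<one>[B] : car B"
  and B_comult: "comult B : lhom B (tensor B B)" and B_counit: "counit B : lhom B complex_mod"

locale yd_pre = hopf_pre B for B :: "('b, 'm) hopf_scheme" +
 fixes V :: "('b, 'v, 'n) yd_scheme"
 assumes Vv: "vsp V" and V_act: "bilin B V V (act V)" and V_coact: "coact V : lhom V (tensor B V)"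
begin

abbreviation T where "T \<equiv> tensor_alg V"

lemma T_alg: "assoc_algebra T" by(rule talg_assoc_algebra[OF Vv])
lemmas Tv = algD(1)[OF T_alg] and T_mult = algD(3)[OF T_alg]
lemmas BTv = tensor_vs[OF Bv Tv] and TTv = tensor_vs[OF Tv Tv]
lemmas T_letter = tword_lhom[OF Vv]
lemma T_one: "\<one>[T] : car T" by(rule algD(4)[OF T_alg])

lemma tact_lhom_left: "w : lists (car V) ==> (%h. tword_act B V h w) : lhom B T"
proof(induction w)
 case Nil
 show ?case using lhomD[OF B_counit] Tv T_one by(auto intro!: lhomI simp: vs_smult_l)
next
 case (Cons v w)
 then have v: "v : car V" and IH: "(%h. tword_act B V h w) : lhom B T" by auto
 have "bilin B B T (%h1 h2. tword V [act V h1 v] \<otimes>[T] tword_act B V h2 w)"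
  by(rule bilin_precomp[OF T_mult lhom_comp[OF bilinD(2)[OF V_act v] T_letter] IH])
 from lhom_comp[OF B_comult cext_lhom[OF Bv Bv Tv this]]
 show ?case by simp
qed

lemma tact_closed: "h : car B ==> w : lists (car V) ==> tword_act B V h w : car T"
 by(rule lhomD(1)[OF tact_lhom_left])

text \<open>Peeling a letter off in front of position \<open>v\<close> leaves a Sweedler sum over
  \<open>comult B h\<close>, which does not involve \<open>v\<close>, so \<open>cext_param\<close>
  applies. The second leg acts on the rest of the word, hence the induction is for all
  \<open>h\<close>.\<close>

lemma tact_lhom_right:
 assumes w: "w : lists (car V)"
 shows "u : lists (car V) ==> h : car B ==> (%v. tword_act B V h (u @ v # w)) : lhom V T"
proof(induction u arbitrary: h)
 case Nil
 have "(%v. class_ext T (%(h1, h2). tword V [act V h1 v] \<otimes>[T] tword_act B V h2 w) (comult B h)) : lhom V T"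
  by(rule cext_param[OF Bv Bv Tv lhomD(1)[OF B_comult Nil(2)]],
    rule lhom_comp[OF lhom_comp[OF bilinD(1)[OF V_act] T_letter] bilinD(2)[OF T_mult]])
   (use tact_closed w in auto)
 then show ?case by simp
next
 case (Cons a u)
 then have a: "a : car V" and u: "u : lists (car V)" by auto
 have "(%v. class_ext T (%(h1, h2). tword V [act V h1 a] \<otimes>[T] tword_act B V h2 (u @ v # w)) (comult B h)) : lhom V T"
  by(rule cext_param[OF Bv Bv Tv lhomD(1)[OF B_comult Cons(3)]],
    rule lhom_comp[OF Cons(1)[OF u] bilinD(1)[OF T_mult]])
   (use a bilinD(3)[OF V_act] lhomD(1)[OF T_letter] in auto)
 then show ?case by simp
qed

lemma tact_mlin: "h : car B ==> mlin V T (tword_act B V h)"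
 unfolding mlin_def using tact_closed tact_lhom_right by blast

abbreviation ract where "ract h \<equiv> class_ext T (tword_act B V h)"

lemma ract_bilin: "bilin B T T ract"
 by(rule bilinI[OF talg_ext_lhom[OF Vv Tv tact_mlin] talg_class_ext_param[OF Vv Tv]])
  (use tact_lhom_left in auto)

text \<open>The effect of putting a letter with coaction component \<open>h \<otimes> v\<close> in
  front of a word whose coaction is already known. Naming it separates the linearity in
  \<open>h\<close>, in \<open>v\<close> and in the tensor.\<close>

definition coact_step :: "'b => 'v => ('b, 'v tens_alg) tens => ('b, 'v tens_alg) tens" where
 "coact_step h v = class_ext (tensor B T) (%(h', w). pure B T (h \<otimes>[B] h') (tword V [v] \<otimes>[T] w))"

lemma coact_step_inner: "h : car B ==> v : car V ==> bilin B T (tensor B T) (%h' w. pure B T (h \<otimes>[B] h') (tword V [v] \<otimes>[T] w))"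
 by(rule bilin_precomp[OF bilin_pure[OF Bv Tv] bilinD(1)[OF B_mult] bilinD(1)[OF T_mult]])
  (auto intro: lhomD(1)[OF T_letter])

lemma coact_step_lhom: "h : car B ==> v : car V ==> coact_step h v : lhom (tensor B T) (tensor B T)"
 unfolding coact_step_def by(rule cext_lhom[OF Bv Tv BTv coact_step_inner])

lemma coact_step_bilin:
 assumes t: "t : car (tensor B T)"
 shows "bilin B V (tensor B T) (%h v. coact_step h v t)"
 unfolding coact_step_def
proof(rule bilinI; rule cext_param[OF Bv Tv BTv t])
 fix h a b assume "h : car B" "a : car B" "b : car T"
 then show "(%v. pure B T (h \<otimes>[B] a) (tword V [v] \<otimes>[T] b)) : lhom V (tensor B T)"
  by(intro lhom_comp[OF lhom_comp[OF T_letter bilinD(2)[OF T_mult]] pure_lhomr[OF Bv Tv]] bilinD(3)[OF B_mult])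
next
 fix v a b assume "v : car V" "a : car B" "b : car T"
 then show "(%h. pure B T (h \<otimes>[B] a) (tword V [v] \<otimes>[T] b)) : lhom B (tensor B T)"
  by(intro lhom_comp[OF bilinD(2)[OF B_mult] pure_lhoml[OF Bv Tv]] bilinD(3)[OF T_mult] lhomD(1)[OF T_letter])
qed

lemma tcoact_Cons: "tword_coact B V (v # w) = class_ext (tensor B T) (%(h, v0). coact_step h v0 (tword_coact B V w)) (coact V v)"
 by(simp add: coact_step_def)

declare tword_coact.simps(2) [simp del]

lemma tcoact_closed: "w : lists (car V) ==> tword_coact B V w : car (tensor B T)"
proof(induction w)
 case Nil
 show ?case using B_one T_one Bv Tv by simp
next
 case (Cons v w)
 then show ?case unfolding tcoact_Cons
  by(intro cext_closed[OF Bv Vv BTv coact_step_bilin] lhomD(1)[OF V_coact]) auto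
qed

lemma tcoact_lhom:
 assumes w: "w : lists (car V)"
 shows "u : lists (car V) ==> (%v. tword_coact B V (u @ v # w)) : lhom V (tensor B T)"
proof(induction u)
 case Nil
 show ?case unfolding append_Nil tcoact_Cons
  by(rule lhom_comp[OF V_coact cext_lhom[OF Bv Vv BTv coact_step_bilin[OF tcoact_closed[OF w]]]])
next
 case (Cons a u)
 then have a: "a : car V" and u: "u : lists (car V)" by auto
 show ?case unfolding append_Cons tcoact_Cons
  by(rule cext_param[OF Bv Vv BTv lhomD(1)[OF V_coact a] lhom_comp[OF Cons(1)[OF u] coact_step_lhom]])
qed

lemma tcoact_mlin: "mlin V (tensor B T) (tword_coact B V)"
 unfolding mlin_def using tcoact_closed tcoact_lhom by blast

abbreviation rcoact where "rcoact \<equiv> class_ext (tensor B T) (tword_coact B V)"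
lemmas rcoact_lhom = talg_ext_lhom[OF Vv BTv tcoact_mlin]

text \<open>The braided product of \<open>a \<otimes> b\<close> with \<open>c \<otimes> d\<close> as
  a function of four variables, so that linearity can be shown variable by variable before it is
  extended to tensors.\<close>

definition braid4 :: "'v tens_alg => 'v tens_alg => 'v tens_alg => 'v tens_alg => ('v tens_alg, 'v tens_alg) tens" where
 "braid4 a b c d = class_ext (tensor T T) (%(h, b0). pure T T (a \<otimes>[T] ract h c) (b0 \<otimes>[T] d)) (rcoact b)"

lemma braid4_inner: "a : car T ==> c : car T ==> d : car T ==>
 bilin B T (tensor T T) (%h b0. pure T T (a \<otimes>[T] ract h c) (b0 \<otimes>[T] d))"
 by(rule bilin_precomp[OF bilin_pure[OF Tv Tv] lhom_comp[OF bilinD(2)[OF ract_bilin] bilinD(1)[OF T_mult]] bilinD(2)[OF T_mult]])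

lemma braid4_b: "a : car T ==> c : car T ==> d : car T ==> (%b. braid4 a b c d) : lhom T (tensor T T)"
 unfolding braid4_def by(rule lhom_comp[OF rcoact_lhom cext_lhom[OF Bv Tv TTv braid4_inner]])

lemma braid4_a:
 assumes "b : car T" "c : car T" "d : car T"
 shows "(%a. braid4 a b c d) : lhom T (tensor T T)"
 unfolding braid4_def
 by(rule cext_param[OF Bv Tv TTv lhomD(1)[OF rcoact_lhom assms(1)]],
   rule lhom_comp[OF bilinD(2)[OF T_mult] pure_lhoml[OF Tv Tv]])
  (use assms bilinD(3)[OF T_mult] bilinD(3)[OF ract_bilin] in auto)

lemma braid4_c:
 assumes "b : car T" "a : car T" "d : car T"
 shows "(%c. braid4 a b c d) : lhom T (tensor T T)"
 unfolding braid4_def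
 by(rule cext_param[OF Bv Tv TTv lhomD(1)[OF rcoact_lhom assms(1)]],
   rule lhom_comp[OF lhom_comp[OF bilinD(1)[OF ract_bilin] bilinD(1)[OF T_mult]] pure_lhoml[OF Tv Tv]])
  (use assms bilinD(3)[OF T_mult] in auto)

lemma braid4_d:
 assumes "b : car T" "a : car T" "c : car T"
 shows "(%d. braid4 a b c d) : lhom T (tensor T T)"
 unfolding braid4_def
 by(rule cext_param[OF Bv Tv TTv lhomD(1)[OF rcoact_lhom assms(1)]],
   rule lhom_comp[OF bilinD(1)[OF T_mult] pure_lhomr[OF Tv Tv]])
  (use assms bilinD(3)[OF T_mult] bilinD(3)[OF ract_bilin] in auto)

abbreviation bmul where "bmul \<equiv> braided_mult (tensor_alg_yd B V)"

lemma bmul_eq: "bmul s t = class_ext (tensor T T) (%(a, b). class_ext (tensor T T) (%(c, d). braid4 a b c d) t) s"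
 by(simp add: braided_mult_def braid4_def)

lemma braid4_bilin_cd: "a : car T ==> b : car T ==> bilin T T (tensor T T) (%c d. braid4 a b c d)"
 by(intro bilinI braid4_c braid4_d)

lemma braid4_bilin_ab:
 assumes t: "t : car (tensor T T)"
 shows "bilin T T (tensor T T) (%a b. class_ext (tensor T T) (%(c, d). braid4 a b c d) t)"
 by(rule bilinI; rule cext_param[OF Tv Tv TTv t]) (auto intro: braid4_a braid4_b)

lemma bmul_bilin: "bilin (tensor T T) (tensor T T) (tensor T T) bmul"
proof(rule bilinI)
 fix s assume s: "s : car (tensor T T)"
 show "bmul s : lhom (tensor T T) (tensor T T)"
  unfolding bmul_eq[abs_def]
  by(rule cext_param[OF Tv Tv TTv s cext_lhom[OF Tv Tv TTv braid4_bilin_cd]])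
next
 fix t assume t: "t : car (tensor T T)"
 show "(%s. bmul s t) : lhom (tensor T T) (tensor T T)"
  unfolding bmul_eq[abs_def] by(rule cext_lhom[OF Tv Tv TTv braid4_bilin_ab[OF t]])
qed

lemma letter_prim_lhom:
 "(%v. pure T T (tword V [v]) \<one>[T] \<oplus>[tensor T T] pure T T \<one>[T] (tword V [v])) : lhom V (tensor T T)"
 by(intro lhom_add lhom_comp[OF T_letter pure_lhoml[OF Tv Tv]] lhom_comp[OF T_letter pure_lhomr[OF Tv Tv]] TTv T_one)

lemma tcomult_closed: "w : lists (car V) ==> tword_comult B V w : car (tensor T T)"
proof(induction w)
 case Nil
 show ?case using T_one Tv by simp
next
 case (Cons v w)
 then show ?case unfolding tword_comult.simps
  by(intro bilinD(3)[OF bmul_bilin] lhomD(1)[OF letter_prim_lhom]) auto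
qed

lemma tcomult_lhom:
 assumes w: "w : lists (car V)"
 shows "u : lists (car V) ==> (%v. tword_comult B V (u @ v # w)) : lhom V (tensor T T)"
proof(induction u)
 case Nil
 show ?case unfolding append_Nil tword_comult.simps
  by(rule lhom_comp[OF letter_prim_lhom bilinD(2)[OF bmul_bilin tcomult_closed[OF w]]])
next
 case (Cons a u)
 then have a: "a : car V" and u: "u : lists (car V)" by auto
 show ?case unfolding append_Cons tword_comult.simps
  by(rule lhom_comp[OF Cons(1)[OF u] bilinD(1)[OF bmul_bilin lhomD(1)[OF letter_prim_lhom a]]])
qed

lemma tcomult_mlin: "mlin V (tensor T T) (tword_comult B V)"
 unfolding mlin_def using tcomult_closed tcomult_lhom by blast

lemmas rcomult_lhom = talg_ext_lhom[OF Vv TTv tcomult_mlin]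

lemma counit_mlin: "mlin V complex_mod (%w. if w = [] then 1 else 0)"
 unfolding mlin_def by(auto intro!: lhomI)

abbreviation rcounit where "rcounit \<equiv> class_ext complex_mod (%w. if w = [] then 1 else (0::complex))"
lemmas rcounit_lhom = talg_ext_lhom[OF Vv cm_vs counit_mlin]
lemmas rcounit_tword = talg_ext_tword[OF Vv cm_vs counit_mlin]

text \<open>Checked on words, where the counit is nonzero only at the empty word and a concatenation
  is empty only if both parts are. It makes the kernel of the counit an ideal.\<close>

lemma rcounit_mult:
 assumes x: "x : car T" and y: "y : car T"
 shows "rcounit (x \<otimes>[T] y) = rcounit x * rcounit y"
proof -
 have cm: "(%z. c * z) : lhom complex_mod complex_mod" "(%z. z * c) : lhom complex_mod complex_mod" for c
  by(auto intro!: lhomI simp: algebra_simps)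
 have 1: "rcounit (tword V u \<otimes>[T] y) = rcounit (tword V u) * rcounit y" if u: "u : lists (car V)" for u
  by(rule talg_eqI[OF Vv lhom_comp[OF bilinD(1)[OF T_mult] rcounit_lhom] lhom_comp[OF rcounit_lhom cm(1)] _ y])
   (use u Vv in \<open>auto simp: tword_mult rcounit_tword simp del: in_lists_conv_set\<close>)
 show ?thesis
  by(rule talg_eqI[OF Vv lhom_comp[OF bilinD(2)[OF T_mult y] rcounit_lhom] lhom_comp[OF rcounit_lhom cm(2)] _ x])
   (use 1 in auto)
qed

lemma rcounit_grade:
 assumes "x : lspan T {tword V w | w. w : lists (car V) & length w = n}" "n ~= 0"
 shows "rcounit x = 0"
proof -
 have S: "{tword V w | w. w : lists (car V) & length w = n} <= car T"
  using Vv by(auto intro!: tword_closed simp del: in_lists_conv_set)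
 have z: "rcounit s = \<zero>[complex_mod]" if s: "s : {tword V w | w. w : lists (car V) & length w = n}" for s
 proof -
  obtain w where w: "w : lists (car V)" "length w = n" "s = tword V w" using s by blast
  show ?thesis unfolding w(3) rcounit_tword[OF w(1)] using w(2) assms(2) by auto
 qed
 have "rcounit x = \<zero>[complex_mod]"
  by(rule lhom_eqI[OF rcounit_lhom lhom_0 Tv _ S z assms(1)]) simp_all
 then show ?thesis by simp
qed

end

section \<open>The map of tensor algebras induced by a morphism of Yetter-Drinfeld modules\<close>

locale yd_mor = V: yd_pre B V + W: yd_pre B W
 for B :: "('b, 'm) hopf_scheme" and V :: "('b, 'v, 'n) yd_scheme" and W :: "('b, 'w, 'o) yd_scheme" +
 fixes f :: "'v => 'w"
 assumes f: "f : lhom V W" and f_act: "!!h v. h : car B ==> v : car V ==> f (act V h v) = act W h (f v)"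
  and f_coact: "!!v. v : car V ==> coact W (f v) = tensor_map B W (%b. b) f (coact V v)"
begin

definition Tf where "Tf = class_ext (tensor_alg W) (%w. tword W (map f w))"

lemma map_lists: "w : lists (car V) ==> map f w : lists (car W)"
 using lhomD(1)[OF f] by auto

lemma Tf_mlin: "mlin V (tensor_alg W) (%w. tword W (map f w))"
 unfolding mlin_def
proof(intro conjI ballI)
 show "tword W (map f w) : car W.T" if "w : lists (car V)" for w
  by(rule tword_closed[OF W.Vv map_lists[OF that]])
 fix u w assume uw: "u : lists (car V)" "w : lists (car V)"
 have "(%v. tword W (map f u @ v # map f w)) : lhom W W.T"
  using tword_mlin[OF W.Vv] map_lists uw unfolding mlin_def by blast
 from lhom_comp[OF f this] show "(%v. tword W (map f (u @ v # w))) : lhom V W.T" by simp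
qed

lemma Tf_lhom: "Tf : lhom V.T W.T"
 unfolding Tf_def by(rule talg_ext_lhom[OF V.Vv W.Tv Tf_mlin])

lemma Tf_tword: "w : lists (car V) ==> Tf (tword V w) = tword W (map f w)"
 unfolding Tf_def by(rule talg_ext_tword[OF V.Vv W.Tv Tf_mlin])

lemmas Tf_closed = lhomD(1)[OF Tf_lhom]

lemma Tf_letter: "v : car V ==> Tf (tword V [v]) = tword W [f v]"
 by(simp add: Tf_tword)

lemma Tf_one: "Tf \<one>[V.T] = \<one>[W.T]"
 by(simp add: talg_one[OF V.Vv] talg_one[OF W.Vv] Tf_tword)

lemma Tf_mult:
 assumes x: "x : car V.T" and y: "y : car V.T"
 shows "Tf (x \<otimes>[V.T] y) = Tf x \<otimes>[W.T] Tf y"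
proof -
 have 1: "Tf (tword V u \<otimes>[V.T] y) = Tf (tword V u) \<otimes>[W.T] Tf y" if u: "u : lists (car V)" for u
 proof(rule talg_eqI[OF V.Vv lhom_comp[OF bilinD(1)[OF V.T_mult] Tf_lhom] lhom_comp[OF Tf_lhom bilinD(1)[OF W.T_mult]] _ y])
  show "tword V u : car V.T" "Tf (tword V u) : car W.T"
   using u V.Vv by(auto intro: Tf_closed tword_closed)
  fix w assume w: "w : lists (car V)"
  show "Tf (tword V u \<otimes>[V.T] tword V w) = Tf (tword V u) \<otimes>[W.T] Tf (tword V w)"
   using u w map_lists[OF u] map_lists[OF w] V.Vv W.Vv
   by(simp add: tword_mult Tf_tword del: in_lists_conv_set)
 qed (rule W.Tv)
 show ?thesis
  by(rule talg_eqI[OF V.Vv lhom_comp[OF bilinD(2)[OF V.T_mult y] Tf_lhom] lhom_comp[OF Tf_lhom bilinD(2)[OF W.T_mult Tf_closed[OF y]]] W.Tv x 1])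
qed

lemma Tf_tact: "h : car B ==> w : lists (car V) ==> Tf (tword_act B V h w) = tword_act B W h (map f w)"
proof(induction w arbitrary: h)
 case Nil
 then show ?case using lhomD(3)[OF Tf_lhom V.T_one] by(simp add: Tf_one)
next
 case (Cons v w)
 then have v: "v : car V" and w: "w : lists (car V)" by auto
 note c = lhomD(1)[OF V.B_comult Cons(2)]
 note VT = bilinD(3)[OF V.T_mult] and WT = bilinD(3)[OF W.T_mult]
 note vl = lhomD(1)[OF V.T_letter] and wl = lhomD(1)[OF W.T_letter]
 have "Tf (tword_act B V h (v # w)) =
  class_ext W.T (%(h1, h2). Tf (tword V [act V h1 v] \<otimes>[V.T] tword_act B V h2 w)) (comult B h)"
  unfolding tword_act.simps
  by(rule lhom_cext[OF V.Bv V.Bv Tf_lhom V.Tv W.Tv c])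
   (use v w V.tact_closed bilinD(3)[OF V.V_act] in \<open>auto intro!: VT vl\<close>)
 also have "... = class_ext W.T (%(h1, h2). tword W [act W h1 (f v)] \<otimes>[W.T] tword_act B W h2 (map f w)) (comult B h)"
 proof(rule cext_cong[OF V.Bv V.Bv c W.Tv])
  fix a b assume ab: "a : car B" "b : car B"
  have av: "act V a v : car V" by(rule bilinD(3)[OF V.V_act ab(1) v])
  have aw: "act W a (f v) : car W" by(rule bilinD(3)[OF W.V_act ab(1) lhomD(1)[OF f v]])
  show "tword W [act W a (f v)] \<otimes>[W.T] tword_act B W b (map f w) : car W.T"
   by(rule WT[OF wl[OF aw] W.tact_closed[OF ab(2) map_lists[OF w]]])
  show "Tf (tword V [act V a v] \<otimes>[V.T] tword_act B V b w) = tword W [act W a (f v)] \<otimes>[W.T] tword_act B W b (map f w)"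
   by(simp only: Tf_mult[OF vl[OF av] V.tact_closed[OF ab(2) w]] Cons(1)[OF ab(2) w] Tf_letter[OF av] f_act[OF ab(1) v])
 qed
 finally show ?case by simp
qed

lemma Tf_ract:
 assumes h: "h : car B" and x: "x : car V.T"
 shows "Tf (V.ract h x) = W.ract h (Tf x)"
 by(rule talg_eqI[OF V.Vv lhom_comp[OF bilinD(1)[OF V.ract_bilin h] Tf_lhom] lhom_comp[OF Tf_lhom bilinD(1)[OF W.ract_bilin h]] W.Tv x])
  (simp only: Tf_tword map_lists talg_ext_tword[OF V.Vv V.Tv V.tact_mlin[OF h]] talg_ext_tword[OF W.Vv W.Tv W.tact_mlin[OF h]] Tf_tact[OF h])

abbreviation BTf where "BTf \<equiv> tensor_map B W.T (%b. b) Tf"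
abbreviation TTf where "TTf \<equiv> tensor_map W.T W.T Tf Tf"
lemmas BTf_lhom = tmap_lhom[OF V.Bv V.Tv V.Bv W.Tv lhom_id Tf_lhom]
lemmas TTf_lhom = tmap_lhom[OF V.Tv V.Tv W.Tv W.Tv Tf_lhom Tf_lhom]
lemmas BTf_pure = tmap_pure[OF V.Bv V.Tv V.Bv W.Tv lhom_id Tf_lhom]
lemmas TTf_pure = tmap_pure[OF V.Tv V.Tv W.Tv W.Tv Tf_lhom Tf_lhom]

text \<open>On pure tensors this is multiplicativity of \<open>Tf\<close>. It is the induction step
  for the coaction on words.\<close>

lemma BTf_coact_step:
 assumes h: "h : car B" and v: "v : car V" and t: "t : car (tensor B V.T)"
 shows "BTf (V.coact_step h v t) = W.coact_step h (f v) (BTf t)"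
proof(rule tensor_eqI[OF V.Bv V.Tv lhom_comp[OF V.coact_step_lhom[OF h v] BTf_lhom] lhom_comp[OF BTf_lhom W.coact_step_lhom[OF h lhomD(1)[OF f v]]] W.BTv t])
 fix a b assume ab: "a : car B" "b : car V.T"
 have vl: "tword V [v] : car V.T" by(rule lhomD(1)[OF V.T_letter v])
 show "BTf (V.coact_step h v (pure B V.T a b)) = W.coact_step h (f v) (BTf (pure B V.T a b))"
  unfolding V.coact_step_def W.coact_step_def
   cext_pure[OF V.Bv V.Tv V.BTv V.coact_step_inner[OF h v] ab]
   BTf_pure[OF ab] cext_pure[OF V.Bv W.Tv W.BTv W.coact_step_inner[OF h lhomD(1)[OF f v]] ab(1) Tf_closed[OF ab(2)]]
   BTf_pure[OF bilinD(3)[OF V.B_mult h ab(1)] bilinD(3)[OF V.T_mult vl ab(2)]] Tf_mult[OF vl ab(2)] Tf_letter[OF v] ..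
qed

lemma BTf_tcoact: "w : lists (car V) ==> BTf (tword_coact B V w) = tword_coact B W (map f w)"
proof(induction w)
 case Nil
 then show ?case by(simp add: BTf_pure[OF V.B_one V.T_one] Tf_one)
next
 case (Cons v w)
 then have v: "v : car V" and w: "w : lists (car V)" by auto
 note c = lhomD(1)[OF V.V_coact v]
 have "BTf (tword_coact B V (v # w)) = class_ext (tensor B W.T) (%(h, v0). BTf (V.coact_step h v0 (tword_coact B V w))) (coact V v)"
  unfolding V.tcoact_Cons
  by(rule lhom_cext[OF V.Bv V.Vv BTf_lhom V.BTv W.BTv c])
   (use lhomD(1)[OF V.coact_step_lhom] V.tcoact_closed[OF w] in auto)
 also have "... = class_ext (tensor B W.T) (%(h, v0). W.coact_step h (f v0) (tword_coact B W (map f w))) (coact V v)"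
  by(rule cext_cong[OF V.Bv V.Vv c W.BTv])
   (use BTf_coact_step V.tcoact_closed[OF w] W.tcoact_closed[OF map_lists[OF w]] Cons(1)[OF w] lhomD(1)[OF f] lhomD(1)[OF W.coact_step_lhom] in auto)
 also have "... = class_ext (tensor B W.T) (%(h, v0). W.coact_step h v0 (tword_coact B W (map f w))) (tensor_map B W (%b. b) f (coact V v))"
  by(rule cext_tmap[OF V.Bv V.Vv V.Bv W.Vv lhom_id f W.BTv W.coact_step_bilin[OF W.tcoact_closed[OF map_lists[OF w]]] c, symmetric])
 finally show ?case by(simp add: f_coact[OF v] W.tcoact_Cons)
qed

lemma BTf_rcoact:
 assumes x: "x : car V.T"
 shows "BTf (V.rcoact x) = W.rcoact (Tf x)"
 by(rule talg_eqI[OF V.Vv lhom_comp[OF V.rcoact_lhom BTf_lhom] lhom_comp[OF Tf_lhom W.rcoact_lhom] W.BTv x])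
  (simp only: Tf_tword map_lists talg_ext_tword[OF V.Vv V.BTv V.tcoact_mlin] talg_ext_tword[OF W.Vv W.BTv W.tcoact_mlin] BTf_tcoact)

text \<open>The braided product of four elements uses one coaction, one action and two products, and
  \<open>Tf\<close> respects each of them. The substitution rule \<open>cext_tmap\<close> turns the
  sum over the coaction of \<open>b\<close> into one over the coaction of
  \<open>Tf b\<close>.\<close>

lemma TTf_braid4:
 assumes abcd: "a : car V.T" "b : car V.T" "c : car V.T" "d : car V.T"
 shows "TTf (V.braid4 a b c d) = W.braid4 (Tf a) (Tf b) (Tf c) (Tf d)"
proof -
 note t = lhomD(1)[OF V.rcoact_lhom abcd(2)]
 note VT = bilinD(3)[OF V.T_mult] and WT = bilinD(3)[OF W.T_mult]
 note T' = Tf_closed[OF abcd(1)] Tf_closed[OF abcd(3)] Tf_closed[OF abcd(4)]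
 have "TTf (V.braid4 a b c d) = class_ext (tensor W.T W.T) (%(h, b0). TTf (pure V.T V.T (a \<otimes>[V.T] V.ract h c) (b0 \<otimes>[V.T] d))) (V.rcoact b)"
  unfolding V.braid4_def
  by(rule lhom_cext[OF V.Bv V.Tv TTf_lhom V.TTv W.TTv t]) (rule bilinD(3)[OF V.braid4_inner[OF abcd(1,3,4)]])
 also have "... = class_ext (tensor W.T W.T) (%(h, b0). pure W.T W.T (Tf a \<otimes>[W.T] W.ract h (Tf c)) (Tf b0 \<otimes>[W.T] Tf d)) (V.rcoact b)"
 proof(rule cext_cong[OF V.Bv V.Tv t W.TTv])
  fix h b0 assume hb: "h : car B" "b0 : car V.T"
  show "pure W.T W.T (Tf a \<otimes>[W.T] W.ract h (Tf c)) (Tf b0 \<otimes>[W.T] Tf d) : car (tensor W.T W.T)"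
   by(rule bilinD(3)[OF W.braid4_inner[OF T'] hb(1) Tf_closed[OF hb(2)]])
  have r: "V.ract h c : car V.T" by(rule bilinD(3)[OF V.ract_bilin hb(1) abcd(3)])
  show "TTf (pure V.T V.T (a \<otimes>[V.T] V.ract h c) (b0 \<otimes>[V.T] d)) = pure W.T W.T (Tf a \<otimes>[W.T] W.ract h (Tf c)) (Tf b0 \<otimes>[W.T] Tf d)"
   by(simp only: TTf_pure[OF VT[OF abcd(1) r] VT[OF hb(2) abcd(4)]] Tf_mult[OF abcd(1) r] Tf_mult[OF hb(2) abcd(4)] Tf_ract[OF hb(1) abcd(3)])
 qed
 also have "... = W.braid4 (Tf a) (Tf b) (Tf c) (Tf d)"
  unfolding W.braid4_def BTf_rcoact[OF abcd(2), symmetric]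
  by(rule cext_tmap[OF V.Bv V.Tv V.Bv W.Tv lhom_id Tf_lhom W.TTv W.braid4_inner[OF T'] t, symmetric])
 finally show ?thesis .
qed

lemma TTf_bmul:
 assumes s: "s : car (tensor V.T V.T)" and t: "t : car (tensor V.T V.T)"
 shows "TTf (V.bmul s t) = W.bmul (TTf s) (TTf t)"
proof -
 have in1: "class_ext (tensor V.T V.T) (%(c, d). V.braid4 a b c d) t : car (tensor V.T V.T)"
  if "a : car V.T" "b : car V.T" for a b
  by(rule cext_closed[OF V.Tv V.Tv V.TTv V.braid4_bilin_cd[OF that] t])
 have t': "TTf t : car (tensor W.T W.T)" by(rule lhomD(1)[OF TTf_lhom t])
 have inner: "TTf (class_ext (tensor V.T V.T) (%(c, d). V.braid4 a b c d) t) =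
  class_ext (tensor W.T W.T) (%(c, d). W.braid4 (Tf a) (Tf b) c d) (TTf t)" if ab: "a : car V.T" "b : car V.T" for a b
 proof -
  note T' = Tf_closed[OF ab(1)] Tf_closed[OF ab(2)]
  have "TTf (class_ext (tensor V.T V.T) (%(c, d). V.braid4 a b c d) t) =
   class_ext (tensor W.T W.T) (%(c, d). TTf (V.braid4 a b c d)) t"
   by(rule lhom_cext[OF V.Tv V.Tv TTf_lhom V.TTv W.TTv t]) (rule bilinD(3)[OF V.braid4_bilin_cd[OF ab]])
  also have "... = class_ext (tensor W.T W.T) (%(c, d). W.braid4 (Tf a) (Tf b) (Tf c) (Tf d)) t"
   by(rule cext_cong[OF V.Tv V.Tv t W.TTv])
    (use bilinD(3)[OF W.braid4_bilin_cd[OF T']] TTf_braid4 ab Tf_closed in auto)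
  also have "... = class_ext (tensor W.T W.T) (%(c, d). W.braid4 (Tf a) (Tf b) c d) (TTf t)"
   by(rule cext_tmap[OF V.Tv V.Tv W.Tv W.Tv Tf_lhom Tf_lhom W.TTv W.braid4_bilin_cd[OF T'] t, symmetric])
  finally show ?thesis .
 qed
 have "TTf (V.bmul s t) = class_ext (tensor W.T W.T) (%(a, b). TTf (class_ext (tensor V.T V.T) (%(c, d). V.braid4 a b c d) t)) s"
  unfolding V.bmul_eq by(rule lhom_cext[OF V.Tv V.Tv TTf_lhom V.TTv W.TTv s in1])
 also have "... = class_ext (tensor W.T W.T) (%(a, b). class_ext (tensor W.T W.T) (%(c, d). W.braid4 (Tf a) (Tf b) c d) (TTf t)) s"
  by(rule cext_cong[OF V.Tv V.Tv s W.TTv])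
   (use inner bilinD(3)[OF W.braid4_bilin_ab[OF t']] Tf_closed in auto)
 also have "... = W.bmul (TTf s) (TTf t)"
  unfolding W.bmul_eq
  by(rule cext_tmap[OF V.Tv V.Tv W.Tv W.Tv Tf_lhom Tf_lhom W.TTv W.braid4_bilin_ab[OF t'] s, symmetric])
 finally show ?thesis .
qed

lemma TTf_tcomult: "w : lists (car V) ==> TTf (tword_comult B V w) = tword_comult B W (map f w)"
proof(induction w)
 case Nil
 then show ?case by(simp add: TTf_pure[OF V.T_one V.T_one] Tf_one)
next
 case (Cons v w)
 then have v: "v : car V" and w: "w : lists (car V)" by auto
 have vl: "tword V [v] : car V.T" by(rule lhomD(1)[OF V.T_letter v])
 have p: "pure V.T V.T (tword V [v]) \<one>[V.T] : car (tensor V.T V.T)" "pure V.T V.T \<one>[V.T] (tword V [v]) : car (tensor V.T V.T)"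
  using V.Tv vl V.T_one by auto
 show ?case
  unfolding tword_comult.simps list.map
  by(simp only: TTf_bmul[OF lhomD(1)[OF V.letter_prim_lhom v] V.tcomult_closed[OF w]] Cons(1)[OF w]
   lhomD(2)[OF TTf_lhom p] TTf_pure[OF vl V.T_one] TTf_pure[OF V.T_one vl] Tf_one Tf_letter[OF v])
qed

lemma TTf_rcomult:
 assumes x: "x : car V.T"
 shows "TTf (class_ext (tensor V.T V.T) (tword_comult B V) x) = class_ext (tensor W.T W.T) (tword_comult B W) (Tf x)"
 by(rule talg_eqI[OF V.Vv lhom_comp[OF V.rcomult_lhom TTf_lhom] lhom_comp[OF Tf_lhom W.rcomult_lhom] W.TTv x])
  (simp only: Tf_tword map_lists talg_ext_tword[OF V.Vv V.TTv V.tcomult_mlin] talg_ext_tword[OF W.Vv W.TTv W.tcomult_mlin] TTf_tcomult)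

lemma Tf_rcounit:
 assumes x: "x : car V.T"
 shows "V.rcounit x = W.rcounit (Tf x)"
 by(rule talg_eqI[OF V.Vv V.rcounit_lhom lhom_comp[OF Tf_lhom W.rcounit_lhom] cm_vs x])
  (simp add: Tf_tword map_lists V.rcounit_tword W.rcounit_tword del: in_lists_conv_set)

end

section \<open>Functoriality of the Nichols algebra\<close>

lemma tspan_mono:
 assumes "vsp V" "vsp W" "A' <= car V" "C' <= car W" "A <= A'" "C <= C'"
 shows "tensor_span V W A C <= tensor_span V W A' C'"
proof -
 have "{pure V W a c | a c. a : A' & c : C'} <= car (tensor V W)" using assms by(auto simp: subset_iff)
 moreover have "{pure V W a c | a c. a : A & c : C} <= {pure V W a c | a c. a : A' & c : C'}" using assms(5,6) by blast
 ultimately show ?thesis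
  unfolding tensor_span_def by(rule lspan_mono[OF tensor_vs[OF assms(1,2)]])
qed

lemma (in hopf_pre) hopf_automorphism_id: "hopf_automorphism B (%b. b)"
 unfolding hopf_automorphism_def
proof(intro conjI ballI)
 show "(%b. b) : Ring.ring_hom B B" by(rule ring_hom_memI) auto
 show "comult B x = tensor_map B B (%b. b) (%b. b) (comult B x)" if "x : car B" for x
  using tensor_map_id[OF Bv Bv lhomD(1)[OF B_comult that]] by simp
qed (auto simp: bij_betw_def lhom_id)

locale yd_alg = hopf_pre B for B :: "('b, 'm) hopf_scheme" +
 fixes R :: "('b, 'r, 'n) yd_hopf_scheme"
 assumes R_alg: "assoc_algebra R" and R_act: "bilin B R R (act R)" and R_coact: "coact R : lhom R (tensor B R)"
  and R_comult: "bcomult R : lhom R (tensor R R)" and R_counit: "bcounit R : lhom R complex_mod"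

locale yd_quot = yd_alg B R for B :: "('b, 'm) hopf_scheme" and R :: "('b, 'r, 'n) yd_hopf_scheme" +
 fixes J
 assumes J_ideal: "ideal J R" and J_act: "!!h j. h : car B ==> j : J ==> act R h j : J"
  and J_coact: "!!j. j : J ==> coact R j : tensor_span B R (car B) J"
  and J_comult: "!!j. j : J ==> bcomult R j : tensor_span R R J (car R) <+>\<^bsub>tensor R R\<^esub> tensor_span R R (car R) J"
  and J_counit: "!!j. j : J ==> bcounit R j = 0"
begin

abbreviation q where "q x \<equiv> J +>\<^bsub>R\<^esub> x"
abbreviation Q where "Q \<equiv> quot_alg R J"
abbreviation QR where "QR \<equiv> yd_hopf_quot B R J"

lemmas Rv = algD(1)[OF R_alg]
lemma J_sub: "ssp J R" by(rule ideal_subspace[OF R_alg J_ideal])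
lemma Qv: "vsp Q" using J_sub by simp
lemmas q_lhom = quot_lhom[OF J_sub]

lemma QR_simps:
 "car QR = car Q" "add QR = add Q" "module.smult QR = module.smult Q" "\<zero>[QR] = \<zero>[Q]"
 "monoid.mult QR = monoid.mult Q" "\<one>[QR] = \<one>[Q]"
 "act QR = (%h X. q (act R h (SOME x. x : X)))"
 "coact QR = (%X. tensor_map B Q (%b. b) q (coact R (SOME x. x : X)))"
 "bcomult QR = (%X. tensor_map Q Q q q (bcomult R (SOME x. x : X)))"
 "bcounit QR = (%X. bcounit R (SOME x. x : X))"
 "grade QR = (%n. q ` grade R n)"
 by(simp_all add: yd_hopf_quot_def Let_def module.defs yd.defs yd_hopf.defs)

text \<open>The structure maps of the quotient are evaluated at a representative chosen by
  \<open>SOME\<close>. A linear map that kills \<open>J\<close> does not see the choice, and this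
  one fact serves action, coaction, comultiplication and counit.\<close>

lemma rep_eq:
 assumes g: "g : lhom R X" and X: "vsp X" and k: "!!j. j : J ==> g j = \<zero>[X]" and x: "x : car R"
 shows "g (SOME y. y : q x) = g x"
proof -
 have "(SOME y. y : q x) : q x" by(rule someI[of _ x]) (rule rcoset_self[OF J_sub x])
 then obtain j where j: "j : J" "(SOME y. y : q x) = j \<oplus>[R] x" by(auto simp: mem_rcoset)
 have jR: "j : car R" using subspD(6)[OF J_sub j(1)] .
 show ?thesis unfolding j(2) lhomD(2)[OF g jR x] k[OF j(1)] using X lhomD(1)[OF g x] by simp
qed

lemma q_zero: "j : J ==> q j = \<zero>[Q]"
 using rcoset_zero_iff[OF J_sub subspD(6)[OF J_sub]] by simp

lemma act_q: "h : car B ==> x : car R ==> act QR h (q x) = q (act R h x)"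
 unfolding QR_simps
 by(rule rep_eq[OF lhom_comp[OF bilinD(1)[OF R_act] q_lhom] Qv]) (use J_act q_zero in auto)

lemma coact_q: "x : car R ==> coact QR (q x) = tensor_map B Q (%b. b) q (coact R x)"
 unfolding QR_simps
proof(rule rep_eq[OF lhom_comp[OF R_coact tmap_lhom[OF Bv Rv Bv Qv lhom_id q_lhom]] tensor_vs[OF Bv Qv]])
 fix j assume j: "j : J"
 have "tensor_map B Q (%b. b) q (coact R j) : {\<zero>[tensor B Q]}"
 proof(rule tspan_img[OF Bv Rv subset_refl subspD(1)[OF J_sub] tmap_lhom[OF Bv Rv Bv Qv lhom_id q_lhom] _ _ J_coact[OF j]])
  fix a c assume ac: "a : car B" "c : J"
  show "tensor_map B Q (%b. b) q (pure B R a c) : {\<zero>[tensor B Q]}"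
   unfolding tmap_pure[OF Bv Rv Bv Qv lhom_id q_lhom ac(1) subspD(6)[OF J_sub ac(2)]] q_zero[OF ac(2)]
   using pure_zero_right[OF Bv Qv ac(1)] by simp
 qed (rule zero_subsp[OF tensor_vs[OF Bv Qv]])
 then show "tensor_map B Q (%b. b) q (coact R j) = \<zero>[tensor B Q]" by simp
qed

text \<open>The coideal condition puts \<open>bcomult R j\<close> into a sum of two tensor spans,
  each with a factor from \<open>J\<close>, which \<open>q \<otimes> q\<close> sends to
  zero.\<close>

lemma comult_q: "x : car R ==> bcomult QR (q x) = tensor_map Q Q q q (bcomult R x)"
 unfolding QR_simps
proof(rule rep_eq[OF lhom_comp[OF R_comult tmap_lhom[OF Rv Rv Qv Qv q_lhom q_lhom]] tensor_vs[OF Qv Qv]])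
 fix j assume j: "j : J"
 note l = tmap_lhom[OF Rv Rv Qv Qv q_lhom q_lhom]
 note zs = zero_subsp[OF tensor_vs[OF Qv Qv]]
 note JR = subspD(1)[OF J_sub]
 obtain s t where st: "s : tensor_span R R J (car R)" "t : tensor_span R R (car R) J" "bcomult R j = s \<oplus>[tensor R R] t"
  using J_comult[OF j] by(auto simp: mem_set_add)
 have s: "tensor_map Q Q q q s : {\<zero>[tensor Q Q]}"
 proof(rule tspan_img[OF Rv Rv JR subset_refl l zs _ st(1)])
  fix a c assume ac: "a : J" "c : car R"
  show "tensor_map Q Q q q (pure R R a c) : {\<zero>[tensor Q Q]}"
   unfolding tmap_pure[OF Rv Rv Qv Qv q_lhom q_lhom subspD(6)[OF J_sub ac(1)] ac(2)] q_zero[OF ac(1)]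
   using pure_zero_left[OF Qv Qv lhomD(1)[OF q_lhom ac(2)]] by simp
 qed
 have t: "tensor_map Q Q q q t : {\<zero>[tensor Q Q]}"
 proof(rule tspan_img[OF Rv Rv subset_refl JR l zs _ st(2)])
  fix a c assume ac: "a : car R" "c : J"
  show "tensor_map Q Q q q (pure R R a c) : {\<zero>[tensor Q Q]}"
   unfolding tmap_pure[OF Rv Rv Qv Qv q_lhom q_lhom ac(1) subspD(6)[OF J_sub ac(2)]] q_zero[OF ac(2)]
   using pure_zero_right[OF Qv Qv lhomD(1)[OF q_lhom ac(1)]] by simp
 qed
 have sR: "s : car (tensor R R)" "t : car (tensor R R)"
  using st subspD(6)[OF tspan_subsp[OF Rv Rv JR subset_refl]] subspD(6)[OF tspan_subsp[OF Rv Rv subset_refl JR]] by auto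
 show "tensor_map Q Q q q (bcomult R j) = \<zero>[tensor Q Q]"
  unfolding st(3) lhomD(2)[OF l sR] using s t vs_l_zero[OF tensor_vs[OF Qv Qv] vs_zero[OF tensor_vs[OF Qv Qv]]] by simp
qed

lemma counit_q: "x : car R ==> bcounit QR (q x) = bcounit R x"
 unfolding QR_simps by(rule rep_eq[OF R_counit cm_vs]) (use J_counit in auto)

lemma tensor_QR: "tensor QR X = tensor Q X" "tensor X QR = tensor X Q" "pure QR X = pure Q X" "pure X QR = pure X Q"
 by(intro tensor_cong; simp add: QR_simps)+

lemma QR_cases: "X : car QR ==> (!!x. x : car R ==> X = q x ==> thesis) ==> thesis"
 by(auto simp: QR_simps mem_quot)

end

text \<open>An isomorphism \<open>F\<close> carrying \<open>J\<close> onto \<open>J'\<close> carries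
  cosets to cosets, and the induced bijection inherits each compatibility. The automorphism of
  \<open>B\<close> is taken to be the identity.\<close>

lemma pull_push_iso_quot:
 assumes 1: "yd_quot B R J" and 2: "yd_quot B R' J'"
  and F: "F : lhom R R'" and inj: "inj_on F (car R)" and surj: "F ` car R = car R'" and FJ: "F ` J = J'"
  and F_mult: "!!x y. x : car R ==> y : car R ==> F (x \<otimes>[R] y) = F x \<otimes>[R'] F y"
  and F_one: "F \<one>[R] = \<one>[R']"
  and F_act: "!!h x. h : car B ==> x : car R ==> F (act R h x) = act R' h (F x)"
  and F_coact: "!!x. x : car R ==> coact R' (F x) = tensor_map B R' (%b. b) F (coact R x)"
  and F_comult: "!!x. x : car R ==> bcomult R' (F x) = tensor_map R' R' F F (bcomult R x)"
  and F_counit: "!!x. x : car R ==> bcounit R' (F x) = bcounit R x"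
  and F_grade: "!!n. F ` grade R n = grade R' n" and grade: "!!n. grade R n <= car R"
 shows "pull_push_iso B (yd_hopf_quot B R J) (yd_hopf_quot B R' J')"
proof -
 interpret A: yd_quot B R J by(rule 1)
 interpret C: yd_quot B R' J' by(rule 2)
 note FD = lhomD[OF F]
 \<comment> \<open>The image set of a coset of \<open>J\<close> is a coset of \<open>J'\<close>, so
   the map between the quotients needs no choice of representatives.\<close>
 define psi where "psi X = F ` X" for X
 have JR: "!!j. j : J ==> j : car R" using subspD(6)[OF A.J_sub] .
 have psi_q: "psi (A.q x) = C.q (F x)" if x: "x : car R" for x
 proof(intro Set.set_eqI iffI)
  fix y assume "y : psi (A.q x)"
  then obtain j where "j : J" "y = F (j \<oplus>[R] x)" unfolding psi_def by(auto simp: mem_rcoset)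
  then show "y : C.q (F x)" using FD(2)[OF JR x] FJ by(auto simp: mem_rcoset)
 next
  fix y assume "y : C.q (F x)"
  then obtain j where j: "j : J" "y = F j \<oplus>[R'] F x" unfolding FJ[symmetric] by(auto simp: mem_rcoset)
  then have "y = F (j \<oplus>[R] x)" using FD(2)[OF JR x] by simp
  moreover have "j \<oplus>[R] x : A.q x" using j(1) by(auto simp: mem_rcoset)
  ultimately show "y : psi (A.q x)" unfolding psi_def by blast
 qed
 have qA: "A.q x : car A.Q" if "x : car R" for x using lhomD(1)[OF A.q_lhom that] .
 have qC: "C.q x : car C.Q" if "x : car R'" for x using lhomD(1)[OF C.q_lhom that] .
 have add: "psi (X \<oplus>[A.Q] Y) = psi X \<oplus>[C.Q] psi Y" if XY: "X : car A.Q" "Y : car A.Q" for X Y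
 proof -
  obtain x y where xy: "x : car R" "y : car R" "X = A.q x" "Y = A.q y" using XY by(auto simp: mem_quot)
  show ?thesis unfolding xy(3,4) lhomD(2)[OF A.q_lhom xy(1,2), symmetric] psi_q[OF xy(1)] psi_q[OF xy(2)]
    psi_q[OF vs_add[OF A.Rv xy(1,2)]] FD(2)[OF xy(1,2)] lhomD(2)[OF C.q_lhom FD(1)[OF xy(1)] FD(1)[OF xy(2)]] ..
 qed
 have mult: "psi (X \<otimes>[A.Q] Y) = psi X \<otimes>[C.Q] psi Y" if XY: "X : car A.Q" "Y : car A.Q" for X Y
 proof -
  obtain x y where xy: "x : car R" "y : car R" "X = A.q x" "Y = A.q y" using XY by(auto simp: mem_quot)
  show ?thesis unfolding xy(3,4) quot_mult[OF A.J_ideal xy(1,2)] psi_q[OF xy(1)] psi_q[OF xy(2)]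
    psi_q[OF algD(5)[OF A.R_alg xy(1,2)]] F_mult[OF xy(1,2)] quot_mult[OF C.J_ideal FD(1)[OF xy(1)] FD(1)[OF xy(2)]] ..
 qed
 have clos: "psi X : car C.Q" if "X : car A.Q" for X
  using that psi_q qC FD(1) by(auto simp: mem_quot)
 have lh: "psi : lhom A.Q C.Q"
 proof(rule lhomI)
  fix k X assume "X : car A.Q"
  then obtain x where x: "x : car R" "X = A.q x" by(auto simp: mem_quot)
  show "psi (k \<odot>[A.Q] X) = k \<odot>[C.Q] psi X"
   unfolding x(2) lhomD(3)[OF A.q_lhom x(1), symmetric] psi_q[OF x(1)] psi_q[OF vs_smult[OF A.Rv x(1)]]
    FD(3)[OF x(1)] lhomD(3)[OF C.q_lhom FD(1)[OF x(1)]] ..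
 qed (use clos add in auto)
 have bij: "bij_betw psi (car A.Q) (car C.Q)"
  unfolding bij_betw_def
 proof
  show "inj_on psi (car A.Q)"
  proof(rule inj_onI)
   fix X Y assume XY: "X : car A.Q" "Y : car A.Q" "psi X = psi Y"
   obtain x y where xy: "x : car R" "y : car R" "X = A.q x" "Y = A.q y" using XY by(auto simp: mem_quot)
   have "F x \<oplus>[R'] (-1) \<odot>[R'] F y : J'"
    using XY(3) rcoset_eq_iff[OF C.J_sub FD(1)[OF xy(1)] FD(1)[OF xy(2)]] psi_q xy by simp
   then have "F (x \<oplus>[R] (-1) \<odot>[R] y) : F ` J"
    using FD(2)[OF xy(1) vs_smult[OF A.Rv xy(2)]] FD(3)[OF xy(2)] FJ by simp
   then obtain j where j: "j : J" "F (x \<oplus>[R] (-1) \<odot>[R] y) = F j" by auto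
   have "x \<oplus>[R] (-1) \<odot>[R] y = j"
    by(rule inj_onD[OF inj j(2)]) (use xy A.Rv JR[OF j(1)] in auto)
   then show "X = Y" using j rcoset_eq_iff[OF A.J_sub xy(1,2)] xy by simp
  qed
  show "psi ` car A.Q = car C.Q"
  proof
   show "psi ` car A.Q <= car C.Q" using clos by auto
   show "car C.Q <= psi ` car A.Q"
   proof
    fix Y assume "Y : car C.Q"
    then obtain y0 where y0: "y0 : car R'" "Y = C.q y0" by(auto simp: mem_quot)
    then obtain x where "x : car R" "Y = C.q (F x)" unfolding surj[symmetric] by blast
    then show "Y : psi ` car A.Q" using psi_q qA by(metis imageI)
   qed
  qed
 qed
 note Tm = tensor_map_comp
 have comp: "!!x. x : car R ==> C.q (F x) = psi (A.q x)" using psi_q by simp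
 show ?thesis
  unfolding pull_push_iso_def
 proof(intro exI[of _ "%b. b"] exI[of _ psi] conjI allI ballI)
  show "hopf_automorphism B (%b. b)" by(rule A.hopf_automorphism_id)
  show "bij_betw psi (car A.QR) (car C.QR)" unfolding A.QR_simps C.QR_simps by(rule bij)
  show "psi : module_hom CC A.QR C.QR" using lh unfolding module_hom_def A.QR_simps C.QR_simps .
  have "psi \<one>[A.Q] = \<one>[C.Q]"
   using psi_q[OF algD(4)[OF A.R_alg]] F_one by simp
  then show "psi : Ring.ring_hom A.QR C.QR"
   by(intro ring_hom_memI) (simp_all only: A.QR_simps C.QR_simps clos add mult)
  show "psi ` grade A.QR n = grade C.QR n" for n
  proof -
   have "psi ` (A.q ` grade R n) = C.q ` (F ` grade R n)"
    unfolding image_image by(rule image_cong[OF refl]) (use grade psi_q in auto)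
   then show ?thesis unfolding A.QR_simps C.QR_simps F_grade .
  qed
  fix X assume "X : car A.QR"
  then obtain x where x: "x : car R" "X = A.q x" by(rule A.QR_cases)
  note x' = FD(1)[OF x(1)]
  have tC: "tensor_map C.QR C.QR = tensor_map C.Q C.Q" "tensor_map B C.QR = tensor_map B C.Q"
   by(intro ext, simp add: tensor_map_def C.tensor_QR)+
  show "bcomult C.QR (psi X) = tensor_map C.QR C.QR psi psi (bcomult A.QR X)"
  proof -
   note t = lhomD(1)[OF A.R_comult x(1)]
   have "bcomult C.QR (psi X) = tensor_map C.Q C.Q C.q C.q (tensor_map R' R' F F (bcomult R x))"
    unfolding x(2) psi_q[OF x(1)] C.comult_q[OF x'] F_comult[OF x(1)] ..
   also have "... = tensor_map C.Q C.Q (%x. C.q (F x)) (%x. C.q (F x)) (bcomult R x)"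
    by(rule Tm[OF A.Rv A.Rv C.Rv C.Rv C.Qv C.Qv F F C.q_lhom C.q_lhom t])
   also have "... = tensor_map C.Q C.Q (%x. psi (A.q x)) (%x. psi (A.q x)) (bcomult R x)"
    by(rule tensor_map_cong[OF A.Rv A.Rv C.Qv C.Qv t lhom_comp[OF A.q_lhom lh] lhom_comp[OF A.q_lhom lh] comp comp])
   also have "... = tensor_map C.Q C.Q psi psi (tensor_map A.Q A.Q A.q A.q (bcomult R x))"
    by(rule Tm[OF A.Rv A.Rv A.Qv A.Qv C.Qv C.Qv A.q_lhom A.q_lhom lh lh t, symmetric])
   finally show ?thesis unfolding x(2) A.comult_q[OF x(1)] tC .
  qed
  show "bcounit C.QR (psi X) = bcounit A.QR X"
   unfolding x(2) psi_q[OF x(1)] C.counit_q[OF x'] A.counit_q[OF x(1)] F_counit[OF x(1)] ..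
  show "coact C.QR (psi X) = tensor_map B C.QR (%b. b) psi (coact A.QR X)"
  proof -
   note t = lhomD(1)[OF A.R_coact x(1)]
   have "coact C.QR (psi X) = tensor_map B C.Q (%b. b) C.q (tensor_map B R' (%b. b) F (coact R x))"
    unfolding x(2) psi_q[OF x(1)] C.coact_q[OF x'] F_coact[OF x(1)] ..
   also have "... = tensor_map B C.Q (%b. b) (%x. C.q (F x)) (coact R x)"
    by(rule Tm[OF A.Bv A.Rv A.Bv C.Rv A.Bv C.Qv lhom_id F lhom_id C.q_lhom t])
   also have "... = tensor_map B C.Q (%b. b) (%x. psi (A.q x)) (coact R x)"
    by(rule tensor_map_cong[OF A.Bv A.Rv A.Bv C.Qv t lhom_id lhom_comp[OF A.q_lhom lh] refl comp])
   also have "... = tensor_map B C.Q (%b. b) psi (tensor_map B A.Q (%b. b) A.q (coact R x))"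
    by(rule Tm[OF A.Bv A.Rv A.Bv A.Qv A.Bv C.Qv lhom_id A.q_lhom lhom_id lh t, symmetric])
   finally show ?thesis unfolding x(2) A.coact_q[OF x(1)] tC .
  qed
 next
  fix b X assume b: "b : car B" and "X : car A.QR"
  then obtain x where x: "x : car R" "X = A.q x" by(metis A.QR_cases)
  show "psi (act A.QR b X) = act C.QR b (psi X)"
   unfolding x(2) psi_q[OF x(1)] A.act_q[OF b x(1)] C.act_q[OF b FD(1)[OF x(1)]] psi_q[OF bilinD(3)[OF A.R_act b x(1)]] F_act[OF b x(1)] ..
 qed
qed

section \<open>The ideal that defines the Nichols algebra\<close>

context yd_pre
begin

abbreviation HT where "HT \<equiv> tensor_hopf B V"

lemma HT_alg: "assoc_algebra HT"
 by(rule assoc_algebra_cong[OF T_alg]) simp_all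
lemmas HTv = algD(1)[OF HT_alg]

lemma HT_yd_alg: "yd_alg B HT"
proof(unfold_locales)
 show "assoc_algebra HT" by(rule HT_alg)
 show "bilin B HT HT (act HT)" using ract_bilin by(simp add: bilin_def)
 show "coact HT : lhom HT (tensor B HT)" using rcoact_lhom by simp
 show "bcomult HT : lhom HT (tensor HT HT)" using rcomult_lhom by simp
 show "bcounit HT : lhom HT complex_mod" using rcounit_lhom by simp
qed

lemma grade_carrier: "grade HT n <= car HT"
 unfolding tensor_hopf_simps
 by(rule lspan_closed[OF Tv]) (use Vv in \<open>auto intro!: tword_closed simp del: in_lists_conv_set\<close>)

lemma NIsD:
 assumes "J : nichols_ideals B V"
 shows "\<exists>S \<subseteq> (\<Union>n\<in>{2..}. grade HT n). J = Idl\<^bsub>HT\<^esub> S"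
  "!!j. j : J ==> bcomult HT j : tensor_span HT HT J (car HT) <+>\<^bsub>tensor HT HT\<^esub> tensor_span HT HT (car HT) J"
  "!!h j. h : car B ==> j : J ==> act HT h j : J"
  "!!j. j : J ==> coact HT j : tensor_span B HT (car B) J"
proof -
 have *: "(\<exists>S \<subseteq> (\<Union>n\<in>{2..}. grade HT n). J = Idl\<^bsub>HT\<^esub> S) &
    bcomult HT ` J <= tensor_span HT HT J (car HT) <+>\<^bsub>tensor HT HT\<^esub> tensor_span HT HT (car HT) J &
    (\<forall>h\<in>car B. act HT h ` J <= J) & coact HT ` J <= tensor_span B HT (car B) J"
  using assms unfolding nichols_ideals_def Let_def mem_Collect_eq .
 show "\<exists>S \<subseteq> (\<Union>n\<in>{2..}. grade HT n). J = Idl\<^bsub>HT\<^esub> S" using * by(elim conjE)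
 show "!!j. j : J ==> bcomult HT j : tensor_span HT HT J (car HT) <+>\<^bsub>tensor HT HT\<^esub> tensor_span HT HT (car HT) J"
  using conjunct1[OF conjunct2[OF *]] by(rule subsetD) (rule imageI)
 show "!!h j. h : car B ==> j : J ==> act HT h j : J"
  using conjunct1[OF conjunct2[OF conjunct2[OF *]]] by(blast dest: bspec)
 show "!!j. j : J ==> coact HT j : tensor_span B HT (car B) J"
  using conjunct2[OF conjunct2[OF conjunct2[OF *]]] by(rule subsetD) (rule imageI)
qed

lemma nichols_idealsI:
 assumes "S <= (\<Union>n\<in>{2..}. grade HT n)" "J = Idl\<^bsub>HT\<^esub> S"
  "!!j. j : J ==> bcomult HT j : tensor_span HT HT J (car HT) <+>\<^bsub>tensor HT HT\<^esub> tensor_span HT HT (car HT) J"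
  "!!h j. h : car B ==> j : J ==> act HT h j : J"
  "!!j. j : J ==> coact HT j : tensor_span B HT (car B) J"
 shows "J : nichols_ideals B V"
 unfolding nichols_ideals_def Let_def mem_Collect_eq
 by(intro conjI exI[of _ S] image_subsetI ballI assms)

lemma grades_carrier: "(\<Union>n\<in>{2..}. grade HT n) <= car HT"
 using grade_carrier by blast

lemma nichols_ideals_ideal: "J : nichols_ideals B V ==> ideal J HT"
proof -
 assume "J : nichols_ideals B V"
 then obtain S where S: "S <= (\<Union>n\<in>{2..}. grade HT n)" "J = Idl\<^bsub>HT\<^esub> S" by(meson NIsD(1))
 show "ideal J HT"
  unfolding S(2) by(rule ring.genideal_ideal[OF algD(2)[OF HT_alg] subset_trans[OF S(1) grades_carrier]])
qed

lemma NIs_carrier: "J : nichols_ideals B V ==> J <= car HT"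
 using ideal_subspace[OF HT_alg nichols_ideals_ideal] subspD(1) by blast

text \<open>The counit vanishes on every degree other than \<open>0\<close>, in particular on the
  generators, and it is multiplicative, so its kernel is an ideal containing the generated
  one.\<close>

lemma nichols_ideals_counit:
 assumes J: "J : nichols_ideals B V" and j: "j : J"
 shows "bcounit HT j = 0"
proof -
 obtain S where S: "S <= (\<Union>n\<in>{2..}. grade HT n)" "J = Idl\<^bsub>HT\<^esub> S" using NIsD(1)[OF J] by blast
 have sub: "ssp {x : car HT. rcounit x = \<zero>[complex_mod]} HT"
  by(rule ker_subsp[OF _ HTv cm_vs]) (simp add: rcounit_lhom)
 have m: "rcounit (x \<otimes>[HT] y) = rcounit x * rcounit y" if "x : car HT" "y : car HT" for x y
  using rcounit_mult that by simp
 have "ideal {x : car HT. rcounit x = \<zero>[complex_mod]} HT"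
  by(rule ideal_of_subspace[OF HT_alg sub]) (use m algD(5)[OF HT_alg] in auto)
 moreover have "S <= {x : car HT. rcounit x = \<zero>[complex_mod]}"
 proof
  fix x assume "x : S"
  then obtain n where n: "n \<ge> 2" "x : grade HT n" using S(1) by auto
  then show "x : {x : car HT. rcounit x = \<zero>[complex_mod]}"
   using rcounit_grade[of x n] grade_carrier[of n] by auto
 qed
 ultimately have "J <= {x : car HT. rcounit x = \<zero>[complex_mod]}"
  unfolding S(2) by(rule ring.genideal_minimal[OF algD(2)[OF HT_alg]])
 then show ?thesis using j by auto
qed

abbreviation NI where "NI \<equiv> nichols_ideal B V"

lemma Un_carrier: "\<Union>(nichols_ideals B V) <= car HT"
 using NIs_carrier by blast

lemma NI_sub: "ssp NI HT"
 unfolding nichols_ideal_def by(rule lspan_subsp[OF HTv Un_carrier])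

lemma NI_superset: "J : nichols_ideals B V ==> J <= NI"
 unfolding nichols_ideal_def using lspan_sup[OF HTv Un_carrier] by blast

lemma NI_least: "ssp N HT ==> (!!J. J : nichols_ideals B V ==> J <= N) ==> NI <= N"
 unfolding nichols_ideal_def by(rule lspan_least[OF HTv]) auto

text \<open>Each closure property of the sum has the form \<open>NI \<subseteq> N\<close> with
  \<open>N\<close> a preimage subspace, so it follows from the same property of the single ideals
  \<open>J\<close>, whose target only grows when \<open>J\<close> is enlarged to
  \<open>NI\<close>.\<close>

lemma nichols_yd_quot: "yd_quot B HT NI"
proof -
 interpret yd_alg B HT by(rule HT_yd_alg)
 note NC = subspD(1)[OF NI_sub]
 show ?thesis
 proof(rule yd_quot.intro[OF HT_yd_alg], rule yd_quot_axioms.intro)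
  have "NI <= {a : car HT. x \<otimes>[HT] a : NI}" if x: "x : car HT" for x
   by(rule NI_least[OF preim_subsp[OF bilinD(1)[OF algD(3)[OF HT_alg] x] HTv HTv NI_sub]])
    (use NIs_carrier NI_superset ideal.I_l_closed[OF nichols_ideals_ideal] x in blast)
  moreover have "NI <= {a : car HT. a \<otimes>[HT] x : NI}" if x: "x : car HT" for x
   by(rule NI_least[OF preim_subsp[OF bilinD(2)[OF algD(3)[OF HT_alg] x] HTv HTv NI_sub]])
    (use NIs_carrier NI_superset ideal.I_r_closed[OF nichols_ideals_ideal] x in blast)
  ultimately show "ideal NI HT"
   by(intro ideal_of_subspace[OF HT_alg NI_sub]) auto
 next
  fix h j assume h: "h : car B" and j: "j : NI"
  have "NI <= {a : car HT. act HT h a : NI}"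
   by(rule NI_least[OF preim_subsp[OF bilinD(1)[OF R_act h] HTv HTv NI_sub]])
    (use NIs_carrier NI_superset NIsD(3) h in blast)
  then show "act HT h j : NI" using j by blast
 next
  fix j assume j: "j : NI"
  have BH: "vsp (tensor B HT)" using Bv HTv by(rule tensor_vs)
  have HH: "vsp (tensor HT HT)" using HTv HTv by(rule tensor_vs)
  have "NI <= {a : car HT. coact HT a : tensor_span B HT (car B) NI}"
  proof(rule NI_least[OF preim_subsp[OF R_coact HTv BH tspan_subsp[OF Bv HTv subset_refl NC]]])
   fix J assume J: "J : nichols_ideals B V"
   show "J <= {a : car HT. coact HT a : tensor_span B HT (car B) NI}"
    using NIsD(4)[OF J] tspan_mono[OF Bv HTv subset_refl NC subset_refl NI_superset[OF J]] NIs_carrier[OF J]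
    by blast
  qed
  then show "coact HT j : tensor_span B HT (car B) NI" using j by blast
  have "NI <= {a : car HT. bcomult HT a : tensor_span HT HT NI (car HT) <+>\<^bsub>tensor HT HT\<^esub> tensor_span HT HT (car HT) NI}"
  proof(rule NI_least[OF preim_subsp[OF R_comult HTv HH subspace_set_add[OF tspan_subsp[OF HTv HTv NC subset_refl] tspan_subsp[OF HTv HTv subset_refl NC]]]])
   fix J assume J: "J : nichols_ideals B V"
   show "J <= {a : car HT. bcomult HT a : tensor_span HT HT NI (car HT) <+>\<^bsub>tensor HT HT\<^esub> tensor_span HT HT (car HT) NI}"
   proof
    fix a assume a: "a : J"
    show "a : {a : car HT. bcomult HT a : tensor_span HT HT NI (car HT) <+>\<^bsub>tensor HT HT\<^esub> tensor_span HT HT (car HT) NI}"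
     using NIsD(2)[OF J a] tspan_mono[OF HTv HTv subset_refl NC subset_refl NI_superset[OF J]]
      tspan_mono[OF HTv HTv NC subset_refl NI_superset[OF J] subset_refl] NIs_carrier[OF J] a
     unfolding mem_set_add by blast
   qed
  qed
  then show "bcomult HT j : tensor_span HT HT NI (car HT) <+>\<^bsub>tensor HT HT\<^esub> tensor_span HT HT (car HT) NI" using j by blast
  have "NI <= {x : car HT. bcounit HT x = \<zero>[complex_mod]}"
   by(rule NI_least[OF ker_subsp[OF R_counit HTv cm_vs]])
    (use nichols_ideals_counit NIs_carrier in auto)
  then show "bcounit HT j = 0" using j by auto
 qed
qed

end

section \<open>Transport of Nichols ideals along an isomorphism\<close>

locale yd_iso = F: yd_mor B V W f + G: yd_mor B W V g
 for B :: "('b, 'm) hopf_scheme" and V :: "('b, 'v, 'n) yd_scheme" and W :: "('b, 'w, 'o) yd_scheme" and f g +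
 assumes gf: "!!v. v : car V ==> g (f v) = v" and fg: "!!w. w : car W ==> f (g w) = w"
begin

lemma map_gf: "w : lists (car V) ==> map g (map f w) = w"
 by(induction w) (auto simp: gf)

lemma TgTf: "x : car F.V.T ==> G.Tf (F.Tf x) = x"
 by(rule talg_eqI[OF F.V.Vv lhom_comp[OF F.Tf_lhom G.Tf_lhom] lhom_id F.V.Tv])
  (simp_all only: F.Tf_tword G.Tf_tword F.map_lists map_gf)

end

lemma yd_iso_sym: "yd_iso B V W f g ==> yd_iso B W V g f"
 by(simp add: yd_iso_def yd_iso_axioms_def)

context yd_iso
begin

interpretation S: yd_iso B W V g f by(rule yd_iso_sym) unfold_locales

abbreviation Fm where "Fm \<equiv> F.Tf"
abbreviation Gm where "Gm \<equiv> G.Tf"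
abbreviation HV where "HV \<equiv> tensor_hopf B V"
abbreviation HW where "HW \<equiv> tensor_hopf B W"

lemma Fm_lhom: "Fm : lhom HV HW" using F.Tf_lhom by simp
lemma Gm_lhom: "Gm : lhom HW HV" using G.Tf_lhom by simp

text \<open>Rewriting the image as a preimage under the inverse is what lets
  \<open>ideal_vimage\<close> apply, since ideals pull back along homomorphisms.\<close>

lemma Fm_image: "N <= car HV ==> Fm ` N = {y : car HW. Gm y : N}"
proof(intro Set.set_eqI iffI)
 fix y assume N: "N <= car HV" and "y : Fm ` N"
 then obtain x where "x : N" "y = Fm x" by auto
 then show "y : {y : car HW. Gm y : N}" using N TgTf[of x] F.Tf_closed[of x] by auto
next
 fix y assume "y : {y : car HW. Gm y : N}"
 then show "y : Fm ` N" using S.TgTf[of y] by(metis (no_types, lifting) image_eqI mem_Collect_eq tensor_hopf_simps(1))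
qed

lemma Fm_surj: "Fm ` car HV = car HW"
 unfolding Fm_image[OF subset_refl] using G.Tf_closed by auto

lemma Fm_grade: "Fm ` grade HV n = grade HW n"
proof -
 have "Fm ` {tword V w | w. w : lists (car V) & length w = n} = {tword W w | w. w : lists (car W) & length w = n}"
 proof(intro Set.set_eqI iffI)
  fix y assume "y : Fm ` {tword V w | w. w : lists (car V) & length w = n}"
  then obtain w where w: "w : lists (car V)" "length w = n" "y = Fm (tword V w)" by blast
  note w = w(1,2) w(3)[unfolded F.Tf_tword[OF w(1)]]
  show "y : {tword W w | w. w : lists (car W) & length w = n}"
   by(rule CollectI, rule exI[of _ "map f w"]) (use w F.map_lists[OF w(1)] in auto)
 next
  fix y assume "y : {tword W w | w. w : lists (car W) & length w = n}"
  then obtain w where w: "w : lists (car W)" "length w = n" "y = tword W w" by auto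
  have "y = Fm (tword V (map g w))" using F.Tf_tword[OF G.map_lists[OF w(1)]] S.map_gf[OF w(1)] w(3) by simp
  then show "y : Fm ` {tword V w | w. w : lists (car V) & length w = n}"
   using G.map_lists[OF w(1)] w(2) by(intro image_eqI[of _ _ "tword V (map g w)"]) auto
 qed
 moreover have "{tword V w | w. w : lists (car V) & length w = n} <= car F.V.T"
  using F.V.Vv by(auto intro!: tword_closed simp del: in_lists_conv_set)
 ultimately show ?thesis unfolding tensor_hopf_simps
  using img_lspan[OF F.Tf_lhom F.V.Tv F.W.Tv] by simp
qed

lemma Fm_mult: "x : car HV ==> y : car HV ==> Fm (x \<otimes>[HV] y) = Fm x \<otimes>[HW] Fm y"
 using F.Tf_mult by simp

lemma Fm_act: "h : car B ==> x : car HV ==> Fm (act HV h x) = act HW h (Fm x)"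
 using F.Tf_ract by simp
lemma Fm_coact: "x : car HV ==> coact HW (Fm x) = tensor_map B HW (%b. b) Fm (coact HV x)"
 using F.BTf_rcoact by(simp add: tensor_map_def)
lemma Fm_comult: "x : car HV ==> bcomult HW (Fm x) = tensor_map HW HW Fm Fm (bcomult HV x)"
 using F.TTf_rcomult by(simp add: tensor_map_def)
lemma Fm_counit: "x : car HV ==> bcounit HW (Fm x) = bcounit HV x"
 using F.Tf_rcounit by simp

lemma Fm_ideal: "ideal I HV ==> ideal (Fm ` I) HW"
 using ideal_vimage[OF F.W.HT_alg F.V.HT_alg Gm_lhom _, of I] G.Tf_mult
  Fm_image[OF subspD(1)[OF ideal_subspace[OF F.V.HT_alg]]] by simp

text \<open>Minimality of generated ideals is used on both sides, once against the image ideal and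
  once against the preimage of the ideal generated by the images.\<close>

lemma Fm_genideal:
 assumes S: "S <= car HV"
 shows "Fm ` (Idl\<^bsub>HV\<^esub> S) = Idl\<^bsub>HW\<^esub> (Fm ` S)"
proof
 note RV = algD(2)[OF F.V.HT_alg] and RW = algD(2)[OF F.W.HT_alg]
 have FS: "Fm ` S <= car HW" using S Fm_surj by auto
 show "Idl\<^bsub>HW\<^esub> (Fm ` S) <= Fm ` (Idl\<^bsub>HV\<^esub> S)"
  by(rule ring.genideal_minimal[OF RW Fm_ideal[OF ring.genideal_ideal[OF RV S]] image_mono[OF ring.genideal_self[OF RV S]]])
 have "ideal {x : car HV. Fm x : Idl\<^bsub>HW\<^esub> (Fm ` S)} HV"
  by(rule ideal_vimage[OF F.V.HT_alg F.W.HT_alg Fm_lhom Fm_mult ring.genideal_ideal[OF RW FS]])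
 moreover have "S <= {x : car HV. Fm x : Idl\<^bsub>HW\<^esub> (Fm ` S)}"
  using S ring.genideal_self[OF RW FS] by auto
 ultimately have "Idl\<^bsub>HV\<^esub> S <= {x : car HV. Fm x : Idl\<^bsub>HW\<^esub> (Fm ` S)}"
  by(rule ring.genideal_minimal[OF RV])
 then show "Fm ` (Idl\<^bsub>HV\<^esub> S) <= Idl\<^bsub>HW\<^esub> (Fm ` S)" by auto
qed

lemma Fm_nichols_ideals:
 assumes J: "J : nichols_ideals B V"
 shows "Fm ` J : nichols_ideals B W"
proof -
 interpret VA: yd_alg B HV by(rule F.V.HT_yd_alg)
 interpret WA: yd_alg B HW by(rule F.W.HT_yd_alg)
 note JC = F.V.NIs_carrier[OF J]
 note Bv = F.V.Bv and Hv = F.V.HTv and Hw = F.W.HTv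
 obtain S where S: "S <= (\<Union>n\<in>{2..}. grade HV n)" "J = Idl\<^bsub>HV\<^esub> S" using F.V.NIsD(1)[OF J] by blast
 show ?thesis
 proof(rule F.W.nichols_idealsI)
  show "Fm ` S <= (\<Union>n\<in>{2..}. grade HW n)" using S(1) Fm_grade by blast
  show "Fm ` J = Idl\<^bsub>HW\<^esub> (Fm ` S)"
   unfolding S(2) by(rule Fm_genideal) (use S(1) F.V.grades_carrier in blast)
 next
  fix h y assume h: "h : car B" and "y : Fm ` J"
  then obtain j where j: "j : J" "y = Fm j" by auto
  then show "act HW h y : Fm ` J"
   using Fm_act[OF h, of j] JC F.V.NIsD(3)[OF J h j(1)] by auto
 next
  fix y assume "y : Fm ` J"
  then obtain j where j: "j : J" "y = Fm j" by auto
  have jc: "j : car HV" using j JC by auto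
  have "tensor_map B HW (%b. b) Fm ` tensor_span B HV (car B) J = tensor_span B HW ((%b. b) ` car B) (Fm ` J)"
   by(rule tmap_span[OF Bv Hv Bv Hw lhom_id Fm_lhom subset_refl JC])
  then show "coact HW y : tensor_span B HW (car B) (Fm ` J)"
   unfolding j(2) Fm_coact[OF jc] using F.V.NIsD(4)[OF J j(1)] by auto
  have 1: "tensor_map HW HW Fm Fm ` tensor_span HV HV J (car HV) = tensor_span HW HW (Fm ` J) (car HW)"
   using tmap_span[OF Hv Hv Hw Hw Fm_lhom Fm_lhom JC subset_refl] unfolding Fm_surj .
  have 2: "tensor_map HW HW Fm Fm ` tensor_span HV HV (car HV) J = tensor_span HW HW (car HW) (Fm ` J)"
   using tmap_span[OF Hv Hv Hw Hw Fm_lhom Fm_lhom subset_refl JC] unfolding Fm_surj .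
  obtain s t where st: "s : tensor_span HV HV J (car HV)" "t : tensor_span HV HV (car HV) J" "bcomult HV j = s \<oplus>[tensor HV HV] t"
   using F.V.NIsD(2)[OF J j(1)] unfolding mem_set_add by blast
  have sR: "s : car (tensor HV HV)" "t : car (tensor HV HV)"
   using st subspD(6)[OF tspan_subsp[OF Hv Hv JC subset_refl]] subspD(6)[OF tspan_subsp[OF Hv Hv subset_refl JC]] by blast+
  show "bcomult HW y : tensor_span HW HW (Fm ` J) (car HW) <+>\<^bsub>tensor HW HW\<^esub> tensor_span HW HW (car HW) (Fm ` J)"
   unfolding j(2) Fm_comult[OF jc] st(3) lhomD(2)[OF tmap_lhom[OF Hv Hv Hw Hw Fm_lhom Fm_lhom] sR] mem_set_add
   using 1 2 st(1,2) by blast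
 qed
qed

text \<open>Every member of \<open>nichols_ideals\<close> is carried to a member, hence their sum
  into the sum. The reverse inclusion comes from the inverse isomorphism.\<close>

lemma Fm_nichols_subset: "Fm ` nichols_ideal B V <= nichols_ideal B W"
proof -
 have "nichols_ideal B V <= {x : car HV. Fm x : nichols_ideal B W}"
  by(rule F.V.NI_least[OF preim_subsp[OF Fm_lhom F.V.HTv F.W.HTv F.W.NI_sub]])
   (use Fm_nichols_ideals F.W.NI_superset F.V.NIs_carrier in blast)
 then show ?thesis by blast
qed

end

lemma (in yd_iso) nichols_pull_push_iso: "pull_push_iso B (nichols B V) (nichols B W)"
proof -
 interpret S: yd_iso B W V g f by(rule yd_iso_sym) unfold_locales
 have NI: "Fm ` nichols_ideal B V = nichols_ideal B W"
 proof
  show "nichols_ideal B W <= Fm ` nichols_ideal B V"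
  proof
   fix y assume y: "y : nichols_ideal B W"
   then have "Gm y : nichols_ideal B V" using S.Fm_nichols_subset by blast
   moreover have "Fm (Gm y) = y" using S.TgTf[of y] y subspD(1)[OF F.W.NI_sub] by auto
   ultimately show "y : Fm ` nichols_ideal B V" by(metis imageI)
  qed
 qed (rule Fm_nichols_subset)
 have inj: "inj_on Fm (car HV)" by(rule inj_on_inverseI[of _ Gm]) (use TgTf in simp)
 have one: "Fm \<one>[HV] = \<one>[HW]" using F.Tf_one by simp
 show ?thesis unfolding nichols_def
  by(rule pull_push_iso_quot[OF F.V.nichols_yd_quot F.W.nichols_yd_quot Fm_lhom inj Fm_surj NI Fm_mult one Fm_act Fm_coact Fm_comult Fm_counit Fm_grade F.V.grade_carrier])
qed

section \<open>Graded modules over a finite group as Yetter-Drinfeld modules\<close>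

lemma finsum_fields_cong:
 assumes "car X = car Y" "add X = add Y" "\<zero>[X] = \<zero>[Y]"
 shows "finsum X f A = finsum Y f A"
 using assms by(simp add: finsum_def finprod_def)

lemma lin_ext_fields_cong:
 assumes "car X = car Y" "add X = add Y" "\<zero>[X] = \<zero>[Y]" "module.smult X = module.smult Y"
 shows "lin_ext X f p = lin_ext Y f p"
 unfolding lin_ext_def using finsum_fields_cong[OF assms(1-3)] assms(4) by simp

lemma group_algebra_simps [simp]:
 "car (group_algebra G) = {p. kys p <= car G}"
 "monoid.mult (group_algebra G) = conv (monoid.mult G)"
 "\<one>[group_algebra G] = sng \<one>[G] 1"
 "\<zero>[group_algebra G] = 0"
 "add (group_algebra G) = (+)"
 "module.smult (group_algebra G) = (%c. pmap ((*) c))"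
 "comult (group_algebra G) = lin_ext (tensor (monoid_algebra G) (monoid_algebra G))
  (%g. pure (monoid_algebra G) (monoid_algebra G) (sng g 1) (sng g 1))"
 "counit (group_algebra G) = lin_ext complex_mod (%g. 1)"
 by(simp_all add: group_algebra_def Let_def module.defs hopf.defs monoid_algebra_def)

lemma group_algebra_tensor:
 "tensor (group_algebra G) X = tensor (monoid_algebra G) X" "tensor X (group_algebra G) = tensor X (monoid_algebra G)"
 "pure (group_algebra G) X = pure (monoid_algebra G) X" "pure X (group_algebra G) = pure X (monoid_algebra G)"
 by(intro tensor_cong; simp add: monoid_algebra_def)+

lemma galg_vs [simp]: "vsp (group_algebra G)"
 by(rule poly_vs) simp_all

lemma group_algebra_assoc_algebra: "monoid G ==> assoc_algebra (group_algebra G)"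
 by(rule assoc_algebra_cong[OF mon_alg]) (simp_all add: monoid_algebra_def)

lemma group_algebra_hopf_pre:
 assumes "monoid G"
 shows "hopf_pre (group_algebra G)"
proof(rule hopf_pre.intro)
 note D = algD[OF group_algebra_assoc_algebra[OF assms]]
 show "vsp (group_algebra G)" by simp
 show "bilin (group_algebra G) (group_algebra G) (group_algebra G) (monoid.mult (group_algebra G))" by(rule D)
 show "\<one>[group_algebra G] : car (group_algebra G)" by(rule D)
 have "lin_ext (tensor (monoid_algebra G) (monoid_algebra G))
  (%g. pure (monoid_algebra G) (monoid_algebra G) (sng g 1) (sng g 1))
  : lhom (free_space (car G)) (tensor (monoid_algebra G) (monoid_algebra G))"
  by(rule lin_ext_lhom) auto
 then show "comult (group_algebra G) : lhom (group_algebra G) (tensor (group_algebra G) (group_algebra G))"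
  by(simp add: group_algebra_tensor module_hom_def)
 have "lin_ext complex_mod (%g. 1) : lhom (free_space (car G)) complex_mod"
  by(rule lin_ext_lhom) auto
 then show "counit (group_algebra G) : lhom (group_algebra G) complex_mod"
  by(simp add: module_hom_def)
qed

lemma lookup_lhom: "(%p. lkp p g) : lhom (group_algebra G) complex_mod"
 by(rule lhomI) (simp_all add: lookup_add)

lemma group_algebra_eqI:
 assumes "f : lhom (group_algebra G) X" "f' : lhom (group_algebra G) X" "vsp X"
  "!!g. g : car G ==> f (sng g 1) = f' (sng g 1)" "p : car (group_algebra G)"
 shows "f p = f' p"
 by(rule lhom_eq_on_free[OF assms(1,2) _ assms(3,4)]) (use assms(5) in auto)

text \<open>For finite \<open>G\<close> the elements \<open>sng g 1\<close> form a basis with dual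
  functionals \<open>lkp _ g\<close>; both sides are linear, so it suffices to look at
  \<open>h \<otimes> w\<close>, where a single summand survives.\<close>

lemma galg_expand:
 assumes W: "vsp W" and fin: "finite (car G)" and t: "t : car (tensor (group_algebra G) W)"
 shows "finsum (tensor (group_algebra G) W)
  (%g. pure (group_algebra G) W (sng g 1) (lslice W (%p. lkp p g) t)) (car G) = t"
proof -
 let ?A = "group_algebra G"
 have A: "vsp ?A" by simp
 note T = tensor_vs[OF A W]
 have sg: "sng g 1 : car ?A" if "g : car G" for g using that by simp
 have F: "(%t. finsum (tensor ?A W) (%g. pure ?A W (sng g 1) (lslice W (%p. lkp p g) t)) (car G))
  : lhom (tensor ?A W) (tensor ?A W)"
  by(rule lhom_finsum[OF fin lhom_comp[OF lslice_lhom[OF A W lookup_lhom] pure_lhomr[OF A W sg]] T])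
 show ?thesis
 proof(rule tensor_eqI[OF A W F lhom_id T t])
  fix v w assume v: "v : car ?A" and w: "w : car W"
  show "finsum (tensor ?A W) (%g. pure ?A W (sng g 1) (lslice W (%p. lkp p g) (pure ?A W v w))) (car G) = pure ?A W v w"
  proof(rule group_algebra_eqI[OF lhom_comp[OF pure_lhoml[OF A W w] F] pure_lhoml[OF A W w] T _ v])
   fix h assume h: "h : car G"
   have "finsum (tensor ?A W) (%g. pure ?A W (sng g 1) (lslice W (%p. lkp p g) (pure ?A W (sng h 1) w))) (car G)
    = pure ?A W (sng h 1) (lslice W (%p. lkp p h) (pure ?A W (sng h 1) w))"
    by(rule fsum_single[OF T fin h])
     (use h w W sg pure_closed[OF A W] in \<open>auto simp: lslice_pure[OF A W lookup_lhom sg[OF h] w] lookup_single pure_zero_right[OF A W]\<close>)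
   then show "finsum (tensor ?A W) (%g. pure ?A W (sng g 1) (lslice W (%p. lkp p g) (pure ?A W (sng h 1) w))) (car G)
    = pure ?A W (sng h 1) w"
    using lslice_pure[OF A W lookup_lhom sg[OF h] w] w W by simp
  qed
 qed
qed

text \<open>Action and coaction of the group algebra rewritten as operators: \<open>sig g\<close> is
  the action of \<open>g\<close>, and \<open>\<pi> g\<close> the part of degree \<open>g\<close>, as
  the coaction is the sum of all \<open>g \<otimes> \<pi> g v\<close>. That these form a
  representation and a grading is demanded in \<open>graded_rep\<close>.\<close>

definition graded_module :: "('g, 'm) monoid_scheme => ('g \<Rightarrow>\<^sub>0 complex, 'v, 'n) yd_scheme => ('g => 'v => 'v) => ('g => 'v => 'v) => bool" where
 "graded_module G V sig \<pi> \<longleftrightarrow> vsp V & (\<forall>g\<in>car G. sig g : lhom V V & \<pi> g : lhom V V) &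
  (\<forall>b\<in>car (group_algebra G). \<forall>v\<in>car V. act V b v = lin_ext V (%g. sig g v) b) &
  (\<forall>v\<in>car V. coact V v = finsum (tensor (group_algebra G) V)
    (%g. pure (group_algebra G) V (sng g 1) (\<pi> g v)) (car G))"

lemma gmodD:
 assumes "graded_module G V sig \<pi>"
 shows "vsp V" "!!g. g : car G ==> sig g : lhom V V" "!!g. g : car G ==> \<pi> g : lhom V V"
  "!!b v. b : car (group_algebra G) ==> v : car V ==> act V b v = lin_ext V (%g. sig g v) b"
  "!!v. v : car V ==> coact V v = finsum (tensor (group_algebra G) V)
    (%g. pure (group_algebra G) V (sng g 1) (\<pi> g v)) (car G)"
 using assms unfolding graded_module_def by blast+

lemma bilin_cong:
 assumes "bilin V W X f" "vsp V" "vsp W" "!!v w. v : car V ==> w : car W ==> g v w = f v w"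
 shows "bilin V W X g"
 by(intro bilinI lhomI) (simp_all add: assms bilinD[OF assms(1)])

lemma gmod_coact_lhom:
 assumes "graded_module G V sig \<pi>" "finite (car G)"
 shows "coact V : lhom V (tensor (group_algebra G) V)"
proof -
 note D = gmodD[OF assms(1)]
 have A: "vsp (group_algebra G)" by simp
 have "(%v. finsum (tensor (group_algebra G) V) (%g. pure (group_algebra G) V (sng g 1) (\<pi> g v)) (car G)) : lhom V (tensor (group_algebra G) V)"
  by(rule lhom_finsum[OF assms(2) lhom_comp[OF D(3) pure_lhomr[OF A D(1)]] tensor_vs[OF A D(1)]]) auto
 then show ?thesis by(rule lhom_cong) (use D in auto)
qed

lemma graded_module_yd_pre:
 assumes V: "graded_module G V sig \<pi>" and fin: "finite (car G)" and G: "monoid G"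
 shows "yd_pre (group_algebra G) V"
proof -
 note D = gmodD[OF V]
 show ?thesis
 proof(rule yd_pre.intro[OF group_algebra_hopf_pre[OF G] yd_pre_axioms.intro])
  show "vsp V" by(rule D)
  show "coact V : lhom V (tensor (group_algebra G) V)" by(rule gmod_coact_lhom[OF V fin])
  have 1: "lin_ext V (%g. sig g v) : lhom (group_algebra G) V" if "v : car V" for v
  proof -
   have "(%g. sig g v) : car G \<rightarrow> car V" using D(2) that by(auto dest: lhomD(1))
   from lin_ext_lhom[OF D(1) this] show ?thesis by(simp add: module_hom_def)
  qed
  have 2: "(%v. lin_ext V (%g. sig g v) b) : lhom V V" if "b : car (group_algebra G)" for b
   unfolding lin_ext_def by(rule lhom_finsum[OF _ lhom_smult]) (use that D in auto)
  show "bilin (group_algebra G) V V (act V)"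
   by(rule bilin_cong[where f="%b v. lin_ext V (%g. sig g v) b"], rule bilinI) (use 1 2 D in auto)
 qed
qed

lemma graded_module_yd_mor:
 assumes V: "graded_module G V sig \<pi>" and W: "graded_module G W sig' \<pi>'" and fin: "finite (car G)" and G: "monoid G"
  and f: "f : lhom V W" and fs: "!!g v. g : car G ==> v : car V ==> f (sig g v) = sig' g (f v)"
  and fp: "!!g v. g : car G ==> v : car V ==> f (\<pi> g v) = \<pi>' g (f v)"
 shows "yd_mor (group_algebra G) V W f"
proof -
 note D = gmodD[OF V] and E = gmodD[OF W]
 have A: "vsp (group_algebra G)" by simp
 interpret V: yd_pre "group_algebra G" V by(rule graded_module_yd_pre[OF V fin G])
 interpret W: yd_pre "group_algebra G" W by(rule graded_module_yd_pre[OF W fin G])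
 show ?thesis
 proof
  show "f : lhom V W" by(rule f)
  fix b v assume b: "b : car (group_algebra G)" and v: "v : car V"
  have k: "kys b <= car G" using b by simp
  have "f (act V b v) = lin_ext W (%g. f (sig g v)) b"
   unfolding D(4)[OF b v] by(rule lhom_lin_ext[OF f D(1) E(1)]) (use D(2) k v in \<open>auto dest!: lhomD(1)\<close>)
  also have "... = lin_ext W (%g. sig' g (f v)) b"
   by(rule lin_ext_cong[OF E(1)]) (use lhomD(1)[OF E(2)] k v fs lhomD(1)[OF f] in \<open>auto simp: subset_iff\<close>)
  finally show "f (act V b v) = act W b (f v)" using E(4)[OF b lhomD(1)[OF f v]] by simp
 next
  fix v assume v: "v : car V"
  let ?T = "tensor_map (group_algebra G) W (%b. b) f"
  have T: "?T : lhom (tensor (group_algebra G) V) (tensor (group_algebra G) W)" by(rule tmap_lhom[OF A D(1) A E(1) lhom_id f])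
  have pc: "\<pi> g v : car V" if "g : car G" for g using D(3)[OF that] v by(auto dest: lhomD(1))
  have pc': "\<pi>' g (f v) : car W" if "g : car G" for g using E(3)[OF that] lhomD(1)[OF f v] by(auto dest: lhomD(1))
  have "?T (coact V v) = finsum (tensor (group_algebra G) W) (%g. ?T (pure (group_algebra G) V (sng g 1) (\<pi> g v))) (car G)"
   unfolding D(5)[OF v]
   by(rule lhom_fsum[OF T tensor_vs[OF A D(1)] tensor_vs[OF A E(1)] fin]) (use pc pure_closed[OF A D(1)] in auto)
  also have "... = finsum (tensor (group_algebra G) W) (%g. pure (group_algebra G) W (sng g 1) (\<pi>' g (f v))) (car G)"
   by(rule fsum_cong[OF tensor_vs[OF A E(1)]])
    (use pc pc' fp v pure_closed[OF A E(1)] in \<open>auto simp: tmap_pure[OF A D(1) A E(1) lhom_id f]\<close>)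
  finally show "coact W (f v) = ?T (coact V v)" using E(5)[OF lhomD(1)[OF f v]] by simp
 qed
qed

text \<open>The inverse \<open>h\<close> is given merely as a set map. Its linearity and its
  compatibilities follow by cancelling \<open>f\<close>, so a caller has to construct only one
  direction.\<close>

lemma graded_module_nichols_iso:
 assumes V: "graded_module G V sig \<pi>" and W: "graded_module G W sig' \<pi>'" and fin: "finite (car G)" and G: "monoid G"
  and f: "f : lhom V W" and fs: "!!g v. g : car G ==> v : car V ==> f (sig g v) = sig' g (f v)"
  and fp: "!!g v. g : car G ==> v : car V ==> f (\<pi> g v) = \<pi>' g (f v)"
  and h: "!!w. w : car W ==> h w : car V" and hf: "!!v. v : car V ==> h (f v) = v"
  and fh: "!!w. w : car W ==> f (h w) = w"
 shows "pull_push_iso (group_algebra G) (nichols (group_algebra G) V) (nichols (group_algebra G) W)"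
proof -
 note D = gmodD[OF V] and E = gmodD[OF W]
 note fD = lhomD[OF f]
 have hl: "h : lhom W V"
 proof(rule lhomI)
  show "h (x \<oplus>[W] y) = h x \<oplus>[V] h y" if xy: "x : car W" "y : car W" for x y
   using hf[OF vs_add[OF D(1) h[OF xy(1)] h[OF xy(2)]]] unfolding fD(2)[OF h[OF xy(1)] h[OF xy(2)]] fh[OF xy(1)] fh[OF xy(2)] .
  show "h (c \<odot>[W] x) = c \<odot>[V] h x" if x: "x : car W" for x c
   using hf[OF vs_smult[OF D(1) h[OF x]]] unfolding fD(3)[OF h[OF x]] fh[OF x] .
 qed (rule h)
 have hs: "h (sig' g w) = sig g (h w)" if "g : car G" "w : car W" for g w
  using hf[OF lhomD(1)[OF D(2)[OF that(1)] h[OF that(2)]]] unfolding fs[OF that(1) h[OF that(2)]] fh[OF that(2)] .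
 have hp: "h (\<pi>' g w) = \<pi> g (h w)" if "g : car G" "w : car W" for g w
  using hf[OF lhomD(1)[OF D(3)[OF that(1)] h[OF that(2)]]] unfolding fp[OF that(1) h[OF that(2)]] fh[OF that(2)] .
 interpret F: yd_mor "group_algebra G" V W f by(rule graded_module_yd_mor[OF V W fin G f]) (simp_all add: fs fp)
 interpret H: yd_mor "group_algebra G" W V h by(rule graded_module_yd_mor[OF W V fin G hl]) (simp_all add: hs hp)
 interpret yd_iso "group_algebra G" V W f h by unfold_locales (use hf fh in auto)
 show ?thesis by(rule nichols_pull_push_iso)
qed

section \<open>Direct sums\<close>

lemma dsum_simps:
 "\<zero>[direct_sum I M] = (\<lambda>i\<in>I. \<zero>[M i])"
 "f \<oplus>[direct_sum I M] g = (\<lambda>i\<in>I. f i \<oplus>[M i] g i)"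
 "c \<odot>[direct_sum I M] f = (\<lambda>i\<in>I. c \<odot>[M i] f i)"
 "car (direct_sum I M) = {f : (\<Pi>\<^sub>E i\<in>I. car (M i)). finite {i : I. f i ~= \<zero>[M i]}}"
 by(simp_all add: direct_sum_def)

lemma dsum_vs:
 assumes M: "!!i. i : I ==> vsp (M i)"
 shows "vsp (direct_sum I M)"
proof(rule vectorspaceI)
 fix x y assume x: "x : car (direct_sum I M)" and y: "y : car (direct_sum I M)"
 have "{i : I. x i \<oplus>[M i] y i ~= \<zero>[M i]} <= {i : I. x i ~= \<zero>[M i]} \<union> {i : I. y i ~= \<zero>[M i]}"
  using M by auto
 then have "finite {i : I. x i \<oplus>[M i] y i ~= \<zero>[M i]}"
  using x y by(auto simp: dsum_simps elim!: finite_subset)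
 moreover have "{i : I. (\<lambda>i\<in>I. x i \<oplus>[M i] y i) i ~= \<zero>[M i]} = {i : I. x i \<oplus>[M i] y i ~= \<zero>[M i]}" by auto
 ultimately show "x \<oplus>[direct_sum I M] y : car (direct_sum I M)" using x y M by(auto simp: dsum_simps PiE_iff)
next
 have "{i : I. (\<lambda>i\<in>I. \<zero>[M i]) i ~= \<zero>[M i]} = {}" by auto
 then show "\<zero>[direct_sum I M] : car (direct_sum I M)" using M by(auto simp: dsum_simps PiE_iff)
next
 fix c x assume x: "x : car (direct_sum I M)"
 have "{i : I. (\<lambda>i\<in>I. c \<odot>[M i] x i) i ~= \<zero>[M i]} <= {i : I. x i ~= \<zero>[M i]}"
  using M by auto
 then have "finite {i : I. (\<lambda>i\<in>I. c \<odot>[M i] x i) i ~= \<zero>[M i]}"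
  by(rule finite_subset) (use x in \<open>simp add: dsum_simps\<close>)
 then show "c \<odot>[direct_sum I M] x : car (direct_sum I M)" using x M by(auto simp: dsum_simps PiE_iff)
qed (use M in \<open>auto simp: dsum_simps PiE_iff vs_assoc vs_comm vs_lcomm vs_smult_l vs_smult_r extensional_def fun_eq_iff restrict_def\<close>)

lemma dsum_fin: "finite I ==> car (direct_sum I M) = (\<Pi>\<^sub>E i\<in>I. car (M i))"
 by(auto simp: dsum_simps)

lemma comp_lhom: "i : I ==> (%f. f i) : lhom (direct_sum I M) (M i)"
 by(rule lhomI) (auto simp: dsum_simps PiE_iff)

lemma dsum_eqI:
 "f : car (direct_sum I M) ==> g : car (direct_sum I M) ==> (!!i. i : I ==> f i = g i) ==> f = g"
 by(auto simp: dsum_simps intro: PiE_ext)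

lemma summand_lhom:
 assumes M: "!!i. i : I ==> vsp (M i)" and i: "i : I"
 shows "summand_in I M i : lhom (M i) (direct_sum I M)"
proof(rule lhomI)
 fix x assume x: "x : car (M i)"
 have "{j : I. summand_in I M i x j ~= \<zero>[M j]} <= {i}" by(auto simp: summand_in_def)
 then show "summand_in I M i x : car (direct_sum I M)"
  using x M finite_subset by(force simp: dsum_simps summand_in_def)
qed (use M i in \<open>auto simp: summand_in_def dsum_simps fun_eq_iff\<close>)

lemma dsum_lhom:
 assumes M: "!!i. i : I ==> vsp (M i)" and I: "finite I" and V: "vsp V"
  and f: "!!i. i : I ==> f i : lhom V (M i)"
 shows "(%v. \<lambda>i\<in>I. f i v) : lhom V (direct_sum I M)"
 by(rule lhomI) (use lhomD[OF f] in \<open>auto simp: dsum_fin[OF I] dsum_simps(1-3) fun_eq_iff\<close>)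

lemma dsum_expand:
 assumes M: "!!i. i : I ==> vsp (M i)" and I: "finite I" and x: "x : car (direct_sum I M)"
 shows "finsum (direct_sum I M) (%i. summand_in I M i (x i)) I = x"
proof(rule dsum_eqI)
 have S: "vsp (direct_sum I M)" by(rule dsum_vs[OF M])
 have s: "summand_in I M i (x i) : car (direct_sum I M)" if "i : I" for i
  by(rule lhomD(1)[OF summand_lhom[OF M that]]) (use lhomD(1)[OF comp_lhom[OF that] x] in auto)
 show "finsum (direct_sum I M) (%i. summand_in I M i (x i)) I : car (direct_sum I M)"
  by(rule fsum_closed[OF S]) (use s in auto)
 fix j assume j: "j : I"
 have "finsum (direct_sum I M) (%i. summand_in I M i (x i)) I j = finsum (M j) (%i. summand_in I M i (x i) j) I"
  by(rule lhom_fsum[OF comp_lhom[OF j] S M[OF j] I]) (use s in auto)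
 also have "... = summand_in I M j (x j) j"
  by(rule fsum_single[OF M[OF j] I j]) (use j lhomD(1)[OF comp_lhom[OF j] x] in \<open>auto simp: summand_in_def\<close>)
 finally show "finsum (direct_sum I M) (%i. summand_in I M i (x i)) I j = x j" using j by(simp add: summand_in_def)
qed (rule x)

lemma yd_dsum_simps:
 "car (yd_direct_sum B I M) = car (direct_sum I M)" "add (yd_direct_sum B I M) = add (direct_sum I M)"
 "\<zero>[yd_direct_sum B I M] = \<zero>[direct_sum I M]" "module.smult (yd_direct_sum B I M) = module.smult (direct_sum I M)"
 "act (yd_direct_sum B I M) = (%b f. \<lambda>i\<in>I. act (M i) b (f i))"
 "coact (yd_direct_sum B I M) = (%f. finsum (tensor B (direct_sum I M))
    (%i. tensor_map B (direct_sum I M) (%b. b) (summand_in I M i) (coact (M i) (f i))) {i : I. f i ~= \<zero>[M i]})"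
 by(simp_all add: yd_direct_sum_def Let_def module.defs yd.defs)

lemma gmod_dsum:
 assumes M: "!!i. i : I ==> graded_module G (M i) (sig i) (\<pi> i)" and I: "finite I" and fin: "finite (car G)"
 shows "graded_module G (yd_direct_sum (group_algebra G) I M) (%g f. \<lambda>i\<in>I. sig i g (f i)) (%g f. \<lambda>i\<in>I. \<pi> i g (f i))"
 unfolding graded_module_def
proof(intro conjI ballI)
 let ?S = "direct_sum I M" and ?Y = "yd_direct_sum (group_algebra G) I M" and ?A = "group_algebra G"
 note MD = gmodD[OF M]
 have A: "vsp ?A" by simp
 have S: "vsp ?S" by(rule dsum_vs[OF MD(1)])
 show "vsp ?Y" by(rule vectorspace_cong[OF S]) (simp_all add: yd_dsum_simps)
 have ph: "(%f. \<lambda>i\<in>I. phi i (f i)) : lhom ?S ?S" if "!!i. i : I ==> phi i : lhom (M i) (M i)" for phi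
  by(rule dsum_lhom[OF MD(1) I S]) (use that in \<open>auto intro: lhom_comp[OF comp_lhom]\<close>)
 have YS: "lhom ?Y ?Y = lhom ?S ?S" by(simp add: module_hom_def yd_dsum_simps)
 show "(%f. \<lambda>i\<in>I. sig i g (f i)) : lhom ?Y ?Y" if "g : car G" for g
  unfolding YS by(rule ph) (use that MD(2) in auto)
 show "(%f. \<lambda>i\<in>I. \<pi> i g (f i)) : lhom ?Y ?Y" if "g : car G" for g
  unfolding YS by(rule ph) (use that MD(3) in auto)
 have TY: "tensor ?A ?Y = tensor ?A ?S" "pure ?A ?Y = pure ?A ?S" by(intro tensor_cong; simp add: yd_dsum_simps)+
 fix f assume "f : car ?Y"
 then have f: "f : car ?S" by(simp add: yd_dsum_simps)
 have fi: "f i : car (M i)" if "i : I" for i using lhomD(1)[OF comp_lhom[OF that] f] .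
 have sc: "sig i g (f i) : car (M i)" if "i : I" "g : car G" for i g using lhomD(1)[OF MD(2) fi] that by blast
 have pc: "\<pi> i g (f i) : car (M i)" if "i : I" "g : car G" for i g using lhomD(1)[OF MD(3) fi] that by blast
 have pS: "(\<lambda>i\<in>I. \<pi> i g (f i)) : car ?S" "(\<lambda>i\<in>I. sig i g (f i)) : car ?S" if "g : car G" for g
  using pc sc that by(auto simp: dsum_fin[OF I])
 {
  fix b assume b: "b : car ?A"
  have k: "kys b <= car G" using b by simp
  have "lin_ext ?Y (%g. \<lambda>i\<in>I. sig i g (f i)) b = lin_ext ?S (%g. \<lambda>i\<in>I. sig i g (f i)) b"
   by(rule lin_ext_fields_cong) (simp_all add: yd_dsum_simps)
  also have "... = act ?Y b f"
  proof(rule dsum_eqI)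
   show "lin_ext ?S (%g. \<lambda>i\<in>I. sig i g (f i)) b : car ?S"
    by(rule lin_ext_closed[OF S _ k]) (use pS in auto)
   have ac: "act (M i) b (f i) = lin_ext (M i) (%g. sig i g (f i)) b" if "i : I" for i by(rule MD(4)[OF that b fi[OF that]])
   show "act ?Y b f : car ?S"
    using ac lin_ext_closed[OF MD(1) _ k] sc by(auto simp: yd_dsum_simps dsum_fin[OF I])
   fix i assume i: "i : I"
   have "lin_ext ?S (%g. \<lambda>i\<in>I. sig i g (f i)) b i = lin_ext (M i) (%g. (\<lambda>i\<in>I. sig i g (f i)) i) b"
    by(rule lhom_lin_ext[OF comp_lhom[OF i] S MD(1)[OF i]]) (use pS k in auto)
   then show "lin_ext ?S (%g. \<lambda>i\<in>I. sig i g (f i)) b i = act ?Y b f i" using i ac by(simp add: yd_dsum_simps)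
  qed
  finally show "act ?Y b f = lin_ext ?Y (%g. \<lambda>i\<in>I. sig i g (f i)) b" by simp
 }
 have AS: "vsp (tensor ?A ?S)" by(rule tensor_vs[OF A S])
 have sg: "sng g 1 : car ?A" if "g : car G" for g using that by simp
 have sl: "summand_in I M i : lhom (M i) ?S" if "i : I" for i by(rule summand_lhom[OF MD(1) that])
 define t where "t i = tensor_map ?A ?S (%b. b) (summand_in I M i) (coact (M i) (f i))" for i
 have tl: "tensor_map ?A ?S (%b. b) (summand_in I M i) : lhom (tensor ?A (M i)) (tensor ?A ?S)" if "i : I" for i
  by(rule tmap_lhom[OF A MD(1) A S lhom_id sl]) (use that in auto)
 have tc: "t i : car (tensor ?A ?S)" if "i : I" for i
  unfolding t_def by(rule lhomD(1)[OF tl[OF that] lhomD(1)[OF gmod_coact_lhom[OF M fin] fi]]) (use that in auto)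
 \<comment> \<open>The coaction of \<open>yd_direct_sum\<close> sums over the support of
   \<open>f\<close> only. Vanishing summands allow the sum to run over all of \<open>I\<close>,
   after which it can be exchanged with the sum over the group.\<close>
 have t0: "t i = \<zero>[tensor ?A ?S]" if i: "i : I" "f i = \<zero>[M i]" for i
  unfolding t_def i(2)
  using lhom_zero[OF gmod_coact_lhom[OF M[OF i(1)] fin] MD(1)[OF i(1)] tensor_vs[OF A MD(1)[OF i(1)]]]
   lhom_zero[OF tl[OF i(1)] tensor_vs[OF A MD(1)[OF i(1)]] AS] by simp
 have ti: "t i = finsum (tensor ?A ?S) (%g. pure ?A ?S (sng g 1) (summand_in I M i (\<pi> i g (f i)))) (car G)" if i: "i : I" for i
 proof -
  have "t i = finsum (tensor ?A ?S) (%g. tensor_map ?A ?S (%b. b) (summand_in I M i) (pure ?A (M i) (sng g 1) (\<pi> i g (f i)))) (car G)"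
   unfolding t_def MD(5)[OF i fi[OF i]]
   by(rule lhom_fsum[OF tl[OF i] tensor_vs[OF A MD(1)[OF i]] AS fin]) (use pc[OF i] sg pure_closed[OF A MD(1)[OF i]] in auto)
  also have "... = finsum (tensor ?A ?S) (%g. pure ?A ?S (sng g 1) (summand_in I M i (\<pi> i g (f i)))) (car G)"
   by(rule fsum_cong[OF AS refl])
    (use pc[OF i] sg lhomD(1)[OF sl[OF i]] pure_closed[OF A S] i in \<open>auto simp: tmap_pure[OF A MD(1)[OF i] A S lhom_id sl[OF i]]\<close>)
  finally show ?thesis .
 qed
 have "coact ?Y f = finsum (tensor ?A ?S) t {i : I. f i ~= \<zero>[M i]}"
  by(simp add: yd_dsum_simps t_def[abs_def])
 also have "... = finsum (tensor ?A ?S) t I"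
  by(rule fsum_mono[OF AS I, symmetric]) (use tc t0 in auto)
 also have "... = finsum (tensor ?A ?S) (%i. finsum (tensor ?A ?S) (%g. pure ?A ?S (sng g 1) (summand_in I M i (\<pi> i g (f i)))) (car G)) I"
  by(rule fsum_cong[OF AS refl]) (use ti tc in auto)
 also have "... = finsum (tensor ?A ?S) (%g. finsum (tensor ?A ?S) (%i. pure ?A ?S (sng g 1) (summand_in I M i (\<pi> i g (f i)))) I) (car G)"
  by(rule vs_finsum_swap[OF AS I fin]) (use pc sg lhomD(1)[OF sl] pure_closed[OF A S] in auto)
 also have "... = finsum (tensor ?A ?S) (%g. pure ?A ?S (sng g 1) (\<lambda>i\<in>I. \<pi> i g (f i))) (car G)"
 proof(rule fsum_cong[OF AS refl])
  show "(%g. pure ?A ?S (sng g 1) (\<lambda>i\<in>I. \<pi> i g (f i))) : car G \<rightarrow> car (tensor ?A ?S)"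
   using pS sg pure_closed[OF A S] by auto
  fix g assume g: "g : car G"
  have "pure ?A ?S (sng g 1) (\<lambda>i\<in>I. \<pi> i g (f i)) =
   pure ?A ?S (sng g 1) (finsum ?S (%i. summand_in I M i ((\<lambda>i\<in>I. \<pi> i g (f i)) i)) I)"
   using dsum_expand[OF MD(1) I pS(1)[OF g]] by simp
  also have "... = finsum (tensor ?A ?S) (%i. pure ?A ?S (sng g 1) (summand_in I M i ((\<lambda>i\<in>I. \<pi> i g (f i)) i))) I"
   by(rule lhom_fsum[OF pure_lhomr[OF A S sg[OF g]] S AS I]) (use pc g lhomD(1)[OF sl] in auto)
  also have "... = finsum (tensor ?A ?S) (%i. pure ?A ?S (sng g 1) (summand_in I M i (\<pi> i g (f i)))) I"
   by(rule fsum_cong[OF AS refl]) (use pc g sg lhomD(1)[OF sl] pure_closed[OF A S] in auto)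
  finally show "finsum (tensor ?A ?S) (%i. pure ?A ?S (sng g 1) (summand_in I M i (\<pi> i g (f i)))) I
   = pure ?A ?S (sng g 1) (\<lambda>i\<in>I. \<pi> i g (f i))" by simp
 qed
 finally show "coact ?Y f = finsum (tensor ?A ?Y) (%g. pure ?A ?Y (sng g 1) (\<lambda>i\<in>I. \<pi> i g (f i))) (car G)"
  unfolding TY by(simp add: finsum_def yd_dsum_simps)
qed

section \<open>Complete reducibility\<close>

lemma img_subsp:
 assumes f: "f : lhom V W" and W: "vsp W" and S: "ssp S V"
 shows "ssp (f ` S) W"
proof -
 note D = subspD[OF S]
 have S': "lspan V S = S" using lspan_least[OF D(5) S subset_refl] lspan_sup[OF D(5,1)] by(rule subset_antisym)
 have fS: "f ` S <= car W" using D(6) lhomD(1)[OF f] by auto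
 have "lspan W (f ` S) = f ` S" using img_lspan[OF f D(5) W D(1)] unfolding S' by simp
 then show ?thesis using lspan_subsp[OF W fS] by simp
qed

lemma mvec_vs [simp]: "vsp (module_vec TYPE(complex) n)"
 by(rule vec_vs)

lemma mat_eqI_mult_vec:
 fixes A B :: "complex mat"
 assumes A: "A : carrier_mat n n" and B: "B : carrier_mat n n" and e: "!!w. w : carrier_vec n ==> A *\<^sub>v w = B *\<^sub>v w"
 shows "A = B"
proof(rule eq_matI)
 fix i j assume ij: "i < dim_row B" "j < dim_col B"
 have c: "(M *\<^sub>v unit_vec n j) $ i = M $$ (i, j)" if "M : carrier_mat n n" for M :: "complex mat"
  using that ij B by(auto simp: scalar_prod_right_unit)
 show "A $$ (i, j) = B $$ (i, j)"
  using c[OF A] c[OF B] e[of "unit_vec n j"] by simp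
qed (use A B in auto)

abbreviation vecs where "vecs n \<equiv> module_vec TYPE(complex) n"

text \<open>The subspace \<open>U\<close> is the direct sum of irreducible representations of \<open>Gam\<close>, with
 inclusions \<open>P i\<close> and projections \<open>Q i\<close>.\<close>

definition decomposes :: "('g, 'n) monoid_scheme => (complex, 'v, 'm) module_scheme => ('g => 'v => 'v) => 'v set =>
 nat => (nat => nat) => (nat => 'g => complex mat) => (nat => complex vec => 'v) => (nat => 'v => complex vec) => bool" where
 "decomposes Gam V A U k n rho P Q \<longleftrightarrow>
  (\<forall>i<k. irreducible_rep Gam (n i) (rho i) & P i : lhom (vecs (n i)) V & Q i : lhom V (vecs (n i)) &
   (\<forall>w\<in>carrier_vec (n i). P i w : U & (\<forall>g\<in>car Gam. A g (P i w) = P i (rho i g *\<^sub>v w)))) &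
  (\<forall>i<k. \<forall>j<k. \<forall>w\<in>carrier_vec (n j). Q i (P j w) = (if i = j then w else 0\<^sub>v (n i))) &
  (\<forall>v\<in>U. finsum V (%i. P i (Q i v)) {..<k} = v)"

lemma decomposesD:
 assumes "decomposes Gam V A U k n rho P Q"
 shows "!!i. i < k ==> irreducible_rep Gam (n i) (rho i)" "!!i. i < k ==> P i : lhom (vecs (n i)) V" "!!i. i < k ==> Q i : lhom V (vecs (n i))"
    "!!i w. i < k ==> w : carrier_vec (n i) ==> P i w : U"
    "!!i w g. i < k ==> w : carrier_vec (n i) ==> g : car Gam ==> A g (P i w) = P i (rho i g *\<^sub>v w)"
    "!!i j w. i < k ==> j < k ==> w : carrier_vec (n j) ==> Q i (P j w) = (if i = j then w else 0\<^sub>v (n i))"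
    "!!v. v : U ==> finsum V (%i. P i (Q i v)) {..<k} = v"
proof -
 note * = assms[unfolded decomposes_def]
 note a = conjunct1[OF *] and b = conjunct1[OF conjunct2[OF *]] and c = conjunct2[OF conjunct2[OF *]]
 show "!!i. i < k ==> irreducible_rep Gam (n i) (rho i)" "!!i. i < k ==> P i : lhom (vecs (n i)) V" "!!i. i < k ==> Q i : lhom V (vecs (n i))"
    "!!i w. i < k ==> w : carrier_vec (n i) ==> P i w : U"
    "!!i w g. i < k ==> w : carrier_vec (n i) ==> g : car Gam ==> A g (P i w) = P i (rho i g *\<^sub>v w)"
  using a by simp_all
 show "!!i j w. i < k ==> j < k ==> w : carrier_vec (n j) ==> Q i (P j w) = (if i = j then w else 0\<^sub>v (n i))"
  using b by blast
 show "!!v. v : U ==> finsum V (%i. P i (Q i v)) {..<k} = v" using c by blast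
qed

context
 fixes V :: "(complex, 'v, 'm) module_scheme"
 assumes V: "vsp V" and fd: "vectorspace.fin_dim CC V"
begin

interpretation vectorspace CC V by(rule V)

lemma lin_indpt_empty: "lin_indpt {}"
 by(auto simp: lin_dep_def)

text \<open>For a subspace this is its dimension, measured inside \<open>V\<close> without turning
  the subspace into a vector space of its own. It is the induction parameter for decompositions and
  bounds the length of the coradical filtration.\<close>

definition li_rank :: "'v set => nat" where
 "li_rank S = Max (card ` {A. A <= S & lin_indpt A})"

text \<open>An independent subset of \<open>S\<close> of largest size stays independent after adding
  a vector of \<open>T\<close> outside \<open>S\<close>, as such a vector is not in its
  span.\<close>

lemma li_rank_strict:
 assumes S: "ssp S V" and T: "ssp T V" and ST: "S <= T" "S ~= T"
 shows "li_rank S < li_rank T"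
proof -
 have fin: "finite (card ` {A. A <= U & lin_indpt A})" if "U <= car V" for U
  by(rule finite_subset[of _ "{..dim}"]) (use li_le_dim(2)[OF fd] that in auto)
 note SC = subspD(1)[OF S] and TC = subspD(1)[OF T]
 have "li_rank S : card ` {A. A <= S & lin_indpt A}"
  unfolding li_rank_def by(rule Max_in[OF fin[OF SC]]) (use lin_indpt_empty in blast)
 then obtain A where A: "A <= S" "lin_indpt A" "li_rank S = card A" by auto
 obtain t where t: "t : T" "t \<notin> S" using ST by auto
 have nsp: "t \<notin> lspan V A" using lspan_least[OF V S A(1)] t by auto
 have tA: "t \<notin> A" using A t by auto
 have "lin_indpt (A \<union> {t})"
  using lin_dep_iff_in_span[of A t] A SC TC t nsp tA by auto
 moreover have "finite A" using li_le_dim(1)[OF fd] A SC by blast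
 ultimately have "li_rank S + 1 : card ` {A. A <= T & lin_indpt A}"
  using A ST(1) t tA by(intro image_eqI[of _ _ "A \<union> {t}"]) auto
 then have "li_rank S + 1 <= li_rank T"
  unfolding li_rank_def[of T] by(rule Max_ge[OF fin[OF TC]])
 then show ?thesis by simp
qed

context
 fixes Gam :: "('g, 'n) monoid_scheme" and A :: "'g => 'v => 'v"
 assumes Gam: "group Gam" and fin: "finite (car Gam)" and Al: "!!g. g : car Gam ==> A g : lhom V V"
  and A1: "!!v. v : car V ==> A \<one>[Gam] v = v"
  and Am: "!!g h v. g : car Gam ==> h : car Gam ==> v : car V ==> A (g \<otimes>[Gam] h) v = A g (A h v)"
begin

interpretation Gam: group Gam by(rule Gam)

text \<open>Maschke's averaging: the sum of all \<open>g E g^-1\<close> commutes with the group,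
  still maps into \<open>S\<close>, and is multiplication by the group order on \<open>S\<close>,
  which is invertible in characteristic zero.\<close>

lemma equivariant_projection:
 assumes S: "ssp S V" and inv: "!!g v. g : car Gam ==> v : S ==> A g v : S"
  and E: "E : lhom V V" and ES: "!!v. v : car V ==> E v : S" and Eid: "!!v. v : S ==> E v = v"
 shows "\<exists>E' \<in> lhom V V. (\<forall>v\<in>car V. E' v : S) & (\<forall>v\<in>S. E' v = v) &
  (\<forall>g\<in>car Gam. \<forall>v\<in>car V. E' (A g v) = A g (E' v))"
proof -
 define N where "N = complex_of_nat (card (car Gam))"
 have N: "N ~= 0" using fin Gam.one_closed by(auto simp: N_def)
 define F where "F v = finsum V (%g. A g (E (A (inv\<^bsub>Gam\<^esub> g) v))) (car Gam)" for v
 have Fg: "(%v. A g (E (A (inv\<^bsub>Gam\<^esub> g) v))) : lhom V V" if "g : car Gam" for g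
  by(rule lhom_comp[OF lhom_comp[OF Al E] Al]) (use that in auto)
 have Fl: "F : lhom V V" unfolding F_def[abs_def] by(rule lhom_finsum[OF fin Fg V])
 have FS: "F v : S" if v: "v : car V" for v
  unfolding F_def by(rule subsp_fsum[OF S fin]) (use inv ES lhomD(1)[OF Al] v in auto)
 have Fid: "F v = N \<odot>[V] v" if v: "v : S" for v
 proof -
  have vc: "v : car V" using subspD(6)[OF S v] .
  have e: "A g (E (A (inv\<^bsub>Gam\<^esub> g) v)) = v" if g: "g : car Gam" for g
  proof -
   have "E (A (inv\<^bsub>Gam\<^esub> g) v) = A (inv\<^bsub>Gam\<^esub> g) v" by(rule Eid[OF inv[OF _ v]]) (use g in simp)
   then show ?thesis using Am[of g "inv\<^bsub>Gam\<^esub> g" v] g vc A1 by simp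
  qed
  have "F v = finsum V (%g. v) (car Gam)"
   unfolding F_def by(rule fsum_cong[OF V refl]) (use e vc in auto)
  moreover have "finsum V (%g. v) X = of_nat (card X) \<odot>[V] v" if "finite X" for X :: "'g set"
   using that
  proof(induction X rule: finite_induct)
   case empty
   then show ?case using V vc by simp
  next
   case (insert x X)
   have "finsum V (%g. v) (insert x X) = v \<oplus>[V] finsum V (%g. v) X"
    by(rule fsum_insert[OF V]) (use insert vc in auto)
   also have "... = (1 + of_nat (card X)) \<odot>[V] v" using insert vs_smult_l[OF V vc, of 1] V vc by simp
   finally show ?case using insert by simp
  qed
  ultimately show ?thesis using fin by(simp add: N_def)
 qed
 have Fe: "F (A h v) = A h (F v)" if h: "h : car Gam" and v: "v : car V" for h v
 proof -
  define k where "k g = A g (E (A (inv\<^bsub>Gam\<^esub> g) (A h v)))" for g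
  have Ahv: "A h v : car V" by(rule lhomD(1)[OF Al[OF h] v])
  have kc: "k g : car V" if "g : car Gam" for g
   unfolding k_def using lhomD(1)[OF Fg[OF that] Ahv] .
  have "A h (F v) = finsum V (%g. A h (A g (E (A (inv\<^bsub>Gam\<^esub> g) v)))) (car Gam)"
   unfolding F_def by(rule lhom_fsum[OF Al[OF h] V V fin]) (use lhomD(1)[OF Fg] v in auto)
  \<comment> \<open>With \<open>k g\<close> the summands of \<open>F (A h v)\<close>, left
    translation by \<open>h\<close> turns the summands of \<open>A h (F v)\<close> into
    these.\<close>
  also have "... = finsum V (%g. k (h \<otimes>[Gam] g)) (car Gam)"
  proof(rule fsum_cong[OF V refl])
   show "(%g. k (h \<otimes>[Gam] g)) : car Gam \<rightarrow> car V" using kc h by auto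
   fix g assume g: "g : car Gam"
   have "A (inv\<^bsub>Gam\<^esub> (h \<otimes>[Gam] g)) (A h v) = A (inv\<^bsub>Gam\<^esub> g) v"
    using Am[of "inv\<^bsub>Gam\<^esub> (h \<otimes>[Gam] g)" h v] g h v by(simp add: Gam.inv_mult_group Gam.m_assoc)
   moreover have "E (A (inv\<^bsub>Gam\<^esub> g) v) : car V" using lhomD(1)[OF E] lhomD(1)[OF Al] g v by auto
   ultimately show "A h (A g (E (A (inv\<^bsub>Gam\<^esub> g) v))) = k (h \<otimes>[Gam] g)"
    unfolding k_def using Am[OF h g] by simp
  qed
  also have "... = finsum V k ((%g. h \<otimes>[Gam] g) ` car Gam)"
   by(rule vs_finsum_reindex[OF V Gam.inj_on_cmult[OF h], symmetric]) (use kc Gam.surj_const_mult[OF h] in auto)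
  also have "... = F (A h v)" unfolding Gam.surj_const_mult[OF h] F_def k_def ..
  finally show ?thesis by simp
 qed
 have Nl: "(%v. (1 / N) \<odot>[V] F v) : lhom V V" by(rule lhom_smult[OF Fl V])
 show ?thesis
 proof(intro bexI[OF _ Nl] conjI ballI)
  fix v assume v: "v : car V"
  show "(1 / N) \<odot>[V] F v : S" using subspD(4)[OF S FS[OF v]] .
  fix h assume h: "h : car Gam"
  show "(1 / N) \<odot>[V] F (A h v) = A h ((1 / N) \<odot>[V] F v)"
   unfolding Fe[OF h v] lhomD(3)[OF Al[OF h] lhomD(1)[OF Fl v]] ..
 next
  fix v assume v: "v : S"
  then show "(1 / N) \<odot>[V] F v = v" using Fid[OF v] N V subspD(6)[OF S v] by simp
 qed
qed

text \<open>Coordinates with respect to a basis \<open>C\<close> of \<open>S\<close> turn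
  \<open>S\<close> into a matrix representation. \<open>P\<close> forms linear combinations of
  \<open>C\<close>; \<open>Q\<close> takes coordinates after an equivariant projection, so that
  \<open>P\<close> after \<open>Q\<close> is equivariant on all of \<open>V\<close> and its kernel
  can serve as a complement.\<close>

lemma irreducible_summand:
 assumes S: "ssp S V" and inv: "!!g v. g : car Gam ==> v : S ==> A g v : S"
  and nz: "S ~= {\<zero>[V]}"
  and irr: "!!W. ssp W V ==> W <= S ==> (!!g v. g : car Gam ==> v : W ==> A g v : W) ==> W = {\<zero>[V]} \<or> W = S"
 shows "\<exists>n rho P Q. irreducible_rep Gam n rho & P : lhom (vecs n) V & Q : lhom V (vecs n) &
  (\<forall>w\<in>carrier_vec n. P w : S & Q (P w) = w & (\<forall>g\<in>car Gam. A g (P w) = P (rho g *\<^sub>v w))) &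
  (\<forall>v\<in>S. P (Q v) = v) & (\<forall>g\<in>car Gam. \<forall>v\<in>car V. P (Q (A g v)) = A g (P (Q v)))"
proof -
 obtain B C d where BC: "dual_basis V B d" "C <= B" "C <= S" "\<forall>v\<in>S. \<forall>b\<in>B - C. d b v = 0"
  using dual_basis_exists[OF V fd lin_indpt_empty _ S] by blast
 note D = dual_basisD[OF BC(1)]
 have finC: "finite C" using BC(2) D(1) finite_subset by auto
 have dl: "d c : lhom V complex_mod" if "c : C" for c using D(3) BC(2) that by auto
 have CV: "!!c. c : C ==> c : car V" using BC(2) D(6) by auto
 define E where "E v = finsum V (%c. d c v \<odot>[V] c) C" for v
 have sm: "(%v. d c v \<odot>[V] c) : lhom V V" if "c : C" for c
  using lhomD[OF dl[OF that]] CV[OF that] V by(auto intro!: lhomI simp: vs_smult_l)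
 have El: "E : lhom V V" unfolding E_def[abs_def] by(rule lhom_finsum[OF finC sm V])
 have ES: "E v : S" for v
  unfolding E_def by(rule subsp_fsum[OF S finC]) (use subspD(4)[OF S] BC(3) in auto)
 have Eid: "E v = v" if v: "v : S" for v
 proof -
  have "finsum V (%b. d b v \<odot>[V] b) B = finsum V (%b. d b v \<odot>[V] b) C"
   by(rule fsum_mono[OF V D(1) BC(2)]) (use v BC(4) V D(6) CV in auto)
  then show ?thesis using D(5)[OF subspD(6)[OF S v]] by(simp add: E_def)
 qed
 obtain E' where E': "E' : lhom V V" "!!v. v : car V ==> E' v : S" "!!v. v : S ==> E' v = v"
  "!!g v. g : car Gam ==> v : car V ==> E' (A g v) = A g (E' v)"
  using equivariant_projection[OF S inv El ES Eid] by blast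
 define n where "n = card C"
 obtain c where c: "bij_betw c {..<n} C" using ex_bij_betw_nat_finite[OF finC] by(auto simp: n_def atLeast0LessThan)
 have cC: "c k : C" if "k < n" for k using c that by(auto simp: bij_betw_def)
 have dc: "d (c k) (c l) = (if k = l then 1 else 0)" if "k < n" "l < n" for k l
 proof -
  have "c k = c l \<longleftrightarrow> k = l" using c that by(auto simp: bij_betw_def inj_on_def)
  moreover have "c k : B" "c l : B" using cC[OF that(1)] cC[OF that(2)] BC(2) by auto
  ultimately show ?thesis using D(4)[of "c k" "c l"] by simp
 qed
 define P where "P w = finsum V (%k. w $ k \<odot>[V] c k) {..<n}" for w
 define Co where "Co v = vec n (%k. d (c k) v)" for v
 have Pl: "P : lhom (vecs n) V"
  unfolding P_def[abs_def]
 proof(rule lhom_finsum[OF _ _ V])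
  fix k assume "k : {..<n}"
  then show "(%w. w $ k \<odot>[V] c k) : lhom (vecs n) V"
   using cC CV V by(auto intro!: lhomI simp: module_vec_simps vs_smult_l)
 qed simp
 have Col: "Co : lhom V (vecs n)"
  by(rule lhomI) (use lhomD[OF dl[OF cC]] in \<open>auto simp: Co_def module_vec_simps\<close>)
 have PS: "P w : S" for w
  unfolding P_def by(rule subsp_fsum[OF S]) (use subspD(4)[OF S] BC(3) cC in auto)
 have CoP: "Co (P w) = w" if w: "w : carrier_vec n" for w
 proof(rule eq_vecI)
  fix k assume "k < dim_vec w"
  then have k: "k < n" using w by simp
  have "d (c k) (P w) = finsum complex_mod (%l. d (c k) (w $ l \<odot>[V] c l)) {..<n}"
   unfolding P_def by(rule lhom_fsum[OF dl[OF cC[OF k]] V]) (use cC CV V in auto)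
  also have "... = (\<Sum>l<n. w $ l * (if k = l then 1 else 0))"
   using lhomD(3)[OF dl[OF cC[OF k]] CV[OF cC]] dc k by(auto intro!: sum.cong)
  also have "... = w $ k" using k by(simp add: if_distrib cong: if_cong)
  finally show "Co (P w) $ k = w $ k" using k by(simp add: Co_def)
 qed (use w in \<open>simp add: Co_def\<close>)
 have PCo: "P (Co v) = v" if v: "v : S" for v
 proof -
  have "P (Co v) = finsum V (%k. d (c k) v \<odot>[V] c k) {..<n}"
   unfolding P_def by(rule fsum_cong[OF V refl]) (use cC CV V in \<open>auto simp: Co_def\<close>)
  also have "... = E v"
   using vs_finsum_reindex[OF V, of c "{..<n}" "%x. d x v \<odot>[V] x"] c CV V by(auto simp: bij_betw_def E_def)
  finally show ?thesis using Eid[OF v] by simp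
 qed
 define Q where "Q v = Co (E' v)" for v
 have Ql: "Q : lhom V (vecs n)" unfolding Q_def[abs_def] by(rule lhom_comp[OF E'(1) Col])
 define rho where "rho g = mat n n (%(k, l). d (c k) (A g (c l)))" for g
 have rc: "rho g : carrier_mat n n" for g by(simp add: rho_def)
 have SV: "v : S ==> v : car V" for v using subspD(6)[OF S] .
 have rCo: "rho g *\<^sub>v w = Co (A g (P w))" if g: "g : car Gam" and w: "w : carrier_vec n" for g w
 proof(rule eq_vecI)
  fix k assume "k < dim_vec (Co (A g (P w)))"
  then have k: "k < n" by(simp add: Co_def)
  have "d (c k) (A g (P w)) = finsum complex_mod (%l. d (c k) (A g (w $ l \<odot>[V] c l))) {..<n}"
   unfolding P_def by(rule lhom_fsum[OF lhom_comp[OF Al[OF g] dl[OF cC[OF k]]] V]) (use cC CV V in auto)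
  also have "... = (\<Sum>l<n. d (c k) (A g (c l)) * w $ l)"
   using lhomD(3)[OF lhom_comp[OF Al[OF g] dl[OF cC[OF k]]] CV[OF cC]] by(auto intro!: sum.cong)
  also have "... = (rho g *\<^sub>v w) $ k"
   using k w by(auto simp: rho_def scalar_prod_def atLeast0LessThan intro!: sum.cong)
  finally show "(rho g *\<^sub>v w) $ k = Co (A g (P w)) $ k" using k by(simp add: Co_def)
 qed (simp add: Co_def rho_def)
 have Pr: "A g (P w) = P (rho g *\<^sub>v w)" if "g : car Gam" "w : carrier_vec n" for g w
  using rCo[OF that] PCo[OF inv[OF that(1) PS]] by simp
 have n0: "n ~= 0"
 proof
  assume "n = 0"
  then have "P w = \<zero>[V]" for w using V by(simp add: P_def)
  then have "S <= {\<zero>[V]}" using PCo by(metis singletonI subsetI)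
  then show False using nz subspD(2)[OF S] by auto
 qed
 have irrep: "irreducible_rep Gam n rho"
  unfolding irreducible_rep_def matrix_rep_def
 proof(intro conjI ballI allI impI n0)
  show "rho g : carrier_mat n n" for g by(rule rc)
  show "rho \<one>[Gam] = 1\<^sub>m n"
   by(rule mat_eqI_mult_vec[OF rc]) (use rCo[OF Gam.one_closed] A1[OF SV[OF PS]] CoP in auto)
  fix g h assume g: "g : car Gam" and h: "h : car Gam"
  show "rho (g \<otimes>[Gam] h) = rho g * rho h"
  proof(rule mat_eqI_mult_vec[OF rc mult_carrier_mat[OF rc rc]])
   fix w :: "complex vec" assume w: "w : carrier_vec n"
   have hw: "rho h *\<^sub>v w : carrier_vec n" by(rule mult_mat_vec_carrier[OF rc w])
   have "rho g * rho h *\<^sub>v w = rho g *\<^sub>v (rho h *\<^sub>v w)" by(rule assoc_mult_mat_vec[OF rc rc w])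
   also have "... = Co (A g (A h (P w)))" using rCo[OF g hw] Pr[OF h w] by simp
   also have "... = rho (g \<otimes>[Gam] h) *\<^sub>v w" using rCo[OF _ w] Am[OF g h SV[OF PS]] g h by simp
   finally show "rho (g \<otimes>[Gam] h) *\<^sub>v w = rho g * rho h *\<^sub>v w" by simp
  qed
 next
  fix W assume W: "ssp W (vecs n) & (\<forall>g\<in>car Gam. \<forall>w\<in>W. rho g *\<^sub>v w : W)"
  have Wc: "w : carrier_vec n" if "w : W" for w using subspD(6)[of W "vecs n"] W that by(simp add: module_vec_simps)
  have PW: "ssp (P ` W) V" by(rule img_subsp[OF Pl V]) (use W in simp)
  \<comment> \<open>Invariant subspaces of coordinate vectors correspond under \<open>P\<close> to
    invariant subspaces of \<open>S\<close>, of which \<open>irr\<close> leaves only two.\<close>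
  have "P ` W = {\<zero>[V]} \<or> P ` W = S"
  proof(rule irr[OF PW])
   show "P ` W <= S" using PS by auto
   fix g v assume "g : car Gam" "v : P ` W"
   then show "A g v : P ` W" using Pr Wc W by auto
  qed
  moreover have CoW: "Co ` (P ` W) = W" using CoP Wc by(force simp: image_image)
  moreover have "Co ` S = carrier_vec n"
  proof
   show "Co ` S <= carrier_vec n" by(auto simp: Co_def)
   show "carrier_vec n <= Co ` S" using CoP PS by(metis imageI subsetI)
  qed
  moreover have "Co \<zero>[V] = 0\<^sub>v n" using lhom_zero[OF Col V] by(simp add: module_vec_simps)
  ultimately show "W = {0\<^sub>v n} \<or> W = carrier_vec n" by auto
 qed
 have PQ: "P (Q v) = E' v" if "v : car V" for v using PCo[OF E'(2)[OF that]] by(simp add: Q_def)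
 show ?thesis
 proof(intro exI conjI ballI)
  show "irreducible_rep Gam n rho" by(rule irrep)
  show "P : lhom (vecs n) V" by(rule Pl)
  show "Q : lhom V (vecs n)" by(rule Ql)
  show "P w : S" for w by(rule PS)
  show "Q (P w) = w" if "w : carrier_vec n" for w using CoP[OF that] E'(3)[OF PS] by(simp add: Q_def)
  show "A g (P w) = P (rho g *\<^sub>v w)" if "w : carrier_vec n" "g : car Gam" for g w using Pr that by blast
  show "P (Q v) = v" if "v : S" for v using PQ E'(3) SV that by simp
  show "P (Q (A g v)) = A g (P (Q v))" if "g : car Gam" "v : car V" for g v
   using PQ E'(4)[OF that] lhomD(1)[OF Al[OF that(1)] that(2)] that by simp
 qed
qed

text \<open>A nonzero invariant subspace \<open>S\<close> of least rank is irreducible, and the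
  kernel in \<open>U\<close> of the equivariant projection onto \<open>S\<close> is an invariant
  complement of smaller rank, to which induction applies.\<close>

theorem complete_reducibility:
 assumes "ssp U V" "!!g v. g : car Gam ==> v : U ==> A g v : U"
 shows "\<exists>k n rho P Q. decomposes Gam V A U k n rho P Q"
 using assms
proof(induction "li_rank U" arbitrary: U rule: less_induct)
 case less
 note U = less.prems(1) and inv = less.prems(2)
 show ?case
 proof(cases "U = {\<zero>[V]}")
  case True
  then have "decomposes Gam V A U 0 undefined undefined undefined undefined"
   using V by(simp add: decomposes_def)
  then show ?thesis by blast
 next
  case False
  define pr where "pr W \<longleftrightarrow> ssp W V & W <= U & W ~= {\<zero>[V]} & (\<forall>g\<in>car Gam. \<forall>v\<in>W. A g v : W)" for W
  have "pr U" using U inv False by(auto simp: pr_def)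
  from ex_has_least_nat[of pr U li_rank, OF this] obtain S where S: "pr S" "!!W. pr W ==> li_rank S <= li_rank W" by blast
  have Ss: "ssp S V" "S <= U" "S ~= {\<zero>[V]}" "!!g v. g : car Gam ==> v : S ==> A g v : S"
   using S(1) by(auto simp: pr_def)
  have irr: "W = {\<zero>[V]} \<or> W = S" if W: "ssp W V" "W <= S" "!!g v. g : car Gam ==> v : W ==> A g v : W" for W
  proof(rule ccontr)
   assume *: "\<not> (W = {\<zero>[V]} \<or> W = S)"
   then have "pr W" using W Ss(2) by(auto simp: pr_def)
   then have "li_rank S <= li_rank W" by(rule S(2))
   moreover have "li_rank W < li_rank S" by(rule li_rank_strict[OF W(1) Ss(1) W(2)]) (use * in auto)
   ultimately show False by simp
  qed
  obtain n0 rho0 P0 Q0 where 0: "irreducible_rep Gam n0 rho0" "P0 : lhom (vecs n0) V" "Q0 : lhom V (vecs n0)"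
   "!!w. w : carrier_vec n0 ==> P0 w : S" "!!w. w : carrier_vec n0 ==> Q0 (P0 w) = w"
   "!!w g. w : carrier_vec n0 ==> g : car Gam ==> A g (P0 w) = P0 (rho0 g *\<^sub>v w)"
   "!!v. v : S ==> P0 (Q0 v) = v" "!!g v. g : car Gam ==> v : car V ==> P0 (Q0 (A g v)) = A g (P0 (Q0 v))"
   using irreducible_summand[OF Ss(1) Ss(4) Ss(3) irr] by blast
  define E where "E v = P0 (Q0 v)" for v
  have El: "E : lhom V V" unfolding E_def[abs_def] by(rule lhom_comp[OF 0(3) 0(2)])
  have Qc: "Q0 v : carrier_vec n0" if "v : car V" for v using lhomD(1)[OF 0(3) that] by(simp add: module_vec_simps)
  have ES: "E v : S" if "v : car V" for v unfolding E_def by(rule 0(4)[OF Qc[OF that]])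
  have UV: "!!v. v : U ==> v : car V" using subspD(6)[OF U] .
  have SV: "!!v. v : S ==> v : car V" using Ss(2) UV by auto
  define U' where "U' = U \<inter> {v : car V. E v = \<zero>[V]}"
  have U's: "ssp U' V" unfolding U'_def by(rule subspace_Int[OF U ker_subsp[OF El V V]])
  have U'i: "A g v : U'" if "g : car Gam" "v : U'" for g v
   using that inv[of g v] UV lhom_zero[OF Al[OF that(1)] V V] lhomD(1)[OF Al[OF that(1)]] 0(8)[of g v]
   by(auto simp: U'_def E_def)
  obtain s where s: "s : S" "s ~= \<zero>[V]" using Ss(3) subspD(2)[OF Ss(1)] by auto
  have "s \<notin> U'" using s 0(7)[OF s(1)] by(auto simp: U'_def E_def)
  then have "li_rank U' < li_rank U"
   by(intro li_rank_strict[OF U's U]) (use s Ss(2) in \<open>auto simp: U'_def\<close>)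
  from less.hyps[OF this U's U'i] obtain k n rho P Q where dec: "decomposes Gam V A U' k n rho P Q" by blast
  note k = decomposesD[OF dec]
  \<comment> \<open>The complementary projection \<open>id - E\<close>. Composing the old
    \<open>Q i\<close> with it makes them vanish on \<open>S\<close>, as the orthogonality relations
    between the old summands and the new one require.\<close>
  define R where "R v = v \<oplus>[V] (-1) \<odot>[V] E v" for v
  have Rl: "R : lhom V V" unfolding R_def[abs_def] by(rule lhom_add[OF lhom_id lhom_smult[OF El V] V])
  have EE: "E (E v) = E v" if "v : car V" for v using 0(7)[OF ES[OF that]] by(simp add: E_def)
  have RU: "R v : U'" if v: "v : U" for v
  proof -
   have vc: "v : car V" using UV[OF v] .
   have Ec: "E v : car V" by(rule lhomD(1)[OF El vc])
   have "R v : U" unfolding R_def using subspD(3,4)[OF U] v ES[OF vc] Ss(2) by blast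
   moreover have "E (R v) = \<zero>[V]"
    unfolding R_def lhomD(2)[OF El vc vs_smult[OF V Ec]] lhomD(3)[OF El Ec] EE[OF vc] by(rule vs_add_neg[OF V Ec])
   ultimately show ?thesis using UV by(auto simp: U'_def)
  qed
  have RU': "R v = v" if "v : U'" for v using that V by(auto simp: U'_def R_def)
  have RS: "R v = \<zero>[V]" if "v : S" for v using 0(7)[OF that] SV[OF that] V by(simp add: R_def E_def)
  define n' rho' P' Q' where "n' = n(k := n0)" and "rho' = rho(k := rho0)" and "P' = P(k := P0)"
   and "Q' = (%i. if i = k then Q0 else (%v. Q i (R v)))"
  note df = n'_def rho'_def P'_def Q'_def
  \<comment> \<open>\<open>Q0\<close> factors through the projection,
    \<open>Q0 (E v) = Q0 v\<close>, and \<open>E\<close> is zero on \<open>U'\<close>.\<close>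
  have Q0z: "Q0 v = 0\<^sub>v n0" if v: "v : U'" for v
  proof -
   have vc: "v : car V" using v by(simp add: U'_def)
   have "Q0 (E v) = Q0 v" unfolding E_def by(rule 0(5)[OF Qc[OF vc]])
   then show ?thesis using v lhom_zero[OF 0(3) V] by(simp add: U'_def module_vec_simps)
  qed
  have "finsum V (%i. P' i (Q' i v)) {..<Suc k} = v" if v: "v : U" for v
  proof -
   have vc: "v : car V" using UV[OF v] .
   have t: "P i (Q i x) : car V" if "i < k" "x : car V" for i x
    using lhomD(1)[OF k(2)] lhomD(1)[OF k(3)] that by(auto simp: module_vec_simps)
   have "finsum V (%i. P' i (Q' i v)) {..<k} = finsum V (%i. P i (Q i (R v))) {..<k}"
    by(rule fsum_cong[OF V refl]) (use t lhomD(1)[OF Rl vc] in \<open>auto simp: df\<close>)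
   also have "... = R v" by(rule k(7)[OF RU[OF v]])
   finally have 1: "finsum V (%i. P' i (Q' i v)) {..<k} = R v" .
   have "finsum V (%i. P' i (Q' i v)) (insert k {..<k}) = P' k (Q' k v) \<oplus>[V] finsum V (%i. P' i (Q' i v)) {..<k}"
    by(rule fsum_insert[OF V]) (use t lhomD(1)[OF Rl vc] lhomD(1)[OF El vc] in \<open>auto simp: df E_def\<close>)
   also have "... = E v \<oplus>[V] R v" using 1 by(simp add: df E_def)
   also have "... = v" unfolding R_def by(rule vs_add_diff[OF V vc lhomD(1)[OF El vc]])
   finally show ?thesis by(simp add: lessThan_Suc)
  qed
  moreover have "Q' i (P' j w) = (if i = j then w else 0\<^sub>v (n' i))"
   if ij: "i < Suc k" "j < Suc k" and w: "w : carrier_vec (n' j)" for i j w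
  proof -
   consider "i = k" "j = k" | "i = k" "j < k" | "i < k" "j = k" | "i < k" "j < k" using ij by linarith
   then show ?thesis
   proof cases
    case 1
    then show ?thesis using w 0(5) by(simp add: df)
   next
    case 2
    then show ?thesis using w Q0z[OF k(4)] by(simp add: df)
   next
    case 3
    then show ?thesis using w RS[OF 0(4)] lhom_zero[OF k(3) V] by(simp add: df module_vec_simps)
   next
    case 4
    then show ?thesis using w RU'[OF k(4)] k(6) by(simp add: df)
   qed
  qed
  moreover have "irreducible_rep Gam (n' i) (rho' i) & P' i : lhom (vecs (n' i)) V & Q' i : lhom V (vecs (n' i)) &
   (\<forall>w\<in>carrier_vec (n' i). P' i w : U & (\<forall>g\<in>car Gam. A g (P' i w) = P' i (rho' i g *\<^sub>v w)))" if i: "i < Suc k" for i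
  proof(cases "i = k")
   case True
   then show ?thesis using 0(1,2,3,4,6) Ss(2) by(auto simp: df)
  next
   case False
   then have "i < k" using i by simp
   then show ?thesis using k(1,2,4,5)[of i] lhom_comp[OF Rl k(3)[of i]] False by(auto simp: df U'_def)
  qed
  ultimately show ?thesis by(intro exI[of _ "Suc k"] exI[of _ n'] exI[of _ rho'] exI[of _ P'] exI[of _ Q']) (simp add: decomposes_def)
 qed
qed

end
end

section \<open>Decomposition of graded modules\<close>

context group
begin

abbreviation cj where "cj g s \<equiv> g \<otimes> s \<otimes> inv g"

lemma cj_cj: "a : car G ==> b : car G ==> s : car G ==> cj a (cj b s) = cj (a \<otimes> b) s"
 by(simp add: m_assoc inv_mult_group)

lemma cj_inv: "a : car G ==> s : car G ==> cj (inv a) (cj a s) = s"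
 by(simp only: cj_cj[OF inv_closed] l_inv) simp

lemma cj_inv': "a : car G ==> s : car G ==> cj a (cj (inv a) s) = s"
 by(simp only: cj_cj[OF _ inv_closed] r_inv) simp

lemma mem_conj_class: "t : conj_class G s \<longleftrightarrow> (\<exists>g\<in>car G. t = cj g s)"
 by(auto simp: conj_class_def)

lemma conj_class_carrier: "s : car G ==> t : conj_class G s ==> t : car G"
 by(auto simp: mem_conj_class)

lemma conj_class_self: "s : car G ==> s : conj_class G s"
 by(auto simp: mem_conj_class intro!: bexI[of _ "\<one>"])

lemma conj_class_cj: "s : car G ==> t : conj_class G s ==> h : car G ==> cj h t : conj_class G s"
 by(auto simp: mem_conj_class cj_cj)

lemma conj_class_eq:
 assumes s: "s : car G" and t: "t : conj_class G s"
 shows "conj_class G t = conj_class G s"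
proof -
 obtain g where g: "g : car G" "t = cj g s" using t by(auto simp: mem_conj_class)
 have tc: "t : car G" using g s by simp
 have st: "s = cj (inv g) t" using g s cj_inv by simp
 show ?thesis
 proof
  show "conj_class G t <= conj_class G s" using conj_class_cj[OF s t] by(auto simp: mem_conj_class[of _ t])
  have "s : conj_class G t" unfolding mem_conj_class using st inv_closed[OF g(1)] by blast
  then show "conj_class G s <= conj_class G t" using conj_class_cj[OF tc] by(auto simp: mem_conj_class[of _ s])
 qed
qed

lemma conj_rep:
 assumes "t : conj_class G s"
 shows "conj_rep G s t : car G" "cj (conj_rep G s t) s = t"
proof -
 have "\<exists>g. g : car G & cj g s = t" using assms by(auto simp: mem_conj_class)
 from someI_ex[OF this] show "conj_rep G s t : car G" "cj (conj_rep G s t) s = t"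
  by(auto simp: conj_rep_def)
qed

lemma centralizer_iff: "s : car G ==> g : centralizer G s \<longleftrightarrow> g : car G & cj g s = s"
 unfolding centralizer_def by(auto simp: inv_solve_right')

lemma centralizer_group:
 assumes s: "s : car G"
 shows "group (G\<lparr>carrier := centralizer G s\<rparr>)"
proof -
 have "subgroup (centralizer G s) G"
 proof(rule subgroupI)
  show "centralizer G s ~= {}" using s centralizer_iff[OF s, of \<one>] by auto
  fix a assume a: "a : centralizer G s"
  then show "inv a : centralizer G s" using cj_inv[of a s] s by(auto simp: centralizer_iff)
  fix b assume b: "b : centralizer G s"
  show "a \<otimes> b : centralizer G s" using a b s cj_cj[of a b s] by(simp add: centralizer_iff)
 qed (auto simp: centralizer_def)
 then show ?thesis by(rule subgroup.subgroup_is_group) (rule is_group)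
qed

text \<open>Write \<open>g_t\<close> for the chosen representative. Both \<open>h g_t'\<close> and
  \<open>g_t\<close> conjugate \<open>s\<close> to \<open>t\<close>, so they differ by an element of
  the centralizer: the cocycle of the induced representation.\<close>

lemma crep_centralizer:
 assumes s: "s : car G" and t: "t : conj_class G s" and h: "h : car G" and t': "t' = inv h \<otimes> t \<otimes> h"
 shows "t' : conj_class G s" "inv (conj_rep G s t) \<otimes> h \<otimes> conj_rep G s t' : centralizer G s"
proof -
 have tc: "t : car G" by(rule conj_class_carrier[OF s t])
 have t'c: "t' = cj (inv h) t" using h by(simp add: t')
 show t'C: "t' : conj_class G s" unfolding t'c by(rule conj_class_cj[OF s t inv_closed[OF h]])
 note r = conj_rep[OF t] and r' = conj_rep[OF t'C]
 have "cj (inv (conj_rep G s t) \<otimes> h \<otimes> conj_rep G s t') s = cj (inv (conj_rep G s t) \<otimes> h) (cj (conj_rep G s t') s)"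
  by(rule cj_cj[symmetric]) (use r r' h s conj_class_carrier[OF s t'C] in auto)
 also have "... = cj (inv (conj_rep G s t)) (cj h (cj (conj_rep G s t') s))"
  by(rule cj_cj[symmetric]) (use r r' h s conj_class_carrier[OF s t'C] in auto)
 also have "... = s" unfolding r'(2) unfolding t'c cj_inv'[OF h tc] using cj_inv[OF r(1) s] r(2) by simp
 finally show "inv (conj_rep G s t) \<otimes> h \<otimes> conj_rep G s t' : centralizer G s"
  using r r' h s by(simp add: centralizer_iff)
qed

end

lemma syd_simps:
 "car (simple_yd G s n rho) = car (direct_sum (conj_class G s) (%t. vecs n))"
 "add (simple_yd G s n rho) = add (direct_sum (conj_class G s) (%t. vecs n))"
 "\<zero>[simple_yd G s n rho] = \<zero>[direct_sum (conj_class G s) (%t. vecs n)]"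
 "module.smult (simple_yd G s n rho) = module.smult (direct_sum (conj_class G s) (%t. vecs n))"
 by(simp_all add: simple_yd_def Let_def module.defs yd.defs)

text \<open>The operator \<open>sig h\<close> of the induced module. Together with
  \<open>simple_proj\<close> it splits the structure of \<open>simple_yd\<close> into a
  representation and a grading.\<close>

definition simple_act :: "('g, 'm) monoid_scheme => 'g => ('g => complex mat) => 'g => ('g => complex vec) => ('g => complex vec)" where
 "simple_act G s rho h f = (\<lambda>t\<in>conj_class G s.
  rho (inv\<^bsub>G\<^esub> (conj_rep G s t) \<otimes>[G] h \<otimes>[G] conj_rep G s (inv\<^bsub>G\<^esub> h \<otimes>[G] t \<otimes>[G] h)) *\<^sub>v f (inv\<^bsub>G\<^esub> h \<otimes>[G] t \<otimes>[G] h))"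

definition simple_proj :: "('g, 'm) monoid_scheme => 'g => nat => 'g => ('g => complex vec) => ('g => complex vec)" where
 "simple_proj G s n g f = (\<lambda>t\<in>conj_class G s. if t = g then f t else 0\<^sub>v n)"

lemma simple_yd_act_coact:
 "act (simple_yd G s n rho) = (%b f. lin_ext (direct_sum (conj_class G s) (%t. vecs n)) (%h. simple_act G s rho h f) b)"
 "coact (simple_yd G s n rho) = (%f. finsum (tensor (group_algebra G) (direct_sum (conj_class G s) (%t. vecs n)))
  (%t. pure (group_algebra G) (direct_sum (conj_class G s) (%t. vecs n)) (sng t 1)
   (summand_in (conj_class G s) (%t. vecs n) t (f t))) (conj_class G s))"
 by(simp_all add: simple_yd_def Let_def module.defs yd.defs simple_act_def)

lemma simple_yd_graded:
 assumes G: "group G" and fin: "finite (car G)" and s: "s : car G"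
  and rho: "matrix_rep (G\<lparr>carrier := centralizer G s\<rparr>) n rho"
 shows "graded_module G (simple_yd G s n rho) (simple_act G s rho) (simple_proj G s n)"
proof -
 interpret group G by(rule G)
 let ?C = "conj_class G s" let ?S = "direct_sum ?C (%t. vecs n)" and ?Y = "simple_yd G s n rho" and ?A = "group_algebra G"
 have A: "vsp ?A" by simp
 have CG: "?C <= car G" using conj_class_carrier[OF s] by auto
 have finC: "finite ?C" using finite_subset[OF CG fin] .
 have S: "vsp ?S" by(rule dsum_vs) simp
 have Sc: "car ?S = (\<Pi>\<^sub>E t\<in>?C. carrier_vec n)" using dsum_fin[OF finC, of "%t. vecs n"] by(simp add: module_vec_simps)
 have Y: "vsp ?Y" by(rule vectorspace_cong[OF S]) (simp_all add: syd_simps)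
 have YS: "lhom ?Y ?Y = lhom ?S ?S" by(simp add: module_hom_def syd_simps)
 have TY: "tensor ?A ?Y = tensor ?A ?S" "pure ?A ?Y = pure ?A ?S" by(intro tensor_cong; simp add: syd_simps)+
 have rc: "rho g : carrier_mat n n" if "g : centralizer G s" for g using rho that by(simp add: matrix_rep_def)
 have al: "simple_act G s rho h : lhom ?S ?S" if h: "h : car G" for h
 proof -
  have "(%f. \<lambda>t\<in>?C. rho (inv\<^bsub>G\<^esub> conj_rep G s t \<otimes>[G] h \<otimes>[G] conj_rep G s (inv\<^bsub>G\<^esub> h \<otimes>[G] t \<otimes>[G] h)) *\<^sub>v f (inv\<^bsub>G\<^esub> h \<otimes>[G] t \<otimes>[G] h)) : lhom ?S ?S"
  proof(rule dsum_lhom[OF mvec_vs finC S])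
   fix t assume t: "t : ?C"
   note r = crep_centralizer[OF s t h refl]
   have "(%v. rho (inv\<^bsub>G\<^esub> conj_rep G s t \<otimes>[G] h \<otimes>[G] conj_rep G s (inv\<^bsub>G\<^esub> h \<otimes>[G] t \<otimes>[G] h)) *\<^sub>v v) : lhom (vecs n) (vecs n)"
    by(rule lhomI) (use rc[OF r(2)] in \<open>auto simp: module_vec_simps mult_add_distrib_mat_vec[of _ n n] mult_mat_vec[of _ n n] intro!: mult_mat_vec_carrier[of _ n n]\<close>)
   then show "(%f. rho (inv\<^bsub>G\<^esub> conj_rep G s t \<otimes>[G] h \<otimes>[G] conj_rep G s (inv\<^bsub>G\<^esub> h \<otimes>[G] t \<otimes>[G] h)) *\<^sub>v f (inv\<^bsub>G\<^esub> h \<otimes>[G] t \<otimes>[G] h)) : lhom ?S (vecs n)"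
    by(rule lhom_comp[OF comp_lhom[OF r(1), of "%t. vecs n"]])
  qed
  then show ?thesis unfolding simple_act_def[abs_def] .
 qed
 have pl: "simple_proj G s n h : lhom ?S ?S" for h
 proof -
  have "(%f. \<lambda>t\<in>?C. if t = h then f t else 0\<^sub>v n) : lhom ?S ?S"
  proof(rule dsum_lhom[OF mvec_vs finC S])
   fix t assume t: "t : ?C"
   have "(%f. 0\<^sub>v n) : lhom ?S (vecs n)" using lhom_0[OF mvec_vs, of n ?S] by(simp add: module_vec_simps)
   then show "(%f. if t = h then f t else 0\<^sub>v n) : lhom ?S (vecs n)"
    using comp_lhom[OF t, of "%t. vecs n"] by(cases "t = h") simp_all
  qed
  then show ?thesis unfolding simple_proj_def[abs_def] .
 qed
 show ?thesis
  unfolding graded_module_def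
 proof(intro conjI ballI)
  show "vsp ?Y" by(rule Y)
  show "simple_act G s rho g : lhom ?Y ?Y" if "g : car G" for g unfolding YS by(rule al[OF that])
  show "simple_proj G s n g : lhom ?Y ?Y" for g unfolding YS by(rule pl)
  show "act ?Y b f = lin_ext ?Y (%g. simple_act G s rho g f) b" for b f
   unfolding simple_yd_act_coact by(rule lin_ext_fields_cong) (simp_all add: syd_simps)
  fix f assume "f : car ?Y"
  then have f: "f : car ?S" by(simp add: syd_simps)
  have AS: "vsp (tensor ?A ?S)" by(rule tensor_vs[OF A S])
  have sg: "sng g 1 : car ?A" if "g : car G" for g using that by simp
  have pc: "simple_proj G s n g f : car ?S" for g by(rule lhomD(1)[OF pl f])
  have z: "simple_proj G s n g f = \<zero>[?S]" if "g \<notin> ?C" for g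
   using that by(auto simp: simple_proj_def dsum_simps module_vec_simps fun_eq_iff)
  have e: "summand_in ?C (%t. vecs n) t (f t) = simple_proj G s n t f" if "t : ?C" for t
   by(auto simp: simple_proj_def summand_in_def module_vec_simps fun_eq_iff)
  have "coact ?Y f = finsum (tensor ?A ?S) (%t. pure ?A ?S (sng t 1) (simple_proj G s n t f)) ?C"
   unfolding simple_yd_act_coact
   by(rule fsum_cong[OF AS refl]) (use e pc sg CG pure_closed[OF A S] in auto)
  \<comment> \<open>Degrees outside the conjugacy class contribute zero, so the coaction may be
    summed over the whole group, as \<open>graded_module\<close> demands.\<close>
  also have "... = finsum (tensor ?A ?S) (%t. pure ?A ?S (sng t 1) (simple_proj G s n t f)) (car G)"
   by(rule fsum_mono[OF AS fin CG, symmetric]) (use pc sg CG pure_closed[OF A S] z pure_zero_right[OF A S] in auto)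
  finally show "coact ?Y f = finsum (tensor ?A ?Y) (%t. pure ?A ?Y (sng t 1) (simple_proj G s n t f)) (car G)"
   unfolding TY by(simp add: finsum_def syd_simps)
 qed
qed

text \<open>A Yetter-Drinfeld module over a finite group in classical terms: a representation with a
  complete system of orthogonal projections \<open>\<pi> g\<close>, where \<open>sig_\<pi>\<close>
  says that \<open>h\<close> carries degree \<open>g\<close> to degree
  \<open>h g h^-1\<close>.\<close>

locale graded_rep = group G for G :: "('g, 'm) monoid_scheme" (structure) +
 fixes V :: "('g \<Rightarrow>\<^sub>0 complex, 'v, 'n) yd_scheme" and sig \<pi> :: "'g => 'v => 'v"
 assumes fin: "finite (car G)" and graded: "graded_module G V sig \<pi>" and fd: "vectorspace.fin_dim CC V"
  and sig_one: "!!v. v : car V ==> sig \<one> v = v"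
  and sig_mult: "!!g h v. g : car G ==> h : car G ==> v : car V ==> sig (g \<otimes> h) v = sig g (sig h v)"
  and \<pi>_\<pi>: "!!g h v. g : car G ==> h : car G ==> v : car V ==> \<pi> g (\<pi> h v) = (if g = h then \<pi> h v else \<zero>[V])"
  and \<pi>_sum: "!!v. v : car V ==> finsum V (%g. \<pi> g v) (car G) = v"
  and sig_\<pi>: "!!g h v. g : car G ==> h : car G ==> v : car V ==> sig h (\<pi> g v) = \<pi> (h \<otimes> g \<otimes> inv h) (sig h v)"
begin

lemmas Vv = gmodD(1)[OF graded]
lemmas sig_lhom = gmodD(2)[OF graded] and \<pi>_lhom = gmodD(3)[OF graded]
lemmas sig_closed = lhomD(1)[OF sig_lhom] and \<pi>_closed = lhomD(1)[OF \<pi>_lhom]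

definition comp :: "'g => 'v set" where "comp g = {v : car V. \<pi> g v = v}"

lemma comp_subspace: "g : car G ==> ssp (comp g) V"
 unfolding comp_def
 by(rule subspaceI[OF Vv]) (use Vv lhomD[OF \<pi>_lhom] lhom_zero[OF \<pi>_lhom] in auto)

lemma \<pi>_comp: "g : car G ==> v : car V ==> \<pi> g v : comp g"
 by(simp add: comp_def \<pi>_closed \<pi>_\<pi>)

lemma sig_comp: "g : car G ==> h : car G ==> v : comp g ==> sig h v : comp (cj h g)"
 using sig_\<pi>[of g h v] by(auto simp: comp_def sig_closed)

lemma \<pi>_comp_other: "g : car G ==> h : car G ==> v : comp g ==> \<pi> h v = (if h = g then v else \<zero>[V])"
 using \<pi>_\<pi>[of h g v] by(auto simp: comp_def)

lemma sig_inv: "g : car G ==> v : car V ==> sig (inv g) (sig g v) = v" "g : car G ==> v : car V ==> sig g (sig (inv g) v) = v"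
 using sig_mult[of "inv g" g v] sig_mult[of g "inv g" v] sig_one by simp_all

text \<open>Elements of the centralizer of \<open>u\<close> carry degree \<open>u\<close> to itself,
  so \<open>comp u\<close> is a representation of the centralizer and Maschke's theorem
  applies.\<close>

lemma decomposition:
 assumes u: "u : car G"
 shows "\<exists>k n rho P Q. decomposes (G\<lparr>carrier := centralizer G u\<rparr>) V sig (comp u) k n rho P Q"
proof(rule complete_reducibility[OF Vv fd centralizer_group[OF u]])
 have sub: "centralizer G u <= car G" by(auto simp: centralizer_def)
 show "finite (car (G\<lparr>carrier := centralizer G u\<rparr>))" using finite_subset[OF sub fin] by simp
 show "ssp (comp u) V" by(rule comp_subspace[OF u])
 fix g assume "g : car (G\<lparr>carrier := centralizer G u\<rparr>)"
 then have g: "g : car G" "cj g u = u" using centralizer_iff[OF u] by auto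
 show "sig g : lhom V V" by(rule sig_lhom[OF g(1)])
 show "sig g v : comp u" if "v : comp u" for v using sig_comp[OF u g(1) that] g(2) by simp
next
 fix g h v assume "g : car (G\<lparr>carrier := centralizer G u\<rparr>)" "h : car (G\<lparr>carrier := centralizer G u\<rparr>)" "v : car V"
 then show "sig (g \<otimes>[G\<lparr>carrier := centralizer G u\<rparr>] h) v = sig g (sig h v)" using sig_mult by(simp add: centralizer_def)
qed (simp add: sig_one)

lemma lhom_injI:
 assumes f: "f : lhom V W" and W: "vsp W" and k: "!!v. v : car V ==> f v = \<zero>[W] ==> v = \<zero>[V]"
 shows "inj_on f (car V)"
proof(rule inj_onI)
 fix x y assume xy: "x : car V" "y : car V" "f x = f y"
 have "f (x \<oplus>[V] (-1) \<odot>[V] y) = \<zero>[W]"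
  using lhomD(2)[OF f xy(1) vs_smult[OF Vv xy(2)]] lhomD(3)[OF f xy(2)] xy lhomD(1)[OF f] W by simp
 then have "x \<oplus>[V] (-1) \<odot>[V] y = \<zero>[V]" using k xy Vv by simp
 then show "x = y" using vs_diff_zero_iff[OF Vv xy(1,2)] by simp
qed

text \<open>For a representative \<open>u C\<close> of each class, the component of degree
  \<open>u C\<close> is decomposed under the centralizer; the rest of the class is determined by
  induction, giving a sum of modules \<open>simple_yd\<close>. The eigenvalue condition and Schur's
  lemma make \<open>u C\<close> act as \<open>-1\<close> on each summand, which yields the trace
  condition and the even order.\<close>

theorem minus_one_type_of_eigenvalues:
 assumes real: "real_group G"
  and ev: "!!s v q. s : car G ==> v : comp s ==> v ~= \<zero>[V] ==> sig s v = q \<odot>[V] v ==> q = -1"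
 shows "nichols_minus_one_type G (nichols (group_algebra G) V)"
proof -
 define X where "X = conj_classes G"
 define u where "u C = (SOME x. x : C)" for C :: "'g set"
 have uC: "u C : C" "u C : car G" "conj_class G (u C) = C" if C: "C : X" for C
 proof -
  obtain s where s: "s : car G" "C = conj_class G s" using C by(auto simp: X_def conj_classes_def)
  show *: "u C : C" unfolding u_def by(rule someI[of _ s]) (use conj_class_self[OF s(1)] s in simp)
  then show "u C : car G" "conj_class G (u C) = C" using conj_class_carrier[OF s(1)] conj_class_eq[OF s(1)] s(2) by auto
 qed
 define Gam where "Gam C = G\<lparr>carrier := centralizer G (u C)\<rparr>" for C
 have "\<forall>C\<in>X. \<exists>k n rho P Q. decomposes (Gam C) V sig (comp (u C)) k n rho P Q"
  using decomposition uC(2) unfolding Gam_def by blast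
 then obtain k n rho P Q where dec: "!!C. C : X ==> decomposes (Gam C) V sig (comp (u C)) (k C) (n C) (rho C) (P C) (Q C)"
  by metis
 note dD = decomposesD[OF dec]
 \<comment> \<open>Classes with zero component are discarded, since the index sets of a ramification
   system must be nonempty.\<close>
 define K where "K = {C : X. \<exists>v\<in>comp (u C). v ~= \<zero>[V]}"
 define I where "I = (SIGMA C:K. {..<k C})"
 have KX: "C : X" if "C : K" for C using that by(simp add: K_def)
 have finX: "finite X" unfolding X_def conj_classes_def using fin by simp
 have finI: "finite I" unfolding I_def using finite_subset[of K X] KX finX by auto
 have compV: "v : car V" if "v : comp g" for v g using that by(simp add: comp_def)
 have kpos: "k C ~= 0" if C: "C : K" for C
 proof
  assume k0: "k C = 0"
  obtain v where v: "v : comp (u C)" "v ~= \<zero>[V]" using C by(auto simp: K_def)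
  show False using dD(7)[OF KX[OF C] v(1)] k0 v(2) Vv by simp
 qed
 have mrep: "matrix_rep (Gam C) (n C i) (rho C i)" if "C : X" "i < k C" for C i
  using dD(1)[OF that] by(simp add: irreducible_rep_def)
 define M where "M = (%(C, i). simple_yd G (u C) (n C i) (rho C i))"
 define sM where "sM = (%(C, i). simple_act G (u C) (rho C i))"
 define pM where "pM = (%(C, i). simple_proj G (u C) (n C i))"
 define W where "W = yd_direct_sum (group_algebra G) I M"
 have gM: "graded_module G (M p) (sM p) (pM p)" if "p : I" for p
 proof -
  obtain C i where p: "p = (C, i)" "C : X" "i < k C" using \<open>p : I\<close> KX by(auto simp: I_def)
  show ?thesis unfolding p(1) M_def sM_def pM_def prod.case
   by(rule simple_yd_graded[OF is_group fin uC(2)[OF p(2)]]) (use mrep[OF p(2,3)] in \<open>simp add: Gam_def\<close>)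
 qed
 note MV = gmodD(1)[OF gM]
 have smI: "summand_in I M p : lhom (M p) (direct_sum I M)" if "p : I" for p by(rule summand_lhom[OF MV that])
 have gW: "graded_module G W (%g f. \<lambda>p\<in>I. sM p g (f p)) (%g f. \<lambda>p\<in>I. pM p g (f p))"
  unfolding W_def by(rule gmod_dsum[OF gM finI fin])
 note WV = gmodD(1)[OF gW]
 \<comment> \<open>Take the part of degree \<open>t\<close>, carry it back to degree
   \<open>u C\<close> by the inverse of the representative of \<open>t\<close>, and read off the
   coordinates in the \<open>i\<close>-th summand. These are the components of the isomorphism
   \<open>f\<close>.\<close>
 define co where "co C i t v = Q C i (sig (inv (conj_rep G (u C) t)) (\<pi> t v))" for C i t v
 define f where "f v = (\<lambda>p\<in>I. \<lambda>t\<in>fst p. co (fst p) (snd p) t v)" for v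
 have rp: "conj_rep G (u C) t : car G" "cj (conj_rep G (u C) t) (u C) = t" "t : car G"
  "cj (inv (conj_rep G (u C) t)) t = u C" if "C : X" "t : C" for C t
 proof -
  have t: "t : conj_class G (u C)" using that uC(3) by simp
  show *: "conj_rep G (u C) t : car G" "cj (conj_rep G (u C) t) (u C) = t" using conj_rep[OF t] by auto
  show "t : car G" by(rule conj_class_carrier[OF uC(2)[OF that(1)] t])
  show "cj (inv (conj_rep G (u C) t)) t = u C" using cj_inv[OF *(1) uC(2)[OF that(1)]] *(2) by simp
 qed
 have cl: "sig (inv (conj_rep G (u C) t)) (\<pi> t v) : comp (u C)" if "C : X" "t : C" "v : car V" for C t v
  using sig_comp[OF rp(3)[OF that(1,2)] inv_closed[OF rp(1)[OF that(1,2)]] \<pi>_comp[OF rp(3)[OF that(1,2)] that(3)]] rp(4)[OF that(1,2)] by simp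
 have col: "co C i t : lhom V (vecs (n C i))" if "C : X" "t : C" "i < k C" for C i t
  unfolding co_def[abs_def]
  by(rule lhom_comp[OF lhom_comp[OF \<pi>_lhom sig_lhom] dD(3)]) (use rp[OF that(1,2)] that in auto)
 have Mc: "lhom Z (M (C, i)) = lhom Z (direct_sum C (%t. vecs (n C i)))" if "C : X" for Z C i
  using uC(3)[OF that] by(simp add: M_def syd_simps module_hom_def)
 have finC: "finite C" if "C : X" for C using rp(3)[OF that] finite_subset[OF _ fin] by blast
 have fl: "f : lhom V W"
 proof -
  have "(%v. \<lambda>p\<in>I. \<lambda>t\<in>fst p. co (fst p) (snd p) t v) : lhom V (direct_sum I M)"
  proof(rule dsum_lhom[OF MV finI Vv])
   fix p assume "p : I"
   then obtain C i where p: "p = (C, i)" "C : X" "i < k C" using KX by(auto simp: I_def)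
   show "(%v. \<lambda>t\<in>fst p. co (fst p) (snd p) t v) : lhom V (M p)"
    unfolding p(1) Mc[OF p(2)] fst_conv snd_conv
    by(rule dsum_lhom[OF mvec_vs finC[OF p(2)] Vv col[OF p(2) _ p(3)]])
  qed
  then show ?thesis unfolding f_def[abs_def] W_def by(simp add: module_hom_def yd_dsum_simps)
 qed
 \<comment> \<open>\<open>decomposes\<close> records equivariance of the inclusions
   \<open>P\<close>; for the projections it follows by expanding \<open>y\<close> and using that
   \<open>Q C i\<close> kills the other summands.\<close>
 have Qr: "Q C i (sig g y) = rho C i g *\<^sub>v Q C i y" if C: "C : X" and i: "i < k C" and g: "g : centralizer G (u C)" and y: "y : comp (u C)" for C i g y
 proof -
  have gG: "g : car G" using g by(simp add: centralizer_def)
  have gGam: "g : car (Gam C)" using g by(simp add: Gam_def)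
  have Qy: "Q C j y : carrier_vec (n C j)" if "j < k C" for j using lhomD(1)[OF dD(3)[OF C that] compV[OF y]] by(simp add: module_vec_simps)
  have rQ: "rho C j g *\<^sub>v Q C j y : carrier_vec (n C j)" if "j < k C" for j
   using mrep[OF C that] gGam Qy[OF that] by(auto simp: matrix_rep_def intro!: mult_mat_vec_carrier)
  have PV: "P C j w : car V" if "j < k C" "w : carrier_vec (n C j)" for j w using dD(4)[OF C that] compV by blast
  have "Q C i (sig g y) = Q C i (sig g (finsum V (%j. P C j (Q C j y)) {..<k C}))" using dD(7)[OF C y] by simp
  also have "... = finsum (vecs (n C i)) (%j. Q C i (sig g (P C j (Q C j y)))) {..<k C}"
   by(rule lhom_fsum[OF lhom_comp[OF sig_lhom[OF gG] dD(3)[OF C i]] Vv]) (use PV Qy in auto)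
  also have "... = Q C i (sig g (P C i (Q C i y)))"
  proof(rule fsum_single)
   show "Q C i (sig g (P C i (Q C i y))) : car (vecs (n C i))"
    by(rule lhomD(1)[OF dD(3)[OF C i] sig_closed[OF gG PV[OF i Qy[OF i]]]])
   fix j assume "j : {..<k C}" "j ~= i"
   then show "Q C i (sig g (P C j (Q C j y))) = \<zero>[vecs (n C i)]"
    using dD(5)[OF C _ Qy gGam, of j] dD(6)[OF C i _ rQ, of j] by(simp add: module_vec_simps)
  qed (use i in auto)
  also have "... = rho C i g *\<^sub>v Q C i y"
   unfolding dD(5)[OF C i Qy[OF i] gGam] using dD(6)[OF C i i rQ[OF i]] by simp
  finally show ?thesis .
 qed
 have eqI: "w = w'" if "w : car W" "w' : car W" "!!C i t. C : K ==> i < k C ==> t : C ==> w (C, i) t = w' (C, i) t" for w w'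
 proof(rule dsum_eqI[of _ I M])
  show w: "w : car (direct_sum I M)" "w' : car (direct_sum I M)" using that by(simp_all add: W_def yd_dsum_simps)
  fix p assume pI: "p : I"
  then obtain C i where p: "p = (C, i)" "C : K" "i < k C" by(auto simp: I_def)
  have m: "w p : car (M p)" "w' p : car (M p)"
   using lhomD(1)[OF comp_lhom[OF pI, of M] w(1)] lhomD(1)[OF comp_lhom[OF pI, of M] w(2)] by auto
  have "car (M p) = car (direct_sum C (%t. vecs (n C i)))" using uC(3)[OF KX[OF p(2)]] by(simp add: p(1) M_def syd_simps)
  then show "w p = w' p" using m that(3)[OF p(2,3)] by(intro dsum_eqI[of _ C "%t. vecs (n C i)"]) (auto simp: p(1))
 qed
 have fap: "f v (C, i) t = co C i t v" if "C : K" "i < k C" "t : C" for v C i t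
  using that by(simp add: f_def I_def)
 have fs: "f (sig g v) = (\<lambda>p\<in>I. sM p g (f v p))" if g: "g : car G" and v: "v : car V" for g v
 proof(rule eqI)
  show "f (sig g v) : car W" by(rule lhomD(1)[OF fl sig_closed[OF g v]])
  show "(\<lambda>p\<in>I. sM p g (f v p)) : car W" by(rule lhomD(1)[OF gmodD(2)[OF gW g] lhomD(1)[OF fl v]])
  fix C i t assume C: "C : K" and i: "i < k C" and t: "t : C"
  note CX = KX[OF C]
  define t' where "t' = inv g \<otimes> t \<otimes> g"
  have tc: "t : conj_class G (u C)" using t uC(3)[OF CX] by simp
  note r = crep_centralizer[OF uC(2)[OF CX] tc g t'_def]
  have t'C: "t' : C" using r(1) uC(3)[OF CX] by simp
  note R = rp[OF CX t] and R' = rp[OF CX t'C]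
  define a b where "a = conj_rep G (u C) t" and "b = conj_rep G (u C) t'"
  have ab: "a : car G" "b : car G" using R(1) R'(1) by(auto simp: a_def b_def)
  have "cj g t' = t" unfolding t'_def using cj_inv'[OF g R(3)] g by simp
  then have 1: "\<pi> t (sig g v) = sig g (\<pi> t' v)" using sig_\<pi>[OF R'(3) g v] by simp
  have pv: "\<pi> t' v : car V" by(rule \<pi>_closed[OF R'(3) v])
  have "sig (inv a) (sig g (\<pi> t' v)) = sig (inv a \<otimes> g) (\<pi> t' v)" using sig_mult[of "inv a" g] ab g pv by simp
  \<comment> \<open>The rule \<open>g b = a \<gamma>\<close> of the induced action, with
    \<open>\<gamma> = a^-1 g b\<close> in the centralizer of \<open>u C\<close>.\<close>
  also have "inv a \<otimes> g = (inv a \<otimes> g \<otimes> b) \<otimes> inv b" using ab g by(simp add: m_assoc)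
  also have "sig ... (\<pi> t' v) = sig (inv a \<otimes> g \<otimes> b) (sig (inv b) (\<pi> t' v))" by(rule sig_mult) (use ab g pv in auto)
  finally have "f (sig g v) (C, i) t = Q C i (sig (inv a \<otimes> g \<otimes> b) (sig (inv b) (\<pi> t' v)))"
   unfolding fap[OF C i t] co_def 1 a_def by simp
  also have "... = rho C i (inv a \<otimes> g \<otimes> b) *\<^sub>v Q C i (sig (inv b) (\<pi> t' v))"
   by(rule Qr[OF CX i]) (use r(2) cl[OF CX t'C v] in \<open>auto simp: a_def b_def\<close>)
  also have "Q C i (sig (inv b) (\<pi> t' v)) = f v (C, i) t'" unfolding fap[OF C i t'C] co_def b_def ..
  also have "rho C i (inv a \<otimes> g \<otimes> b) *\<^sub>v f v (C, i) t' = (\<lambda>p\<in>I. sM p g (f v p)) (C, i) t"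
   using C i tc by(simp add: I_def sM_def simple_act_def a_def b_def t'_def)
  finally show "f (sig g v) (C, i) t = (\<lambda>p\<in>I. sM p g (f v p)) (C, i) t" .
 qed
 have co0: "co C i t \<zero>[V] = 0\<^sub>v (n C i)" if "C : X" "t : C" "i < k C" for C i t
  using lhom_zero[OF col[OF that] Vv mvec_vs] by(simp add: module_vec_simps)
 have co_eq: "co C i t v = Q C i (sig (inv (conj_rep G (u C) t)) v)" if "C : X" "t : C" "v : comp t" for C i t v
  using that by(simp add: co_def comp_def)
 have co_other: "co C i t v = 0\<^sub>v (n C i)" if "C : X" "t : C" "i < k C" "v : comp g" "g : car G" "t ~= g" for C i t v g
  using co0[OF that(1-3)] \<pi>_comp_other[OF that(5) rp(3)[OF that(1,2)] that(4)] that(6) lhom_zero[OF \<pi>_lhom[OF rp(3)[OF that(1,2)]] Vv Vv]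
  by(simp add: co_def)
 have fp: "f (\<pi> g v) = (\<lambda>p\<in>I. pM p g (f v p))" if g: "g : car G" and v: "v : car V" for g v
 proof(rule eqI)
  show "f (\<pi> g v) : car W" by(rule lhomD(1)[OF fl \<pi>_closed[OF g v]])
  show "(\<lambda>p\<in>I. pM p g (f v p)) : car W" by(rule lhomD(1)[OF gmodD(3)[OF gW g] lhomD(1)[OF fl v]])
  fix C i t assume C: "C : K" and i: "i < k C" and t: "t : C"
  have tc: "t : conj_class G (u C)" using t uC(3)[OF KX[OF C]] by simp
  have "co C i t (\<pi> g v) = (if t = g then co C i t v else 0\<^sub>v (n C i))"
  proof(cases "t = g")
   case True
   then show ?thesis using \<pi>_\<pi>[OF g g v] by(simp add: co_def)
  next
   case False
   then show ?thesis using co_other[OF KX[OF C] t i \<pi>_comp[OF g v] g] by simp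
  qed
  then show "f (\<pi> g v) (C, i) t = (\<lambda>p\<in>I. pM p g (f v p)) (C, i) t"
   using C i tc fap[OF C i t] by(cases "t = g") (simp_all add: I_def pM_def simple_proj_def)
 qed
 have inj: "inj_on f (car V)"
 proof(rule lhom_injI[OF fl WV])
  fix v assume v: "v : car V" and f0: "f v = \<zero>[W]"
  have "\<pi> t v = \<zero>[V]" if t: "t : car G" for t
  proof(rule ccontr)
   assume nz: "\<pi> t v ~= \<zero>[V]"
   define C where "C = conj_class G t"
   have CX: "C : X" using t by(simp add: C_def X_def conj_classes_def)
   have tC: "t : C" using conj_class_self[OF t] by(simp add: C_def)
   \<comment> \<open>Transported back, a nonzero part of degree \<open>t\<close> is a nonzero vector
     of degree \<open>u C\<close>. All its coordinates vanish, which contradicts the expansion given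
     by the decomposition.\<close>
   define y where "y = sig (inv (conj_rep G (u C) t)) (\<pi> t v)"
   have yc: "y : comp (u C)" unfolding y_def by(rule cl[OF CX tC v])
   have "sig (conj_rep G (u C) t) y = \<pi> t v" unfolding y_def by(rule sig_inv(2)[OF rp(1)[OF CX tC] \<pi>_closed[OF t v]])
   then have ynz: "y ~= \<zero>[V]" using nz lhom_zero[OF sig_lhom[OF rp(1)[OF CX tC]] Vv Vv] by auto
   then have CK: "C : K" using CX yc by(auto simp: K_def)
   have "Q C i y = 0\<^sub>v (n C i)" if i: "i < k C" for i
   proof -
    have "co C i t v = \<zero>[W] (C, i) t" using fap[OF CK i tC, of v] f0 by simp
    also have "... = 0\<^sub>v (n C i)" using CK i tC uC(3)[OF CX]
     by(simp add: W_def yd_dsum_simps dsum_simps I_def M_def syd_simps module_vec_simps)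
    finally show ?thesis by(simp add: co_def y_def)
   qed
   then have "P C i (Q C i y) = \<zero>[V]" if "i < k C" for i
    using lhom_zero[OF dD(2)[OF CX that] mvec_vs Vv] that by(simp add: module_vec_simps)
   then have "finsum V (%i. P C i (Q C i y)) {..<k C} = \<zero>[V]" by(intro fsum_zero[OF Vv]) auto
   then show False using dD(7)[OF CX yc] ynz by simp
  qed
  then have "finsum V (%t. \<pi> t v) (car G) = \<zero>[V]" by(intro fsum_zero[OF Vv]) auto
  then show "v = \<zero>[V]" using \<pi>_sum[OF v] by simp
 qed
 have surj: "car W <= f ` car V"
 proof
  fix w assume w: "w : car W"
  define N where "N = f ` car V"
  have Ns: "ssp N (direct_sum I M)"
  proof -
   have "ssp N W" unfolding N_def by(rule img_subsp[OF fl WV carrier_subsp[OF Vv]])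
   from subspD(1-4)[OF this] show ?thesis
    by(intro subspaceI[OF dsum_vs[OF MV]]) (simp_all add: W_def yd_dsum_simps)
  qed
  have wD: "w : car (direct_sum I M)" using w by(simp add: W_def yd_dsum_simps)
  \<comment> \<open>The vectors with a single entry \<open>z\<close> at \<open>t\<close> span
    \<open>W\<close>. Such a vector is hit by the representative of \<open>t\<close> applied to
    \<open>P C i z\<close>.\<close>
  have el: "summand_in I M (C, i) (summand_in C (%t. vecs (n C i)) t z) : N"
   if C: "C : K" and i: "i < k C" and t: "t : C" and z: "z : carrier_vec (n C i)" for C i t z
  proof -
   note CX = KX[OF C]
   define a where "a = conj_rep G (u C) t"
   define v where "v = sig a (P C i z)"
   have Pz: "P C i z : comp (u C)" by(rule dD(4)[OF CX i z])
   have aG: "a : car G" using rp(1)[OF CX t] by(simp add: a_def)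
   have vt: "v : comp t" using sig_comp[OF uC(2)[OF CX] aG Pz] rp(2)[OF CX t] by(simp add: v_def a_def)
   have vV: "v : car V" by(rule compV[OF vt])
   have e: "co C' i' t' v = (if t' = t & C' = C & i' = i then z else 0\<^sub>v (n C' i'))" if C': "C' : K" "i' < k C'" "t' : C'" for C' i' t'
   proof(cases "t' = t")
    case True
    have "C' = C" using uC(3)[OF CX] uC(3)[OF KX[OF C'(1)]] conj_class_eq[OF uC(2)[OF CX], of t] conj_class_eq[OF uC(2)[OF KX[OF C'(1)]], of t] C'(3) t True by simp
    moreover have "sig (inv a) v = P C i z" unfolding v_def by(rule sig_inv(1)[OF aG compV[OF Pz]])
    ultimately show ?thesis using True co_eq[OF CX t vt] dD(6)[OF CX _ i z, of i'] C' by(simp add: a_def)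
   next
    case False
    then show ?thesis using co_other[OF KX[OF C'(1)] C'(3,2) vt rp(3)[OF CX t] False] by simp
   qed
   have zs: "summand_in C (%t. vecs (n C i)) t z : car (M (C, i))"
    using lhomD(1)[OF summand_lhom[of C "%t. vecs (n C i)", OF _ t], of z] z uC(3)[OF CX] by(simp add: M_def syd_simps module_vec_simps)
   have pI: "(C, i) : I" using C i by(simp add: I_def)
   have "f v = summand_in I M (C, i) (summand_in C (%t. vecs (n C i)) t z)"
   proof(rule eqI)
    show "f v : car W" by(rule lhomD(1)[OF fl vV])
    show "summand_in I M (C, i) (summand_in C (%t. vecs (n C i)) t z) : car W"
     using lhomD(1)[OF smI[OF pI] zs] by(simp add: W_def yd_dsum_simps)
    fix C' i' t' assume C': "C' : K" "i' < k C'" "t' : C'"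
    show "f v (C', i') t' = summand_in I M (C, i) (summand_in C (%t. vecs (n C i)) t z) (C', i') t'"
     unfolding fap[OF C'] e[OF C'] using C' uC(3)[OF KX[OF C'(1)]]
     by(auto simp: summand_in_def I_def M_def syd_simps dsum_simps module_vec_simps)
   qed
   then show ?thesis unfolding N_def using vV by(metis imageI)
  qed
  have "summand_in I M p (w p) : N" if pI: "p : I" for p
  proof -
   obtain C i where p: "p = (C, i)" "C : K" "i < k C" using pI by(auto simp: I_def)
   note CX = KX[OF p(2)]
   let ?D = "direct_sum C (%t. vecs (n C i))"
   have mp: "car (M p) = car ?D" "add (M p) = add ?D" "\<zero>[M p] = \<zero>[?D]" using uC(3)[OF CX] by(simp_all add: p(1) M_def syd_simps)
   have wp: "w p : car ?D" using lhomD(1)[OF comp_lhom[OF pI, of M] wD] mp by simp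
   have wt: "w p t : carrier_vec (n C i)" if "t : C" for t using lhomD(1)[OF comp_lhom[OF that] wp] by(simp add: module_vec_simps)
   have sc: "summand_in C (%t. vecs (n C i)) t (w p t) : car ?D" if "t : C" for t
    using lhomD(1)[OF summand_lhom[of C "%t. vecs (n C i)", OF _ that], of "w p t"] wt[OF that] by(simp add: module_vec_simps)
   have sl: "summand_in I M p : lhom ?D (direct_sum I M)"
    using smI[OF pI] uC(3)[OF CX] by(simp add: p(1) M_def syd_simps module_hom_def)
   have "summand_in I M p (w p) = summand_in I M p (finsum ?D (%t. summand_in C (%t. vecs (n C i)) t (w p t)) C)"
    using dsum_expand[OF mvec_vs finC[OF CX] wp] by simp
   also have "... = finsum (direct_sum I M) (%t. summand_in I M p (summand_in C (%t. vecs (n C i)) t (w p t))) C"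
    by(rule lhom_fsum[OF sl dsum_vs[OF mvec_vs] dsum_vs[OF MV] finC[OF CX]])
     (use sc in auto)
   also have "... : N" by(rule subsp_fsum[OF Ns finC[OF CX]]) (use el[OF p(2,3)] wt in \<open>auto simp: p(1)\<close>)
   finally show ?thesis .
  qed
  then have "finsum (direct_sum I M) (%p. summand_in I M p (w p)) I : N" by(intro subsp_fsum[OF Ns finI]) auto
  then show "w : f ` car V" using dsum_expand[OF MV finI wD] by(simp add: N_def)
 qed
 define h where "h = inv_into (car V) f"
 have "pull_push_iso (group_algebra G) (nichols (group_algebra G) V) (nichols (group_algebra G) W)"
  by(rule graded_module_nichols_iso[OF graded gW fin is_monoid fl, where h=h])
   (use fs fp surj inj in \<open>auto simp: h_def inv_into_into f_inv_into_f inv_into_f_f subset_iff\<close>)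
 then have iso: "pull_push_iso (group_algebra G) (nichols (group_algebra G) V) (rsr_nichols G u K (%C. {..<k C}) n rho)"
  unfolding rsr_nichols_def W_def I_def M_def .
 have rsr: "rsr G u K (%C. {..<k C}) n rho"
 proof -
  have "{..<k C} ~= {}" if "C : K" for C using kpos[OF that] by auto
  then show ?thesis unfolding rsr_def using uC(1) KX dD(1) by(auto simp: X_def[symmetric] Gam_def simp del: lessThan_empty_iff)
 qed
 have "rsr_minus_one_type G u K (%C. {..<k C}) rho"
  unfolding rsr_minus_one_type_def
 proof(intro ballI)
  fix C i assume C: "C : K" and "i : {..<k C}"
  then have i: "i < k C" by simp
  note CX = KX[OF C]
  have uG: "u C : car G" by(rule uC(2)[OF CX])
  define m E where "m = n C i" and "E = rho C i (u C)"
  have uc: "u C : centralizer G (u C)" using uG by(simp add: centralizer_def)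
  have oc: "\<one> : centralizer G (u C)" using uG by(simp add: centralizer_def)
  note irr = dD(1)[OF CX i, folded m_def]
  have Ec: "E : carrier_mat m m" using mrep[OF CX i] uc by(simp add: matrix_rep_def E_def m_def Gam_def)
  have m0: "m > 0" using irr by(simp add: irreducible_rep_def)
  \<comment> \<open>Over the complex numbers \<open>E\<close> has an eigenvector. Its eigenspace
    \<open>Y\<close> is invariant because \<open>u C\<close> is central in its own centralizer, so
    by irreducibility it is everything: Schur's lemma for one operator.\<close>
  obtain q z where z: "z : carrier_vec m" "z ~= 0\<^sub>v m" "E *\<^sub>v z = q \<cdot>\<^sub>v z"
   using spectrum_non_empty[OF Ec m0] Ec unfolding spectrum_def eigenvalue_def eigenvector_def by auto
  define Y where "Y = {y : carrier_vec m. E *\<^sub>v y = q \<cdot>\<^sub>v y}"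
  have Ys: "ssp Y (vecs m)"
   by(rule subspaceI[OF mvec_vs])
    (use Ec in \<open>auto simp: Y_def module_vec_simps mult_add_distrib_mat_vec[of _ m m] mult_mat_vec[of _ m m] smult_add_distrib_vec[of _ m] smult_smult_assoc mult.commute intro!: eq_vecI\<close>)
  have Yi: "rho C i g *\<^sub>v y : Y" if g: "g : car (Gam C)" and y: "y : Y" for g y
  proof -
   have gc: "rho C i g : carrier_mat m m" using mrep[OF CX i] g by(simp add: matrix_rep_def m_def)
   have yc: "y : carrier_vec m" using y by(simp add: Y_def)
   have rm: "rho C i (a \<otimes> b) = rho C i a * rho C i b" if "a : car (Gam C)" "b : car (Gam C)" for a b
    using mrep[OF CX i] that by(simp add: matrix_rep_def Gam_def)
   have ug: "u C : car (Gam C)" using uc by(simp add: Gam_def)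
   have comm: "g \<otimes> u C = u C \<otimes> g" using g by(simp add: Gam_def centralizer_def)
   have "E *\<^sub>v (rho C i g *\<^sub>v y) = E * rho C i g *\<^sub>v y" by(rule assoc_mult_mat_vec[OF Ec gc yc, symmetric])
   also have "E * rho C i g = rho C i g * E" unfolding E_def using rm[OF ug g] rm[OF g ug] comm by simp
   also have "... *\<^sub>v y = rho C i g *\<^sub>v (E *\<^sub>v y)" by(rule assoc_mult_mat_vec[OF gc Ec yc])
   also have "... = q \<cdot>\<^sub>v (rho C i g *\<^sub>v y)" using y mult_mat_vec[OF gc yc, of q] by(simp add: Y_def)
   finally show ?thesis using mult_mat_vec_carrier[OF gc yc] by(simp add: Y_def)
  qed
  have zY: "z : Y" using z by(simp add: Y_def)
  have "Y = {0\<^sub>v m} \<or> Y = carrier_vec m" using irr Ys Yi unfolding irreducible_rep_def by blast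
  then have Yall: "Y = carrier_vec m" using zY z(2) by auto
  have Pz: "P C i z : comp (u C)" using dD(4)[OF CX i] z by(simp add: m_def)
  have Pnz: "P C i z ~= \<zero>[V]"
   using dD(6)[OF CX i i, of z] z lhom_zero[OF dD(3)[OF CX i] Vv] by(auto simp: m_def module_vec_simps)
  have "sig (u C) (P C i z) = P C i (rho C i (u C) *\<^sub>v z)" using dD(5)[OF CX i, of z "u C"] z uc by(simp add: m_def Gam_def)
  then have sq: "sig (u C) (P C i z) = q \<odot>[V] P C i z"
   using z lhomD(3)[OF dD(2)[OF CX i], of z q] by(simp add: E_def[symmetric] m_def module_vec_simps)
  have q: "q = -1" by(rule ev[OF uG Pz Pnz sq])
  \<comment> \<open>The order enters through the power of \<open>u C\<close> that is
    \<open>1\<close>: an odd order would give \<open>v = - v\<close> for the nonzero vector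
    \<open>v = P C i z\<close>.\<close>
  have pw: "sig (u C [^] (j::nat)) (P C i z) = ((-1) ^ j) \<odot>[V] P C i z" for j
  proof(induction j)
   case 0
   then show ?case using sig_one compV[OF Pz] Vv by simp
  next
   case (Suc j)
   have "sig (u C [^] Suc j) (P C i z) = sig (u C [^] j) (sig (u C) (P C i z))"
    using sig_mult[of "u C [^] j" "u C"] uG compV[OF Pz] by simp
   also have "... = (-1) \<odot>[V] sig (u C [^] j) (P C i z)"
    unfolding sq q by(rule lhomD(3)[OF sig_lhom]) (use uG compV[OF Pz] in auto)
   finally show ?case using Suc Vv compV[OF Pz] by simp
  qed
  have "even (ord (u C))"
  proof(rule ccontr)
   assume "odd (ord (u C))"
   then have "P C i z = (-1) \<odot>[V] P C i z"
    using pw[of "ord (u C)"] uG sig_one compV[OF Pz] by simp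
   then have "2 \<odot>[V] P C i z = \<zero>[V]"
    using vs_smult_l[OF Vv compV[OF Pz], of 1 1] vs_add_neg[OF Vv compV[OF Pz]] Vv compV[OF Pz] by simp
   then have "(1/2) \<odot>[V] (2 \<odot>[V] P C i z) = (1/2) \<odot>[V] \<zero>[V]" by simp
   then show False using Pnz Vv compV[OF Pz] by simp
  qed
  moreover have "character (rho C i) (u C) = - character (rho C i) \<one>"
  proof -
   \<comment> \<open>\<open>E\<close> multiplies every unit vector by \<open>q = -1\<close>, which
     fixes the diagonal and thereby the trace.\<close>
   have d: "E $$ (j, j) = -1" if j: "j < m" for j
   proof -
    have "unit_vec m j : Y" by(simp add: Yall)
    then have "(E *\<^sub>v unit_vec m j) $ j = (q \<cdot>\<^sub>v unit_vec m j) $ j" by(simp add: Y_def)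
    then show ?thesis using j Ec q by(simp add: scalar_prod_right_unit)
   qed
   have "rho C i \<one> = 1\<^sub>m m" using mrep[OF CX i] by(simp add: matrix_rep_def m_def Gam_def)
   then show ?thesis using d Ec unfolding character_def E_def[symmetric] by simp
  qed
  ultimately show "real_element G (u C) & even (ord (u C)) & character (rho C i) (u C) = - character (rho C i) \<one>"
   using real uG by(simp add: real_group_def)
 qed
 then show ?thesis unfolding nichols_minus_one_type_def using rsr iso by blast
qed

end

section \<open>The coradical filtration of a finite-dimensional pointed Hopf algebra\<close>

lemma GL_simps:
 "car (grouplikes H) = {g : car H. g ~= \<zero>[H] & comult H g = pure H H g g}"
 "monoid.mult (grouplikes H) = monoid.mult H" "\<one>[grouplikes H] = \<one>[H]"
 by(simp_all add: grouplikes_def)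

text \<open>The Hopf-theoretic hypotheses together with finite dimension, so that the
  \<open>-1\<close>-type can be proved directly. Finite dimension supplies dual bases and hence
  enough functionals.\<close>

locale fd_pointed =
 fixes H :: "'h hopf" (structure)
 assumes hopf: "hopf_algebra H" and ptd: "pointed H" and finG: "finite (car (grouplikes H))"
  and fd: "vectorspace.fin_dim CC H"
begin

abbreviation HH where "HH \<equiv> tensor H H"
abbreviation GL where "GL \<equiv> car (grouplikes H)"
abbreviation Del where "Del \<equiv> comult H"
abbreviation eps where "eps \<equiv> counit H"
abbreviation duals where "duals \<equiv> lhom H complex_mod"
abbreviation pr where "pr \<equiv> pure H H"

lemma bialg: "bialgebra H" and H_alg: "assoc_algebra H" and coalg: "coalgebra H"
 using hopf by(auto simp: hopf_algebra_def bialgebra_def)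

lemmas Hv = algD(1)[OF H_alg] and H_mult = algD(3)[OF H_alg] and H_one = algD(4)[OF H_alg]
 and H_closed = algD(5)[OF H_alg] and H_assoc = algD(6)[OF H_alg]
 and H_l_one = algD(7)[OF H_alg] and H_r_one = algD(8)[OF H_alg]

lemma HHv: "vsp HH" using Hv Hv by(rule tensor_vs)
lemma Del_lhom: "Del : lhom H HH" and eps_lhom: "eps : duals"
 using coalg by(auto simp: coalgebra_def)
lemma Del_one: "Del \<one> = pr \<one> \<one>" and eps_one: "eps \<one> = 1"
 using bialg by(auto simp: bialgebra_def)
lemma Del_mult: "x : car H ==> y : car H ==> Del (x \<otimes> y) = tensor_mult H (Del x) (Del y)"
 and eps_mult: "x : car H ==> y : car H ==> eps (x \<otimes> y) = eps x * eps y"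
 using bialg by(auto simp: bialgebra_def)
lemmas Del_closed = lhomD(1)[OF Del_lhom]
lemmas m_lin1 = bilinD(2)[OF H_mult] and m_lin2 = bilinD(1)[OF H_mult]

lemma pr_closed: "a : car H ==> b : car H ==> pr a b : car HH"
 by(rule pure_closed[OF Hv Hv])

lemmas lsl = lslice_lhom[OF Hv Hv] and lsp = lslice_pure[OF Hv Hv]
 and rsl = rslice_lhom[OF Hv Hv] and rsp = rslice_pure[OF Hv Hv]

subsection \<open>Slices of the comultiplication\<close>

text \<open>The actions of the dual algebra on \<open>H\<close>: \<open>L f x\<close> is
  \<open>(f \<otimes> id)\<Delta>(x)\<close> and \<open>R f x\<close> is
  \<open>(id \<otimes> f)\<Delta>(x)\<close>.\<close>

definition L where "L f x = lslice H f (Del x)"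
definition R where "R f x = rslice H f (Del x)"

lemma L_lhom: "f : duals ==> L f : lhom H H"
 unfolding L_def[abs_def] by(rule lhom_comp[OF Del_lhom lsl])
lemma R_lhom: "f : duals ==> R f : lhom H H"
 unfolding R_def[abs_def] by(rule lhom_comp[OF Del_lhom rsl])
lemmas L_closed = lhomD(1)[OF L_lhom] and R_closed = lhomD(1)[OF R_lhom]

lemma L_pure: "f : duals ==> a : car H ==> b : car H ==> Del x = pr a b ==> L f x = f a \<odot> b"
 by(simp add: L_def lsp)
lemma R_pure: "f : duals ==> a : car H ==> b : car H ==> Del x = pr a b ==> R f x = f b \<odot> a"
 by(simp add: R_def rsp)

lemma L_eps: "x : car H ==> L eps x = x" and R_eps: "x : car H ==> R eps x = x"
 using coalg by(auto simp: coalgebra_def L_def R_def lslice_def rslice_def)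

text \<open>Coassociativity is an equation between nested Sweedler sums in a triple tensor product.
  Pushing a linear \<open>Phi\<close> through both nestings turns it into an equation for any
  trilinear expression.\<close>

lemma coassoc_apply:
 assumes X: "vsp X" and Phi: "Phi : lhom (tensor H HH) X"
  and phi: "!!a b c. a : car H ==> b : car H ==> c : car H ==> Phi (pure H HH a (pr b c)) = phi a b c"
  and x: "x : car H"
 shows "class_ext X (%(a, b). class_ext X (%(b1, b2). phi a b1 b2) (Del b)) (Del x) =
  class_ext X (%(a, b). class_ext X (%(a1, a2). phi a1 a2 b) (Del a)) (Del x)"
proof -
 let ?T = "tensor H HH"
 have T: "vsp ?T" using Hv HHv by(rule tensor_vs)
 have pc: "pure H HH a (pr b c) : car ?T" if "a : car H" "b : car H" "c : car H" for a b c
  using that by(intro pure_closed[OF Hv HHv] pr_closed)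
 have phic: "phi a b c : car X" if "a : car H" "b : car H" "c : car H" for a b c
  using lhomD(1)[OF Phi pc[OF that]] phi[OF that] by simp
 have b1: "bilin H H ?T (%b c. pure H HH a (pr b c))" if "a : car H" for a
  by(rule bilin_lhom[OF bilin_pure[OF Hv Hv] pure_lhomr[OF Hv HHv that]])
 have b2: "bilin H H ?T (%a b. pure H HH a (pr b c))" if "c : car H" for c
  by(rule bilin_precomp[OF bilin_pure[OF Hv HHv] lhom_id pure_lhoml[OF Hv Hv that]])
 have coa: "class_ext ?T (%(a, b). class_ext ?T (%(b1, b2). pure H HH a (pr b1 b2)) (Del b)) (Del x) =
  class_ext ?T (%(a, b). class_ext ?T (%(a1, a2). pure H HH a1 (pr a2 b)) (Del a)) (Del x)"
  using coalg x by(auto simp: coalgebra_def)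
 have c1: "class_ext ?T (%(b1, b2). pure H HH a (pr b1 b2)) (Del b) : car ?T" if "a : car H" "b : car H" for a b
  by(rule cext_closed[OF Hv Hv T b1[OF that(1)] Del_closed[OF that(2)]])
 have c2: "class_ext ?T (%(a1, a2). pure H HH a1 (pr a2 b)) (Del a) : car ?T" if "a : car H" "b : car H" for a b
  by(rule cext_closed[OF Hv Hv T b2[OF that(2)] Del_closed[OF that(1)]])
 have i1: "Phi (class_ext ?T (%(b1, b2). pure H HH a (pr b1 b2)) (Del b)) = class_ext X (%(b1, b2). phi a b1 b2) (Del b)"
  if ab: "a : car H" "b : car H" for a b
 proof -
  have "Phi (class_ext ?T (%(b1, b2). pure H HH a (pr b1 b2)) (Del b)) = class_ext X (%(b1, b2). Phi (pure H HH a (pr b1 b2))) (Del b)"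
   by(rule lhom_cext[OF Hv Hv Phi T X Del_closed[OF ab(2)]]) (use pc ab in auto)
  also have "... = class_ext X (%(b1, b2). phi a b1 b2) (Del b)"
   by(rule cext_cong[OF Hv Hv Del_closed[OF ab(2)] X]) (use phi phic ab in auto)
  finally show ?thesis .
 qed
 have i2: "Phi (class_ext ?T (%(a1, a2). pure H HH a1 (pr a2 b)) (Del a)) = class_ext X (%(a1, a2). phi a1 a2 b) (Del a)"
  if ab: "a : car H" "b : car H" for a b
 proof -
  have "Phi (class_ext ?T (%(a1, a2). pure H HH a1 (pr a2 b)) (Del a)) = class_ext X (%(a1, a2). Phi (pure H HH a1 (pr a2 b))) (Del a)"
   by(rule lhom_cext[OF Hv Hv Phi T X Del_closed[OF ab(1)]]) (use pc ab in auto)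
  also have "... = class_ext X (%(a1, a2). phi a1 a2 b) (Del a)"
   by(rule cext_cong[OF Hv Hv Del_closed[OF ab(1)] X]) (use phi phic ab in auto)
  finally show ?thesis .
 qed
 note D = Del_closed[OF x]
 have "Phi (class_ext ?T (%(a, b). class_ext ?T (%(b1, b2). pure H HH a (pr b1 b2)) (Del b)) (Del x)) =
  class_ext X (%(a, b). Phi (class_ext ?T (%(b1, b2). pure H HH a (pr b1 b2)) (Del b))) (Del x)"
  by(rule lhom_cext[OF Hv Hv Phi T X D c1])
 also have "... = class_ext X (%(a, b). class_ext X (%(b1, b2). phi a b1 b2) (Del b)) (Del x)"
  by(rule cext_cong[OF Hv Hv D X]) (use i1 lhomD(1)[OF Phi c1] in auto)
 finally have 1: "Phi (class_ext ?T (%(a, b). class_ext ?T (%(b1, b2). pure H HH a (pr b1 b2)) (Del b)) (Del x)) = ..." .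
 have "Phi (class_ext ?T (%(a, b). class_ext ?T (%(a1, a2). pure H HH a1 (pr a2 b)) (Del a)) (Del x)) =
  class_ext X (%(a, b). Phi (class_ext ?T (%(a1, a2). pure H HH a1 (pr a2 b)) (Del a))) (Del x)"
  by(rule lhom_cext[OF Hv Hv Phi T X D c2])
 also have "... = class_ext X (%(a, b). class_ext X (%(a1, a2). phi a1 a2 b) (Del a)) (Del x)"
  by(rule cext_cong[OF Hv Hv D X]) (use i2 lhomD(1)[OF Phi c2] in auto)
 finally show ?thesis using 1 coa by simp
qed

text \<open>The convolution product of the dual algebra, the functional that Sweedler notation
  writes as \<open>e(x_1) f(x_2)\<close>.\<close>

definition cv where "cv e f x = f (L e x)"

lemma cv_dual: "e : duals ==> f : duals ==> cv e f : duals"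
 unfolding cv_def[abs_def] by(rule lhom_comp[OF L_lhom])

lemma cv_eq:
 assumes e: "e : duals" and f: "f : duals" and x: "x : car H"
 shows "cv e f x = class_ext complex_mod (%(a, b). e a * f b) (Del x)" "cv e f x = e (R f x)"
proof -
 note D = Del_closed[OF x]
 have "f (L e x) = class_ext complex_mod (%(a, b). f (e a \<odot> b)) (Del x)"
  unfolding L_def lslice_def by(rule lhom_cext[OF Hv Hv f Hv cm_vs D]) (use Hv in auto)
 also have "... = class_ext complex_mod (%(a, b). e a * f b) (Del x)"
  by(rule cext_cong[OF Hv Hv D]) (use lhomD(3)[OF f] in auto)
 finally show 1: "cv e f x = class_ext complex_mod (%(a, b). e a * f b) (Del x)" by(simp add: cv_def)
 have "e (R f x) = class_ext complex_mod (%(a, b). e (f b \<odot> a)) (Del x)"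
  unfolding R_def rslice_def by(rule lhom_cext[OF Hv Hv e Hv cm_vs D]) (use Hv in auto)
 also have "... = class_ext complex_mod (%(a, b). e a * f b) (Del x)"
  by(rule cext_cong[OF Hv Hv D]) (use lhomD(3)[OF e] in \<open>auto simp: mult.commute\<close>)
 finally show "cv e f x = e (R f x)" using 1 by simp
qed

text \<open>Coassociativity tested against the functional
  \<open>e \<otimes> f \<otimes> g\<close>.\<close>

lemma cv_assoc:
 assumes e: "e : duals" and f: "f : duals" and g: "g : duals" and x: "x : car H"
 shows "cv e (cv f g) x = cv (cv e f) g x"
proof -
 note D = Del_closed[OF x]
 have Phi: "(%t. g (lslice H f (lslice HH e t))) : lhom (tensor H HH) complex_mod"
  by(rule lhom_comp[OF lslice_lhom[OF Hv HHv e] lhom_comp[OF lsl[OF f] g]])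
 have phi: "g (lslice H f (lslice HH e (pure H HH a (pr b c)))) = e a * f b * g c"
  if "a : car H" "b : car H" "c : car H" for a b c
  using that lhomD(3)[OF lsl[OF f] pr_closed[of b c]] lhomD(3)[OF g] Hv
  by(simp add: lslice_pure[OF Hv HHv e] lsp[OF f] pr_closed)
 have l: "(%z. k * z) : lhom complex_mod complex_mod" "(%z. z * k) : lhom complex_mod complex_mod" for k
  by(auto intro!: lhomI simp: algebra_simps)
 have 1: "e a * cv f g b = class_ext complex_mod (%(b1, b2). e a * f b1 * g b2) (Del b)" if b: "b : car H" for a b
  unfolding cv_eq(1)[OF f g b]
  by(subst lhom_cext[OF Hv Hv l(1) cm_vs cm_vs Del_closed[OF b]]) (simp_all add: mult.assoc)
 have 2: "cv e f a * g b = class_ext complex_mod (%(a1, a2). e a1 * f a2 * g b) (Del a)" if a: "a : car H" for a b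
  unfolding cv_eq(1)[OF e f a]
  by(subst lhom_cext[OF Hv Hv l(2) cm_vs cm_vs Del_closed[OF a]]) simp_all
 have "cv e (cv f g) x = class_ext complex_mod (%(a, b). class_ext complex_mod (%(b1, b2). e a * f b1 * g b2) (Del b)) (Del x)"
  unfolding cv_eq(1)[OF e cv_dual[OF f g] x] by(rule cext_cong[OF Hv Hv D]) (simp_all add: 1)
 also have "... = class_ext complex_mod (%(a, b). class_ext complex_mod (%(a1, a2). e a1 * f a2 * g b) (Del a)) (Del x)"
  by(rule coassoc_apply[OF cm_vs Phi phi x])
 also have "... = cv (cv e f) g x"
  unfolding cv_eq(1)[OF cv_dual[OF e f] g x] by(rule cext_cong[OF Hv Hv D]) (simp_all add: 2)
 finally show ?thesis .
qed

text \<open>A dual basis recovers a vector from its coordinates; identities between slices thereby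
  reduce to identities in the convolution algebra.\<close>

lemma duals_eqI:
 assumes "x : car H" "y : car H" "!!g. g : duals ==> g x = g y"
 shows "x = y"
proof -
 obtain B C d where B: "dual_basis H B d"
  using dual_basis_exists[OF Hv fd lin_indpt_empty[OF Hv fd] empty_subsetI carrier_subsp[OF Hv]] by blast
 note BD = dual_basisD[OF B]
 have "finsum H (%b. d b x \<odot> b) B = finsum H (%b. d b y \<odot> b) B"
  by(rule fsum_cong[OF Hv refl]) (use assms(3)[OF BD(3)] BD(6) Hv in auto)
 then show ?thesis unfolding BD(5)[OF assms(1)] BD(5)[OF assms(2)] .
qed

text \<open>Functionals separate points, so this is associativity of convolution read off at an
  arbitrary \<open>g\<close>. The commutation of left and right slices in \<open>L_R\<close> has the
  same source.\<close>

lemma L_L: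
 assumes e: "e : duals" and f: "f : duals" and x: "x : car H"
 shows "L f (L e x) = L (cv e f) x"
proof(rule duals_eqI)
 fix g assume "g : duals"
 from cv_assoc[OF e f this x] show "g (L f (L e x)) = g (L (cv e f) x)" unfolding cv_def .
qed (intro L_closed cv_dual assms)+

lemma L_R:
 assumes e: "e : duals" and f: "f : duals" and x: "x : car H"
 shows "L e (R f x) = R f (L e x)"
proof(rule duals_eqI)
 fix g assume g: "g : duals"
 have "g (L e (R f x)) = cv (cv e g) f x" using cv_eq(2)[OF cv_dual[OF e g] f x] by(simp add: cv_def)
 also have "... = cv e (cv g f) x" by(rule cv_assoc[OF e g f x, symmetric])
 also have "... = g (R f (L e x))" using cv_eq(2)[OF g f L_closed[OF e x]] by(simp add: cv_def)
 finally show "g (L e (R f x)) = g (R f (L e x))" .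
qed (intro L_closed R_closed assms)+

lemma shift_dual: "f : duals ==> a : car H ==> (%u. f (a \<otimes> u)) : duals"
 by(rule lhom_comp[OF m_lin2])
lemma shift_dual': "f : duals ==> a : car H ==> (%u. f (u \<otimes> a)) : duals"
 by(rule lhom_comp[OF m_lin1])

lemma tensor_mult_inner: "a : car H ==> b : car H ==> bilin H H HH (%c d. pr (a \<otimes> c) (b \<otimes> d))"
 by(rule bilin_precomp[OF bilin_pure[OF Hv Hv] m_lin2 m_lin2])

lemma tmult_bilin: "bilin HH HH HH (tensor_mult H)"
proof -
 have pl: "(%a. pr (a \<otimes> c) d) : lhom H HH" if "c : car H" "d : car H" for c d
  by(rule lhom_comp[OF m_lin1[OF that(1)] pure_lhoml[OF Hv Hv that(2)]])
 have pr': "(%b. pr c (b \<otimes> d)) : lhom H HH" if "c : car H" "d : car H" for c d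
  by(rule lhom_comp[OF m_lin1[OF that(2)] pure_lhomr[OF Hv Hv that(1)]])
 have b: "bilin H H HH (%a b. class_ext HH (%(c, d). pr (a \<otimes> c) (b \<otimes> d)) t)" if t: "t : car HH" for t
  by(rule bilinI; rule cext_param[OF Hv Hv HHv t]) (use H_closed in \<open>auto intro!: pl pr'\<close>)
 show ?thesis
 proof(rule bilinI)
  show "(%s. tensor_mult H s t) : lhom HH HH" if "t : car HH" for t
   unfolding tensor_mult_def[abs_def] by(rule cext_lhom[OF Hv Hv HHv b[OF that]])
  show "tensor_mult H s : lhom HH HH" if "s : car HH" for s
   unfolding tensor_mult_def[abs_def]
   by(rule cext_param[OF Hv Hv HHv that cext_lhom[OF Hv Hv HHv tensor_mult_inner]])
 qed
qed

lemma tensor_mult_pure_left: "a : car H ==> b : car H ==> t : car HH ==>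
 tensor_mult H (pr a b) t = class_ext HH (%(c, d). pr (a \<otimes> c) (b \<otimes> d)) t"
proof -
 assume a: "a : car H" and b: "b : car H" and t: "t : car HH"
 have pl: "(%a. pr (a \<otimes> c) d) : lhom H HH" if "c : car H" "d : car H" for c d
  by(rule lhom_comp[OF m_lin1[OF that(1)] pure_lhoml[OF Hv Hv that(2)]])
 have pr': "(%b. pr c (b \<otimes> d)) : lhom H HH" if "c : car H" "d : car H" for c d
  by(rule lhom_comp[OF m_lin1[OF that(2)] pure_lhomr[OF Hv Hv that(1)]])
 have bl: "bilin H H HH (%a b. class_ext HH (%(c, d). pr (a \<otimes> c) (b \<otimes> d)) t)"
  by(rule bilinI; rule cext_param[OF Hv Hv HHv t]) (use H_closed in \<open>auto intro!: pl pr'\<close>)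
 show ?thesis unfolding tensor_mult_def by(rule cext_pure[OF Hv Hv HHv bl a b])
qed

lemma tensor_mult_pure: "a : car H ==> b : car H ==> c : car H ==> d : car H ==>
 tensor_mult H (pr a b) (pr c d) = pr (a \<otimes> c) (b \<otimes> d)"
 by(simp only: tensor_mult_pure_left pr_closed cext_pure[OF Hv Hv HHv tensor_mult_inner])

text \<open>A slice of a product with a pure tensor is again a slice of the other factor, by a
  translated functional, times an element. All four versions are checked on pure tensors.\<close>

lemma slice_tensor_mult:
 assumes f: "f : duals" and ab: "a : car H" "b : car H" and t: "t : car HH"
 shows lslice_tensor_mult: "lslice H f (tensor_mult H (pr a b) t) = b \<otimes> lslice H (%u. f (a \<otimes> u)) t"
  and rslice_tensor_mult_right: "rslice H f (tensor_mult H t (pr a b)) = rslice H (%u. f (u \<otimes> b)) t \<otimes> a"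
  and rslice_tensor_mult_left: "rslice H f (tensor_mult H (pr a b) t) = a \<otimes> rslice H (%u. f (b \<otimes> u)) t"
  and lslice_tensor_mult_right: "lslice H f (tensor_mult H t (pr a b)) = lslice H (%u. f (u \<otimes> a)) t \<otimes> b"
proof -
 note eqI = tensor_eqI[OF Hv Hv _ _ Hv t] and p = pr_closed[OF ab]
 note l = lhom_comp[OF bilinD(1)[OF tmult_bilin p]] lhom_comp[OF bilinD(2)[OF tmult_bilin p]]
 note d = shift_dual[OF f] shift_dual'[OF f]
 note sp = tensor_mult_pure ab lsp rsp f d H_closed bilinD(6,7)[OF H_mult]
 show "lslice H f (tensor_mult H (pr a b) t) = b \<otimes> lslice H (%u. f (a \<otimes> u)) t"
  by(rule eqI[OF l(1)[OF lsl[OF f]] lhom_comp[OF lsl[OF d(1)[OF ab(1)]] m_lin2[OF ab(2)]]]) (simp only: sp)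
 show "rslice H f (tensor_mult H t (pr a b)) = rslice H (%u. f (u \<otimes> b)) t \<otimes> a"
  by(rule eqI[OF l(2)[OF rsl[OF f]] lhom_comp[OF rsl[OF d(2)[OF ab(2)]] m_lin1[OF ab(1)]]]) (simp only: sp)
 show "rslice H f (tensor_mult H (pr a b) t) = a \<otimes> rslice H (%u. f (b \<otimes> u)) t"
  by(rule eqI[OF l(1)[OF rsl[OF f]] lhom_comp[OF rsl[OF d(1)[OF ab(2)]] m_lin2[OF ab(1)]]]) (simp only: sp)
 show "lslice H f (tensor_mult H t (pr a b)) = lslice H (%u. f (u \<otimes> a)) t \<otimes> b"
  by(rule eqI[OF l(2)[OF lsl[OF f]] lhom_comp[OF lsl[OF d(2)[OF ab(1)]] m_lin1[OF ab(2)]]]) (simp only: sp)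
qed

subsection \<open>Group-like elements\<close>

lemma GL_D: assumes "g : GL" shows "g : car H" "g ~= \<zero>" "Del g = pr g g"
 using assms by(auto simp: GL_simps)

lemma GL_eps: "g : GL ==> eps g = 1"
proof -
 assume g: "g : GL"
 note D = GL_D[OF g]
 have e: "eps g \<odot> g = g" using L_pure[OF eps_lhom D(1,1,3)] L_eps[OF D(1)] by simp
 show ?thesis
 proof(rule ccontr)
  assume ne: "eps g ~= 1"
  have "(eps g - 1) \<odot> g = \<zero>" using vs_smult_l[OF Hv D(1), of "eps g" "-1"] e D(1) Hv by simp
  then have "(1 / (eps g - 1)) \<odot> ((eps g - 1) \<odot> g) = \<zero>" using Hv by simp
  then show False using ne D Hv by simp
 qed
qed

lemma GL_mult: assumes g: "g : GL" and h: "h : GL" shows "g \<otimes> h : GL"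
proof -
 note D = GL_D[OF g] and E = GL_D[OF h]
 have "eps (g \<otimes> h) = 1" using eps_mult[OF D(1) E(1)] GL_eps g h by simp
 then have "g \<otimes> h ~= \<zero>" using lhom_zero[OF eps_lhom Hv] by auto
 moreover have "Del (g \<otimes> h) = pr (g \<otimes> h) (g \<otimes> h)"
  using Del_mult[OF D(1) E(1)] tensor_mult_pure[OF D(1,1) E(1,1)] D(3) E(3) by simp
 ultimately show ?thesis using H_closed[OF D(1) E(1)] by(simp add: GL_simps)
qed

lemma GL_one: "\<one> : GL"
proof -
 have "\<one> ~= \<zero>" using eps_one lhom_zero[OF eps_lhom Hv] by auto
 then show ?thesis using H_one Del_one by(simp add: GL_simps)
qed

text \<open>The antipode gives a right inverse of \<open>g\<close> in \<open>H\<close> that is not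
  visibly group-like. It makes right multiplication by \<open>g\<close> injective on the finite set
  \<open>GL\<close>, hence surjective, and a preimage of \<open>1\<close> is a group-like left
  inverse.\<close>

lemma GL_group: "group (grouplikes H)"
proof(rule groupI)
 fix g assume g: "g : GL"
 note D = GL_D[OF g]
 obtain S where S: "S : lhom H H" "!!x. x : car H ==> class_ext H (%(a, b). a \<otimes> S b) (Del x) = eps x \<odot> \<one>"
  using hopf unfolding hopf_algebra_def by blast
 have Sg: "S g : car H" by(rule lhomD(1)[OF S(1) D(1)])
 have "bilin H H H (%a b. a \<otimes> S b)" by(rule bilin_precomp[OF H_mult lhom_id S(1)])
 then have gS: "g \<otimes> S g = \<one>"
  using S(2)[OF D(1)] cext_pure[OF Hv Hv Hv _ D(1,1), of "%a b. a \<otimes> S b"] D(3) GL_eps[OF g] Hv H_one by simp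
 have inj: "inj_on (%y. y \<otimes> g) GL"
 proof(rule inj_onI)
  fix y y' assume y: "y : GL" "y' : GL" "y \<otimes> g = y' \<otimes> g"
  then have "(y \<otimes> g) \<otimes> S g = (y' \<otimes> g) \<otimes> S g" by simp
  then show "y = y'" using GL_D(1)[OF y(1)] GL_D(1)[OF y(2)] by(simp add: H_assoc D(1) Sg gS H_r_one)
 qed
 have "(%y. y \<otimes> g) ` GL = GL"
  by(rule endo_inj_surj[OF finG _ inj]) (use GL_mult g in auto)
 then show "\<exists>y\<in>GL. y \<otimes>[grouplikes H] g = \<one>[grouplikes H]" using GL_one by(force simp: GL_simps(2,3))
qed (use GL_mult GL_one GL_D(1) H_assoc H_l_one in \<open>simp_all add: GL_simps(2,3)\<close>)

interpretation vectorspace CC H by(rule Hv)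

lemma cv_GL: "e : duals ==> f : duals ==> g : GL ==> cv e f g = e g * f g"
 using L_pure[OF _ GL_D(1,1,3)] lhomD(3)[of f H complex_mod g "e g"] GL_D(1) by(simp add: cv_def)

text \<open>If \<open>g\<close> were in the span of independent group-likes \<open>A\<close>, its
  coordinates would be orthogonal idempotents: the convolution of \<open>d a\<close> and
  \<open>d b\<close> agrees on \<open>A\<close> with \<open>d a\<close> or zero, hence also at
  \<open>g\<close>, where it is the product of the two values. So one coordinate is
  \<open>1\<close>, the others are \<open>0\<close>, and \<open>g\<close> lies in
  \<open>A\<close>.\<close>

lemma GL_lin_indpt: "lin_indpt GL"
proof -
 have "lin_indpt A" if "finite A" "A <= GL" for A
  using that
 proof(induction A rule: finite_induct)
  case empty
  show ?case by(rule lin_indpt_empty[OF Hv fd])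
 next
  case (insert g A)
  then have AG: "A <= GL" and g: "g : GL" and li: "lin_indpt A" by auto
  have AC: "A <= car H" using AG GL_D(1) by blast
  show ?case
  proof(rule ccontr)
   assume "\<not> lin_indpt (insert g A)"
   then have gA: "g : lspan H A"
    using lin_dep_iff_in_span[OF AC li GL_D(1)[OF g]] insert.hyps(2) by simp
   obtain B C d where B: "dual_basis H B d" "A <= C" "C <= B"
    using dual_basis_exists[OF Hv fd li AC carrier_subsp[OF Hv]] by blast
   note D = dual_basisD[OF B(1)]
   have AB: "A <= B" using B by auto
   have van: "f g = h g" if "f : duals" "h : duals" "!!a. a : A ==> f a = h a" for f h
    by(rule lhom_eqI[OF that(1,2) Hv cm_vs AC that(3) gA])
   have prod: "d a g * d b g = (if a = b then d a g else 0)" if ab: "a : A" "b : A" for a b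
   proof -
    have dd: "d a : duals" "d b : duals" using ab AB D(3) by auto
    have e: "cv (d a) (d b) c = (if a = b then d a c else 0)" if c: "c : A" for c
     unfolding cv_GL[OF dd subsetD[OF AG c]]
     using D(4)[OF subsetD[OF AB ab(1)] subsetD[OF AB c]] D(4)[OF subsetD[OF AB ab(2)] subsetD[OF AB c]] by auto
    show ?thesis
    proof(cases "a = b")
     case True
     then show ?thesis using van[OF cv_dual[OF dd] dd(1)] e cv_GL[OF dd g] by auto
    next
     case False
     have z: "(%_. 0) : duals" using lhom_0[OF cm_vs] by simp
     show ?thesis using False van[OF cv_dual[OF dd] z] e cv_GL[OF dd g] by auto
    qed
   qed
   have out: "d b g = 0" if b: "b : B - A" for b
   proof -
    have z: "(%_. 0) : duals" using lhom_0[OF cm_vs] by simp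
    show ?thesis by(rule van[OF D(3) z]) (use b AB D(4) in auto)
   qed
   have BC: "!!b. b : B ==> b : car H" using D(6) .
   have "\<exists>a\<in>A. d a g ~= 0"
   proof(rule ccontr)
    assume "\<not> (\<exists>a\<in>A. d a g ~= 0)"
    then have "d b g = 0" if "b : B" for b using out that by(cases "b : A") auto
    then have "finsum H (%b. d b g \<odot> b) B = \<zero>" by(intro fsum_zero[OF Hv]) (use BC Hv in simp)
    then show False using D(5)[OF GL_D(1)[OF g]] GL_D(2)[OF g] by simp
   qed
   then obtain a where a: "a : A" "d a g ~= 0" by auto
   have a1: "d a g = 1" using prod[OF a(1,1)] a(2) by simp
   have a0: "d b g = 0" if "b : B" "b ~= a" for b
   proof(cases "b : A")
    case True
    then show ?thesis using prod[OF a(1) True] a1 that by simp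
   qed (use out that in auto)
   have "finsum H (%b. d b g \<odot> b) B = d a g \<odot> a"
    by(rule fsum_single[OF Hv D(1)]) (use a AB a0 BC Hv in auto)
   then have "g = a" using D(5)[OF GL_D(1)[OF g]] a1 a AC Hv by auto
   then show False using a insert.hyps by simp
  qed
 qed
 then show ?thesis using finG by blast
qed

lemma span_single: "g : car H ==> lspan H {g} = {k \<odot> g | k. True}"
proof
 assume g: "g : car H"
 have "ssp {k \<odot> g | k. True} H"
 proof(rule subspaceI[OF Hv], goal_cases)
  case 2 show ?case using vs_smult_0[OF Hv g] by(metis (mono_tags, lifting) mem_Collect_eq)
 next
  case (3 x y) then show ?case using vs_smult_l[OF Hv g] by(smt (verit) mem_Collect_eq)
 next
  case (4 c x) then show ?case using vs_smult_smult[OF Hv g] by(smt (verit) mem_Collect_eq)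
 qed (use g Hv in auto)
 moreover have "{g} <= {k \<odot> g | k. True}" using vs_smult_1[OF Hv g] by(metis (mono_tags, lifting) mem_Collect_eq singletonD subsetI)
 ultimately show "lspan H {g} <= {k \<odot> g | k. True}" by(rule lspan_least[OF Hv])
 show "{k \<odot> g | k. True} <= lspan H {g}"
  using subspD(4)[OF lspan_subsp[OF Hv, of "{g}"]] lspan_sup[OF Hv, of "{g}"] g by auto
qed

lemma GL_simple: assumes g: "g : GL" shows "simple_subcoalgebra (lspan H {g}) H"
proof -
 note D = GL_D[OF g]
 have gC: "{g} <= car H" using D by simp
 note sp = lspan_subsp[OF Hv gC]
 note gs = lspan_sup[OF Hv gC]
 have tm: "pr g g : tensor_span H H (lspan H {g}) (lspan H {g})"
  by(rule tspan_mem[OF Hv Hv]) (use subspD(1)[OF sp] gs in auto)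
 note ts = tspan_subsp[OF Hv Hv subspD(1)[OF sp] subspD(1)[OF sp]]
 have "Del (k \<odot> g) : tensor_span H H (lspan H {g}) (lspan H {g})" for k
  unfolding lhomD(3)[OF Del_lhom D(1)] D(3) using subspD(4)[OF ts tm] .
 then have "subcoalgebra (lspan H {g}) H" unfolding subcoalgebra_def using sp by(auto simp: span_single[OF D(1)])
 moreover have "lspan H {g} ~= {\<zero>}" using gs D(2) by auto
 moreover have "E = {\<zero>} \<or> E = lspan H {g}" if E: "subcoalgebra E H" "E <= lspan H {g}" for E
 proof(cases "E <= {\<zero>}")
  case True
  then show ?thesis using E(1) subspD(2)[of E H] by(auto simp: subcoalgebra_def)
 next
  case False
  have Es: "ssp E H" using E(1) by(simp add: subcoalgebra_def)
  obtain x where x: "x : E" "x ~= \<zero>" using False by auto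
  then obtain k where k: "x = k \<odot> g" using E(2) by(auto simp: span_single[OF D(1)])
  then have "k ~= 0" using x Hv D(1) by auto
  then have "(1 / k) \<odot> x = g" using k Hv D(1) by simp
  then have "g : E" using subspD(4)[OF Es x(1), of "1 / k"] by simp
  then show ?thesis using lspan_least[OF Hv Es, of "{g}"] E(2) by auto
 qed
 ultimately show ?thesis by(auto simp: simple_subcoalgebra_def)
qed

text \<open>By pointedness \<open>C\<close> is a line, so \<open>\<Delta>(c)\<close> is a multiple
  \<open>k\<close> of \<open>c \<otimes> c\<close>. The counit axiom forces \<open>k\<close> to be
  nonzero, and rescaling to \<open>k c\<close> gives a group-like generator.\<close>

lemma simple_in_GL:
 assumes C: "simple_subcoalgebra C H"
 shows "C <= lspan H GL"
proof -
 have Cs: "ssp C H" "Del ` C <= tensor_span H H C C" "C ~= {\<zero>}"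
  using C by(auto simp: simple_subcoalgebra_def subcoalgebra_def)
 have dim: "vectorspace.fin_dim CC (H\<lparr>carrier := C\<rparr>)" "vectorspace.dim CC (H\<lparr>carrier := C\<rparr>) = 1"
  using ptd C by(auto simp: pointed_def)
 note CV = subsp_vs[OF Cs(1)]
 interpret C: vectorspace CC "H\<lparr>carrier := C\<rparr>" by(rule CV)
 obtain be where b: "finite be" "C.basis be" using C.finite_basis_exists[OF dim(1)] by auto
 have "card be = 1" using C.dim_basis[OF b] dim(2) by simp
 then obtain c where c: "be = {c}" by(auto simp: card_1_singleton_iff)
 have cC: "c : C" using b(2) c by(auto simp: C.basis_def)
 have all: "\<exists>k. x = k \<odot> c" if x: "x : C" for x
 proof -
  have s: "{c} <= car (H\<lparr>carrier := C\<rparr>)" using cC by simp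
  have "x : lspan (H\<lparr>carrier := C\<rparr>) {c}" using b(2) x by(auto simp: C.basis_def c)
  from CV s this show ?thesis
  proof(induction rule: lspan_induct)
   case zero
   have "\<zero> = 0 \<odot> c" using vs_smult_0[OF Hv, of c] subspD(6)[OF Cs(1) cC] by simp
   then show ?case by auto
  next
   case (add k s y)
   then obtain l where "y = l \<odot> c" by auto
   then have "k \<odot> c \<oplus> y = (k + l) \<odot> c" using vs_smult_l[OF Hv, of c k l] subspD(6)[OF Cs(1) cC] by simp
   then show ?case using add by auto
  qed
 qed
 have cH: "c : car H" using subspD(6)[OF Cs(1) cC] .
 have cn: "c ~= \<zero>"
 proof
  assume "c = \<zero>"
  then have "C <= {\<zero>}" using all Hv by auto
  then show False using Cs(3) cC by auto
 qed
 have "ssp {k \<odot>[HH] pr c c | k. True} HH"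
 proof(rule subspaceI[OF HHv], goal_cases)
  case 2 show ?case using vs_smult_0[OF HHv pr_closed[OF cH cH]] by(metis (mono_tags, lifting) mem_Collect_eq)
 next
  case (3 x y) then show ?case using vs_smult_l[OF HHv pr_closed[OF cH cH]] by(smt (verit) mem_Collect_eq)
 next
  case (4 k x) then show ?case using vs_smult_smult[OF HHv pr_closed[OF cH cH]] by(smt (verit) mem_Collect_eq)
 qed (use pr_closed[OF cH cH] HHv in auto)
 moreover have "pr a b : {k \<odot>[HH] pr c c | k. True}" if ab: "a : C" "b : C" for a b
 proof -
  obtain k l where "a = k \<odot> c" "b = l \<odot> c" using all[OF ab(1)] all[OF ab(2)] by auto
  then have "pr a b = (k * l) \<odot>[HH] pr c c"
   using cH Hv HHv pr_closed[OF cH cH] by(simp add: pure_smult_left[OF Hv Hv] pure_smult_right[OF Hv Hv] mult.commute)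
  then show ?thesis by blast
 qed
 ultimately have "Del c : {k \<odot>[HH] pr c c | k. True}"
  using tspan_least[OF Hv Hv, of _ C C "Del c"] Cs(2) cC by blast
 then obtain k where k: "Del c = k \<odot>[HH] pr c c" by blast
 have Dc: "Del c = pr (k \<odot> c) c" using k cH Hv by(simp add: pure_smult_left[OF Hv Hv])
 have "L eps c = eps (k \<odot> c) \<odot> c" by(rule L_pure[OF eps_lhom _ cH Dc]) (use cH Hv in simp)
 then have kn: "k ~= 0" using L_eps[OF cH] cn lhomD(3)[OF eps_lhom cH] cH Hv by auto
 have g: "k \<odot> c : GL"
 proof -
  have "k \<odot> c ~= \<zero>"
  proof
   assume "k \<odot> c = \<zero>"
   then have "(1 / k) \<odot> (k \<odot> c) = \<zero>" using Hv by simp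
   then show False using kn cn cH Hv by simp
  qed
  moreover have "Del (k \<odot> c) = pr (k \<odot> c) (k \<odot> c)"
   unfolding lhomD(3)[OF Del_lhom cH] Dc using cH Hv by(simp add: pure_smult_right[OF Hv Hv])
  ultimately show ?thesis using cH Hv by(simp add: GL_simps)
 qed
 show "C <= lspan H GL"
 proof
  fix x assume "x : C"
  then obtain l where "x = l \<odot> c" using all by blast
  then have "x = (l / k) \<odot> (k \<odot> c)" using kn cH Hv by simp
  moreover have GC: "GL <= car H" using GL_D(1) by auto
  ultimately show "x : lspan H GL"
   using subspD(4)[OF lspan_subsp[OF Hv GC]] lspan_sup[OF Hv GC] g by auto
 qed
qed

lemma GL_carrier: "GL <= car H" using GL_D(1) by auto

lemma coradical_eq: "coradical H = lspan H GL"
proof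
 have sub: "\<Union>{C. simple_subcoalgebra C H} <= lspan H GL" using simple_in_GL by auto
 then show "coradical H <= lspan H GL"
  unfolding coradical_def by(rule lspan_least[OF Hv lspan_subsp[OF Hv GL_carrier]])
 have GS: "GL <= \<Union>{C. simple_subcoalgebra C H}" using GL_simple lspan_sup[OF Hv] GL_D(1) by blast
 have SC: "\<Union>{C. simple_subcoalgebra C H} <= car H" using sub lspan_closed[OF Hv GL_carrier] by auto
 show "lspan H GL <= coradical H"
  unfolding coradical_def by(rule lspan_mono[OF Hv SC GS])
qed

end

section \<open>Skew-primitive elements and their eigenvalues\<close>

context fd_pointed
begin

interpretation vectorspace CC H by(rule Hv)

text \<open>The filtration shifted by one: \<open>F 0\<close> is zero, \<open>F 1\<close> the
  coradical, \<open>F (Suc n)\<close> the \<open>n\<close>-th term. With the zero space included,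
  slicing by \<open>J\<close> lowers the index uniformly; the shift also explains the
  \<open>- 1\<close> in \<open>F_mult\<close>.\<close>

abbreviation F where "F n \<equiv> corad_lower H n"
text \<open>The functionals that annihilate the coradical, that is, the Jacobson radical of the dual
  algebra.\<close>

definition J where "J = {f : duals. \<forall>g\<in>GL. f g = 0}"

lemma J_D: "f : J ==> f : duals" "f : J ==> g : GL ==> f g = 0"
 by(auto simp: J_def)

lemma F_0: "F 0 = {\<zero>}" and F_1: "F 1 = lspan H GL" and F_1': "F (Suc 0) = lspan H GL" and F_Suc: "F (Suc n) = corad_filt H n"
 by(simp_all add: corad_lower_def coradical_eq)

lemma ex_basis: "\<exists>B d. dual_basis H B d & GL <= B"
 using dual_basis_exists[OF Hv fd GL_lin_indpt GL_carrier carrier_subsp[OF Hv]] by blast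

text \<open>A basis containing all group-likes is fixed once and for all. Then \<open>dd g\<close>
  for a group-like \<open>g\<close> extracts the coefficient of \<open>g\<close>, and
  \<open>dd b\<close> for any other basis vector lies in \<open>J\<close>.\<close>

definition bas where "bas = (SOME Bd. dual_basis H (fst Bd) (snd Bd) & GL <= fst Bd)"
abbreviation BB where "BB \<equiv> fst bas"
abbreviation dd where "dd \<equiv> snd bas"

lemma BB: "dual_basis H BB dd" "GL <= BB"
 using someI_ex[of "%Bd. dual_basis H (fst Bd) (snd Bd) & GL <= fst Bd"] ex_basis
 unfolding bas_def by auto

lemmas BB_D = dual_basisD[OF BB(1)]

lemma dd_GL: "g : GL ==> dd g : duals" "g : GL ==> h : GL ==> dd g h = (if g = h then 1 else 0)"
 using BB_D(3,4) subsetD[OF BB(2), of g] subsetD[OF BB(2), of h] by simp_all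

lemma dd_J: "b : BB - GL ==> dd b : J"
 using BB_D(3,4) BB(2) by(auto simp: J_def)

lemma F_1_subspace: "ssp (F 1) H"
 unfolding F_1 by(rule lspan_subsp[OF Hv GL_carrier])
lemmas F_1_D = subspD[OF F_1_subspace]

lemma GL_F_1: "g : GL ==> g : F 1"
 unfolding F_1 using lspan_sup[OF Hv GL_carrier] by auto

lemma J_F_1: "f : J ==> x : F 1 ==> f x = 0"
 using lhom_eqI[OF J_D(1) lhom_0[OF cm_vs] Hv cm_vs GL_carrier, of f x] J_D(2)
 by(simp add: F_1')

lemma F_1_I: assumes x: "x : car H" and f: "!!f. f : J ==> f x = 0" shows "x : F 1"
proof -
 have "finsum H (%b. dd b x \<odot> b) BB : F 1"
 proof(rule subsp_fsum[OF F_1_subspace BB_D(1)], rule Pi_I)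
  fix b assume b: "b : BB"
  show "dd b x \<odot> b : F 1"
  proof(cases "b : GL")
   case True
   then show ?thesis using F_1_D(4) GL_F_1 by blast
  next
   case False
   then have "dd b x \<odot> b = \<zero>" using f[OF dd_J] b BB_D(6) Hv by simp
   then show ?thesis using F_1_D(2) by simp
  qed
 qed
 then show ?thesis using BB_D(5)[OF x] by simp
qed

text \<open>The coradical is the base of the filtration and not given by the wedge recursion. If all
  slices by \<open>J\<close> vanish, the counit gives \<open>f x = \<epsilon>(L f x) = 0\<close> for
  \<open>f \<in> J\<close>, and what \<open>J\<close> kills lies in \<open>F 1\<close>.\<close>

lemma F_step_F_1: "x : F 1 \<longleftrightarrow> x : car H & (\<forall>f\<in>J. L f x : F 0)"
proof
 assume x: "x : F 1"
 have "L f x = \<zero>" if f: "f : J" for f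
 proof(rule lhom_eqI[OF L_lhom[OF J_D(1)[OF f]] lhom_0[OF Hv] Hv Hv GL_carrier _ x[unfolded F_1]])
  fix g assume g: "g : GL"
  show "L f g = \<zero>" using L_pure[OF J_D(1)[OF f] GL_D(1)[OF g] GL_D(1)[OF g] GL_D(3)[OF g]] J_D(2)[OF f g] GL_D(1)[OF g] Hv by simp
 qed
 then show "x : car H & (\<forall>f\<in>J. L f x : F 0)" using F_1_D(6)[OF x] by(simp add: F_0)
next
 assume x: "x : car H & (\<forall>f\<in>J. L f x : F 0)"
 have "f x = 0" if f: "f : J" for f
 proof -
  have "cv f eps x = eps (L f x)" by(simp add: cv_def)
  also have "L f x = \<zero>" using x f by(auto simp: F_0)
  finally show ?thesis using cv_eq(2)[OF J_D(1)[OF f] eps_lhom] R_eps x lhom_zero[OF eps_lhom Hv] by simp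
 qed
 then show "x : F 1" using F_1_I x by auto
qed

text \<open>Slicing by \<open>f \<in> J\<close> kills \<open>F 1 \<otimes> H\<close> and sends
  \<open>H \<otimes> F (Suc n)\<close> into \<open>F (Suc n)\<close>. Conversely expand
  \<open>\<Delta>(x)\<close> along \<open>BB\<close>: terms with a group-like left factor lie in
  \<open>F 1 \<otimes> H\<close>, and the right factors of all others are slices by elements of
  \<open>J\<close>.\<close>

lemma F_step_aux:
 assumes S: "ssp (F (Suc n)) H"
 shows "x : F (Suc (Suc n)) \<longleftrightarrow> x : car H & (\<forall>f\<in>J. L f x : F (Suc n))"
proof -
 note SD = subspD[OF S]
 have F1c: "F 1 <= car H" using F_1_D(1) .
 note t1 = tspan_subsp[OF Hv Hv subset_refl SD(1)]
 note t2 = tspan_subsp[OF Hv Hv F1c subset_refl]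
 note ts = subspace_set_add[OF t1 t2]
 have mem: "x : F (Suc (Suc n)) \<longleftrightarrow> x : car H & Del x : tensor_span H H (car H) (F (Suc n)) <+>\<^bsub>HH\<^esub> tensor_span H H (F 1) (car H)"
  by(simp add: F_Suc F_1 coradical_eq)
 show ?thesis
 proof
  assume x: "x : F (Suc (Suc n))"
  then obtain t u where tu: "t : tensor_span H H (car H) (F (Suc n))" "u : tensor_span H H (F 1) (car H)" "Del x = t \<oplus>[HH] u"
   unfolding mem mem_set_add by blast
  have "L f x : F (Suc n)" if f: "f : J" for f
  proof -
   note fl = lsl[OF J_D(1)[OF f]]
   have 1: "lslice H f t : F (Suc n)"
    by(rule tspan_img[OF Hv Hv subset_refl SD(1) fl S _ tu(1)])
     (use SD(4,6) lsp[OF J_D(1)[OF f]] in simp)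
   have 2: "lslice H f u : {\<zero>}"
    by(rule tspan_img[OF Hv Hv F1c subset_refl fl zero_subsp[OF Hv] _ tu(2)])
     (use lsp[OF J_D(1)[OF f] F_1_D(6)] J_F_1[OF f] Hv in simp)
   have "L f x = lslice H f t \<oplus> lslice H f u"
    unfolding L_def tu(3) by(rule lhomD(2)[OF fl]) (use tu subspD(6)[OF t1] subspD(6)[OF t2] in auto)
   then show ?thesis using 1 2 SD(2,3) by auto
  qed
  then show "x : car H & (\<forall>f\<in>J. L f x : F (Suc n))" using x mem by auto
 next
  assume x: "x : car H & (\<forall>f\<in>J. L f x : F (Suc n))"
  have "finsum HH (%b. pr b (lslice H (dd b) (Del x))) BB : tensor_span H H (car H) (F (Suc n)) <+>\<^bsub>HH\<^esub> tensor_span H H (F 1) (car H)"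
  proof(rule subsp_fsum[OF ts BB_D(1)], rule Pi_I)
   fix b assume b: "b : BB"
   show "pr b (lslice H (dd b) (Del x)) : tensor_span H H (car H) (F (Suc n)) <+>\<^bsub>HH\<^esub> tensor_span H H (F 1) (car H)"
   proof(cases "b : GL")
    case True
    have "pr b (L (dd b) x) : tensor_span H H (F 1) (car H)"
     by(rule tspan_mem[OF Hv Hv F1c subset_refl GL_F_1[OF True]]) (use x L_closed BB_D(3) b in auto)
    moreover have "pr b (L (dd b) x) = \<zero>[HH] \<oplus>[HH] pr b (L (dd b) x)"
     using pr_closed[OF BB_D(6)[OF b] L_closed[OF BB_D(3)[OF b]]] x HHv by simp
    ultimately show ?thesis unfolding mem_set_add L_def using subspD(2)[OF t1] by blast
   next
    case False
    then have "dd b : J" using b dd_J by auto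
    then have "pr b (L (dd b) x) : tensor_span H H (car H) (F (Suc n))"
     by(intro tspan_mem[OF Hv Hv subset_refl SD(1) BB_D(6)[OF b]]) (use x in auto)
    moreover have "pr b (L (dd b) x) = pr b (L (dd b) x) \<oplus>[HH] \<zero>[HH]"
     using pr_closed[OF BB_D(6)[OF b] L_closed[OF BB_D(3)[OF b]]] x HHv by simp
    ultimately show ?thesis unfolding mem_set_add L_def using subspD(2)[OF t2] by blast
   qed
  qed
  then show "x : F (Suc (Suc n))"
   using tensor_expand_left[OF Hv Hv BB(1) Del_closed] x unfolding mem by simp
 qed
qed

lemma F_subspace: "ssp (F n) H"
proof(induction n)
 case 0 show ?case unfolding F_0 by(rule zero_subsp[OF Hv])
next
 case (Suc n)
 show ?case
 proof(cases n)
  case 0 then show ?thesis using F_1_subspace by simp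
 next
  case (Suc m)
  note S = Suc.IH[unfolded Suc] and ld = L_lhom[OF J_D(1)]
  note SD = subspD[OF S]
  show ?thesis unfolding Suc
  proof(rule subspaceI[OF Hv], goal_cases)
   case 1 show ?case using F_step_aux[OF S] by auto
  next
   case 2 show ?case using F_step_aux[OF S] lhom_zero[OF ld Hv Hv] SD(2) Hv by auto
  next
   case (3 x y) then show ?case using F_step_aux[OF S] lhomD(2)[OF ld] SD(3) Hv by auto
  next
   case (4 c x) then show ?case using F_step_aux[OF S] lhomD(3)[OF ld] SD(4) Hv by auto
  qed
 qed
qed

lemmas F_D = subspD[OF F_subspace]

lemma F_step: "x : F (Suc n) \<longleftrightarrow> x : car H & (\<forall>f\<in>J. L f x : F n)"
 using F_step_F_1 F_step_aux[OF F_subspace] by(cases n) auto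

lemma F_L: "f : J ==> x : F (Suc n) ==> L f x : F n" using F_step by blast

lemma cv_J: "e : duals ==> f : J ==> cv e f : J"
 using cv_dual cv_GL by(auto simp: J_def)

text \<open>Slices compose to convolutions, \<open>L f (L e x) = L (cv e f) x\<close>, and
  \<open>J\<close> absorbs convolution with \<open>e\<close>, so the membership test for
  \<open>L e x\<close> is part of the one for \<open>x\<close>.\<close>

lemma F_L': assumes e: "e : duals" and x: "x : F n" shows "L e x : F n"
proof(cases n)
 case 0
 then show ?thesis using x lhom_zero[OF L_lhom[OF e] Hv Hv] by(simp add: F_0)
next
 case (Suc m)
 have xc: "x : car H" using F_D(6)[OF x] .
 show ?thesis unfolding Suc F_step
  using L_closed[OF e xc] L_L[OF e J_D(1) xc] F_L[OF cv_J[OF e]] x Suc by simp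
qed

lemma F_R': "e : duals ==> x : F n ==> R e x : F n"
proof(induction n arbitrary: x)
 case 0
 then show ?case using lhom_zero[OF R_lhom Hv Hv] by(simp add: F_0)
next
 case (Suc m)
 have xc: "x : car H" using F_D(6)[OF Suc.prems(2)] .
 show ?case unfolding F_step
  using R_closed[OF Suc.prems(1) xc] L_R[OF J_D(1) Suc.prems(1) xc] Suc.IH[OF Suc.prems(1) F_L[OF _ Suc.prems(2)]] by simp
qed

lemma F_mono: "m <= n ==> F m <= F n"
proof(rule lift_Suc_mono_le[of F])
 show "F n <= F (Suc n)" for n
 proof(induction n)
  case 0 then show ?case using F_D(2) by(simp add: F_0)
 next
  case (Suc n)
  then show ?case using F_step by blast
 qed
qed

text \<open>Group-likes are closed under products, so translation by a group-like keeps a functional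
  zero on \<open>GL\<close>; linearity extends this to \<open>a\<close> in their span.\<close>

lemma shift_J: "f : J ==> a : F 1 ==> (%u. f (a \<otimes> u)) : J"
proof -
 assume f: "f : J" and a: "a : F 1"
 have "f (a \<otimes> h) = 0" if h: "h : GL" for h
  by(rule lhom_eqI[OF shift_dual'[OF J_D(1)[OF f] GL_D(1)[OF h]] lhom_0[OF cm_vs] Hv cm_vs
     GL_carrier _ a[unfolded F_1], simplified]) (use J_D(2)[OF f GL_mult] h in auto)
 then show ?thesis using shift_dual[OF J_D(1)[OF f] F_1_D(6)[OF a]] by(simp add: J_def)
qed

lemma L_mult:
 assumes f: "f : duals" and x: "x : car H" and y: "y : car H"
 shows "L f (x \<otimes> y) = finsum H (%b. L (dd b) x \<otimes> L (%u. f (b \<otimes> u)) y) BB"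
proof -
 have tm: "(%t. lslice H f (tensor_mult H t (Del y))) : lhom HH H"
  by(rule lhom_comp[OF bilinD(2)[OF tmult_bilin Del_closed[OF y]] lsl[OF f]])
 have c: "pr b (L (dd b) x) : car HH" if "b : BB" for b
  using pr_closed[OF BB_D(6) L_closed[OF BB_D(3) x]] that by simp
 have "L f (x \<otimes> y) = lslice H f (tensor_mult H (finsum HH (%b. pr b (L (dd b) x)) BB) (Del y))"
  unfolding L_def Del_mult[OF x y] using tensor_expand_left[OF Hv Hv BB(1) Del_closed[OF x]] by simp
 also have "... = finsum H (%b. lslice H f (tensor_mult H (pr b (L (dd b) x)) (Del y))) BB"
  by(rule lhom_fsum[OF tm HHv Hv BB_D(1)]) (use c in auto)
 also have "... = finsum H (%b. L (dd b) x \<otimes> L (%u. f (b \<otimes> u)) y) BB"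
  unfolding L_def[of "%u. f (_ \<otimes> u)"]
  by(rule fsum_cong[OF Hv refl])
   (use lslice_tensor_mult[OF f BB_D(6) L_closed[OF BB_D(3) x] Del_closed[OF y]] H_closed L_closed[OF BB_D(3) x]
    lhomD(1)[OF lsl[OF shift_dual[OF f BB_D(6)]] Del_closed[OF y]] in auto)
 finally show ?thesis .
qed

text \<open>Induction by the slice test. In the expansion of \<open>L f (x \<otimes> y)\<close> over
  \<open>BB\<close>, a group-like \<open>b'\<close> leaves a functional of \<open>J\<close> to slice
  \<open>y\<close>, so the index of \<open>y\<close> drops; any other \<open>b'\<close> has
  \<open>dd b' \<in> J\<close>, so that of \<open>x\<close> drops. Either way \<open>a + b\<close>
  decreases.\<close>

lemma F_mult: "x : F a ==> y : F b ==> x \<otimes> y : F (a + b - 1)"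
proof(induction "a + b" arbitrary: a b x y rule: less_induct)
 case less
 have xc: "x : car H" and yc: "y : car H" using less.prems F_D(6) by auto
 have z: "\<zero> \<otimes> y = \<zero>" "x \<otimes> \<zero> = \<zero>"
  using lhom_zero[OF m_lin1[OF yc] Hv Hv] lhom_zero[OF m_lin2[OF xc] Hv Hv] by auto
 show ?case
 proof(cases "a = 0 \<or> b = 0")
  case True
  then show ?thesis using less.prems z F_D(2) by(auto simp: F_0)
 next
  case False
  then obtain k l where kl: "a = Suc k" "b = Suc l" by(metis not0_implies_Suc)
  have "L f (x \<otimes> y) : F (k + l)" if f: "f : J" for f
   unfolding L_mult[OF J_D(1)[OF f] xc yc]
  proof(rule subsp_fsum[OF F_subspace BB_D(1)], rule Pi_I)
   fix b' assume b: "b' : BB"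
   have shd: "(%u. f (b' \<otimes> u)) : duals" by(rule shift_dual[OF J_D(1)[OF f] BB_D(6)[OF b]])
   show "L (dd b') x \<otimes> L (%u. f (b' \<otimes> u)) y : F (k + l)"
   proof(cases "b' : GL")
    case True
    have "L (%u. f (b' \<otimes> u)) y : F l"
     by(rule F_L[OF shift_J[OF f GL_F_1[OF True]]]) (use less.prems kl in auto)
    then show ?thesis using less.hyps[of a l "L (dd b') x"] F_L'[OF BB_D(3)[OF b] less.prems(1)] kl by simp
   next
    case False
    then have "L (dd b') x : F k" using F_L[OF dd_J] b less.prems(1) kl by auto
    then show ?thesis using less.hyps[of k b "L (dd b') x"] F_L'[OF shd less.prems(2)] kl by simp
   qed
  qed
  then show ?thesis using H_closed[OF xc yc] kl F_step by simp
 qed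
qed

lemma F_mult': "x : F a ==> y : F b ==> a + b <= Suc c ==> x \<otimes> y : F c"
 using F_mult[of x a y b] F_mono[of "a + b - 1" c] by(simp add: subset_iff)

subsection \<open>Congruence modulo the filtration\<close>

text \<open>Congruence modulo \<open>F d\<close>. Skew-primitivity and eigenvalue equations hold
  only up to lower terms, and in this form they can still be calculated with.\<close>

definition eqv where "eqv d a b \<longleftrightarrow> a : car H & b : car H & a \<oplus> (-1) \<odot> b : F d"

lemma eqv_D: "eqv d a b ==> a : car H" "eqv d a b ==> b : car H" "eqv d a b ==> a \<oplus> (-1) \<odot> b : F d"
 by(simp_all add: eqv_def)

lemma eqv_refl: "a : car H ==> eqv d a a"
 using F_D(2) Hv by(simp add: eqv_def)

lemma eqvI: "a = b \<oplus> r ==> b : car H ==> r : F d ==> eqv d a b"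
 using F_D(6)[of r d] Hv by(simp add: eqv_def vs_comm[of H b r] vs_assoc)

lemma eqv_E: assumes "eqv d a b" obtains r where "r : F d" "a = b \<oplus> r"
 using eqv_D[OF assms] vs_add_diff[OF Hv, of a b] by metis

lemma eqv_lhom: assumes g: "g : lhom H H" "!!u. u : F d ==> g u : F e" and ab: "eqv d a b" shows "eqv e (g a) (g b)"
proof -
 from ab obtain r where r: "r : F d" "a = b \<oplus> r" by(rule eqv_E)
 show ?thesis
  by(rule eqvI[of _ _ "g r"]) (use r g(2) lhomD(1,2)[OF g(1)] eqv_D(2)[OF ab] F_D(6) in auto)
qed

lemma eqv_add: assumes ab: "eqv d a b" and cd: "eqv d a' b'" shows "eqv d (a \<oplus> a') (b \<oplus> b')"
proof -
 obtain r where r: "r : F d" "a = b \<oplus> r" using ab by(rule eqv_E)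
 obtain r' where r': "r' : F d" "a' = b' \<oplus> r'" using cd by(rule eqv_E)
 show ?thesis
  by(rule eqvI[of _ _ "r \<oplus> r'"])
   (use r r' eqv_D(2)[OF ab] eqv_D(2)[OF cd] F_D(3,6) Hv in \<open>auto simp: vs_assoc vs_lcomm\<close>)
qed

lemma eqv_trans [trans]: assumes ab: "eqv d a b" and bc: "eqv d b c" shows "eqv d a c"
proof -
 obtain r where r: "r : F d" "a = b \<oplus> r" using ab by(rule eqv_E)
 obtain r' where r': "r' : F d" "b = c \<oplus> r'" using bc by(rule eqv_E)
 show ?thesis
  by(rule eqvI[of _ _ "r' \<oplus> r"]) (use r r' eqv_D(2)[OF bc] F_D(3,6) Hv in \<open>auto simp: vs_assoc\<close>)
qed

lemma eqv_sym: assumes ab: "eqv d a b" shows "eqv d b a"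
proof -
 obtain r where r: "r : F d" "a = b \<oplus> r" using ab by(rule eqv_E)
 show ?thesis
  by(rule eqvI[of _ _ "(-1) \<odot> r"]) (use r eqv_D[OF ab] F_D(4,6) Hv in \<open>auto simp: vs_assoc\<close>)
qed

lemma eqv_mem: "eqv d a b ==> a : F d \<longleftrightarrow> b : F d"
 by(metis eqv_D(3) eqv_E eqv_sym F_D(3))

lemma eqv_drop: "a : car H ==> r : F d ==> eqv d (a \<oplus> r) a"
 by(rule eqvI) auto

lemma eqv_smult: "eqv d a b ==> eqv d (c \<odot> a) (c \<odot> b)"
 by(rule eqv_lhom[OF lhom_smult[OF lhom_id Hv]]) (use F_D(4) in auto)

lemma eqv_left: "x : F k ==> eqv d a b ==> k + d <= Suc e ==> eqv e (x \<otimes> a) (x \<otimes> b)"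
 by(rule eqv_lhom[OF m_lin2]) (use F_mult' F_D(6) in auto)

lemma eqv_right: "x : F k ==> eqv d a b ==> d + k <= Suc e ==> eqv e (a \<otimes> x) (b \<otimes> x)"
 by(rule eqv_lhom[OF m_lin1]) (use F_mult' F_D(6) in auto)

lemma eqv_L: "f : J ==> eqv (Suc d) a b ==> eqv d (L f a) (L f b)"
 by(rule eqv_lhom[OF L_lhom[OF J_D(1)]]) (use F_L in auto)

lemma eqv_GL_left: "g : GL ==> eqv 1 a b ==> eqv 1 (g \<otimes> a) (g \<otimes> b)"
 by(rule eqv_left[OF GL_F_1]) auto

lemma eqv_GL_right: "g : GL ==> eqv 1 a b ==> eqv 1 (a \<otimes> g) (b \<otimes> g)"
 by(rule eqv_right[OF GL_F_1]) auto

lemma J_eqv: assumes f: "f : J" and ab: "eqv 1 a b" shows "f a = f b"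
proof -
 obtain r where r: "r : F 1" "a = b \<oplus> r" using ab by(rule eqv_E)
 show ?thesis using lhomD(2)[OF J_D(1)[OF f] eqv_D(2)[OF ab] F_D(6)[OF r(1)]] J_F_1[OF f r(1)] r(2) by simp
qed

subsection \<open>Group inverses and powers\<close>

abbreviation gi where "gi g \<equiv> inv\<^bsub>grouplikes H\<^esub> g"

lemma GL_inv: assumes "g : GL" shows "gi g : GL" "g \<otimes> gi g = \<one>" "gi g \<otimes> g = \<one>"
 using group.inv_closed[OF GL_group assms] group.r_inv[OF GL_group assms] group.l_inv[OF GL_group assms]
 by(simp_all only: GL_simps(2,3))

definition pw where "pw z n = (((\<otimes>) z) ^^ n) \<one>"

lemma pw_simps [simp]: "pw z 0 = \<one>" "pw z (Suc n) = z \<otimes> pw z n"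
 by(simp_all add: pw_def)

lemma pw_closed: "z : car H ==> pw z n : car H"
 by(induction n) (use H_one H_closed in auto)

lemma pw_GL: assumes g: "g : GL" shows "pw g n = g [^]\<^bsub>grouplikes H\<^esub> n" "pw g n : GL" "pw g (card GL) = \<one>" "pw g n \<otimes> g = g \<otimes> pw g n"
proof -
 interpret G: group "grouplikes H" by(rule GL_group)
 show 1: "pw g n = g [^]\<^bsub>grouplikes H\<^esub> n" for n
 proof(induction n)
  case (Suc n)
  then show ?case using G.nat_pow_Suc2[OF g, of n] by(simp only: pw_simps GL_simps(2))
 qed (simp add: GL_simps(3))
 show "pw g n : GL" unfolding 1 by(rule G.nat_pow_closed[OF g])
 show "pw g (card GL) = \<one>" unfolding 1 using G.pow_order_eq_1[OF g] by(simp only: Coset.order_def GL_simps(3))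
 show "pw g n \<otimes> g = g \<otimes> pw g n"
  unfolding 1 using G.nat_pow_Suc2[OF g, of n] G.nat_pow_Suc[of g n] by(simp only: GL_simps(2))
qed

lemma card_GL: "0 < card GL" using finG GL_one by(auto simp: card_gt_0_iff)

subsection \<open>Skew-primitive elements modulo the coradical\<close>

text \<open>The skew-primitive equation holds only up to an error \<open>r\<close> in the tensor
  square of the coradical. That much is true for every lift of a homogeneous element of the diagram
  in degree one, so no better lift has to be found.\<close>

definition skew where
 "skew s x \<longleftrightarrow> s : GL & x : car H &
  (\<exists>r\<in>tensor_span H H (F 1) (F 1). Del x = pr s x \<oplus>[HH] (pr x \<one> \<oplus>[HH] r))"

lemma skew_D: "skew s x ==> s : GL" "skew s x ==> x : car H" "skew s x ==> s : car H"
 using GL_D(1) by(auto simp: skew_def)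

lemmas ts11 = tspan_subsp[OF Hv Hv F_1_D(1) F_1_D(1)]

text \<open>Consequences of \<open>skew\<close> are drawn by applying a linear map under which the
  error term lands in a negligible subspace \<open>N\<close>.\<close>

lemma skew_apply:
 assumes x: "skew s x" and Phi: "Phi : lhom HH X" and X: "vsp X" and N: "ssp N X"
  and F: "!!a c. a : F 1 ==> c : F 1 ==> Phi (pr a c) : N"
 obtains r where "r : N" "Phi (Del x) = Phi (pr s x) \<oplus>[X] (Phi (pr x \<one>) \<oplus>[X] r)"
proof -
 obtain r where r: "r : tensor_span H H (F 1) (F 1)" "Del x = pr s x \<oplus>[HH] (pr x \<one> \<oplus>[HH] r)"
  using x by(auto simp: skew_def)
 have "Phi r : N" by(rule tspan_img[OF Hv Hv F_1_D(1) F_1_D(1) Phi N F r(1)])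
 moreover have "Phi (Del x) = Phi (pr s x) \<oplus>[X] (Phi (pr x \<one>) \<oplus>[X] Phi r)"
  unfolding r(2) using pr_closed skew_D(2,3)[OF x] H_one subspD(6)[OF ts11 r(1)] HHv by(simp add: lhomD(2)[OF Phi])
 ultimately show ?thesis using that by blast
qed

text \<open>The slice of \<open>x \<otimes> 1\<close> is a multiple of \<open>1\<close> and the
  error slices into the coradical, so only the term from \<open>s \<otimes> x\<close>
  survives.\<close>

lemma skew_L:
 assumes x: "skew s x" and e: "e : duals"
 shows "eqv 1 (L e x) (e s \<odot> x)"
proof -
 note xs = skew_D(2,3)[OF x]
 note le = lsp[OF e]
 obtain r where r: "r : F 1" "L e x = lslice H e (pr s x) \<oplus> (lslice H e (pr x \<one>) \<oplus> r)"
  using skew_apply[OF x lsl[OF e] Hv F_1_subspace] le F_1_D(4,6) unfolding L_def by metis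
 show ?thesis
  by(rule eqvI[of _ _ "e x \<odot> \<one> \<oplus> r"]) (use r le xs H_one Hv F_1_D(3,4) GL_F_1[OF GL_one] in auto)
qed

text \<open>Here the slice of \<open>s \<otimes> x\<close> is a multiple of the group-like
  \<open>s\<close>, so the term from \<open>x \<otimes> 1\<close> survives.\<close>

lemma skew_R:
 assumes x: "skew s x" and e: "e : duals"
 shows "eqv 1 (R e x) (e \<one> \<odot> x)"
proof -
 note xs = skew_D(2,3)[OF x]
 note le = rsp[OF e]
 obtain r where r: "r : F 1" "R e x = rslice H e (pr s x) \<oplus> (rslice H e (pr x \<one>) \<oplus> r)"
  using skew_apply[OF x rsl[OF e] Hv F_1_subspace] le F_1_D(4,6) unfolding R_def by metis
 have rc: "r : car H" using r(1) F_1_D(6) by blast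
 show ?thesis
  by(rule eqvI[of _ _ "e x \<odot> s \<oplus> r"])
   (use r(2) le xs H_one Hv rc F_1_D(3)[OF F_1_D(4)[OF GL_F_1[OF skew_D(1)[OF x]]] r(1)] in \<open>auto simp: vs_lcomm\<close>)
qed

lemma R_GL_right: "e : duals ==> g : GL ==> x : car H ==> R e (x \<otimes> g) = R (%u. e (u \<otimes> g)) x \<otimes> g"
 unfolding R_def using Del_mult[of x g] GL_D[of g] rslice_tensor_mult_right[of e g g "Del x"] Del_closed[of x] by simp

lemma R_GL_left: "e : duals ==> g : GL ==> x : car H ==> R e (g \<otimes> x) = g \<otimes> R (%u. e (g \<otimes> u)) x"
 unfolding R_def using Del_mult[of g x] GL_D[of g] rslice_tensor_mult_left[of e g g "Del x"] Del_closed[of x] by simp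

text \<open>Modulo the coradical \<open>k x g\<close> has right degree \<open>k g\<close>; this is
  what a right-invariant functional is built from.\<close>

lemma skew_R_GL:
 assumes x: "skew s x" and e: "e : duals" and k: "k : GL" and g: "g : GL"
 shows "eqv 1 (R e (k \<otimes> x \<otimes> g)) (e (k \<otimes> g) \<odot> (k \<otimes> x \<otimes> g))"
proof -
 note xs = skew_D(2)[OF x] and kg = GL_D(1)[OF k] GL_D(1)[OF g]
 let ?e = "%u. e (k \<otimes> u \<otimes> g)"
 have ed: "?e : duals" by(rule shift_dual[OF shift_dual'[OF e kg(2)] kg(1)])
 have "R e (k \<otimes> x \<otimes> g) = R (%u. e (u \<otimes> g)) (k \<otimes> x) \<otimes> g" by(rule R_GL_right[OF e g H_closed[OF kg(1) xs]])
 also have "... = k \<otimes> R ?e x \<otimes> g" by(subst R_GL_left[OF shift_dual'[OF e kg(2)] k xs]) simp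
 finally have 1: "R e (k \<otimes> x \<otimes> g) = k \<otimes> R ?e x \<otimes> g" .
 have "eqv 1 (k \<otimes> R ?e x \<otimes> g) (k \<otimes> (?e \<one> \<odot> x) \<otimes> g)"
  by(rule eqv_GL_right[OF g eqv_GL_left[OF k skew_R[OF x ed]]])
 also have "k \<otimes> (?e \<one> \<odot> x) \<otimes> g = e (k \<otimes> g) \<odot> (k \<otimes> x \<otimes> g)"
  using lhomD(3)[OF m_lin2[OF kg(1)] xs] lhomD(3)[OF m_lin1[OF kg(2)] H_closed[OF kg(1) xs]] H_r_one[OF kg(1)] by simp
 finally show ?thesis unfolding 1 .
qed

lemma skew_F_2: assumes x: "skew s x" shows "x : F 2"
proof -
 have "L f x : F 1" if f: "f : J" for f
 proof -
  have "e0 \<odot> x : F 1" if "e0 = 0" for e0 using that skew_D(2)[OF x] Hv F_1_D(2) by simp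
  then show ?thesis using eqv_mem[OF skew_L[OF x J_D(1)[OF f]]] J_D(2)[OF f skew_D(1)[OF x]] by blast
 qed
 then show ?thesis using F_step[of x 1] skew_D(2)[OF x] by(simp add: numeral_2_eq_2)
qed

text \<open>Conjugation by \<open>h\<close> acts on \<open>H \<otimes> H\<close> as conjugation by
  \<open>h \<otimes> h\<close>, which preserves the tensor square of the coradical and fixes the
  \<open>1\<close> in \<open>x \<otimes> 1\<close>.\<close>

lemma skew_conj:
 assumes x: "skew s x" and h: "h : GL"
 shows "skew (h \<otimes> s \<otimes> gi h) (h \<otimes> x \<otimes> gi h)"
proof -
 note xs = skew_D(2,3)[OF x] and hc = GL_D(1)[OF h] and hi = GL_inv[OF h]
 note ic = GL_D(1)[OF hi(1)]
 define Psi where "Psi t = tensor_mult H (tensor_mult H (pr h h) t) (pr (gi h) (gi h))" for t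
 have Psi: "Psi : lhom HH HH" unfolding Psi_def[abs_def]
  by(rule lhom_comp[OF bilinD(1)[OF tmult_bilin pr_closed[OF hc hc]] bilinD(2)[OF tmult_bilin pr_closed[OF ic ic]]])
 have Psip: "Psi (pr a c) = pr (h \<otimes> a \<otimes> gi h) (h \<otimes> c \<otimes> gi h)" if "a : car H" "c : car H" for a c
  unfolding Psi_def using that by(simp only: tensor_mult_pure hc ic H_closed)
 have F: "h \<otimes> a \<otimes> gi h : F 1" if "a : F 1" for a
  by(rule F_mult'[OF F_mult'[OF GL_F_1[OF h] that] GL_F_1[OF hi(1)], of 1]) auto
 obtain r where r: "r : tensor_span H H (F 1) (F 1)" "Psi (Del x) = Psi (pr s x) \<oplus>[HH] (Psi (pr x \<one>) \<oplus>[HH] r)"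
  by(rule skew_apply[OF x Psi HHv ts11])
   (use Psip F_1_D(6) tspan_mem[OF Hv Hv F_1_D(1) F_1_D(1) F F] in auto)
 have "Del (h \<otimes> x \<otimes> gi h) = Psi (Del x)"
  unfolding Psi_def Del_mult[OF H_closed[OF hc xs(1)] ic] Del_mult[OF hc xs(1)] GL_D(3)[OF h] GL_D(3)[OF hi(1)] ..
 also have "... = pr (h \<otimes> s \<otimes> gi h) (h \<otimes> x \<otimes> gi h) \<oplus>[HH] (pr (h \<otimes> x \<otimes> gi h) \<one> \<oplus>[HH] r)"
  unfolding r(2) using Psip xs H_one hi(2) H_r_one[OF hc] by simp
 finally show ?thesis
  unfolding skew_def using GL_mult[OF GL_mult[OF h skew_D(1)[OF x]] hi(1)] H_closed[OF H_closed[OF hc xs(1)] ic] r(1) by blast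
qed

text \<open>A twisted Leibniz rule: the summands \<open>x \<otimes> 1\<close> and
  \<open>s \<otimes> x\<close> of \<open>\<Delta>(x)\<close> give the two terms. For an error
  \<open>a \<otimes> c\<close> the functional \<open>f\<close> translated by \<open>a\<close> is
  still in \<open>J\<close>, so its slice of \<open>w\<close> drops into \<open>F n\<close>.\<close>

lemma L_skew_mult:
 assumes x: "skew s x" and f: "f : J" and w: "w : F (Suc n)"
 shows "eqv n (L f (x \<otimes> w)) (L (%u. f (x \<otimes> u)) w \<oplus> x \<otimes> L (%u. f (s \<otimes> u)) w)"
proof -
 note xs = skew_D(2,3)[OF x] and wc = F_D(6)[OF w] and fd = J_D(1)[OF f]
 note wD = Del_closed[OF wc]
 define Phi where "Phi t = lslice H f (tensor_mult H t (Del w))" for t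
 have Phi: "Phi : lhom HH H" unfolding Phi_def[abs_def]
  by(rule lhom_comp[OF bilinD(2)[OF tmult_bilin wD] lsl[OF fd]])
 have Phip: "Phi (pr a c) = c \<otimes> L (%u. f (a \<otimes> u)) w" if "a : car H" "c : car H" for a c
  unfolding Phi_def L_def using lslice_tensor_mult[OF fd that wD] .
 have Lc: "L (%u. f (a \<otimes> u)) w : car H" if "a : car H" for a
  by(rule L_closed[OF shift_dual[OF fd that] wc])
 obtain r where r: "r : F n" "Phi (Del x) = Phi (pr s x) \<oplus> (Phi (pr x \<one>) \<oplus> r)"
 proof(rule skew_apply[OF x Phi Hv F_subspace[of n]])
  fix a c assume ac: "a : F 1" "c : F 1"
  have "L (%u. f (a \<otimes> u)) w : F n" by(rule F_L[OF shift_J[OF f ac(1)] w])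
  then show "Phi (pr a c) : F n" unfolding Phip[OF F_1_D(6)[OF ac(1)] F_1_D(6)[OF ac(2)]]
   by(rule F_mult'[OF ac(2)]) simp
 qed auto
 have "L f (x \<otimes> w) = Phi (Del x)" by(simp add: L_def Phi_def Del_mult[OF xs(1) wc])
 then have "L f (x \<otimes> w) = L (%u. f (x \<otimes> u)) w \<oplus> x \<otimes> L (%u. f (s \<otimes> u)) w \<oplus> r"
  unfolding r(2) using Phip xs H_one H_l_one Lc H_closed F_D(6)[OF r(1)] Hv by(simp add: vs_assoc vs_lcomm)
 then show ?thesis
  by(rule eqvI) (use r Lc xs H_closed Hv in auto)
qed

lemma LR_lincomb:
 assumes "f : duals" "g : duals" "h : duals" "!!u. u : car H ==> h u = f u + c * g u" "w : car H"
 shows L_lincomb: "L h w = L f w \<oplus> c \<odot> L g w" and R_lincomb: "R h w = R f w \<oplus> c \<odot> R g w"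
proof -
 note e = tensor_eqI[OF Hv Hv _ _ Hv Del_closed[OF assms(5)]]
 show "L h w = L f w \<oplus> c \<odot> L g w" unfolding L_def
  by(rule e[OF lsl[OF assms(3)] lhom_add[OF lsl[OF assms(1)] lhom_smult[OF lsl[OF assms(2)] Hv] Hv]])
   (use assms(1-4) Hv in \<open>simp add: lsp vs_smult_l\<close>)
 show "R h w = R f w \<oplus> c \<odot> R g w" unfolding R_def
  by(rule e[OF rsl[OF assms(3)] lhom_add[OF rsl[OF assms(1)] lhom_smult[OF rsl[OF assms(2)] Hv] Hv]])
   (use assms(1-4) Hv in \<open>simp add: rsp vs_smult_l\<close>)
qed

text \<open>With a well-chosen \<open>f\<close> both translated functionals are known: translation
  by \<open>s\<close> multiplies \<open>f\<close> by \<open>q\<close>, and translation by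
  \<open>x\<close> agrees on group-likes with \<open>c\<close> times the counit, so the difference
  is in \<open>J\<close> and contributes lower terms only. What remains is the rule of a
  \<open>q\<close>-derivation with value \<open>c\<close> at \<open>x\<close>.\<close>

lemma L_skew:
 assumes x: "skew s x" and f: "f : J" and xg: "!!g. g : GL ==> f (x \<otimes> g) = c"
  and su: "!!u. u : car H ==> f (s \<otimes> u) = q * f u" and w: "w : F (Suc n)"
 shows "eqv n (L f (x \<otimes> w)) (c \<odot> w \<oplus> q \<odot> (x \<otimes> L f w))"
proof -
 note xs = skew_D(2,3)[OF x] and wc = F_D(6)[OF w] and fd = J_D(1)[OF f]
 define k where "k u = f (x \<otimes> u) - c * eps u" for u
 have kd: "k : duals"
  by(rule lhom_cong[OF lhom_add[OF shift_dual[OF fd xs(1)] lhom_smult[OF eps_lhom cm_vs, of "-c"] cm_vs] Hv])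
   (simp add: k_def)
 have kJ: "k : J" using kd xg GL_eps by(simp add: J_def k_def)
 have "L (%u. f (x \<otimes> u)) w = L k w \<oplus> c \<odot> L eps w"
  by(rule L_lincomb[OF kd eps_lhom shift_dual[OF fd xs(1)] _ wc]) (simp add: k_def)
 then have 1: "eqv n (L (%u. f (x \<otimes> u)) w) (c \<odot> w)"
  by(intro eqvI[OF _ _ F_L[OF kJ w]]) (use L_eps[OF wc] L_closed[OF kd wc] Hv wc in \<open>simp_all add: vs_comm\<close>)
 have "L (%u. f (s \<otimes> u)) w = L f w \<oplus> (q - 1) \<odot> L f w"
  by(rule L_lincomb[OF fd fd shift_dual[OF fd xs(2)] _ wc]) (simp add: su algebra_simps)
 also have "... = q \<odot> L f w" using vs_smult_l[OF Hv L_closed[OF fd wc], of 1 "q - 1"] L_closed[OF fd wc] Hv by simp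
 finally have 2: "x \<otimes> L (%u. f (s \<otimes> u)) w = q \<odot> (x \<otimes> L f w)"
  using lhomD(3)[OF m_lin2[OF xs(1)] L_closed[OF fd wc]] by simp
 have c: "q \<odot> (x \<otimes> L f w) : car H" using H_closed[OF xs(1) L_closed[OF fd wc]] Hv by simp
 show ?thesis using eqv_trans[OF L_skew_mult[OF x f w] eqv_add[OF _ eqv_refl]] 1 c unfolding 2 by blast
qed

end

section \<open>Excluding every eigenvalue other than \<open>-1\<close>\<close>

context fd_pointed
begin

interpretation vectorspace CC H by(rule Hv)

lemma GL_cancel: "k : GL ==> y : car H ==> gi k \<otimes> (k \<otimes> y) = y"
 using GL_inv[of k] GL_D(1) by(simp add: H_assoc[symmetric] H_l_one)

lemma skew_pw:
 assumes x: "skew s x" and q: "eqv 1 (s \<otimes> x) (q \<odot> (x \<otimes> s))"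
 shows "eqv 1 (pw s k \<otimes> x) (q ^ k \<odot> (x \<otimes> pw s k))"
proof(induction k)
 case 0
 then show ?case using skew_D(2)[OF x] Hv by(simp add: H_l_one H_r_one eqv_refl)
next
 case (Suc k)
 note xs = skew_D(2,3)[OF x] and sG = skew_D(1)[OF x]
 note pk = pw_GL(2)[OF sG, of k]
 note pc = GL_D(1)[OF pk]
 have "pw s (Suc k) \<otimes> x = s \<otimes> (pw s k \<otimes> x)" using xs pc by(simp add: H_assoc)
 also have "eqv 1 ... (s \<otimes> (q ^ k \<odot> (x \<otimes> pw s k)))" by(rule eqv_GL_left[OF sG Suc])
 also have "s \<otimes> (q ^ k \<odot> (x \<otimes> pw s k)) = q ^ k \<odot> (s \<otimes> x \<otimes> pw s k)"
  using lhomD(3)[OF m_lin2[OF xs(2)] H_closed[OF xs(1) pc]] H_assoc[OF xs(2,1) pc] by simp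
 also have "eqv 1 ... (q ^ k \<odot> (q \<odot> (x \<otimes> s) \<otimes> pw s k))" by(rule eqv_smult[OF eqv_GL_right[OF pk q]])
 also have "q ^ k \<odot> (q \<odot> (x \<otimes> s) \<otimes> pw s k) = q ^ Suc k \<odot> (x \<otimes> pw s (Suc k))"
  using lhomD(3)[OF m_lin1[OF pc] H_closed[OF xs]] H_assoc[OF xs pc] H_closed xs pc Hv by(simp add: mult.commute)
 finally show ?case .
qed

text \<open>The power \<open>card GL\<close> of \<open>s\<close> is \<open>1\<close>, so
  \<open>x\<close> is congruent to \<open>q ^ card GL\<close> times itself, although it is nonzero
  modulo \<open>F 1\<close>.\<close>

lemma skew_root_of_unity:
 assumes x: "skew s x" "x \<notin> F 1" and q: "eqv 1 (s \<otimes> x) (q \<odot> (x \<otimes> s))"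
 shows "q ^ card GL = 1"
proof(rule ccontr)
 assume ne: "q ^ card GL ~= 1"
 let ?Q = "q ^ card GL"
 note xs = skew_D(2)[OF x(1)]
 have "eqv 1 x (?Q \<odot> x)"
  using skew_pw[OF x(1) q, of "card GL"] xs by(simp add: pw_GL(3)[OF skew_D(1)[OF x(1)]] H_l_one H_r_one)
 then have "x \<oplus> (-1) \<odot> (?Q \<odot> x) : F 1" by(rule eqv_D)
 moreover have "x \<oplus> (-1) \<odot> (?Q \<odot> x) = (1 - ?Q) \<odot> x" using vs_smult_l[OF Hv xs, of 1 "- ?Q"] xs Hv by simp
 ultimately have "(1 / (1 - ?Q)) \<odot> ((1 - ?Q) \<odot> x) : F 1" using F_1_D(4) by simp
 then show False using x(2) ne xs Hv by simp
qed

text \<open>The functional \<open>alp\<close> is obtained from a functional \<open>a\<close> that detects \<open>x\<close> by making it right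
 invariant under the group and averaging it over the powers of \<open>s\<close>.\<close>

lemma skew_functional:
 assumes x: "skew s x" "x \<notin> F 1" and q: "eqv 1 (s \<otimes> x) (q \<odot> (x \<otimes> s))"
 shows "\<exists>alp\<in>J. (\<forall>g\<in>GL. alp (x \<otimes> g) = 1) & (\<forall>u\<in>car H. alp (s \<otimes> u) = q * alp u) &
  (\<forall>t y. \<forall>g\<in>GL. skew t y --> t ~= s --> alp (y \<otimes> g) = 0)"
proof -
 note xs = skew_D(2,3)[OF x(1)] and sG = skew_D(1)[OF x(1)]
 define N where "N = card GL"
 have qN: "q ^ N = 1" using skew_root_of_unity[OF x q] by(simp add: N_def)
 have N0: "N > 0" using card_GL by(simp add: N_def)
 have q0: "q ~= 0" using qN N0 by(metis power_0_left zero_neq_one not_gr0)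
 obtain f where f: "f : J" "f x ~= 0" using F_1_I[OF xs(1)] x(2) by blast
 define a0 where "a0 u = f u / f x" for u
 have a0: "a0 : J"
  using lhom_cong[OF lhom_smult[OF J_D(1)[OF f(1)] cm_vs, of "1 / f x"] Hv, of a0] J_D(2)[OF f(1)]
  by(simp add: J_def a0_def)
 have a0x: "a0 x = 1" using f(2) by(simp add: a0_def)
 \<comment> \<open>Convolution with \<open>dd s\<close> restricts to degree \<open>s\<close>: by
   \<open>skew_L\<close> the value on a skew element of degree \<open>t\<close> is multiplied by
   \<open>dd s t\<close>.\<close>
 define a where "a = cv (dd s) a0"
 have aJ: "a : J" unfolding a_def by(rule cv_J[OF dd_GL(1)[OF sG] a0])
 have ad: "a : duals" using J_D(1)[OF aJ] .
 have a_skew: "a y = (if t = s then a0 y else 0)" if y: "skew t y" for t y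
 proof -
  have "a y = a0 (dd s t \<odot> y)" unfolding a_def cv_def by(rule J_eqv[OF a0 skew_L[OF y dd_GL(1)[OF sG]]])
  also have "... = dd s t * a0 y" using lhomD(3)[OF J_D(1)[OF a0] skew_D(2)[OF y]] by simp
  finally show ?thesis using dd_GL(2)[OF sG skew_D(1)[OF y]] by(cases "t = s") auto
 qed
 \<comment> \<open>Makes the functional independent of a right group-like factor: on
   \<open>k y g\<close> the slice by \<open>dd h\<close> selects \<open>h = k g\<close>, and
   multiplication by its inverse leaves \<open>k y k^-1\<close>, whatever \<open>g\<close>
   is.\<close>
 define alp1 where "alp1 u = (\<Sum>h\<in>GL. a (R (dd h) u \<otimes> gi h))" for u
 have alp1: "alp1 : duals"
 proof -
  have "(%u. finsum complex_mod (%h. a (R (dd h) u \<otimes> gi h)) GL) : duals"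
   by(rule lhom_finsum[OF finG _ cm_vs],
     rule lhom_comp[OF lhom_comp[OF R_lhom[OF dd_GL(1)] m_lin1[OF GL_D(1)[OF GL_inv(1)]]] ad])
  then show ?thesis by(simp add: alp1_def[abs_def] complex_mod_finsum[OF finG])
 qed
 have alp1G: "alp1 g = 0" if g: "g : GL" for g
 proof -
  have "a (R (dd h) g \<otimes> gi h) = 0" if h: "h : GL" for h
   by(rule J_F_1[OF aJ F_mult'[OF F_R'[OF dd_GL(1)[OF h] GL_F_1[OF g]] GL_F_1[OF GL_inv(1)[OF h]]]]) simp
  then show ?thesis by(simp add: alp1_def)
 qed
 have alp1_skew: "alp1 (k \<otimes> y \<otimes> g) = a (k \<otimes> y \<otimes> gi k)" if y: "skew t y" and k: "k : GL" and g: "g : GL" for t y k g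
 proof -
  note yc = skew_D(2)[OF y] and kg = GL_mult[OF k g] and kc = GL_D(1)[OF k] and gc = GL_D(1)[OF g]
  let ?v = "k \<otimes> y \<otimes> g"
  have vc: "?v : car H" using yc kc gc H_closed by simp
  have tm: "a (R (dd h) ?v \<otimes> gi h) = (if h = k \<otimes> g then a (?v \<otimes> gi h) else 0)" if h: "h : GL" for h
  proof -
   note hic = GL_D(1)[OF GL_inv(1)[OF h]]
   have "a (R (dd h) ?v \<otimes> gi h) = a (dd h (k \<otimes> g) \<odot> ?v \<otimes> gi h)"
    by(rule J_eqv[OF aJ eqv_GL_right[OF GL_inv(1)[OF h] skew_R_GL[OF y dd_GL(1)[OF h] k g]]])
   also have "... = dd h (k \<otimes> g) * a (?v \<otimes> gi h)"
    using lhomD(3)[OF m_lin1[OF hic] vc] lhomD(3)[OF ad H_closed[OF vc hic]] by simp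
   finally show ?thesis using dd_GL(2)[OF h kg] by(cases "h = k \<otimes> g") auto
  qed
  have "alp1 ?v = (\<Sum>h\<in>GL. if h = k \<otimes> g then a (?v \<otimes> gi h) else 0)" unfolding alp1_def by(rule sum.cong[OF refl tm])
  also have "... = a (?v \<otimes> gi (k \<otimes> g))" using kg finG by(simp add: sum.delta')
  also have "gi (k \<otimes> g) = gi g \<otimes> gi k"
   using group.inv_mult_group[OF GL_group k g] by(simp only: GL_simps(2))
  also have "?v \<otimes> (gi g \<otimes> gi k) = k \<otimes> y \<otimes> gi k"
   using yc kc gc GL_D(1)[OF GL_inv(1)[OF g]] GL_D(1)[OF GL_inv(1)[OF k]] GL_inv(2)[OF g] H_closed
   by(metis H_assoc H_l_one)
  finally show ?thesis .
 qed
 \<comment> \<open>The weight \<open>q^-k\<close> is chosen so that translation by \<open>s\<close>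
   shifts the sum and multiplies it by \<open>q\<close>; since \<open>q ^ N = 1\<close> and the
   \<open>N\<close>-th power of \<open>s\<close> is \<open>1\<close>, the shift closes up
   cyclically.\<close>
 define c where "c u k = (1 / q) ^ k * alp1 (pw s k \<otimes> u)" for u k
 define alp where "alp u = 1 / of_nat N * (\<Sum>k<N. c u k)" for u
 have cd: "(%u. c u k) : duals" for k
 proof -
  have "(%u. (1 / q) ^ k \<odot>[complex_mod] alp1 (pw s k \<otimes> u)) : duals"
   by(rule lhom_smult[OF shift_dual[OF alp1 pw_closed[OF xs(2)]] cm_vs])
  then show ?thesis by(simp add: c_def[abs_def])
 qed
 have alpd: "alp : duals"
 proof -
  have "(%u. (1 / of_nat N) \<odot>[complex_mod] finsum complex_mod (c u) {..<N}) : duals"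
   by(rule lhom_smult[OF lhom_finsum[OF _ cd cm_vs] cm_vs]) simp
  then show ?thesis by(simp add: alp_def[abs_def])
 qed
 have "alp g = 0" if g: "g : GL" for g
 proof -
  have "c g k = 0" for k using alp1G[OF GL_mult[OF pw_GL(2)[OF sG] g]] by(simp add: c_def)
  then show ?thesis by(simp add: alp_def)
 qed
 then have alpJ: "alp : J" using alpd by(simp add: J_def)
 have cs: "c (y \<otimes> g) k = (1 / q) ^ k * a (pw s k \<otimes> y \<otimes> gi (pw s k))" if "skew t y" "g : GL" for t y g k
  unfolding c_def using alp1_skew[OF that(1) pw_GL(2)[OF sG] that(2), of k]
   H_assoc[OF pw_closed[OF xs(2)] skew_D(2)[OF that(1)] GL_D(1)[OF that(2)]] by simp
 \<comment> \<open>Powers of \<open>s\<close> commute with \<open>s\<close>, so conjugation by them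
   never turns another degree into \<open>s\<close>.\<close>
 have comm: "pw s k \<otimes> t \<otimes> gi (pw s k) = s \<longleftrightarrow> t = s" if t: "t : GL" for k t
 proof
  note pk = pw_GL(2)[OF sG, of k]
  note pc = GL_D(1)[OF pk] and ic = GL_D(1)[OF GL_inv(1)[OF pk]] and tc = GL_D(1)[OF t]
  note sk = pw_GL(4)[OF sG, of k]
  { assume "t = s"
   then show "pw s k \<otimes> t \<otimes> gi (pw s k) = s"
    using sk H_assoc[OF xs(2) pc ic] GL_inv(2)[OF pk] H_r_one[OF xs(2)] by simp }
  assume e: "pw s k \<otimes> t \<otimes> gi (pw s k) = s"
  have "pw s k \<otimes> t = pw s k \<otimes> t \<otimes> gi (pw s k) \<otimes> pw s k"
   using H_assoc[OF H_closed[OF pc tc] ic pc] GL_inv(3)[OF pk] H_r_one[OF H_closed[OF pc tc]] by simp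
  also have "... = pw s k \<otimes> s" using e sk by simp
  finally have "gi (pw s k) \<otimes> (pw s k \<otimes> t) = gi (pw s k) \<otimes> (pw s k \<otimes> s)" by simp
  then show "t = s" using GL_cancel[OF pk tc] GL_cancel[OF pk xs(2)] by simp
 qed
 have A1: "alp (x \<otimes> g) = 1" if g: "g : GL" for g
 proof -
  have "c (x \<otimes> g) k = 1" for k
  proof -
   note pk = pw_GL(2)[OF sG, of k]
   note pc = GL_D(1)[OF pk] and ic = GL_D(1)[OF GL_inv(1)[OF pk]]
   have "a (pw s k \<otimes> x \<otimes> gi (pw s k)) = a (q ^ k \<odot> (x \<otimes> pw s k) \<otimes> gi (pw s k))"
    by(rule J_eqv[OF aJ eqv_GL_right[OF GL_inv(1)[OF pk] skew_pw[OF x(1) q]]])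
   also have "q ^ k \<odot> (x \<otimes> pw s k) \<otimes> gi (pw s k) = q ^ k \<odot> x"
    using lhomD(3)[OF m_lin1[OF ic] H_closed[OF xs(1) pc]] H_assoc[OF xs(1) pc ic] GL_inv(2)[OF pk] H_r_one[OF xs(1)] by simp
   also have "a (q ^ k \<odot> x) = q ^ k" using lhomD(3)[OF ad xs(1)] a_skew[OF x(1)] a0x by simp
   finally show ?thesis using cs[OF x(1) g, of k] q0 by(simp add: power_one_over)
  qed
  then show ?thesis using N0 by(simp add: alp_def)
 qed
 have A0: "alp (y \<otimes> g) = 0" if y: "skew t y" "t ~= s" and g: "g : GL" for t y g
 proof -
  have "c (y \<otimes> g) k = 0" for k
   using cs[OF y(1) g] a_skew[OF skew_conj[OF y(1) pw_GL(2)[OF sG]]] comm[OF skew_D(1)[OF y(1)]] y(2) by simp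
  then show ?thesis by(simp add: alp_def)
 qed
 have As: "alp (s \<otimes> u) = q * alp u" if u: "u : car H" for u
 proof -
  have c1: "c (s \<otimes> u) k = q * c u (Suc k)" for k
  proof -
   have "pw s k \<otimes> (s \<otimes> u) = pw s (Suc k) \<otimes> u"
    using H_assoc[OF pw_closed[OF xs(2)] xs(2) u, of k] pw_GL(4)[OF sG, of k] by simp
   then show ?thesis using q0 by(simp add: c_def)
  qed
  have "c u N = c u 0" using qN pw_GL(3)[OF sG] by(simp add: c_def N_def power_one_over)
  moreover have "(\<Sum>k<N. c u k) + c u N = c u 0 + (\<Sum>k<N. c u (Suc k))"
   using sum.lessThan_Suc_shift[of "c u" N] by(simp add: add.commute)
  ultimately have "(\<Sum>k<N. c u (Suc k)) = (\<Sum>k<N. c u k)" by simp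
  then have "(\<Sum>k<N. c (s \<otimes> u) k) = q * (\<Sum>k<N. c u k)" unfolding c1 by(simp add: sum_distrib_left[symmetric])
  then show ?thesis by(simp add: alp_def)
 qed
 show ?thesis using alpJ A1 A0 As by blast
qed

text \<open>A strict inclusion in every block of \<open>k\<close> steps makes \<open>li_rank\<close>
  grow without bound, while the rank of \<open>H\<close> itself bounds it.\<close>

lemma no_strict_chain:
 assumes k: "k \<ge> 1" and ne: "!!n. F (k * n) ~= F (Suc (k * n))"
 shows False
proof -
 have lt: "li_rank H (F (k * n)) < li_rank H (F (k * Suc n))" for n
 proof(rule li_rank_strict[OF Hv fd F_subspace F_subspace F_mono])
  have "F (k * n) <= F (Suc (k * n))" "F (Suc (k * n)) <= F (k * Suc n)" using k by(auto intro!: F_mono)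
  then show "F (k * n) ~= F (k * Suc n)" using ne[of n] by blast
 qed simp
 have ge: "n <= li_rank H (F (k * n))" for n
 proof(induction n)
  case (Suc n) then show ?case using lt[of n] by simp
 qed simp
 have le: "li_rank H (F m) <= li_rank H (car H)" for m
  using li_rank_strict[OF Hv fd F_subspace[of m] carrier_subsp[OF Hv] F_D(1)] by(cases "F m = car H") (auto simp: less_imp_le)
 show False using ge[of "Suc (li_rank H (car H))"] le[of "k * Suc (li_rank H (car H))"] by linarith
qed

lemma one_notin_F_0: "\<one> \<notin> F 0" using GL_D(2)[OF GL_one] by(simp add: F_0)

text \<open>For \<open>q = 1\<close> the slice by the special functional is an ordinary derivation
  modulo lower terms, so it sends \<open>x^(n+1)\<close> to \<open>(n+1) x^n\<close>. In
  characteristic zero the factor is invertible, and no power of \<open>x\<close> can drop in the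
  filtration.\<close>

lemma skew_eigenvalue_ne_1:
 assumes x: "skew s x" "x \<notin> F 1" and q: "eqv 1 (s \<otimes> x) (1 \<odot> (x \<otimes> s))"
 shows False
proof -
 note xs = skew_D(2,3)[OF x(1)]
 have "\<exists>alp\<in>J. (\<forall>g\<in>GL. alp (x \<otimes> g) = 1) & (\<forall>u\<in>car H. alp (s \<otimes> u) = 1 * alp u)"
  using skew_functional[OF x q] by blast
 then obtain alp where alp: "alp : J" "!!g. g : GL ==> alp (x \<otimes> g) = 1" "!!u. u : car H ==> alp (s \<otimes> u) = 1 * alp u" by blast
 have pF: "pw x n : F (Suc n)" for n
 proof(induction n)
  case 0 then show ?case using GL_F_1[OF GL_one] by simp
 next
  case (Suc n) then show ?case using F_mult'[OF skew_F_2[OF x(1)] Suc] by simp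
 qed
 have pc: "pw x n : car H" for n by(rule pw_closed[OF xs(1)])
 have D: "eqv n (L alp (pw x (Suc n))) (of_nat (Suc n) \<odot> pw x n)" for n
 proof(induction n)
  case 0
  have "eqv 0 (L alp (x \<otimes> \<one>)) (1 \<odot> \<one> \<oplus> 1 \<odot> (x \<otimes> L alp \<one>))"
   by(rule L_skew[OF x(1) alp]) (use pF[of 0] in simp_all)
  moreover have "L alp \<one> = \<zero>" using F_L[OF alp(1), of \<one> 0] pF[of 0] by(simp add: F_0)
  ultimately show ?case using H_one Hv lhom_zero[OF m_lin2[OF xs(1)] Hv Hv] by simp
 next
  case (Suc n)
  let ?w = "pw x (Suc n)"
  have "eqv (Suc n) (L alp (x \<otimes> ?w)) (1 \<odot> ?w \<oplus> 1 \<odot> (x \<otimes> L alp ?w))"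
   by(rule L_skew[OF x(1) alp pF]) auto
  also have "eqv (Suc n) ... (1 \<odot> ?w \<oplus> 1 \<odot> (x \<otimes> (of_nat (Suc n) \<odot> pw x n)))"
   by(rule eqv_add[OF eqv_smult[OF eqv_refl[OF pc]] eqv_smult[OF eqv_left[OF skew_F_2[OF x(1)] Suc]]]) simp
  also have "1 \<odot> ?w \<oplus> 1 \<odot> (x \<otimes> (of_nat (Suc n) \<odot> pw x n)) = of_nat (Suc (Suc n)) \<odot> ?w"
   using lhomD(3)[OF m_lin2[OF xs(1)] pc] pc[of "Suc n"] vs_smult_l[OF Hv pc[of "Suc n"], of 1 "of_nat (Suc n)"] Hv by simp
  finally show ?case by simp
 qed
 have "pw x n \<notin> F n" for n
 proof(induction n)
  case 0 then show ?case using one_notin_F_0 by simp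
 next
  case (Suc n)
  show ?case
  proof
   assume "pw x (Suc n) : F (Suc n)"
   then have "of_nat (Suc n) \<odot> pw x n : F n" using eqv_mem[OF D] F_L[OF alp(1)] by blast
   then have "(1 / of_nat (Suc n)) \<odot> (of_nat (Suc n) \<odot> pw x n) : F n" using F_D(4) by blast
   moreover have "(1 / of_nat (Suc n)) \<odot> (of_nat (Suc n) \<odot> pw x n) = pw x n"
    using pc[of n] Hv by(simp del: of_nat_Suc)
   ultimately show False using Suc by simp
  qed
 qed
 then have "F (1 * n) ~= F (Suc (1 * n))" for n using pF[of n] by auto
 then show False using no_strict_chain[of 1] by auto
qed

text \<open>For \<open>q ~= 1\<close> and \<open>s\<^sup>-\<^sup>1 = h s h\<^sup>-\<^sup>1\<close> put \<open>y = h x h\<^sup>-\<^sup>1\<close> and \<open>z = x y - q\<^sup>-\<^sup>1 y x\<close>. The skew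
 derivations \<open>D\<close> and \<open>E\<close> belonging to \<open>x\<close> and \<open>y\<close> satisfy \<open>E D z\<^sup>n \<equiv> n (1 - q\<^sup>-\<^sup>2) z\<^bsup>n-1\<^esup>\<close>, so no
 power of \<open>z\<close> drops in the filtration.\<close>

lemma skew_pair:
 assumes x: "skew s x" "x \<notin> F 1" and q: "eqv 1 (s \<otimes> x) (q \<odot> (x \<otimes> s))"
  and y: "skew t y" "y \<notin> F 1" and p: "eqv 1 (t \<otimes> y) (q \<odot> (y \<otimes> t))"
  and st: "s ~= t" "s \<otimes> t = \<one>" and q2: "q * q ~= 1"
 shows False
proof -
 note xs = skew_D(2,3)[OF x(1)] and ys = skew_D(2,3)[OF y(1)]
 have q0: "q ~= 0" using skew_root_of_unity[OF x q] card_GL by(metis power_0_left zero_neq_one not_gr0)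
 define p' where "p' = 1 / q"
 have pq: "p' * q = 1" "q * p' = 1" using q0 by(simp_all add: p'_def)
 \<comment> \<open>Each functional detects its own element and, because the degrees \<open>s\<close>
   and \<open>t\<close> differ, kills the other one times any group-like.\<close>
 obtain alp where alp: "alp : J" "!!g. g : GL ==> alp (x \<otimes> g) = 1" "!!u. u : car H ==> alp (s \<otimes> u) = q * alp u"
  and alpy: "!!g. g : GL ==> alp (y \<otimes> g) = 0"
  using skew_functional[OF x q] y(1) st(1) by metis
 obtain be where be: "be : J" "!!g. g : GL ==> be (y \<otimes> g) = 1" "!!u. u : car H ==> be (t \<otimes> u) = q * be u"
  and bex: "!!g. g : GL ==> be (x \<otimes> g) = 0"
  using skew_functional[OF y p] x(1) st(1) by metis
 have ts: "t \<otimes> s = \<one>"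
 proof -
  have "gi s = t" using st(2) GL_cancel[OF skew_D(1)[OF x(1)] ys(2)] GL_D(1)[OF GL_inv(1)[OF skew_D(1)[OF x(1)]]] H_r_one by simp
  then show ?thesis using GL_inv(3)[OF skew_D(1)[OF x(1)]] by simp
 qed
 \<comment> \<open>Translation by \<open>t\<close>, the inverse of \<open>s\<close>, has the inverse
   eigenvalue \<open>p'\<close>.\<close>
 have alpt: "alp (t \<otimes> u) = p' * alp u" if u: "u : car H" for u
 proof -
  have "alp u = q * alp (t \<otimes> u)"
   using alp(3)[OF H_closed[OF ys(2) u]] H_assoc[OF xs(2) ys(2) u] st(2) H_l_one[OF u] by simp
  then show ?thesis using q0 by(simp add: p'_def)
 qed
 have bes: "be (s \<otimes> u) = p' * be u" if u: "u : car H" for u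
 proof -
  have "be u = q * be (s \<otimes> u)"
   using be(3)[OF H_closed[OF xs(2) u]] H_assoc[OF ys(2) xs(2) u] ts H_l_one[OF u] by simp
  then show ?thesis using q0 by(simp add: p'_def)
 qed
 define D where "D = L alp"
 define E where "E = L be"
 note Dl = L_lhom[OF J_D(1)[OF alp(1)], folded D_def] and El = L_lhom[OF J_D(1)[OF be(1)], folded E_def]
 \<comment> \<open>The coefficient \<open>- p'\<close> is forced by \<open>E\<close>: in
   \<open>Z\<close> below, the term with \<open>b - p'\<close> disappears for \<open>be\<close>,
   whose eigenvalue is \<open>b = p'\<close>. Hence \<open>E\<close> commutes with left
   multiplication by \<open>z\<close> up to lower terms.\<close>
 define z where "z = x \<otimes> y \<oplus> (- p') \<odot> (y \<otimes> x)"
 have xy: "x \<otimes> y : F 3" "y \<otimes> x : F 3"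
  by(rule F_mult'[OF skew_F_2[OF x(1)] skew_F_2[OF y(1)]], simp, rule F_mult'[OF skew_F_2[OF y(1)] skew_F_2[OF x(1)]], simp)
 have zF: "z : F 3" unfolding z_def using xy F_D(3,4) by blast
 have zc: "z : car H" using F_D(6)[OF zF] .
 have zw: "z \<otimes> w = x \<otimes> (y \<otimes> w) \<oplus> (- p') \<odot> (y \<otimes> (x \<otimes> w))" if w: "w : car H" for w
 proof -
  have "z \<otimes> w = (x \<otimes> y) \<otimes> w \<oplus> (- p') \<odot> ((y \<otimes> x) \<otimes> w)"
   unfolding z_def using lhomD(2,3)[OF m_lin1[OF w]] H_closed[OF xs(1) ys(1)] H_closed[OF ys(1) xs(1)] Hv by simp
  then show ?thesis using H_assoc[OF xs(1) ys(1) w] H_assoc[OF ys(1) xs(1) w] by simp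
 qed
 have mlin: "b \<otimes> (c \<odot> a) = c \<odot> (b \<otimes> a)" "b \<otimes> (a \<oplus> a') = b \<otimes> a \<oplus> b \<otimes> a'"
  if "a : car H" "b : car H" "a' : car H" for a a' b c
  using lhomD(2,3)[OF m_lin2[OF that(2)]] that by simp_all
 \<comment> \<open>One computation for both functionals: \<open>a\<close> and \<open>a'\<close> are
   the values at \<open>x\<close> and \<open>y\<close>, \<open>b\<close> and \<open>b'\<close> the
   eigenvalues under \<open>s\<close> and \<open>t\<close>. \<open>L_skew\<close> is applied twice
   to each of the two products in \<open>z\<close>.\<close>
 have Z: "eqv (Suc n) (L f (z \<otimes> w)) (z \<otimes> L f w \<oplus> ((a * (1 - p' * b')) \<odot> (y \<otimes> w) \<oplus> (a' * (b - p')) \<odot> (x \<otimes> w)))"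
  if f: "f : J" and fx: "!!g. g : GL ==> f (x \<otimes> g) = a" and fy: "!!g. g : GL ==> f (y \<otimes> g) = a'"
   and fs: "!!u. u : car H ==> f (s \<otimes> u) = b * f u" and ft: "!!u. u : car H ==> f (t \<otimes> u) = b' * f u"
   and bb: "b * b' = 1" "b' * b = 1" and w: "w : F (Suc n)" for f a a' b b' w n
 proof -
  note wc = F_D(6)[OF w] and fx = L_skew[OF x(1) f fx fs] and fy = L_skew[OF y(1) f fy ft]
  note lf = L_lhom[OF J_D(1)[OF f]]
  note fw = lhomD(1)[OF lf wc]
  have xw: "x \<otimes> w : F (Suc (Suc n))" and yw: "y \<otimes> w : F (Suc (Suc n))"
   using F_mult'[OF skew_F_2[OF x(1)] w] F_mult'[OF skew_F_2[OF y(1)] w] by simp_all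
  note cl = H_closed[OF xs(1)] H_closed[OF ys(1)]
  define A B C E where "A = y \<otimes> w" and "B = x \<otimes> w" and "C = x \<otimes> (y \<otimes> L f w)" and "E = y \<otimes> (x \<otimes> L f w)"
  have ABC: "A : car H" "B : car H" "C : car H" "E : car H" using cl wc fw by(simp_all add: A_def B_def C_def E_def)
  have "eqv (Suc n) (L f (x \<otimes> (y \<otimes> w))) (a \<odot> (y \<otimes> w) \<oplus> b \<odot> (x \<otimes> L f (y \<otimes> w)))" by(rule fx[OF _ _ yw]) auto
  also have "eqv (Suc n) ... (a \<odot> (y \<otimes> w) \<oplus> b \<odot> (x \<otimes> (a' \<odot> w \<oplus> b' \<odot> (y \<otimes> L f w))))"
   by(rule eqv_add[OF eqv_refl eqv_smult[OF eqv_left[OF skew_F_2[OF x(1)] fy[OF _ _ w]]]]) (use cl wc Hv in auto)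
  also have "... = a \<odot> A \<oplus> ((b * a') \<odot> B \<oplus> C)"
   using mlin[of "a' \<odot> w" x "b' \<odot> (y \<otimes> L f w)"] mlin(1)[of w x] mlin(1)[of "y \<otimes> L f w" x] cl wc fw xs bb Hv
   by(simp add: A_def B_def C_def vs_smult_r)
  finally have 1: "eqv (Suc n) (L f (x \<otimes> (y \<otimes> w))) (a \<odot> A \<oplus> ((b * a') \<odot> B \<oplus> C))" .
  have "eqv (Suc n) (L f (y \<otimes> (x \<otimes> w))) (a' \<odot> (x \<otimes> w) \<oplus> b' \<odot> (y \<otimes> L f (x \<otimes> w)))" by(rule fy[OF _ _ xw]) auto
  also have "eqv (Suc n) ... (a' \<odot> (x \<otimes> w) \<oplus> b' \<odot> (y \<otimes> (a \<odot> w \<oplus> b \<odot> (x \<otimes> L f w))))"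
   by(rule eqv_add[OF eqv_refl eqv_smult[OF eqv_left[OF skew_F_2[OF y(1)] fx[OF _ _ w]]]]) (use cl wc Hv in auto)
  also have "... = a' \<odot> B \<oplus> ((b' * a) \<odot> A \<oplus> E)"
   using mlin[of "a \<odot> w" y "b \<odot> (x \<otimes> L f w)"] mlin(1)[of w y] mlin(1)[of "x \<otimes> L f w" y] cl wc fw ys bb Hv
   by(simp add: A_def B_def E_def vs_smult_r)
  finally have 2: "eqv (Suc n) (L f (y \<otimes> (x \<otimes> w))) (a' \<odot> B \<oplus> ((b' * a) \<odot> A \<oplus> E))" .
  have co: "(a * (1 - p' * b')) \<odot> A = a \<odot> A \<oplus> (- (p' * (b' * a))) \<odot> A" "(a' * (b - p')) \<odot> B = (b * a') \<odot> B \<oplus> (- (p' * a')) \<odot> B"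
   unfolding vs_smult_l[OF Hv ABC(1), symmetric] vs_smult_l[OF Hv ABC(2), symmetric] by(simp_all add: algebra_simps)
  have "L f (z \<otimes> w) = L f (x \<otimes> (y \<otimes> w)) \<oplus> (- p') \<odot> L f (y \<otimes> (x \<otimes> w))"
   unfolding zw[OF wc] using lhomD(2,3)[OF lf] cl wc Hv by simp
  also have "eqv (Suc n) ... ((a \<odot> A \<oplus> ((b * a') \<odot> B \<oplus> C)) \<oplus> (- p') \<odot> (a' \<odot> B \<oplus> ((b' * a) \<odot> A \<oplus> E)))"
   by(rule eqv_add[OF 1 eqv_smult[OF 2]])
  also have "... = (C \<oplus> (- p') \<odot> E) \<oplus> ((a * (1 - p' * b')) \<odot> A \<oplus> (a' * (b - p')) \<odot> B)"
   unfolding co using ABC Hv by(simp add: vs_smult_r vs_assoc vs_comm[OF Hv] vs_lcomm[OF Hv])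
  finally show ?thesis unfolding zw[OF fw] A_def B_def C_def E_def .
 qed
 have Dz: "eqv (Suc n) (D (z \<otimes> w)) (z \<otimes> D w \<oplus> (1 - p' * p') \<odot> (y \<otimes> w))"
  and Ez: "eqv (Suc n) (E (z \<otimes> w)) (z \<otimes> E w)" if w: "w : F (Suc n)" for w n
  using Z[OF alp(1,2) alpy alp(3) alpt pq(2,1) w] Z[OF be(1) bex be(2) bes be(3) pq w] F_D(6)[OF w] H_closed xs(1) ys(1) zc Hv
   lhomD(1)[OF Dl F_D(6)[OF w]] lhomD(1)[OF El F_D(6)[OF w]] by(simp_all add: D_def E_def)
 have pc: "pw z n : car H" for n by(rule pw_closed[OF zc])
 have pF: "pw z n : F (Suc (2 * n))" for n
 proof(induction n)
  case 0 then show ?case using GL_F_1[OF GL_one] by simp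
 next
  case (Suc n) then show ?case using F_mult'[OF zF Suc] by simp
 qed
 have DF: "D u : F n" if "u : F (Suc n)" for u n unfolding D_def by(rule F_L[OF alp(1) that])
 have EF: "E u : F n" if "u : F (Suc n)" for u n unfolding E_def by(rule F_L[OF be(1) that])
 define c where "c = 1 - p' * p'"
 have c0: "c ~= 0"
 proof
  assume "c = 0"
  then have "p' * p' = 1" by(simp add: c_def)
  then have "q * q = 1" using pq(1) by(metis mult.assoc mult.right_neutral mult.commute)
  then show False using q2 by simp
 qed
 \<comment> \<open>One index less than slicing an element of \<open>F (Suc (2 * Suc n))\<close>
   would give, because \<open>E\<close> passes over \<open>z\<close> and annihilates the
   unit.\<close>
 have EpF: "E (pw z (Suc n)) : F (Suc (2 * n))" for n
 proof(induction n)
  case 0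
  have 1: "\<one> : F (Suc 0)" using GL_F_1[OF GL_one] by simp
  have "E \<one> = \<zero>" using EF[OF 1] by(simp add: F_0)
  then show ?case using eqv_mem[OF Ez[OF 1]] lhom_zero[OF m_lin2[OF zc] Hv Hv] F_D(2) by simp
 next
  case (Suc n)
  have "z \<otimes> E (pw z (Suc n)) : F (Suc (2 * Suc n))" by(rule F_mult'[OF zF Suc]) simp
  then show ?case using eqv_mem[OF Ez[OF pF[of "Suc n"]]] by simp
 qed
 have EpF': "y \<otimes> E (pw z n) : F (2 * n)" for n
 proof(cases n)
  case 0
  have 1: "\<one> : F (Suc 0)" using GL_F_1[OF GL_one] by simp
  have "E \<one> = \<zero>" using EF[OF 1] by(simp add: F_0)
  then show ?thesis using 0 lhom_zero[OF m_lin2[OF ys(1)] Hv Hv] F_D(2) by simp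
 next
  case (Suc m)
  then show ?thesis using F_mult'[OF skew_F_2[OF y(1)] EpF[of m]] by simp
 qed
 \<comment> \<open>\<open>E\<close> takes the value \<open>1\<close> at \<open>y\<close>, and the
   other term of the derivation rule is of lower order by the bound just shown.\<close>
 have Ey': "eqv (2 * n) (E (y \<otimes> pw z n)) (pw z n)" for n
 proof -
  have "eqv (2 * n) (E (y \<otimes> pw z n)) (1 \<odot> pw z n \<oplus> q \<odot> (y \<otimes> E (pw z n)))"
   unfolding E_def by(rule L_skew[OF y(1) be pF]) auto
  also have "1 \<odot> pw z n = pw z n" using pc Hv by simp
  also have "eqv (2 * n) (pw z n \<oplus> q \<odot> (y \<otimes> E (pw z n))) (pw z n)" by(rule eqv_drop[OF pc F_D(4)[OF EpF']])
  finally show ?thesis .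
 qed
 have step: "eqv (2 * n) (E (D (pw z (Suc n)))) (E (z \<otimes> D (pw z n)) \<oplus> c \<odot> pw z n)" for n
 proof -
  have Dc: "z \<otimes> D (pw z n) : car H" by(rule H_closed[OF zc lhomD(1)[OF Dl pc]])
  have yc: "y \<otimes> pw z n : car H" by(rule H_closed[OF ys(1) pc])
  have "eqv (2 * n) (E (D (z \<otimes> pw z n))) (E (z \<otimes> D (pw z n) \<oplus> c \<odot> (y \<otimes> pw z n)))"
   unfolding E_def by(rule eqv_L[OF be(1)]) (use Dz[OF pF[of n]] in \<open>simp add: c_def\<close>)
  also have "... = E (z \<otimes> D (pw z n)) \<oplus> c \<odot> E (y \<otimes> pw z n)"
   using lhomD(2,3)[OF El] Dc yc Hv by simp
  also have "eqv (2 * n) ... (E (z \<otimes> D (pw z n)) \<oplus> c \<odot> pw z n)"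
   by(rule eqv_add[OF eqv_refl[OF lhomD(1)[OF El Dc]] eqv_smult[OF Ey']])
  finally show ?thesis by simp
 qed
 \<comment> \<open>For each factor \<open>z\<close>, the derivation \<open>D\<close> leaves
   \<open>c\<close> times \<open>y\<close>, which \<open>E\<close> turns into the scalar
   \<open>c\<close>; the contributions of the \<open>n + 1\<close> factors add up.\<close>
 have ED: "eqv (2 * n) (E (D (pw z (Suc n)))) ((c * of_nat (Suc n)) \<odot> pw z n)" for n
 proof(induction n)
  case 0
  have 1: "\<one> : F (Suc 0)" using GL_F_1[OF GL_one] by simp
  have "D \<one> = \<zero>" using DF[OF 1] by(simp add: F_0)
  then have "E (z \<otimes> D \<one>) = \<zero>" using lhom_zero[OF m_lin2[OF zc] Hv Hv] lhom_zero[OF El Hv Hv] by simp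
  then show ?case using step[of 0] H_one Hv by simp
 next
  case (Suc n)
  let ?w = "pw z (Suc n)"
  have Dw: "D ?w : F (Suc (Suc (2 * n)))" using DF[OF pF[of "Suc n"]] by simp
  have "eqv (2 * Suc n) (E (z \<otimes> D ?w)) (z \<otimes> E (D ?w))" using Ez[OF Dw] by simp
  also have "eqv (2 * Suc n) ... (z \<otimes> ((c * of_nat (Suc n)) \<odot> pw z n))"
   by(rule eqv_left[OF zF Suc]) simp
  also have "... = (c * of_nat (Suc n)) \<odot> ?w" using lhomD(3)[OF m_lin2[OF zc] pc] by simp
  finally have 1: "eqv (2 * Suc n) (E (z \<otimes> D ?w)) ((c * of_nat (Suc n)) \<odot> ?w)" .
  have "eqv (2 * Suc n) (E (D (pw z (Suc (Suc n))))) (E (z \<otimes> D ?w) \<oplus> c \<odot> ?w)" by(rule step)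
  also have "eqv (2 * Suc n) ... ((c * of_nat (Suc n)) \<odot> ?w \<oplus> c \<odot> ?w)"
   by(rule eqv_add[OF 1 eqv_refl]) (use pc[of "Suc n"] Hv in auto)
  also have "... = (c * of_nat (Suc (Suc n))) \<odot> ?w"
   using vs_smult_l[OF Hv pc[of "Suc n"], of "c * of_nat (Suc n)" c] by(simp add: algebra_simps)
  finally show ?case .
 qed
 have "pw z n \<notin> F (2 * n)" for n
 proof(induction n)
  case 0 then show ?case using one_notin_F_0 by simp
 next
  case (Suc n)
  show ?case
  proof
   assume "pw z (Suc n) : F (2 * Suc n)"
   then have "E (D (pw z (Suc n))) : F (2 * n)" by(intro EF DF) simp
   then have "(c * of_nat (Suc n)) \<odot> pw z n : F (2 * n)" using eqv_mem[OF ED] by blast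
   then have "(1 / (c * of_nat (Suc n))) \<odot> ((c * of_nat (Suc n)) \<odot> pw z n) : F (2 * n)" using F_D(4) by blast
   moreover have "(1 / (c * of_nat (Suc n))) \<odot> ((c * of_nat (Suc n)) \<odot> pw z n) = pw z n"
    using pc[of n] Hv c0 by(simp del: of_nat_Suc)
   ultimately show False using Suc by simp
  qed
 qed
 then have "F (2 * n) ~= F (Suc (2 * n))" for n using pF[of n] by auto
 then show False using no_strict_chain[of 2] by auto
qed

text \<open>Reality supplies \<open>h\<close> with \<open>s^-1 = h s h^-1\<close>, and
  \<open>h x h^-1\<close> is skew of degree \<open>s^-1\<close> with the same eigenvalue. If
  \<open>s\<close> were its own inverse, \<open>s^2 = 1\<close> would already give
  \<open>q^2 = 1\<close>, so the two degrees are distinct.\<close>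

theorem skew_eigenvalue:
 assumes real: "real_group (grouplikes H)" and x: "skew s x" "x \<notin> F 1" and q: "eqv 1 (s \<otimes> x) (q \<odot> (x \<otimes> s))"
 shows "q = -1"
proof(rule ccontr)
 assume qn: "q ~= -1"
 have q1: "q ~= 1" using skew_eigenvalue_ne_1[OF x] q by auto
 have q2: "q * q ~= 1" using qn q1 by(metis square_eq_1_iff)
 note sG = skew_D(1)[OF x(1)] and xs = skew_D(2,3)[OF x(1)]
 have "real_element (grouplikes H) s" using real sG unfolding real_group_def by blast
 then obtain h where h: "h : GL" "gi s = h \<otimes> s \<otimes> gi h"
  unfolding real_element_def conj_class_def by(auto simp: GL_simps(2))
 note hc = GL_D(1)[OF h(1)] and hi = GL_inv[OF h(1)]
 note ic = GL_D(1)[OF hi(1)]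
 define t y where "t = h \<otimes> s \<otimes> gi h" and "y = h \<otimes> x \<otimes> gi h"
 have y: "skew t y" unfolding t_def y_def by(rule skew_conj[OF x(1) h(1)])
 have st: "s \<otimes> t = \<one>" using GL_inv(2)[OF sG] h(2) by(simp add: t_def)
 have hu: "h \<otimes> u \<otimes> gi h \<otimes> (h \<otimes> v \<otimes> gi h) = h \<otimes> (u \<otimes> v) \<otimes> gi h" if "u : car H" "v : car H" for u v
  using that hc ic hi(3) H_closed by(metis H_assoc H_l_one)
 have conj: "eqv 1 (h \<otimes> u \<otimes> gi h) (h \<otimes> v \<otimes> gi h)" if "eqv 1 u v" for u v
  by(rule eqv_GL_right[OF hi(1) eqv_GL_left[OF h(1) that]])
 have yF: "y \<notin> F 1"
 proof
  assume "y : F 1"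
  then have "gi h \<otimes> y \<otimes> h : F 1" using F_mult'[OF F_mult'[OF GL_F_1[OF hi(1)]] GL_F_1[OF h(1)], of y 1 1 1] by simp
  moreover have "gi h \<otimes> y \<otimes> h = x"
   unfolding y_def using xs(1) hc ic hi(3) H_closed by(metis H_assoc H_l_one H_r_one)
  ultimately show False using x(2) by simp
 qed
 have ysm: "h \<otimes> (q \<odot> (x \<otimes> s)) \<otimes> gi h = q \<odot> (h \<otimes> (x \<otimes> s) \<otimes> gi h)"
  using lhomD(3)[OF m_lin2[OF hc] H_closed[OF xs]] lhomD(3)[OF m_lin1[OF ic] H_closed[OF hc H_closed[OF xs]]] by simp
 have p: "eqv 1 (t \<otimes> y) (q \<odot> (y \<otimes> t))"
  unfolding t_def y_def hu[OF xs(2,1)] hu[OF xs] using conj[OF q] unfolding ysm .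
 have "s ~= t"
 proof
  assume e: "s = t"
  then have "s \<otimes> s = \<one>" using st by simp
  then have "eqv 1 x ((q * q) \<odot> x)"
   using skew_pw[OF x(1) q, of 2] xs H_l_one H_r_one by(simp add: numeral_2_eq_2 power2_eq_square)
  then have "x \<oplus> (-1) \<odot> ((q * q) \<odot> x) : F 1" by(rule eqv_D)
  moreover have "x \<oplus> (-1) \<odot> ((q * q) \<odot> x) = (1 - q * q) \<odot> x" using vs_smult_l[OF Hv xs(1), of 1 "- (q * q)"] xs Hv by simp
  ultimately have "(1 / (1 - q * q)) \<odot> ((1 - q * q) \<odot> x) : F 1" using F_1_D(4) by simp
  then show False using x(2) q2 xs Hv by simp
 qed
 then show False using skew_pair[OF x q y yF p _ st q2] by simp
qed

end

section \<open>The associated graded Hopf algebra in degrees zero and one\<close>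

text \<open>The graded comultiplication is defined through formal representatives with keys in
  prescribed filtration terms, so membership in a tensor span has to be turned into such a
  representative.\<close>

lemma tensor_span_rep:
 assumes V: "vsp V" and W: "vsp W" and A: "A <= car V" and C: "C <= car W"
  and t: "t : tensor_span V W A C"
 shows "\<exists>p. kys p <= A \<times> C & t = tensor_null V W +>\<^bsub>free_space (car V \<times> car W)\<^esub> p"
proof -
 let ?q = "%p. tensor_null V W +>\<^bsub>free_space (car V \<times> car W)\<^esub> p"
 have T: "vsp (tensor V W)" using V W by simp
 note q = lhomD[OF tcoset_lhom[OF V W], simplified]
 have S: "{pure V W a c | a c. a : A & c : C} <= car (tensor V W)" using A C pure_closed[OF V W] by blast
 from T S t[unfolded tensor_span_def] show ?thesis
 proof(induction rule: lspan_induct)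
  case zero
  have "?q 0 = \<zero>[tensor V W]" using lhom_zero[OF tcoset_lhom[OF V W] free_vs T] by simp
  then show ?case by(intro exI[of _ 0]) simp
 next
  case (add k s y)
  from add(1) obtain a c where ac: "s = pure V W a c" "a : A" "c : C" by blast
  from add(3) obtain p where p: "kys p <= A \<times> C" "y = ?q p" by blast
  let ?m = "pmap ((*) k) (sng (a, c) 1)"
  have km: "kys ?m <= A \<times> C" using keys_map_mult[of k "sng (a, c) 1"] ac by auto
  have kA: "A \<times> C <= car V \<times> car W" using A C by auto
  have "?q (?m + p) = ?q ?m \<oplus>[tensor V W] ?q p" by(rule q(2)) (use km p kA in blast)+
  also have "?q ?m = k \<odot>[tensor V W] s" unfolding ac(1) pure_def by(rule q(3)) (use ac kA in auto)
  finally have "k \<odot>[tensor V W] s \<oplus>[tensor V W] y = ?q (?m + p)" by(simp only: p(2))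
  moreover have "kys (?m + p) <= A \<times> C" using Poly_Mapping.keys_add[of ?m p] km p(1) by blast
  ultimately show ?case by blast
 qed
qed

context fd_pointed
begin

interpretation vectorspace CC H by(rule Hv)

lemma projection_exists:
 assumes S: "ssp S H"
 shows "\<exists>Q\<in>lhom H H. (\<forall>x\<in>car H. Q x : S) & (\<forall>x\<in>S. Q x = x)"
proof -
 obtain B C d where BC: "dual_basis H B d" "C <= B" "C <= S" "\<forall>v\<in>S. \<forall>b\<in>B - C. d b v = 0"
  using dual_basis_exists[OF Hv fd lin_indpt_empty[OF Hv fd] _ S] by blast
 note D = dual_basisD[OF BC(1)]
 have fC: "finite C" using BC(2) D(1) finite_subset by auto
 have CH: "c : car H" "c : B" "c : S" if "c : C" for c using that BC(2,3) D(6) by auto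
 define Q where "Q x = finsum H (%c. d c x \<odot> c) C" for x
 have sm: "(%x. d c x \<odot> c) : lhom H H" if "c : C" for c
  using lhomD[OF D(3)[OF CH(2)[OF that]]] CH(1)[OF that] Hv by(intro lhomI) (simp_all add: vs_smult_l)
 have "Q : lhom H H" unfolding Q_def[abs_def] by(rule lhom_finsum[OF fC sm Hv])
 moreover have "Q x : S" if "x : car H" for x
  unfolding Q_def by(rule subsp_fsum[OF S fC]) (use CH subspD(4)[OF S] in auto)
 moreover have "Q x = x" if x: "x : S" for x
 proof -
  have "finsum H (%c. d c x \<odot> c) B = finsum H (%c. d c x \<odot> c) C"
   by(rule fsum_mono[OF Hv D(1) BC(2)]) (use CH Hv BC(4) x D(6) in auto)
  then show ?thesis using D(5)[OF subspD(6)[OF S x]] by(simp add: Q_def)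
 qed
 ultimately show ?thesis by blast
qed

text \<open>A linear projection onto \<open>F 2\<close>. It extends the class map of degree one from
  \<open>F 2\<close> to all of \<open>H\<close>, so that it can be tensored and applied to
  \<open>\<Delta>(x)\<close>; \<open>P1\<close> does the same for degree zero.\<close>

definition Q2 where "Q2 = (SOME Q. Q : lhom H H & (\<forall>x\<in>car H. Q x : F 2) & (\<forall>x\<in>F 2. Q x = x))"

lemma Q2: "Q2 : lhom H H" "x : car H ==> Q2 x : F 2" "x : F 2 ==> Q2 x = x"
 using someI_ex[of "%Q. Q : lhom H H & (\<forall>x\<in>car H. Q x : F 2) & (\<forall>x\<in>F 2. Q x = x)"] projection_exists[OF F_subspace[of 2]]
 unfolding Q2_def[symmetric] by blast+

definition P1 where "P1 x = finsum H (%g. dd g x \<odot> g) GL"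

lemma smult_GL_lhom: "e : duals ==> g : car V ==> vsp V ==> (%x. e x \<odot>[V] g) : lhom H V"
 by(rule lhomI) (simp_all add: lhomD vs_smult_l)

lemma P1_lhom: "P1 : lhom H H"
 unfolding P1_def[abs_def] by(rule lhom_finsum[OF finG smult_GL_lhom[OF dd_GL(1) GL_D(1) Hv] Hv])

lemma P1_F: "P1 x : F 1"
 unfolding P1_def by(rule subsp_fsum[OF F_1_subspace finG]) (use F_1_D(4)[OF GL_F_1] in blast)

lemma P1_id: "x : F 1 ==> P1 x = x"
proof -
 assume x: "x : F 1"
 have "P1 g = g" if g: "g : GL" for g
 proof -
  have "P1 g = dd g g \<odot> g" unfolding P1_def
   by(rule fsum_single[OF Hv finG g]) (use dd_GL(2) g GL_D(1) Hv in \<open>simp_all\<close>)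
  then show ?thesis using dd_GL(2)[OF g g] GL_D(1)[OF g] Hv by simp
 qed
 then show ?thesis using lhom_eqI[OF P1_lhom lhom_id Hv Hv GL_carrier _ x[unfolded F_1]] by simp
qed

lemma F_1_2: "x : F 1 ==> x : F 2" using F_mono[of 1 2] by auto

text \<open>The filtration is tested by left slices. Right slices commute with these and, for
  \<open>f \<in> J\<close>, vanish on the coradical; this gives the symmetric statement for
  \<open>F 2\<close>.\<close>

lemma R_J: assumes f: "f : J" and x: "x : F 2" shows "R f x : F 1"
proof -
 have z: "R f y = \<zero>" if y: "y : F 1" for y
 proof(rule lhom_eqI[OF R_lhom[OF J_D(1)[OF f]] lhom_0[OF Hv] Hv Hv GL_carrier _ y[unfolded F_1]])
  fix g assume g: "g : GL"
  note gD = GL_D[OF g]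
  show "R f g = \<zero>" using R_pure[OF J_D(1)[OF f] gD(1,1,3)] J_D(2)[OF f g] gD(1) Hv by simp
 qed
 have xc: "x : car H" using F_D(6)[OF x] .
 have "L e (R f x) : F 0" if e: "e : J" for e
 proof -
  have "L e x : F 1" using F_L[OF e, of x 1] x by(simp add: numeral_2_eq_2)
  then show ?thesis using L_R[OF J_D(1)[OF e] J_D(1)[OF f] xc] z F_D(2) by simp
 qed
 then show ?thesis using F_step[of "R f x" 0] R_closed[OF J_D(1)[OF f] xc] by simp
qed

text \<open>The difference of the two functionals is in \<open>J\<close> and slices
  \<open>F 2\<close> into \<open>F 1\<close>. Modulo the coradical a slice of \<open>F 2\<close>
  therefore depends only on the values at group-likes.\<close>

lemma eqv_dual:
 assumes f: "f : duals" and g: "g : duals" and fg: "!!h. h : GL ==> f h = g h" and x: "x : F 2"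
 shows "eqv 1 (L f x) (L g x)" "eqv 1 (R f x) (R g x)"
proof -
 have xc: "x : car H" using F_D(6)[OF x] .
 define k where "k u = f u + (-1) * g u" for u
 have kd: "k : duals"
  using lhom_add[OF f lhom_smult[OF g cm_vs, of "-1"] cm_vs] by(simp add: k_def[abs_def])
 have kJ: "k : J" using kd fg by(simp add: J_def k_def)
 have fk: "f u = g u + 1 * k u" for u by(simp add: k_def)
 have 1: "L k x : F 1" using F_L[OF kJ, of x 1] x by(simp add: numeral_2_eq_2)
 show "eqv 1 (L f x) (L g x)"
  by(rule eqvI[OF _ _ 1]) (use L_lincomb[OF g kd f fk xc] L_closed[OF kd xc] L_closed[OF g xc] Hv in simp_all)
 show "eqv 1 (R f x) (R g x)"
  by(rule eqvI[OF _ _ R_J[OF kJ x]]) (use R_lincomb[OF g kd f fk xc] R_closed[OF kd xc] R_closed[OF g xc] Hv in simp_all)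
qed

subsection \<open>Classes\<close>

abbreviation Hs where "Hs k \<equiv> H\<lparr>carrier := F (Suc k)\<rparr>"
abbreviation GS where "GS \<equiv> gr_space H"
abbreviation cl where "cl \<equiv> gr_class H"

lemma gr_comp_eq: "gr_comp H k = quot_alg (Hs k) (F k)"
 by(simp add: gr_comp_def F_Suc)

lemma Hs_vs: "vsp (Hs k)" by(rule subsp_vs[OF F_subspace])

lemma Hs_F: "ssp (F k) (Hs k)"
 by(rule subspaceI[OF Hs_vs]) (use F_mono[of k "Suc k"] F_D(2,3,4) in auto)

lemma gr_comp_vs: "vsp (gr_comp H k)"
 unfolding gr_comp_eq by(rule quot_vectorspace[OF Hs_F])

lemma Gv: "vsp GS"
 unfolding gr_space_def by(rule dsum_vs[OF gr_comp_vs])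

lemma coset_Hs: "F k +>\<^bsub>H\<^esub> x = F k +>\<^bsub>Hs k\<^esub> x" by(simp add: a_r_coset_def')

lemma cl_eq: "cl k x = summand_in UNIV (gr_comp H) k (F k +>\<^bsub>Hs k\<^esub> x)"
 by(simp add: gr_class_def coset_Hs)

lemma cl_lhom: "cl k : lhom (Hs k) GS"
proof -
 have 1: "(%x. F k +>\<^bsub>Hs k\<^esub> x) : lhom (Hs k) (gr_comp H k)" unfolding gr_comp_eq by(rule quot_lhom[OF Hs_F])
 have 2: "summand_in UNIV (gr_comp H) k : lhom (gr_comp H k) GS"
  unfolding gr_space_def by(rule summand_lhom[OF gr_comp_vs UNIV_I])
 from lhom_comp[OF 1 2] show ?thesis by(simp add: cl_eq[abs_def])
qed

lemma cl_closed: "x : F (Suc k) ==> cl k x : car GS" using lhomD(1)[OF cl_lhom] by simp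

lemma cl_add: "x : F (Suc k) ==> y : F (Suc k) ==> cl k (x \<oplus> y) = cl k x \<oplus>[GS] cl k y"
 and cl_smult: "x : F (Suc k) ==> cl k (c \<odot> x) = c \<odot>[GS] cl k x"
 using lhomD(2,3)[OF cl_lhom] by simp_all

lemma cl_component: "cl k x n = (if n = k then F k +>\<^bsub>Hs k\<^esub> x else F n)"
 unfolding cl_eq by(simp add: summand_in_def gr_comp_eq)

lemma cl_eq_iff: assumes x: "x : F (Suc k)" and y: "y : F (Suc k)" shows "cl k x = cl k y \<longleftrightarrow> eqv k x y"
proof
 have "eqv k x y \<longleftrightarrow> F k +>\<^bsub>Hs k\<^esub> x = F k +>\<^bsub>Hs k\<^esub> y"
  using rcoset_eq_iff[OF Hs_F, of x k y] x y F_D(6) by(simp add: eqv_def)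
 moreover have "F k +>\<^bsub>Hs k\<^esub> x = F k +>\<^bsub>Hs k\<^esub> y" if "cl k x = cl k y" using that cl_component[of k x k] cl_component[of k y k] by simp
 ultimately show "cl k x = cl k y ==> eqv k x y" "eqv k x y ==> cl k x = cl k y" by(auto simp: cl_eq)
qed

lemma cl_zero_iff: assumes x: "x : F (Suc k)" shows "cl k x = \<zero>[GS] \<longleftrightarrow> x : F k"
proof -
 have z: "cl k \<zero> = \<zero>[GS]" using lhom_zero[OF cl_lhom[of k] Hs_vs Gv] by simp
 have "eqv k x \<zero> \<longleftrightarrow> x : F k" using x F_D(2,6) Hv by(simp add: eqv_def)
 then show ?thesis using cl_eq_iff[OF x F_D(2)] z by simp
qed

lemma F_k_zero: "\<zero>[gr_comp H k] = F k" by(simp add: gr_comp_eq)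

lemma mem_coset:
 assumes v: "v : F (Suc k)"
 shows "u : F k +>\<^bsub>Hs k\<^esub> v \<longleftrightarrow> eqv k u v"
proof
 assume "u : F k +>\<^bsub>Hs k\<^esub> v"
 then obtain r where r: "r : F k" "u = r \<oplus> v" by(auto simp: mem_rcoset)
 then show "eqv k u v" using v F_D(6) by(intro eqvI[of _ _ r]) (auto simp: vs_comm[OF Hv])
next
 assume "eqv k u v"
 then obtain r where r: "r : F k" "u = v \<oplus> r" by(rule eqv_E)
 then have "u = r \<oplus> v" using v F_D(6) by(auto simp: vs_comm[OF Hv])
 then show "u : F k +>\<^bsub>Hs k\<^esub> v" using r by(auto simp: mem_rcoset)
qed

lemma UN_const: "p : A ==> q : B ==> (\<Union>a\<in>A. \<Union>b\<in>B. C) = C"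
 by auto

text \<open>\<open>gr_mult\<close> multiplies all representatives of the components. Congruent
  factors have congruent products by \<open>F_mult\<close>, so each union is a single coset, and
  only the pair of degrees \<open>i\<close> and \<open>j\<close> contributes.\<close>

lemma gr_mult_cl:
 assumes a: "a : F (Suc i)" and b: "b : F (Suc j)"
 shows "gr_mult H (cl i a) (cl j b) = cl (i + j) (a \<otimes> b)"
proof
 fix n
 \<comment> \<open>Representatives of the components of the two classes in every degree, zero away
   from \<open>i\<close> and \<open>j\<close>.\<close>
 define alp where "alp k = (if k = i then a else \<zero>)" for k
 define be where "be k = (if k = j then b else \<zero>)" for k
 have alpF: "alp k : F (Suc k)" and beF: "be k : F (Suc k)" for k using a b F_D(2) by(auto simp: alp_def be_def)
 have cz: "F k = F k +>\<^bsub>Hs k\<^esub> \<zero>" for k using rcoset_zero_iff[OF Hs_F, of \<zero> k] F_D(2) by simp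
 have calp: "cl i a k = F k +>\<^bsub>Hs k\<^esub> alp k" and cbe: "cl j b k = F k +>\<^bsub>Hs k\<^esub> be k" for k
  using cz[of k] by(simp_all add: cl_component alp_def be_def)
 have tm: "(\<Union>a'\<in>cl i a k. \<Union>b'\<in>cl j b (n - k). corad_lower H n +>\<^bsub>H\<^esub> (a' \<otimes> b')) = F n +>\<^bsub>Hs n\<^esub> (alp k \<otimes> be (n - k))" if k: "k <= n" for k
 proof -
  have ab: "alp k \<otimes> be (n - k) : F (Suc n)" using F_mult'[OF alpF beF] k by simp
  have const: "F n +>\<^bsub>Hs n\<^esub> (a' \<otimes> b') = F n +>\<^bsub>Hs n\<^esub> (alp k \<otimes> be (n - k))" if a': "eqv k a' (alp k)" and b': "eqv (n - k) b' (be (n - k))" for a' b'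
  proof -
   obtain r where r: "r : F (n - k)" "b' = be (n - k) \<oplus> r" using b' by(rule eqv_E)
   have b'F: "b' : F (Suc (n - k))" using r F_D(3)[OF beF subsetD[OF F_mono r(1)]] by simp
   have "eqv n (a' \<otimes> b') (alp k \<otimes> b')" by(rule eqv_right[OF b'F a']) (use k in simp)
   also have "eqv n (alp k \<otimes> b') (alp k \<otimes> be (n - k))" by(rule eqv_left[OF alpF b']) (use k in simp)
   finally have e: "eqv n (a' \<otimes> b') (alp k \<otimes> be (n - k))" .
   obtain r' where r': "r' : F n" "a' \<otimes> b' = alp k \<otimes> be (n - k) \<oplus> r'" using e by(rule eqv_E)
   have "a' \<otimes> b' : F (Suc n)" using r' F_D(3)[OF ab subsetD[OF F_mono r'(1)]] by simp
   then show ?thesis using rcoset_eq_iff[OF Hs_F, of "a' \<otimes> b'" n "alp k \<otimes> be (n - k)"] ab eqv_D(3)[OF e] by simp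
  qed
  let ?c = "F n +>\<^bsub>Hs n\<^esub> (alp k \<otimes> be (n - k))"
  have A: "alp k : cl i a k" "be (n - k) : cl j b (n - k)"
   unfolding calp cbe using mem_coset[OF alpF] mem_coset[OF beF] eqv_refl[OF F_D(6)[OF alpF]] eqv_refl[OF F_D(6)[OF beF]] by simp_all
  have "F n +>\<^bsub>H\<^esub> (a' \<otimes> b') = ?c" if "a' : cl i a k" "b' : cl j b (n - k)" for a' b'
   using const that mem_coset[OF alpF] mem_coset[OF beF] unfolding calp cbe coset_Hs by simp
  then have "(\<Union>a'\<in>cl i a k. \<Union>b'\<in>cl j b (n - k). corad_lower H n +>\<^bsub>H\<^esub> (a' \<otimes> b')) = (\<Union>a'\<in>cl i a k. \<Union>b'\<in>cl j b (n - k). ?c)"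
   by(intro SUP_cong refl) simp
  also have "... = ?c" by(rule UN_const[OF A])
  finally show ?thesis .
 qed
 have "gr_mult H (cl i a) (cl j b) n = finsum (gr_comp H n) (%k. F n +>\<^bsub>Hs n\<^esub> (alp k \<otimes> be (n - k))) {..n}"
  unfolding gr_mult_def
 proof(rule fsum_cong[OF gr_comp_vs refl])
  show "(%k. F n +>\<^bsub>Hs n\<^esub> (alp k \<otimes> be (n - k))) : {..n} \<rightarrow> car (gr_comp H n)"
   unfolding gr_comp_eq using lhomD(1)[OF quot_lhom[OF Hs_F]] F_mult'[OF alpF beF] by simp
 qed (use tm in simp)
 also have "... = cl (i + j) (a \<otimes> b) n"
 proof -
  have zero: "F n +>\<^bsub>Hs n\<^esub> (alp k \<otimes> be (n - k)) = \<zero>[gr_comp H n]" if "k <= n" "n = i + j --> k ~= i" for k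
  proof -
   have "alp k = \<zero> \<or> be (n - k) = \<zero>" using that by(auto simp: alp_def be_def)
   then have "alp k \<otimes> be (n - k) = \<zero>"
    using lhom_zero[OF m_lin1[OF F_D(6)[OF beF]] Hv Hv] lhom_zero[OF m_lin2[OF F_D(6)[OF alpF]] Hv Hv] by auto
   then show ?thesis using cz[of n] by(simp add: F_k_zero)
  qed
  show ?thesis
  proof(cases "n = i + j")
   case True
   have "finsum (gr_comp H n) (%k. F n +>\<^bsub>Hs n\<^esub> (alp k \<otimes> be (n - k))) {..n} = F n +>\<^bsub>Hs n\<^esub> (alp i \<otimes> be (n - i))"
   proof(rule fsum_single[OF gr_comp_vs])
    show "F n +>\<^bsub>Hs n\<^esub> (alp i \<otimes> be (n - i)) : car (gr_comp H n)"
     unfolding gr_comp_eq using lhomD(1)[OF quot_lhom[OF Hs_F]] F_mult'[OF alpF beF] True by simp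
   qed (use True zero in auto)
   then show ?thesis using True by(simp add: cl_component alp_def be_def)
  next
   case False
   then show ?thesis using fsum_zero[OF gr_comp_vs, of "{..n}"] zero by(simp add: cl_component F_k_zero)
  qed
 qed
 finally show "gr_mult H (cl i a) (cl j b) n = cl (i + j) (a \<otimes> b) n" .
qed

end

context fd_pointed
begin

interpretation vectorspace CC H by(rule Hv)

subsection \<open>The comultiplication of elements of degree one\<close>

text \<open>If one leg of the map sees only the coordinates at group-likes, the tensor map collapses
  to a sum over \<open>GL\<close> of slices by \<open>dd g\<close>.\<close>

lemma tensor_map_sum:
 assumes X: "vsp X" and Y: "vsp Y" and t: "t : car HH"
 shows tensor_map_sum_left: "kap : lhom H X ==> k : lhom H Y ==> (!!g. g : GL ==> v g : car X) ==>
   (!!x. x : car H ==> kap x = finsum X (%g. dd g x \<odot>[X] v g) GL) ==>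
   tensor_map X Y kap k t = finsum (tensor X Y) (%g. pure X Y (v g) (k (lslice H (dd g) t))) GL"
  and tensor_map_sum_right: "k : lhom H X ==> kap : lhom H Y ==> (!!g. g : GL ==> w g : car Y) ==>
   (!!x. x : car H ==> kap x = finsum Y (%g. dd g x \<odot>[Y] w g) GL) ==>
   tensor_map X Y k kap t = finsum (tensor X Y) (%g. pure X Y (k (rslice H (dd g) t)) (w g)) GL"
proof -
 note T = tensor_vs[OF X Y] and tl = tmap_lhom[OF Hv Hv X Y] and tp = tmap_pure[OF Hv Hv X Y]
 note sm = pure_smult_left[OF X Y] pure_smult_right[OF X Y] and pc = pure_closed[OF X Y]
 {
  assume kap: "kap : lhom H X" and k: "k : lhom H Y" and v: "!!g. g : GL ==> v g : car X"
   and e: "!!x. x : car H ==> kap x = finsum X (%g. dd g x \<odot>[X] v g) GL"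
  show "tensor_map X Y kap k t = finsum (tensor X Y) (%g. pure X Y (v g) (k (lslice H (dd g) t))) GL"
  proof(rule tensor_eqI[OF Hv Hv tl[OF kap k] lhom_finsum[OF finG lhom_comp[OF lhom_comp[OF lsl[OF dd_GL(1)] k] pure_lhomr[OF X Y v]] T] T t])
   fix a b assume ab: "a : car H" "b : car H"
   note kb = lhomD(1)[OF k ab(2)]
   show "tensor_map X Y kap k (pr a b) = finsum (tensor X Y) (%g. pure X Y (v g) (k (lslice H (dd g) (pr a b)))) GL"
    unfolding tp[OF kap k ab] e[OF ab(1)]
    by(subst lhom_fsum[OF pure_lhoml[OF X Y kb] X T finG], use v X in blast, rule fsum_cong[OF T refl])
     (use v kb ab lsp[OF dd_GL(1)] lhomD(3)[OF k] Y in \<open>auto intro!: pc simp: sm Hv\<close>)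
  qed
 next
  assume k: "k : lhom H X" and kap: "kap : lhom H Y" and v: "!!g. g : GL ==> w g : car Y"
   and e: "!!x. x : car H ==> kap x = finsum Y (%g. dd g x \<odot>[Y] w g) GL"
  show "tensor_map X Y k kap t = finsum (tensor X Y) (%g. pure X Y (k (rslice H (dd g) t)) (w g)) GL"
  proof(rule tensor_eqI[OF Hv Hv tl[OF k kap] lhom_finsum[OF finG lhom_comp[OF lhom_comp[OF rsl[OF dd_GL(1)] k] pure_lhoml[OF X Y v]] T] T t])
   fix a b assume ab: "a : car H" "b : car H"
   note ka = lhomD(1)[OF k ab(1)]
   show "tensor_map X Y k kap (pr a b) = finsum (tensor X Y) (%g. pure X Y (k (rslice H (dd g) (pr a b))) (w g)) GL"
    unfolding tp[OF k kap ab] e[OF ab(2)]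
    by(subst lhom_fsum[OF pure_lhomr[OF X Y ka] Y T finG], use v Y in blast, rule fsum_cong[OF T refl])
     (use v ka ab rsp[OF dd_GL(1)] lhomD(3)[OF k] X in \<open>auto intro!: pc simp: sm Hv\<close>)
  qed
 }
qed

definition P1c where "P1c x = x \<oplus> (-1) \<odot> P1 x"

lemma P1c_lhom: "P1c : lhom H H"
 unfolding P1c_def[abs_def] by(rule lhom_add[OF lhom_id lhom_smult[OF P1_lhom Hv] Hv])

lemma P1c_zero: "x : F 1 ==> P1c x = \<zero>"
 using P1_id[of x] F_1_D(6)[of x] Hv by(simp add: P1c_def)

text \<open>With \<open>P\<close> the projection onto the coradical this is
  \<open>P \<otimes> id + (id - P) \<otimes> P\<close>, a projection of \<open>H \<otimes> H\<close>
  onto \<open>F 1 \<otimes> H + H \<otimes> F 1\<close>. It fixes \<open>\<Delta>(x)\<close> for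
  \<open>x \<in> F 2\<close> and so splits it into two explicit parts.\<close>

definition Xi where "Xi t = tensor_map H H P1 (%x. x) t \<oplus>[HH] tensor_map H H P1c P1 t"

lemma Xi_lhom: "Xi : lhom HH HH"
 unfolding Xi_def[abs_def]
 by(rule lhom_add[OF tmap_lhom[OF Hv Hv Hv Hv P1_lhom lhom_id] tmap_lhom[OF Hv Hv Hv Hv P1c_lhom P1_lhom] HHv])

lemma Xi_pure: "a : car H ==> b : car H ==> Xi (pr a b) = pr (P1 a) b \<oplus>[HH] pr (P1c a) (P1 b)"
 unfolding Xi_def
 by(simp only: tmap_pure[OF Hv Hv Hv Hv P1_lhom lhom_id] tmap_pure[OF Hv Hv Hv Hv P1c_lhom P1_lhom])

lemma F_2_Del: "x : F 2 ==> Del x : tensor_span H H (car H) (F 1) <+>\<^bsub>HH\<^esub> tensor_span H H (F 1) (car H)"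
 by(simp add: numeral_2_eq_2 F_Suc F_1 coradical_eq)

lemma Xi_Del: assumes x: "x : F 2" shows "Xi (Del x) = Del x"
proof -
 define N where "N = {t : car HH. Xi t = t}"
 have N: "ssp N HH"
  by(rule subspaceI[OF HHv]) (use HHv lhomD[OF Xi_lhom] lhom_zero[OF Xi_lhom HHv HHv] in \<open>auto simp: N_def\<close>)
 have 1: "t : N" if "t : tensor_span H H (car H) (F 1)" for t
 proof(rule tspan_least[OF Hv Hv N _ that])
  fix a c assume a: "a : car H" and c: "c : F 1"
  note cc = F_1_D(6)[OF c] and Pa = lhomD(1)[OF P1_lhom a]
  have "Xi (pr a c) = pr (P1 a) c \<oplus>[HH] pr (P1c a) c" unfolding Xi_pure[OF a cc] P1_id[OF c] ..
  also have "... = pr (P1 a \<oplus> P1c a) c"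
   using pure_add_left[OF Hv Hv Pa lhomD(1)[OF P1c_lhom a] cc] by simp
  also have "P1 a \<oplus> P1c a = a" unfolding P1c_def by(rule vs_add_diff[OF Hv a Pa])
  finally show "pr a c : N" using pr_closed[OF a cc] by(simp add: N_def)
 qed
 have 2: "t : N" if "t : tensor_span H H (F 1) (car H)" for t
 proof(rule tspan_least[OF Hv Hv N _ that])
  fix a c assume a: "a : F 1" and c: "c : car H"
  note ac = F_1_D(6)[OF a]
  have "Xi (pr a c) = pr a c"
   unfolding Xi_pure[OF ac c] P1_id[OF a] P1c_zero[OF a] using pr_closed[OF ac c] lhomD(1)[OF P1_lhom c] Hv HHv
   by(simp add: pure_zero_left[OF Hv Hv])
  then show "pr a c : N" using pr_closed[OF ac c] by(simp add: N_def)
 qed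
 from F_2_Del[OF x] obtain t u where "t : N" "u : N" "Del x = t \<oplus>[HH] u"
  unfolding mem_set_add using 1 2 by blast
 then have "Del x : N" using subspD(3)[OF N] by simp
 then show ?thesis by(simp add: N_def)
qed

text \<open>Each summand of \<open>Xi\<close> has a leg \<open>P1\<close>, which reads off
  group-like coordinates, so \<open>tensor_map_sum\<close> makes both of them sums over
  \<open>GL\<close>.\<close>

lemma Del_decomp:
 assumes x: "x : F 2"
 shows "Del x = finsum HH (%g. pr g (L (dd g) x)) GL \<oplus>[HH] finsum HH (%h. pr (P1c (R (dd h) x)) h) GL"
proof -
 note D = Del_closed[OF F_D(6)[OF x]]
 have P1e: "P1 x = finsum H (%g. dd g x \<odot> g) GL" for x by(simp add: P1_def)
 have 1: "tensor_map H H P1 (%x. x) (Del x) = finsum HH (%g. pr g (L (dd g) x)) GL"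
  unfolding L_def by(rule tensor_map_sum_left[OF Hv Hv D P1_lhom lhom_id GL_D(1) P1e])
 have 2: "tensor_map H H P1c P1 (Del x) = finsum HH (%h. pr (P1c (R (dd h) x)) h) GL"
  unfolding R_def by(rule tensor_map_sum_right[OF Hv Hv D P1c_lhom P1_lhom GL_D(1) P1e])
 show ?thesis using Xi_Del[OF x] unfolding Xi_def 1 2 by simp
qed

abbreviation TT where "TT \<equiv> tensor GS GS"
abbreviation pt where "pt \<equiv> pure GS GS"
lemma TTv: "vsp TT" by(rule tensor_vs[OF Gv Gv])

lemma F_F2: "F (Suc (Suc 0)) = F 2" "F (Suc 1) = F 2" by(simp_all add: numeral_2_eq_2)

lemma cl_1_closed: "x : F 2 ==> cl 1 x : car GS" using cl_closed[of x 1] by(simp only: F_F2)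
lemma cl_0_closed: "x : F 1 ==> cl 0 x : car GS" using cl_closed[of x 0] by simp
lemma cl_0_GL: "g : GL ==> cl 0 g : car GS" by(rule cl_0_closed[OF GL_F_1])
lemma cl_1_eq_iff: "x : F 2 ==> y : F 2 ==> cl 1 x = cl 1 y \<longleftrightarrow> eqv 1 x y"
 using cl_eq_iff[of x 1 y] by(simp only: F_F2)
lemma cl_1_zero_iff: "x : F 2 ==> cl 1 x = \<zero>[GS] \<longleftrightarrow> x : F 1"
 using cl_zero_iff[of x 1] by(simp only: F_F2)
lemma cl_1_add: "x : F 2 ==> y : F 2 ==> cl 1 (x \<oplus> y) = cl 1 x \<oplus>[GS] cl 1 y"
 using cl_add[of x 1 y] by(simp only: F_F2)
lemma cl_1_smult: "x : F 2 ==> cl 1 (c \<odot> x) = c \<odot>[GS] cl 1 x"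
 using cl_smult[of x 1 c] by(simp only: F_F2)

definition kap0 where "kap0 x = cl 0 (P1 x)"
definition kap1 where "kap1 x = cl 1 (Q2 x)"

lemma kap0_lhom: "kap0 : lhom H GS"
proof -
 have "P1 : lhom H (Hs 0)" by(rule lhomI) (use lhomD(2,3)[OF P1_lhom] P1_F in auto)
 from lhom_comp[OF this cl_lhom] show ?thesis by(simp add: kap0_def[abs_def])
qed

lemma kap1_lhom: "kap1 : lhom H GS"
 by(rule lhomI) (simp_all only: kap1_def lhomD(2,3)[OF Q2(1)] cl_1_add[OF Q2(2) Q2(2)] cl_1_smult[OF Q2(2)] cl_1_closed[OF Q2(2)])

lemma kap0_sum: "x : car H ==> kap0 x = finsum GS (%g. dd g x \<odot>[GS] cl 0 g) GL"
proof -
 assume x: "x : car H"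
 have "kap0 x = kap0 (P1 x)" by(simp add: kap0_def P1_id[OF P1_F])
 also have "... = finsum GS (%g. kap0 (dd g x \<odot> g)) GL"
  unfolding P1_def by(rule lhom_fsum[OF kap0_lhom Hv Gv finG]) (use GL_D(1) Hv in blast)
 also have "... = finsum GS (%g. dd g x \<odot>[GS] cl 0 g) GL"
  by(rule fsum_cong[OF Gv refl])
   (use cl_0_GL Gv lhomD(3)[OF kap0_lhom GL_D(1)] P1_id[OF GL_F_1] in \<open>auto simp: kap0_def\<close>)
 finally show ?thesis .
qed

lemma kap_vals: "x : F 1 ==> kap0 x = cl 0 x" "x : F 2 ==> kap1 x = cl 1 x" "x : F 1 ==> kap1 x = \<zero>[GS]"
proof -
 show "x : F 1 ==> kap0 x = cl 0 x" by(simp add: kap0_def P1_id)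
 show 1: "x : F 2 ==> kap1 x = cl 1 x" by(simp add: kap1_def Q2(3))
 show "x : F 1 ==> kap1 x = \<zero>[GS]" using 1 F_1_2 cl_1_zero_iff by metis
qed

text \<open>In total degree one the two classes can only have degrees \<open>0\<close> and
  \<open>1\<close> in some order. This makes the graded comultiplication of the class of
  \<open>x\<close> one linear expression in \<open>x\<close>, without reference to a representative
  of \<open>\<Delta>(x)\<close>.\<close>

definition Th where "Th x = tensor_map GS GS kap0 kap1 (Del x) \<oplus>[TT] tensor_map GS GS kap1 kap0 (Del x)"

lemma Th_lhom: "Th : lhom H TT"
 unfolding Th_def[abs_def]
 by(rule lhom_comp[OF Del_lhom lhom_add[OF tmap_lhom[OF Hv Hv Gv Gv kap0_lhom kap1_lhom] tmap_lhom[OF Hv Hv Gv Gv kap1_lhom kap0_lhom] TTv]])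

lemma Th_eq:
 assumes x: "x : F 2"
 shows "Th x = finsum TT (%g. pt (cl 0 g) (cl 1 (L (dd g) x))) GL \<oplus>[TT] finsum TT (%h. pt (cl 1 (R (dd h) x)) (cl 0 h)) GL"
proof -
 note D = Del_closed[OF F_D(6)[OF x]]
 have L2: "L (dd g) x : F 2" "R (dd g) x : F 2" if "g : GL" for g
  using F_L'[OF dd_GL(1)[OF that] x] F_R'[OF dd_GL(1)[OF that] x] by auto
 have "finsum TT (%g. pt (cl 0 g) (kap1 (L (dd g) x))) GL = finsum TT (%g. pt (cl 0 g) (cl 1 (L (dd g) x))) GL"
  by(rule fsum_cong[OF TTv refl]) (use pure_closed[OF Gv Gv cl_0_GL cl_1_closed[OF L2(1)]] kap_vals(2)[OF L2(1)] in auto)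
 moreover have "finsum TT (%g. pt (kap1 (R (dd g) x)) (cl 0 g)) GL = finsum TT (%g. pt (cl 1 (R (dd g) x)) (cl 0 g)) GL"
  by(rule fsum_cong[OF TTv refl]) (use pure_closed[OF Gv Gv cl_1_closed[OF L2(2)] cl_0_GL] kap_vals(2)[OF L2(2)] in auto)
 moreover have "tensor_map GS GS kap0 kap1 (Del x) = finsum TT (%g. pt (cl 0 g) (kap1 (L (dd g) x))) GL"
  unfolding L_def by(rule tensor_map_sum_left[OF Gv Gv D kap0_lhom kap1_lhom cl_0_GL kap0_sum])
 moreover have "tensor_map GS GS kap1 kap0 (Del x) = finsum TT (%g. pt (kap1 (R (dd g) x)) (cl 0 g)) GL"
  unfolding R_def by(rule tensor_map_sum_right[OF Gv Gv D kap1_lhom kap0_lhom cl_0_GL kap0_sum])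
 ultimately show ?thesis unfolding Th_def by simp
qed

lemma Th_zero: assumes x: "x : F 1" shows "Th x = \<zero>[TT]"
proof -
 have z: "cl 1 (L (dd g) x) = \<zero>[GS]" "cl 1 (R (dd g) x) = \<zero>[GS]" if "g : GL" for g
  using F_L'[OF dd_GL(1)[OF that] x] F_R'[OF dd_GL(1)[OF that] x] cl_1_zero_iff F_1_2 by blast+
 show ?thesis unfolding Th_eq[OF F_1_2[OF x]]
  using fsum_zero[OF TTv, of GL "%g. pt (cl 0 g) (cl 1 (L (dd g) x))"]
   fsum_zero[OF TTv, of GL "%h. pt (cl 1 (R (dd h) x)) (cl 0 h)"] z
   pure_zero_left[OF Gv Gv cl_0_GL] pure_zero_right[OF Gv Gv cl_0_GL] TTv by simp
qed

lemma Th_class_ext: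
 assumes x: "x : car H"
 shows "bilin H H TT (%a b. pt (kap0 a) (kap1 b) \<oplus>[TT] pt (kap1 a) (kap0 b))"
  "class_ext TT (%(a, b). pt (kap0 a) (kap1 b) \<oplus>[TT] pt (kap1 a) (kap0 b)) (Del x) = Th x"
proof -
 note b1 = bilin_tensor_map[OF Gv Gv kap0_lhom kap1_lhom] and b2 = bilin_tensor_map[OF Gv Gv kap1_lhom kap0_lhom]
 show bl: "bilin H H TT (%a b. pt (kap0 a) (kap1 b) \<oplus>[TT] pt (kap1 a) (kap0 b))"
  by(rule bilinI) (rule lhom_add[OF bilinD(1)[OF b1] bilinD(1)[OF b2] TTv] lhom_add[OF bilinD(2)[OF b1] bilinD(2)[OF b2] TTv]; assumption)+
 show "class_ext TT (%(a, b). pt (kap0 a) (kap1 b) \<oplus>[TT] pt (kap1 a) (kap0 b)) (Del x) = Th x"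
  unfolding Th_def
 proof(rule tensor_eqI[OF Hv Hv cext_lhom[OF Hv Hv TTv bl]
    lhom_add[OF tmap_lhom[OF Hv Hv Gv Gv kap0_lhom kap1_lhom] tmap_lhom[OF Hv Hv Gv Gv kap1_lhom kap0_lhom] TTv]
    TTv Del_closed[OF x]])
  fix v w assume vw: "v : car H" "w : car H"
  show "class_ext TT (%(a, b). pt (kap0 a) (kap1 b) \<oplus>[TT] pt (kap1 a) (kap0 b)) (pr v w) =
   tensor_map GS GS kap0 kap1 (pr v w) \<oplus>[TT] tensor_map GS GS kap1 kap0 (pr v w)"
   unfolding cext_pure[OF Hv Hv TTv bl vw] tmap_pure[OF Hv Hv Gv Gv kap0_lhom kap1_lhom vw]
    tmap_pure[OF Hv Hv Gv Gv kap1_lhom kap0_lhom vw] ..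
 qed
qed

text \<open>A key in \<open>F 1 \<times> F 2\<close> has zero degree-one class on the left, so the
  second summand of \<open>Th\<close> vanishes on it and the first is the prescribed tensor;
  symmetrically for \<open>F 2 \<times> F 1\<close>. Hence every admissible choice of
  \<open>p\<close> and \<open>d\<close> gives the same value.\<close>

lemma gr_comult_rep_unique:
 assumes x: "x : F 2" and p: "p : Del x"
  and d: "\<forall>(a, b)\<in>kys p. d (a, b) <= 1 & a : corad_filt H (d (a, b)) & b : corad_filt H (1 - d (a, b))"
 shows "lin_ext TT (%(a, b). pt (cl (d (a, b)) a) (cl (1 - d (a, b)) b)) p = Th x"
proof -
 note xc = F_D(6)[OF x]
 note bl = Th_class_ext(1)[OF xc]
 have ke: "pt (cl (d (a, b)) a) (cl (1 - d (a, b)) b) = pt (kap0 a) (kap1 b) \<oplus>[TT] pt (kap1 a) (kap0 b) & a : car H & b : car H"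
  if k: "(a, b) : kys p" for a b
 proof -
  have "d (a, b) = 0 \<or> d (a, b) = 1" using d k by auto
  then show ?thesis
  proof
   assume d0: "d (a, b) = 0"
   then have ab: "a : F 1" "b : F 2" using d k F_Suc[of 0] F_Suc[of 1] by(auto simp: F_F2)
   note c = F_1_D(6)[OF ab(1)] F_D(6)[OF ab(2)]
   show ?thesis using c pure_closed[OF Gv Gv cl_0_closed[OF ab(1)] cl_1_closed[OF ab(2)]] pure_zero_left[OF Gv Gv lhomD(1)[OF kap0_lhom c(2)]] TTv
    unfolding d0 kap_vals(1)[OF ab(1)] kap_vals(2)[OF ab(2)] kap_vals(3)[OF ab(1)] by simp
  next
   assume d1: "d (a, b) = 1"
   then have ab: "a : F 2" "b : F 1" using d k F_Suc[of 0] F_Suc[of 1] by(auto simp: F_F2)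
   note c = F_D(6)[OF ab(1)] F_1_D(6)[OF ab(2)]
   show ?thesis using c pure_closed[OF Gv Gv cl_1_closed[OF ab(1)] cl_0_closed[OF ab(2)]] pure_zero_right[OF Gv Gv lhomD(1)[OF kap0_lhom c(1)]] TTv
    unfolding d1 kap_vals(1)[OF ab(2)] kap_vals(2)[OF ab(1)] kap_vals(3)[OF ab(2)] by simp
  qed
 qed
 have "lin_ext TT (%(a, b). pt (cl (d (a, b)) a) (cl (1 - d (a, b)) b)) p
  = lin_ext TT (%(a, b). pt (kap0 a) (kap1 b) \<oplus>[TT] pt (kap1 a) (kap0 b)) p"
  by(rule lin_ext_cong[OF TTv]) (use ke bilinD(3)[OF bl] in auto)
 also have "... = class_ext TT (%(a, b). pt (kap0 a) (kap1 b) \<oplus>[TT] pt (kap1 a) (kap0 b)) (Del x)"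
  by(rule class_ext_rep[OF Hv Hv TTv bl Del_closed[OF xc] p, symmetric])
 also have "... = Th x" by(rule Th_class_ext(2)[OF xc])
 finally show ?thesis .
qed

lemma gr_comult_rep_exists:
 assumes x: "x : F 2"
 shows "\<exists>p. p : Del x & kys p <= F 1 \<times> F 2 \<union> F 2 \<times> F 1"
proof -
 let ?q = "%p. tensor_null H H +>\<^bsub>free_space (car H \<times> car H)\<^esub> p"
 define t where "t = finsum HH (%g. pr g (L (dd g) x)) GL"
 define u where "u = finsum HH (%h. pr (P1c (R (dd h) x)) h) GL"
 note F1H = F_1_D(1) and F2H = F_D(1)[of 2]
 have t: "t : tensor_span H H (F 1) (F 2)" unfolding t_def
 proof(rule subsp_fsum[OF tspan_subsp[OF Hv Hv F1H F2H] finG], rule Pi_I)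
  fix g assume g: "g : GL"
  show "pr g (L (dd g) x) : tensor_span H H (F 1) (F 2)"
   by(rule tspan_mem[OF Hv Hv F1H F2H GL_F_1[OF g] F_L'[OF dd_GL(1)[OF g] x]])
 qed
 have u: "u : tensor_span H H (F 2) (F 1)" unfolding u_def
 proof(rule subsp_fsum[OF tspan_subsp[OF Hv Hv F2H F1H] finG], rule Pi_I)
  fix g assume g: "g : GL"
  have "P1c (R (dd g) x) : F 2" unfolding P1c_def
   by(rule F_D(3)[OF F_R'[OF dd_GL(1)[OF g] x] F_D(4)[OF F_1_2[OF P1_F]]])
  then show "pr (P1c (R (dd g) x)) g : tensor_span H H (F 2) (F 1)"
   by(rule tspan_mem[OF Hv Hv F2H F1H _ GL_F_1[OF g]])
 qed
 obtain p where p: "kys p <= F 1 \<times> F 2" "t = ?q p" using tensor_span_rep[OF Hv Hv F1H F2H t] by blast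
 obtain r where r: "kys r <= F 2 \<times> F 1" "u = ?q r" using tensor_span_rep[OF Hv Hv F2H F1H u] by blast
 have c: "p : car (free_space (car H \<times> car H))" "r : car (free_space (car H \<times> car H))"
  using p(1) r(1) F1H F2H by auto
 have k: "kys (p + r) <= F 1 \<times> F 2 \<union> F 2 \<times> F 1" using Poly_Mapping.keys_add[of p r] p(1) r(1) by blast
 have "Del x = ?q (p + r)"
  using Del_decomp[OF x] lhomD(2)[OF tcoset_lhom[OF Hv Hv] c] p(2) r(2) by(simp add: t_def u_def)
 moreover have "p + r : ?q (p + r)"
  by(rule rcoset_self[OF tnull_subsp[OF Hv Hv]]) (use k F1H F2H in auto)
 ultimately show ?thesis using k by blast
qed

lemma gr_comult_hom_1:
 assumes x: "x : F 2"
 shows "gr_comult_hom H 1 x = Th x"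
 unfolding gr_comult_hom_def
proof(rule some_equality)
 obtain p where p: "p : Del x" "kys p <= F 1 \<times> F 2 \<union> F 2 \<times> F 1" using gr_comult_rep_exists[OF x] by blast
 \<comment> \<open>A pair lying in both products could be counted in either degree; \<open>0\<close>
   is taken.\<close>
 define d where "d ab = (if ab : F 1 \<times> F 2 then 0 else 1 :: nat)" for ab
 have d: "\<forall>(a, b)\<in>kys p. d (a, b) <= 1 & a : corad_filt H (d (a, b)) & b : corad_filt H (1 - d (a, b))"
  using p(2) F_Suc[of 0, symmetric] F_Suc[of 1, symmetric] by(auto simp: d_def F_F2)
 show "\<exists>p d. p : Del x & (\<forall>(a, b)\<in>kys p. d (a, b) <= 1 & a : corad_filt H (d (a, b)) & b : corad_filt H (1 - d (a, b))) &
   Th x = lin_ext TT (%(a, b). pt (cl (d (a, b)) a) (cl (1 - d (a, b)) b)) p"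
  by(rule exI[of _ p], rule exI[of _ d]) (use p(1) d gr_comult_rep_unique[OF x p(1) d] in blast)
next
 fix t assume "\<exists>p d. p : Del x & (\<forall>(a, b)\<in>kys p. d (a, b) <= 1 & a : corad_filt H (d (a, b)) & b : corad_filt H (1 - d (a, b))) &
   t = lin_ext TT (%(a, b). pt (cl (d (a, b)) a) (cl (1 - d (a, b)) b)) p"
 then show "t = Th x" using gr_comult_rep_unique[OF x] by blast
qed

text \<open>\<open>gr_comult\<close> sums over nonzero components and picks representatives by
  \<open>SOME\<close>. The empty support for \<open>x \<in> F 1\<close> and a change of
  representative by an element of \<open>F 1\<close> are both harmless because \<open>Th\<close>
  vanishes there.\<close>

lemma gr_comult_1:
 assumes x: "x : F 2"
 shows "gr_comult H (cl 1 x) = Th x"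
proof(cases "x : F 1")
 case True
 have "F 1 +>\<^bsub>Hs 1\<^esub> x = F 1" using rcoset_zero_iff[OF Hs_F[of 1], of x] x True by(simp only: F_F2 partial_object.select_convs partial_object.update_convs) simp
 then have "{n. cl 1 x n ~= \<zero>[gr_comp H n]} = {}" unfolding cl_component F_k_zero by auto
 then show ?thesis using Th_zero[OF True] TTv unfolding gr_comult_def by simp
next
 case False
 have "F 1 +>\<^bsub>Hs 1\<^esub> x ~= F 1" using rcoset_zero_iff[OF Hs_F[of 1], of x] x False by(simp only: F_F2 partial_object.select_convs partial_object.update_convs) simp
 then have s: "{n. cl 1 x n ~= \<zero>[gr_comp H n]} = {1}" unfolding cl_component F_k_zero by auto
 define a where "a = (SOME a. a : cl 1 x 1)"
 have xF: "x : F (Suc 1)" using x by(simp only: F_F2)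
 have c1: "cl 1 x 1 = F 1 +>\<^bsub>Hs 1\<^esub> x" by(simp add: cl_component)
 have "x : cl 1 x 1" unfolding c1 mem_coset[OF xF] by(rule eqv_refl[OF F_D(6)[OF x]])
 then have "a : cl 1 x 1" unfolding a_def by(rule someI)
 then have "eqv 1 a x" unfolding c1 mem_coset[OF xF] .
 then obtain r where r: "r : F 1" "a = x \<oplus> r" by(rule eqv_E)
 have aF: "a : F 2" unfolding r(2) by(rule F_D(3)[OF x F_1_2[OF r(1)]])
 have "Th a = Th x" unfolding r(2)
  using lhomD(2)[OF Th_lhom F_D(6)[OF x] F_1_D(6)[OF r(1)]] Th_zero[OF r(1)] lhomD(1)[OF Th_lhom F_D(6)[OF x]] TTv by simp
 then have g: "gr_comult_hom H 1 a = Th x" using gr_comult_hom_1[OF aF] by simp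
 have "gr_comult H (cl 1 x) = finsum TT (%n. gr_comult_hom H n (SOME a. a : cl 1 x n)) {1}" unfolding gr_comult_def s ..
 also have "... = gr_comult_hom H 1 (SOME a. a : cl 1 x 1)"
  by(rule fsum_single[OF TTv]) (use g lhomD(1)[OF Th_lhom F_D(6)[OF x]] in \<open>auto simp: a_def\<close>)
 finally show ?thesis using g by(simp only: a_def)
qed

end

section \<open>The degree one part of the diagram\<close>

lemma gr_simps:
 "car (gr H) = car (gr_space H)" "add (gr H) = add (gr_space H)" "\<zero>[gr H] = \<zero>[gr_space H]"
 "module.smult (gr H) = module.smult (gr_space H)" "comult (gr H) = gr_comult H" "monoid.mult (gr H) = gr_mult H"
 by(simp_all add: gr_def module.defs hopf.defs)

lemma gr_tensor_map:
 "tensor_map (gr H) W = tensor_map (gr_space H) W" "tensor_map W (gr H) = tensor_map W (gr_space H)"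
 "pure (gr H) W = pure (gr_space H) W"
proof -
 have 1: "tensor (gr H) W = tensor (gr_space H) W" "pure (gr H) W = pure (gr_space H) W"
  and 2: "tensor W (gr H) = tensor W (gr_space H)" "pure W (gr H) = pure W (gr_space H)"
  by(rule tensor_cong; simp add: gr_simps)+
 show "tensor_map (gr H) W = tensor_map (gr_space H) W" "tensor_map W (gr H) = tensor_map W (gr_space H)"
  by(intro ext, simp only: tensor_map_def 1 2)+
 show "pure (gr H) W = pure (gr_space H) W" by(rule 1)
qed

lemma diag_one_simps:
 "car (diag_one H) = diag_filt H \<inter> gr_degree H 1" "add (diag_one H) = add (gr_space H)" "\<zero>[diag_one H] = \<zero>[gr_space H]"
 "module.smult (diag_one H) = module.smult (gr_space H)"
 "act (diag_one H) = (%b x. lin_ext (gr_space H\<lparr>carrier := diag_filt H \<inter> gr_degree H 1\<rparr>)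
  (%g. gr_class H 0 g \<otimes>[gr H] x \<otimes>[gr H] gr_class H 0 (inv\<^bsub>grouplikes H\<^esub> g)) b)"
 "coact (diag_one H) = (%x. THE t. t : car (tensor (group_algebra (grouplikes H)) (gr_space H\<lparr>carrier := diag_filt H \<inter> gr_degree H 1\<rparr>)) &
  tensor_map (group_algebra (grouplikes H)) (gr H) (%b. b) (%v. v) t
   = tensor_map (group_algebra (grouplikes H)) (gr H) (proj0 H) (%v. v) (comult (gr H) x))"
 by(simp_all add: diag_one_def Let_def module.defs yd.defs)

context fd_pointed
begin

interpretation vectorspace CC H by(rule Hv)

abbreviation kG where "kG \<equiv> group_algebra (grouplikes H)"
abbreviation sg where "sg g \<equiv> sng g (1::complex)"

lemma kGv: "vectorspace CC kG" by simp
lemma sg_closed: "g : GL ==> sg g : carrier kG" by simp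

subsection \<open>The projection onto degree zero\<close>

definition pj where "pj x = (\<Sum>g\<in>GL. sng g (dd g x))"

lemma lookup_pj: "lkp (pj x) g = (if g : GL then dd g x else 0)"
 unfolding pj_def lookup_sum lookup_single when_def using finG by(simp add: sum.delta' sum.delta)

lemma pj_closed: "pj x : carrier kG"
 by(auto simp: in_keys_iff lookup_pj split: if_splits)

lemma pj_lhom: "pj : lhom H kG"
 by(rule lhomI) (use pj_closed lhomD(2,3)[OF dd_GL(1)] in \<open>auto intro!: poly_mapping_eqI simp: lookup_pj lookup_add\<close>)

lemma pj_GL: "g : GL ==> pj g = sg g"
 by(rule poly_mapping_eqI) (auto simp: lookup_pj lookup_single when_def dd_GL(2))

lemma lin_ext_pj: assumes x: "x : F 1" and p: "p : carrier kG" shows "lin_ext H (%g. g) p = x \<longleftrightarrow> p = pj x"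
proof
 have GLf: "(%g. g) : GL \<rightarrow> car H" using GL_D(1) by blast
 have k: "kys p <= GL" using p by simp
 have le: "lin_ext H (%g. g) : lhom kG H"
  using lin_ext_lhom[OF Hv GLf] by(simp add: module_hom_def)
 { assume e: "lin_ext H (%g. g) p = x"
  have "dd g (lin_ext H (%g. g) p) = lkp p g" if g: "g : GL" for g
  proof(rule group_algebra_eqI[OF lhom_comp[OF le dd_GL(1)[OF g]] lookup_lhom cm_vs _ p])
   fix h assume h: "h : GL"
   have "lin_ext H (%g. g) (sg h) = h" using lin_ext_single[OF Hv GLf h, of 1] GL_D(1)[OF h] Hv by simp
   then show "dd g (lin_ext H (%g. g) (sg h)) = lkp (sg h) g"
    using dd_GL(2)[OF g h] by(auto simp: lookup_single when_def)
  qed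
  then show "p = pj x" using k e by(intro poly_mapping_eqI) (auto simp: lookup_pj in_keys_iff)
 }
 assume "p = pj x"
 then have "lin_ext H (%g. g) p = finsum H (%g. lkp (pj x) g \<odot> g) GL"
  using lin_ext_finsum[OF Hv finG k _ GLf] GLf k by(auto simp: Pi_iff)
 also have "... = P1 x" unfolding P1_def
  by(rule fsum_cong[OF Hv refl]) (use GL_D(1) Hv in \<open>auto simp: lookup_pj\<close>)
 finally show "lin_ext H (%g. g) p = x" using P1_id[OF x] by simp
qed

text \<open>Cosets of the zero space are singletons, so the description in \<open>proj0\<close> asks
  for the expression of \<open>x\<close> in the basis \<open>GL\<close> of the coradical.\<close>

lemma proj0_eq: assumes x: "x : F 1" and X: "X 0 = F 0 +>\<^bsub>Hs 0\<^esub> x" shows "proj0 H X = pj x"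
proof -
 have xF: "x : F (Suc 0)" using x by simp
 have m: "u : X 0 \<longleftrightarrow> u = x" for u
  unfolding X mem_coset[OF xF] using F_1_D(6)[OF x] vs_diff_zero_iff[OF Hv, of u x] by(auto simp: eqv_def F_0)
 show ?thesis unfolding proj0_def m using lin_ext_pj[OF x] pj_closed by(intro the_equality) blast+
qed

lemma proj0_lhom: "proj0 H : lhom GS kG"
proof -
 note ql = quot_lhom[OF Hs_F[of 0], folded gr_comp_eq]
 have rep: "\<exists>x\<in>F 1. X 0 = F 0 +>\<^bsub>Hs 0\<^esub> x" if "X : car GS" for X
 proof -
  have "X 0 : car (gr_comp H 0)"
   using lhomD(1)[OF comp_lhom[OF UNIV_I, of 0 "gr_comp H"]] that unfolding gr_space_def by blast
  then show ?thesis unfolding gr_comp_eq mem_quot by simp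
 qed
 have c: "(X \<oplus>[GS] Y) 0 = X 0 \<oplus>[gr_comp H 0] Y 0" "(c \<odot>[GS] X) 0 = c \<odot>[gr_comp H 0] X 0" for X Y c
  by(simp_all add: gr_space_def dsum_simps)
 show ?thesis
 proof(rule lhomI)
  fix X assume "X : car GS"
  then obtain x where x: "x : F 1" "X 0 = F 0 +>\<^bsub>Hs 0\<^esub> x" using rep by blast
  then show "proj0 H X : carrier kG" using proj0_eq pj_closed by metis
  fix c
  have e: "(c \<odot>[GS] X) 0 = F 0 +>\<^bsub>Hs 0\<^esub> (c \<odot> x)" unfolding c x(2) using lhomD(3)[OF ql, of x] x(1) by simp
  show "proj0 H (c \<odot>[GS] X) = c \<odot>[kG] proj0 H X"
   unfolding proj0_eq[of "c \<odot> x" "c \<odot>[GS] X", OF F_1_D(4)[OF x(1)] e] proj0_eq[of x X, OF x] by(rule lhomD(3)[OF pj_lhom F_1_D(6)[OF x(1)]])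
 next
  fix X Y assume "X : car GS" "Y : car GS"
  then obtain x y where x: "x : F 1" "X 0 = F 0 +>\<^bsub>Hs 0\<^esub> x" and y: "y : F 1" "Y 0 = F 0 +>\<^bsub>Hs 0\<^esub> y" using rep by metis
  have e: "(X \<oplus>[GS] Y) 0 = F 0 +>\<^bsub>Hs 0\<^esub> (x \<oplus> y)" unfolding c x(2) y(2) using lhomD(2)[OF ql, of x y] x(1) y(1) by simp
  show "proj0 H (X \<oplus>[GS] Y) = proj0 H X \<oplus>[kG] proj0 H Y"
   unfolding proj0_eq[of "x \<oplus> y" "X \<oplus>[GS] Y", OF F_1_D(3)[OF x(1) y(1)] e] proj0_eq[of x X, OF x] proj0_eq[of y Y, OF y]
   by(rule lhomD(2)[OF pj_lhom F_1_D(6)[OF x(1)] F_1_D(6)[OF y(1)]])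
 qed
qed

lemma proj0_cl_0: "g : GL ==> proj0 H (cl 0 g) = sg g"
 using proj0_eq[OF GL_F_1, of g "cl 0 g"] pj_GL[of g] by(simp only: cl_component if_True refl)

lemma proj0_cl_1: "proj0 H (cl 1 x) = 0"
proof -
 have "cl 1 x 0 = F 0 +>\<^bsub>Hs 0\<^esub> \<zero>"
  using rcoset_zero_iff[OF Hs_F, of \<zero> 0] F_D(2) by(simp add: cl_component)
 then have "proj0 H (cl 1 x) = pj \<zero>" by(rule proj0_eq[OF F_1_D(2)])
 then show ?thesis using lhom_zero[OF pj_lhom Hv kGv] by simp
qed

lemma L_F2: "g : GL ==> x : F 2 ==> L (dd g) x : F 2" using F_L'[OF dd_GL(1)] .
lemma R_F2: "g : GL ==> x : F 2 ==> R (dd g) x : F 2" using F_R'[OF dd_GL(1)] .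
lemmas cl_L = cl_1_closed[OF L_F2] and cl_R = cl_1_closed[OF R_F2]

lemma Th_map:
 assumes x: "x : F 2" and M: "M : lhom TT U" and U: "vsp U"
 shows "M (Th x) = finsum U (%g. M (pt (cl 0 g) (cl 1 (L (dd g) x)))) GL \<oplus>[U] finsum U (%h. M (pt (cl 1 (R (dd h) x)) (cl 0 h))) GL"
proof -
 have c: "(%g. pt (cl 0 g) (cl 1 (L (dd g) x))) : GL \<rightarrow> car TT" "(%h. pt (cl 1 (R (dd h) x)) (cl 0 h)) : GL \<rightarrow> car TT"
  using pure_closed[OF Gv Gv cl_0_GL cl_L[OF _ x]] pure_closed[OF Gv Gv cl_R[OF _ x] cl_0_GL] by blast+
 show ?thesis
  unfolding Th_eq[OF x] lhomD(2)[OF M fsum_closed[OF TTv c(1)] fsum_closed[OF TTv c(2)]]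
   lhom_fsum[OF M TTv U finG c(1)] lhom_fsum[OF M TTv U finG c(2)] ..
qed

text \<open>\<open>proj0\<close> kills classes of degree one and sends the class of \<open>g\<close>
  to \<open>g\<close>, so only the summands with the group-like on the right survive.\<close>

lemma Th_proj_right:
 assumes x: "x : F 2"
 shows "tensor_map GS kG (%y. y) (proj0 H) (Th x) = finsum (tensor GS kG) (%h. pure GS kG (cl 1 (R (dd h) x)) (sg h)) GL"
proof -
 let ?T = "tensor GS kG"
 have T: "vsp ?T" by(rule tensor_vs[OF Gv kGv])
 note Mp = tmap_pure[OF Gv Gv Gv kGv lhom_id proj0_lhom]
 have z: "pure GS kG (cl 0 g) 0 = \<zero>[?T]" if "g : GL" for g using pure_zero_right[OF Gv kGv cl_0_GL[OF that]] by simp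
 have c: "(%h. pure GS kG (cl 1 (R (dd h) x)) (sg h)) : GL \<rightarrow> car ?T"
  using pure_closed[OF Gv kGv cl_R[OF _ x] sg_closed] by blast
 show ?thesis
  unfolding Th_map[OF x tmap_lhom[OF Gv Gv Gv kGv lhom_id proj0_lhom] T]
  by(subst fsum_zero[OF T], simp only: Mp cl_0_GL cl_L[OF _ x] proj0_cl_1 z,
    subst fsum_cong[OF T refl c], simp only: Mp cl_0_GL cl_R[OF _ x] proj0_cl_0, rule vs_l_zero[OF T fsum_closed[OF T c]])
qed

lemma Th_proj_left:
 assumes x: "x : F 2"
 shows "tensor_map kG GS (proj0 H) (%y. y) (Th x) = finsum (tensor kG GS) (%g. pure kG GS (sg g) (cl 1 (L (dd g) x))) GL"
proof -
 let ?T = "tensor kG GS"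
 have T: "vsp ?T" by(rule tensor_vs[OF kGv Gv])
 note Mp = tmap_pure[OF Gv Gv kGv Gv proj0_lhom lhom_id]
 have z: "pure kG GS 0 (cl 0 h) = \<zero>[?T]" if "h : GL" for h using pure_zero_left[OF kGv Gv cl_0_GL[OF that]] by simp
 have c: "(%g. pure kG GS (sg g) (cl 1 (L (dd g) x))) : GL \<rightarrow> car ?T"
  using pure_closed[OF kGv Gv sg_closed cl_L[OF _ x]] by blast
 show ?thesis
  unfolding Th_map[OF x tmap_lhom[OF Gv Gv kGv Gv proj0_lhom lhom_id] T]
  by(subst fsum_cong[OF T refl c], simp only: Mp cl_0_GL cl_L[OF _ x] proj0_cl_0,
    subst fsum_zero[OF T], simp only: Mp cl_0_GL cl_R[OF _ x] proj0_cl_1 z, rule vs_r_zero[OF T fsum_closed[OF T c]])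
qed

subsection \<open>The elements of the diagram\<close>

text \<open>Lifts to \<open>F 2\<close> of the degree-one elements of the diagram: the coinvariance
  condition read off at each coefficient \<open>h\<close> of the group algebra.\<close>

definition D1 where "D1 = {x : F 2. \<forall>h\<in>GL. eqv 1 (R (dd h) x) (if h = \<one> then x else \<zero>)}"

lemma D1_D: "x : D1 ==> x : F 2" "x : D1 ==> x : car H" "x : D1 ==> h : GL ==> eqv 1 (R (dd h) x) (if h = \<one> then x else \<zero>)"
 using F_D(6) by(auto simp: D1_def)

text \<open>The group-likes form a basis of \<open>kG\<close>, so the coinvariance equation can be
  compared coefficient by coefficient, by slicing with \<open>lkp _ h\<close>.\<close>

lemma diag_iff:
 assumes x: "x : F 2"
 shows "cl 1 x : diag_filt H \<longleftrightarrow> x : D1"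
proof -
 let ?T = "tensor GS kG"
 have T: "vsp ?T" by(rule tensor_vs[OF Gv kGv])
 let ?S = "finsum ?T (%h. pure GS kG (cl 1 (R (dd h) x)) (sg h)) GL"
 have xc: "cl 1 x : car GS" by(rule cl_1_closed[OF x])
 have one: "\<one>[kG] = sg \<one>" by(simp add: GL_simps(3))
 have zc: "(if h = \<one> then x else \<zero>) : F 2" for h using x F_D(2) by auto
 have cz: "cl 1 \<zero> = \<zero>[GS]" using cl_1_zero_iff[OF F_D(2)] F_1_D(2) by blast
 have pc: "(%h. pure GS kG (cl 1 (R (dd h) x)) (sg h)) : GL \<rightarrow> car ?T"
  using pure_closed[OF Gv kGv cl_R[OF _ x] sg_closed] by blast
 have "cl 1 x : diag_filt H \<longleftrightarrow> ?S = pure GS kG (cl 1 x) (sg \<one>)"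
  unfolding diag_filt_def Let_def gr_tensor_map gr_simps using xc gr_comult_1[OF x] Th_proj_right[OF x]
  by(simp only: one mem_Collect_eq simp_thms)
 also have "... \<longleftrightarrow> x : D1"
 proof
  assume e: "?S = pure GS kG (cl 1 x) (sg \<one>)"
  have "eqv 1 (R (dd h) x) (if h = \<one> then x else \<zero>)" if h: "h : GL" for h
  proof -
   note rl = rslice_lhom[OF Gv kGv lookup_lhom, of h]
   note rp = rslice_pure[OF Gv kGv lookup_lhom]
   have "rslice GS (%p. lkp p h) ?S
    = finsum GS (%k. rslice GS (%p. lkp p h) (pure GS kG (cl 1 (R (dd k) x)) (sg k))) GL"
    by(rule lhom_fsum[OF rl T Gv finG pc])
   also have "... = rslice GS (%p. lkp p h) (pure GS kG (cl 1 (R (dd h) x)) (sg h))"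
    by(rule fsum_single[OF Gv finG h])
     (use rp[OF cl_R[OF _ x] sg_closed] cl_R[OF _ x] h Gv in \<open>auto simp: lookup_single when_def\<close>)
   also have "... = cl 1 (R (dd h) x)"
    unfolding rp[OF cl_R[OF h x] sg_closed[OF h]] using cl_R[OF h x] Gv by simp
   finally have "cl 1 (R (dd h) x) = rslice GS (%p. lkp p h) (pure GS kG (cl 1 x) (sg \<one>))"
    unfolding e by simp
   also have "... = (if h = \<one> then cl 1 x else \<zero>[GS])"
    unfolding rp[OF xc sg_closed[OF GL_one]] using xc Gv by(auto simp: lookup_single when_def)
   also have "... = cl 1 (if h = \<one> then x else \<zero>)" using cz by simp
   finally show ?thesis by(rule iffD1[OF cl_1_eq_iff[OF R_F2[OF h x] zc]])
  qed
  then show "x : D1" using x unfolding D1_def by blast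
 next
  assume D: "x : D1"
  have R: "cl 1 (R (dd h) x) = (if h = \<one> then cl 1 x else \<zero>[GS])" if h: "h : GL" for h
   using cl_1_eq_iff[OF R_F2[OF h x] zc[of h]] D1_D(3)[OF D h] cz by(cases "h = \<one>") auto
  have "?S = pure GS kG (cl 1 (R (dd \<one>) x)) (sg \<one>)"
  proof(rule fsum_single[OF T finG GL_one])
   show "pure GS kG (cl 1 (R (dd \<one>) x)) (sg \<one>) : car ?T" using pc GL_one by blast
   fix h assume "h : GL" "h ~= \<one>"
   then show "pure GS kG (cl 1 (R (dd h) x)) (sg h) = \<zero>[?T]"
    using R[of h] pure_zero_left[OF Gv kGv sg_closed[of h]] by simp
  qed
  then show "?S = pure GS kG (cl 1 x) (sg \<one>)" unfolding R[OF GL_one] by simp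
 qed
 finally show ?thesis .
qed

lemma diag_carrier: "car (diag_one H) = cl 1 ` D1"
proof -
 have e: "gr_degree H 1 = cl 1 ` F 2" using F_Suc[of 1] by(simp only: gr_degree_def F_F2)
 show ?thesis unfolding diag_one_simps e
 proof(intro equalityI subsetI)
  fix X assume "X : diag_filt H \<inter> cl 1 ` F 2"
  then obtain x where x: "x : F 2" "X = cl 1 x" "X : diag_filt H" by(elim IntE imageE)
  then have "x : D1" using diag_iff[OF x(1)] by(simp only: x(2))
  then show "X : cl 1 ` D1" unfolding x(2) by(rule imageI)
 next
  fix X assume "X : cl 1 ` D1"
  then obtain x where x: "x : D1" "X = cl 1 x" by(elim imageE)
  show "X : diag_filt H \<inter> cl 1 ` F 2"
   unfolding x(2) by(intro IntI iffD2[OF diag_iff[OF D1_D(1)[OF x(1)]] x(1)] imageI D1_D(1)[OF x(1)])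
 qed
qed

lemma D1_I: "x : F 2 ==> (!!h. h : GL ==> eqv 1 (R (dd h) x) (if h = \<one> then x else \<zero>)) ==> x : D1"
 unfolding D1_def by blast

lemma D1_subspace: "ssp D1 H"
proof(rule subspaceI[OF Hv])
 show "D1 <= car H" using D1_D(2) by blast
 show "\<zero> : D1"
  by(rule D1_I[OF F_D(2)]) (simp only: lhom_zero[OF R_lhom[OF dd_GL(1)] Hv Hv] if_cancel eqv_refl[OF vs_zero[OF Hv]])
next
 fix x y assume x: "x : D1" and y: "y : D1"
 have "eqv 1 (R (dd h) (x \<oplus> y)) (if h = \<one> then x \<oplus> y else \<zero>)" if h: "h : GL" for h
 proof -
  have "R (dd h) (x \<oplus> y) = R (dd h) x \<oplus> R (dd h) y" using lhomD(2)[OF R_lhom[OF dd_GL(1)[OF h]]] D1_D(2) x y by simp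
  then show ?thesis using eqv_add[OF D1_D(3)[OF x h] D1_D(3)[OF y h]] Hv by(cases "h = \<one>") auto
 qed
 then show "x \<oplus> y : D1" by(rule D1_I[OF F_D(3)[OF D1_D(1)[OF x] D1_D(1)[OF y]]])
next
 fix c x assume x: "x : D1"
 have "eqv 1 (R (dd h) (c \<odot> x)) (if h = \<one> then c \<odot> x else \<zero>)" if h: "h : GL" for h
 proof -
  have "R (dd h) (c \<odot> x) = c \<odot> R (dd h) x" using lhomD(3)[OF R_lhom[OF dd_GL(1)[OF h]]] D1_D(2) x by simp
  then show ?thesis using eqv_smult[OF D1_D(3)[OF x h], of c] Hv by(cases "h = \<one>") auto
 qed
 then show "c \<odot> x : D1" by(rule D1_I[OF F_D(4)[OF D1_D(1)[OF x]]])
qed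

text \<open>Left slices commute with the right slices that define \<open>D1\<close>.\<close>

lemma D1_L: assumes e: "e : duals" and x: "x : D1" shows "L e x : D1"
proof -
 have "eqv 1 (R (dd h) (L e x)) (if h = \<one> then L e x else \<zero>)" if h: "h : GL" for h
 proof -
  have "eqv 1 (L e (R (dd h) x)) (L e (if h = \<one> then x else \<zero>))"
   by(rule eqv_lhom[OF L_lhom[OF e] F_L'[OF e] D1_D(3)[OF x h]])
  then show ?thesis using L_R[OF e dd_GL(1)[OF h] D1_D(2)[OF x]] lhom_zero[OF L_lhom[OF e] Hv Hv] by(cases "h = \<one>") auto
 qed
 then show ?thesis by(rule D1_I[OF F_L'[OF e D1_D(1)[OF x]]])
qed

definition cj where "cj h x = h \<otimes> x \<otimes> gi h"

lemma cj_lhom: "h : GL ==> cj h : lhom H H"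
 unfolding cj_def[abs_def] by(rule lhom_comp[OF m_lin2[OF GL_D(1)] m_lin1[OF GL_D(1)[OF GL_inv(1)]]])

lemma cj_F: "h : GL ==> x : F n ==> cj h x : F n"
 unfolding cj_def by(rule F_mult'[OF F_mult'[OF GL_F_1] GL_F_1[OF GL_inv(1)]]) auto

lemma cj_cj: "h : GL ==> x : car H ==> cj (gi h) (cj h x) = x" "h : GL ==> x : car H ==> cj h (cj (gi h) x) = x"
proof -
 assume h: "h : GL" and x: "x : car H"
 have ii: "gi (gi h) = h" using group.inv_inv[OF GL_group h] .
 note hc = GL_D(1)[OF h] and ic = GL_D(1)[OF GL_inv(1)[OF h]] and i = GL_inv[OF h]
 show "cj (gi h) (cj h x) = x" unfolding cj_def ii using x hc ic i(2,3) H_closed by(metis H_assoc H_l_one H_r_one)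
 show "cj h (cj (gi h) x) = x" unfolding cj_def ii using x hc ic i(2,3) H_closed by(metis H_assoc H_l_one H_r_one)
qed

lemma cj_GL: "h : GL ==> g : GL ==> cj h g : GL"
 unfolding cj_def by(rule GL_mult[OF GL_mult GL_inv(1)])

lemma dd_cj: assumes h: "h : GL" and k: "k : GL" and u: "u : GL" shows "dd k (cj h u) = dd (cj (gi h) k) u"
proof -
 have "k = cj h u \<longleftrightarrow> cj (gi h) k = u" using cj_cj[OF h GL_D(1)[OF k]] cj_cj[OF h GL_D(1)[OF u]] by metis
 then show ?thesis using dd_GL(2)[OF k cj_GL[OF h u]] dd_GL(2)[OF cj_GL[OF GL_inv(1)[OF h] k] u] by simp
qed

lemma cj_dual: "h : GL ==> e : duals ==> (%u. e (cj h u)) : duals"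
 by(rule lhom_comp[OF cj_lhom])

text \<open>The comultiplication turns conjugation by \<open>h\<close> into conjugation by
  \<open>h \<otimes> h\<close>: the sliced leg conjugates the functional, the other leg the
  result.\<close>

lemma R_cj: assumes e: "e : duals" and h: "h : GL" and x: "x : car H" shows "R e (cj h x) = cj h (R (%u. e (cj h u)) x)"
proof -
 note hc = GL_D(1)[OF h] and i = GL_inv(1)[OF h]
 have "R e (cj h x) = R (%u. e (u \<otimes> gi h)) (h \<otimes> x) \<otimes> gi h"
  unfolding cj_def by(rule R_GL_right[OF e i H_closed[OF hc x]])
 also have "R (%u. e (u \<otimes> gi h)) (h \<otimes> x) = h \<otimes> R (%u. e (h \<otimes> u \<otimes> gi h)) x"
  by(rule R_GL_left[OF shift_dual'[OF e GL_D(1)[OF i]] h x])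
 finally show ?thesis by(simp add: cj_def)
qed

lemma L_cj: assumes e: "e : duals" and h: "h : GL" and x: "x : car H" shows "L e (cj h x) = cj h (L (%u. e (cj h u)) x)"
proof -
 note hD = GL_D[OF h] and i = GL_inv(1)[OF h]
 note iD = GL_D[OF i]
 have hx: "h \<otimes> x : car H" by(rule H_closed[OF hD(1) x])
 have "L e (cj h x) = lslice H e (tensor_mult H (Del (h \<otimes> x)) (pr (gi h) (gi h)))"
  unfolding L_def cj_def Del_mult[OF hx iD(1)] iD(3) ..
 also have "... = lslice H (%u. e (u \<otimes> gi h)) (Del (h \<otimes> x)) \<otimes> gi h"
  by(rule lslice_tensor_mult_right[OF e iD(1,1) Del_closed[OF hx]])
 also have "lslice H (%u. e (u \<otimes> gi h)) (Del (h \<otimes> x)) = h \<otimes> lslice H (%u. e (h \<otimes> u \<otimes> gi h)) (Del x)"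
  unfolding Del_mult[OF hD(1) x] hD(3) by(rule lslice_tensor_mult[OF shift_dual'[OF e iD(1)] hD(1,1) Del_closed[OF x]])
 finally show ?thesis by(simp add: cj_def L_def)
qed

lemma eqv_cj: "h : GL ==> eqv 1 a b ==> eqv 1 (cj h a) (cj h b)"
 by(rule eqv_lhom[OF cj_lhom]) (use cj_F in blast)+

text \<open>Conjugation permutes the functionals \<open>dd k\<close> on group-likes and fixes
  \<open>1\<close>, and modulo \<open>F 1\<close> only the values on group-likes matter.\<close>

lemma D1_cj: assumes h: "h : GL" and x: "x : D1" shows "cj h x : D1"
proof -
 note xc = D1_D(2)[OF x]
 have "eqv 1 (R (dd k) (cj h x)) (if k = \<one> then cj h x else \<zero>)" if k: "k : GL" for k
 proof -
  note k' = cj_GL[OF GL_inv(1)[OF h] k]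
  have one: "cj (gi h) k = \<one> \<longleftrightarrow> k = \<one>"
  proof -
   have "cj h \<one> = \<one>" unfolding cj_def using GL_D(1)[OF h] GL_inv(2)[OF h] H_r_one by simp
   moreover have "cj (gi h) \<one> = \<one>"
    unfolding cj_def using GL_D(1)[OF GL_inv(1)[OF h]] GL_inv(2)[OF GL_inv(1)[OF h]] H_r_one by simp
   ultimately show ?thesis using cj_cj[OF h GL_D(1)[OF k]] by metis
  qed
  have "R (dd k) (cj h x) = cj h (R (%u. dd k (cj h u)) x)" by(rule R_cj[OF dd_GL(1)[OF k] h xc])
  also have "eqv 1 ... (cj h (R (dd (cj (gi h) k)) x))"
   by(rule eqv_cj[OF h eqv_dual(2)[OF cj_dual[OF h dd_GL(1)[OF k]] dd_GL(1)[OF k'] dd_cj[OF h k] D1_D(1)[OF x]]])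
  also have "eqv 1 ... (cj h (if cj (gi h) k = \<one> then x else \<zero>))" by(rule eqv_cj[OF h D1_D(3)[OF x k']])
  also have "... = (if k = \<one> then cj h x else \<zero>)" using one lhom_zero[OF cj_lhom[OF h] Hv Hv] by simp
  finally show ?thesis .
 qed
 then show ?thesis by(rule D1_I[OF cj_F[OF h D1_D(1)[OF x]]])
qed

text \<open>In the decomposition of \<open>\<Delta>(x)\<close> the first sum reduces to
  \<open>s \<otimes> x\<close> because \<open>x\<close> has degree \<open>s\<close>, the second to
  \<open>x \<otimes> 1\<close> because \<open>x\<close> is coinvariant; all corrections lie in the
  tensor square of the coradical.\<close>

lemma D1_skew:
 assumes x: "x : D1" and s: "s : GL" and L: "!!g. g : GL ==> eqv 1 (L (dd g) x) (if g = s then x else \<zero>)"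
 shows "skew s x"
proof -
 note x2 = D1_D(1)[OF x] and xc = D1_D(2)[OF x]
 define dl where "dl g = (if g = s then x else \<zero>)" for g
 have dlc: "dl g : car H" for g using xc Hv by(simp add: dl_def)
 define c where "c g = L (dd g) x \<oplus> (-1) \<odot> dl g" for g
 have cF: "c g : F 1" if "g : GL" for g using eqv_D(3)[OF L[OF that]] by(simp add: c_def dl_def)
 have Lc: "L (dd g) x = dl g \<oplus> c g" if g: "g : GL" for g
  unfolding c_def by(rule vs_add_diff[OF Hv L_closed[OF dd_GL(1)[OF g] xc] dlc, symmetric])
 have pg: "(%g. pr g (dl g)) : GL \<rightarrow> car HH" "(%g. pr g (c g)) : GL \<rightarrow> car HH"
  using pr_closed[OF GL_D(1) dlc] pr_closed[OF GL_D(1) F_1_D(6)[OF cF]] by blast+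
 have "finsum HH (%g. pr g (L (dd g) x)) GL = finsum HH (%g. pr g (dl g) \<oplus>[HH] pr g (c g)) GL"
 proof(rule fsum_cong[OF HHv refl])
  fix g assume g: "g : GL"
  show "pr g (L (dd g) x) = pr g (dl g) \<oplus>[HH] pr g (c g)"
   unfolding Lc[OF g] by(rule pure_add_right[OF Hv Hv GL_D(1)[OF g] dlc F_1_D(6)[OF cF[OF g]]])
 qed (use pg HHv in blast)
 also have "... = finsum HH (%g. pr g (dl g)) GL \<oplus>[HH] finsum HH (%g. pr g (c g)) GL"
  by(rule fsum_add[OF HHv pg])
 also have "finsum HH (%g. pr g (dl g)) GL = pr s (dl s)"
  by(rule fsum_single[OF HHv finG s])
   (use pr_closed[OF GL_D(1)[OF s] xc] pure_zero_right[OF Hv Hv GL_D(1)] in \<open>simp_all add: dl_def\<close>)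
 also have "dl s = x" by(simp add: dl_def)
 finally have 1: "finsum HH (%g. pr g (L (dd g) x)) GL = pr s x \<oplus>[HH] finsum HH (%g. pr g (c g)) GL" .
 note r1 = R_closed[OF dd_GL(1)[OF GL_one] xc]
 have "finsum HH (%h. pr (P1c (R (dd h) x)) h) GL = pr (P1c (R (dd \<one>) x)) \<one>"
 proof(rule fsum_single[OF HHv finG GL_one])
  show "pr (P1c (R (dd \<one>) x)) \<one> : car HH" by(rule pr_closed[OF lhomD(1)[OF P1c_lhom r1] H_one])
  fix h assume h: "h : GL" "h ~= \<one>"
  have "R (dd h) x : F 1" using D1_D(3)[OF x h(1)] h(2) eqv_mem[of 1 "R (dd h) x" \<zero>] F_1_D(2) by simp
  then show "pr (P1c (R (dd h) x)) h = \<zero>[HH]" using P1c_zero pure_zero_left[OF Hv Hv GL_D(1)[OF h(1)]] by simp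
 qed
 also have "P1c (R (dd \<one>) x) = P1c x"
 proof -
  have "eqv 1 (R (dd \<one>) x) x" using D1_D(3)[OF x GL_one] by simp
  then obtain r where r: "r : F 1" "R (dd \<one>) x = x \<oplus> r" by(rule eqv_E)
  show ?thesis using lhomD(2)[OF P1c_lhom xc F_1_D(6)[OF r(1)]] P1c_zero[OF r(1)] lhomD(1)[OF P1c_lhom xc] Hv r(2) by simp
 qed
 also have "pr (P1c x) \<one> = pr x \<one> \<oplus>[HH] pr ((-1) \<odot> P1 x) \<one>"
  unfolding P1c_def by(rule pure_add_left[OF Hv Hv xc _ H_one]) (use lhomD(1)[OF P1_lhom xc] Hv in simp)
 finally have 2: "finsum HH (%h. pr (P1c (R (dd h) x)) h) GL = pr x \<one> \<oplus>[HH] pr ((-1) \<odot> P1 x) \<one>" .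
 define r where "r = finsum HH (%g. pr g (c g)) GL \<oplus>[HH] pr ((-1) \<odot> P1 x) \<one>"
 note tm = tspan_mem[OF Hv Hv F_1_D(1) F_1_D(1)]
 have a: "finsum HH (%g. pr g (c g)) GL : tensor_span H H (F 1) (F 1)"
  by(rule subsp_fsum[OF ts11 finG], rule Pi_I, rule tm[OF GL_F_1 cF])
 have b: "pr ((-1) \<odot> P1 x) \<one> : tensor_span H H (F 1) (F 1)" by(rule tm[OF F_1_D(4)[OF P1_F] GL_F_1[OF GL_one]])
 have rF: "r : tensor_span H H (F 1) (F 1)" unfolding r_def by(rule subspD(3)[OF ts11 a b])
 have "Del x = pr s x \<oplus>[HH] (pr x \<one> \<oplus>[HH] r)"
  unfolding Del_decomp[OF x2] 1 2 r_def
  using pr_closed[OF GL_D(1)[OF s] xc] pr_closed[OF xc H_one] subspD(6)[OF ts11 a] subspD(6)[OF ts11 b] HHv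
  by(simp add: vs_assoc vs_lcomm)
 then show ?thesis unfolding skew_def using s xc rF by blast
qed

end

section \<open>The degree one part as a graded representation\<close>

context fd_pointed
begin

interpretation vectorspace CC H by(rule Hv)

abbreviation VV where "VV \<equiv> diag_one H"

lemma cl_D1_subspace: "ssp (cl 1 ` D1) GS"
proof -
 have "kap1 ` D1 = cl 1 ` D1" by(rule image_cong[OF refl kap_vals(2)[OF D1_D(1)]])
 then show ?thesis using img_subsp[OF kap1_lhom Gv D1_subspace] by simp
qed

lemma VVv: "vsp VV"
 by(rule vectorspace_cong[OF subsp_vs[OF cl_D1_subspace]]) (simp_all add: diag_carrier diag_one_simps(2-4))

lemma VV_incl: "(%v. v) : lhom VV GS"
 by(rule lhomI) (use subspD(6)[OF cl_D1_subspace] in \<open>simp_all add: diag_carrier diag_one_simps(2-4)\<close>)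

text \<open>The space is the image of \<open>H\<close> under a projection onto \<open>D1\<close>
  followed by the class map.\<close>

lemma VV_fd: "vectorspace.fin_dim CC VV"
proof -
 obtain Q where Q: "Q : lhom H H" "!!x. x : car H ==> Q x : D1" "!!x. x : D1 ==> Q x = x"
  using projection_exists[OF D1_subspace] by blast
 define f where "f x = kap1 (Q x)" for x
 have fG: "f : lhom H GS" unfolding f_def[abs_def] by(rule lhom_comp[OF Q(1) kap1_lhom])
 have fc: "f x = cl 1 (Q x)" if "x : car H" for x unfolding f_def by(rule kap_vals(2)[OF D1_D(1)[OF Q(2)[OF that]]])
 have fV: "f : lhom H VV"
  by(rule lhomI) (use lhomD(2,3)[OF fG] fc Q(2) in \<open>simp_all add: diag_carrier diag_one_simps(2-4)\<close>)
 obtain A where A: "finite A" "A <= car H" "lspan H A = car H" using fd unfolding fin_dim_def by blast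
 have "f ` car H = car VV"
 proof(intro equalityI subsetI)
  fix X assume "X : car VV"
  then obtain x where x: "x : D1" "X = cl 1 x" unfolding diag_carrier by(elim imageE)
  have "X = f x" using fc[OF D1_D(2)[OF x(1)]] Q(3)[OF x(1)] x(2) by simp
  then show "X : f ` car H" using D1_D(2)[OF x(1)] by simp
 qed (use lhomD(1)[OF fV] in blast)
 then have "lspan VV (f ` A) = car VV" using img_lspan[OF fV Hv VVv A(2)] A(3) by simp
 moreover have "f ` A <= car VV" using lhomD(1)[OF fV] A(2) by blast
 ultimately show ?thesis
  unfolding vectorspace.fin_dim_def[OF VVv] using A(1) by(intro exI[of _ "f ` A"]) simp
qed

definition rp where "rp X = (SOME x. x : D1 & cl 1 x = X)"

lemma rp: "X : car VV ==> rp X : D1 & cl 1 (rp X) = X"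
 unfolding rp_def diag_carrier by(rule someI_ex) blast

definition induced where "induced T X = cl 1 (T (rp X))"
text \<open>The conditions under which an endomorphism of \<open>H\<close> descends to classes of
  elements of \<open>D1\<close> modulo \<open>F 1\<close>.\<close>

definition compat where "compat T \<longleftrightarrow> T : lhom H H & (\<forall>x\<in>F 1. T x : F 1) & (\<forall>x\<in>D1. T x : D1)"

lemma compat_D: "compat T ==> T : lhom H H" "compat T ==> x : F 1 ==> T x : F 1" "compat T ==> x : D1 ==> T x : D1"
 by(simp_all add: compat_def)

lemma cl_D1_eq_iff: "x : D1 ==> y : D1 ==> cl 1 x = cl 1 y \<longleftrightarrow> eqv 1 x y"
 by(rule cl_1_eq_iff[OF D1_D(1) D1_D(1)])

lemma cl_D1_VV: "x : D1 ==> cl 1 x : car VV"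
 unfolding diag_carrier by(rule imageI)

lemma induced_cl: assumes T: "compat T" and x: "x : D1" shows "induced T (cl 1 x) = cl 1 (T x)"
proof -
 have r: "rp (cl 1 x) : D1" "cl 1 (rp (cl 1 x)) = cl 1 x" using rp[OF cl_D1_VV[OF x]] by blast+
 have e: "eqv 1 (rp (cl 1 x)) x" using r(2) unfolding cl_D1_eq_iff[OF r(1) x] .
 have "eqv 1 (T (rp (cl 1 x))) (T x)" by(rule eqv_lhom[OF compat_D(1)[OF T] compat_D(2)[OF T] e])
 then show ?thesis unfolding induced_def cl_D1_eq_iff[OF compat_D(3)[OF T r(1)] compat_D(3)[OF T x]] .
qed

lemma VV_E: assumes "X : car VV" obtains x where "x : D1" "X = cl 1 x"
 using assms unfolding diag_carrier by(elim imageE)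

lemma induced_lhom: assumes T: "compat T" shows "induced T : lhom VV VV"
proof(rule lhomI)
 note Tl = lhomD(2,3)[OF compat_D(1)[OF T]]
 fix X assume "X : car VV"
 then obtain x where x: "x : D1" "X = cl 1 x" by(rule VV_E)
 note Tx = compat_D(3)[OF T x(1)]
 show "induced T X : car VV" unfolding x(2) induced_cl[OF T x(1)] by(rule cl_D1_VV[OF Tx])
 fix c
 have "c \<odot>[VV] X = cl 1 (c \<odot> x)" unfolding x(2) diag_one_simps cl_1_smult[OF D1_D(1)[OF x(1)]] ..
 then show "induced T (c \<odot>[VV] X) = c \<odot>[VV] induced T X"
  unfolding x(2) induced_cl[OF T x(1)] diag_one_simps
  by(simp only: induced_cl[OF T subspD(4)[OF D1_subspace x(1)]] Tl(2)[OF D1_D(2)[OF x(1)]] cl_1_smult[OF D1_D(1)[OF Tx]])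
next
 note Tl = lhomD(2,3)[OF compat_D(1)[OF T]]
 fix X Y assume "X : car VV" "Y : car VV"
 then obtain x y where x: "x : D1" "X = cl 1 x" and y: "y : D1" "Y = cl 1 y" by(metis VV_E)
 note Tx = compat_D(3)[OF T x(1)] and Ty = compat_D(3)[OF T y(1)]
 have "X \<oplus>[VV] Y = cl 1 (x \<oplus> y)" unfolding x(2) y(2) diag_one_simps cl_1_add[OF D1_D(1)[OF x(1)] D1_D(1)[OF y(1)]] ..
 then show "induced T (X \<oplus>[VV] Y) = induced T X \<oplus>[VV] induced T Y"
  unfolding x(2) y(2) induced_cl[OF T x(1)] induced_cl[OF T y(1)] diag_one_simps
  by(simp only: induced_cl[OF T subspD(3)[OF D1_subspace x(1) y(1)]] Tl(1)[OF D1_D(2)[OF x(1)] D1_D(2)[OF y(1)]]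
    cl_1_add[OF D1_D(1)[OF Tx] D1_D(1)[OF Ty]])
qed

text \<open>On lifts the group acts by conjugation, and the projection to degree \<open>g\<close> is
  the left slice by \<open>dd g\<close>. Both descend because they preserve \<open>F 1\<close> and
  \<open>D1\<close>.\<close>

definition sig where "sig g = induced (cj g)"
definition \<pi> where "\<pi> g = induced (L (dd g))"

lemma cj_compat: "g : GL ==> compat (cj g)"
 unfolding compat_def using cj_lhom cj_F D1_cj by blast

lemma L_compat: "e : duals ==> compat (L e)"
 unfolding compat_def using L_lhom F_L' D1_L by blast

lemma sig_cl: "g : GL ==> x : D1 ==> sig g (cl 1 x) = cl 1 (cj g x)"
 unfolding sig_def by(rule induced_cl[OF cj_compat])

lemma \<pi>_cl: "g : GL ==> x : D1 ==> \<pi> g (cl 1 x) = cl 1 (L (dd g) x)"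
 unfolding \<pi>_def by(rule induced_cl[OF L_compat[OF dd_GL(1)]])

lemma VV_act:
 assumes b: "b : carrier kG" and X: "X : car VV"
 shows "act VV b X = lin_ext VV (%g. sig g X) b"
proof -
 from X obtain x where x: "x : D1" "X = cl 1 x" by(rule VV_E)
 let ?a = "%g. cl 0 g \<otimes>[gr H] X \<otimes>[gr H] cl 0 (gi g)"
 have e: "?a g = sig g X" if g: "g : GL" for g
 proof -
  have gF: "g : F (Suc 0)" "gi g : F (Suc 0)" using GL_F_1[OF g] GL_F_1[OF GL_inv(1)[OF g]] by simp_all
  have xF: "x : F (Suc 1)" using D1_D(1)[OF x(1)] by(simp only: F_F2)
  have gx: "g \<otimes> x : F (Suc (0 + 1))" by(rule F_mult'[OF gF(1) xF]) simp
  have "?a g = cl (0 + 1 + 0) (g \<otimes> x \<otimes> gi g)"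
   unfolding gr_simps x(2) gr_mult_cl[OF gF(1) xF] by(rule gr_mult_cl[OF gx gF(2)])
  also have "... = sig g X" unfolding x(2) sig_cl[OF g x(1)] by(simp add: cj_def)
  finally show ?thesis .
 qed
 have k: "g : GL" if "g : kys b" for g using b that by(auto)
 have "act VV b X = lin_ext VV ?a b"
  unfolding diag_one_simps(5) by(rule lin_ext_fields_cong) (simp_all add: diag_one_simps(1-4))
 also have "... = lin_ext VV (%g. sig g X) b"
  by(rule lin_ext_cong[OF VVv]) (use e k lhomD(1)[OF induced_lhom[OF cj_compat] X] in \<open>auto simp: sig_def\<close>)
 finally show ?thesis .
qed

text \<open>The coaction is described by \<open>THE\<close>, so uniqueness matters: the map from
  \<open>kG \<otimes> VV\<close> to \<open>kG \<otimes> GS\<close> is injective, because a tensor is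
  recovered from its slices by \<open>lkp _ g\<close> and these are the same elements on both
  sides.\<close>

lemma VV_coact:
 assumes X: "X : car VV"
 shows "coact VV X = finsum (tensor kG VV) (%g. pure kG VV (sg g) (\<pi> g X)) GL"
proof -
 from X obtain x where x: "x : D1" "X = cl 1 x" by(rule VV_E)
 let ?Vr = "GS\<lparr>carrier := diag_filt H \<inter> gr_degree H 1\<rparr>"
 let ?M = "tensor_map kG GS (%b. b) (%v. v)" and ?T = "tensor kG VV" and ?U = "tensor kG GS"
 let ?t = "finsum ?T (%g. pure kG VV (sg g) (\<pi> g X)) GL"
 have T: "vsp ?T" and U: "vsp ?U"
  by(rule tensor_vs[OF kGv VVv], rule tensor_vs[OF kGv Gv])
 have tV: "tensor kG ?Vr = ?T" by(rule tensor_cong) (simp_all add: diag_one_simps)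
 note M = tmap_lhom[OF kGv VVv kGv Gv lhom_id VV_incl]
 note Mp = tmap_pure[OF kGv VVv kGv Gv lhom_id VV_incl]
 have \<pi>c: "\<pi> g X : car VV" if g: "g : GL" for g
  unfolding \<pi>_def by(rule lhomD(1)[OF induced_lhom[OF L_compat[OF dd_GL(1)[OF g]]] X])
 have pc: "(%g. pure kG VV (sg g) (\<pi> g X)) : GL \<rightarrow> car ?T"
  using pure_closed[OF kGv VVv sg_closed \<pi>c] by blast
 note tc = fsum_closed[OF T pc]
 have "?M ?t = finsum ?U (%g. ?M (pure kG VV (sg g) (\<pi> g X))) GL"
  by(rule lhom_fsum[OF M T U finG pc])
 also have "... = finsum ?U (%g. pure kG GS (sg g) (cl 1 (L (dd g) x))) GL"
 proof(rule fsum_cong[OF U refl])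
  fix g assume g: "g : GL"
  show "?M (pure kG VV (sg g) (\<pi> g X)) = pure kG GS (sg g) (cl 1 (L (dd g) x))"
   unfolding Mp[OF sg_closed[OF g] \<pi>c[OF g]] unfolding x(2) \<pi>_cl[OF g x(1)] ..
 qed (use pure_closed[OF kGv Gv sg_closed cl_L[OF _ D1_D(1)[OF x(1)]]] in blast)
 also have "... = tensor_map kG (gr H) (proj0 H) (%v. v) (comult (gr H) X)"
  unfolding gr_tensor_map gr_simps x(2) gr_comult_1[OF D1_D(1)[OF x(1)]] Th_proj_left[OF D1_D(1)[OF x(1)]] ..
 finally have Mt: "?M ?t = tensor_map kG (gr H) (proj0 H) (%v. v) (comult (gr H) X)" .
 have inj: "t = ?t" if t: "t : car ?T" "?M t = ?M ?t" for t
 proof -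
  have sl: "lslice VV (%p. lkp p g) r = lslice GS (%p. lkp p g) (?M r)" if r: "r : car ?T" for g r
  proof(rule tensor_eqI[OF kGv VVv _ _ Gv r])
   show "lslice VV (%p. lkp p g) : lhom ?T GS"
    by(rule lhom_comp[OF lslice_lhom[OF kGv VVv lookup_lhom] VV_incl])
   show "(%r. lslice GS (%p. lkp p g) (?M r)) : lhom ?T GS"
    by(rule lhom_comp[OF M lslice_lhom[OF kGv Gv lookup_lhom]])
   fix p v assume pv: "p : carrier kG" "v : car VV"
   show "lslice VV (%p. lkp p g) (pure kG VV p v) = lslice GS (%p. lkp p g) (?M (pure kG VV p v))"
    unfolding Mp[OF pv] lslice_pure[OF kGv VVv lookup_lhom pv] lslice_pure[OF kGv Gv lookup_lhom pv(1) lhomD(1)[OF VV_incl pv(2)]]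
    by(simp only: diag_one_simps(4))
  qed
  have "lslice VV (%p. lkp p g) t = lslice VV (%p. lkp p g) ?t" for g
   unfolding sl[OF t(1)] sl[OF tc] t(2) ..
  then have "finsum ?T (%g. pure kG VV (sg g) (lslice VV (%p. lkp p g) t)) GL
   = finsum ?T (%g. pure kG VV (sg g) (lslice VV (%p. lkp p g) ?t)) GL" by(simp only:)
  then show ?thesis unfolding galg_expand[OF VVv finG t(1)] galg_expand[OF VVv finG tc] .
 qed
 show ?thesis
  unfolding diag_one_simps(6) tV
 proof(rule the_equality)
  show "?t : car ?T & tensor_map kG (gr H) (%b. b) (%v. v) ?t = tensor_map kG (gr H) (proj0 H) (%v. v) (comult (gr H) X)"
   using tc Mt by(simp only: gr_tensor_map simp_thms)
 next
  fix t assume t: "t : car ?T & tensor_map kG (gr H) (%b. b) (%v. v) t = tensor_map kG (gr H) (proj0 H) (%v. v) (comult (gr H) X)"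
  have "?M t = ?M ?t" using t Mt by(simp only: gr_tensor_map)
  then show "t = ?t" using inj t by blast
 qed
qed

lemma VV_graded: "graded_module (grouplikes H) VV sig \<pi>"
 unfolding graded_module_def sig_def \<pi>_def
 using VVv induced_lhom[OF cj_compat] induced_lhom[OF L_compat[OF dd_GL(1)]] VV_act[unfolded sig_def] VV_coact[unfolded \<pi>_def] by blast

lemma L_sum:
 assumes x: "x : car H"
 shows "L (%u. \<Sum>g\<in>GL. dd g u) x = finsum H (%g. L (dd g) x) GL" "(%u. \<Sum>g\<in>GL. dd g u) : duals"
proof -
 have "(%u. finsum complex_mod (%g. dd g u) GL) : duals" by(rule lhom_finsum[OF finG dd_GL(1) cm_vs])
 then show d: "(%u. \<Sum>g\<in>GL. dd g u) : duals" by(simp only: complex_mod_finsum[OF finG])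
 show "L (%u. \<Sum>g\<in>GL. dd g u) x = finsum H (%g. L (dd g) x) GL"
  unfolding L_def
 proof(rule tensor_eqI[OF Hv Hv lsl[OF d] lhom_finsum[OF finG lsl[OF dd_GL(1)] Hv] Hv Del_closed[OF x]])
  fix a b assume ab: "a : car H" "b : car H"
  have bl: "(%c. c \<odot> b) : lhom complex_mod H" using ab Hv by(auto intro!: lhomI simp: vs_smult_l)
  have "(\<Sum>g\<in>GL. dd g a) \<odot> b = finsum H (%g. dd g a \<odot> b) GL"
   using lhom_fsum[OF bl cm_vs Hv finG, of "%g. dd g a"] by(simp add: complex_mod_finsum[OF finG])
  also have "... = finsum H (%g. lslice H (dd g) (pr a b)) GL"
   by(rule fsum_cong[OF Hv refl]) (use lsp[OF dd_GL(1) ab] ab Hv in \<open>auto\<close>)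
  finally show "lslice H (%u. \<Sum>g\<in>GL. dd g u) (pr a b) = finsum H (%g. lslice H (dd g) (pr a b)) GL"
   unfolding lsp[OF d ab] .
 qed
qed

text \<open>All laws are checked on lifts. Those for \<open>\<pi>\<close> compare functionals on
  group-likes: there the convolution of \<open>dd h\<close> and \<open>dd g\<close> is
  \<open>dd h\<close> or zero, and the sum of all \<open>dd g\<close> agrees with the
  counit.\<close>

lemma VV_graded_rep: "graded_rep (grouplikes H) VV sig \<pi>"
proof(rule graded_rep.intro[OF GL_group graded_rep_axioms.intro[OF finG VV_graded VV_fd]])
 note G = GL_simps(2,3)
 have cz: "cl 1 \<zero> = \<zero>[VV]" using cl_1_zero_iff[OF F_D(2)] F_1_D(2) by(simp only: diag_one_simps)
 { fix X assume "X : car VV"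
  then obtain x where x: "x : D1" "X = cl 1 x" by(rule VV_E)
  note xc = D1_D(2)[OF x(1)] and x2 = D1_D(1)[OF x(1)]
  have "gi \<one> = \<one>" using GL_inv(2)[OF GL_one] H_l_one[OF GL_D(1)[OF GL_inv(1)[OF GL_one]]] by simp
  then show "sig \<one>[grouplikes H] X = X"
   unfolding G x(2) sig_cl[OF GL_one x(1)] cj_def using H_l_one[OF xc] H_r_one[OF xc] by simp
  have lh: "cl 1 : lhom (Hs 1) GS" by(rule cl_lhom)
  have LH: "(%g. L (dd g) x) : GL \<rightarrow> F 2" using L_F2[OF _ x2] by blast
  have "finsum VV (%g. \<pi> g X) GL = finsum GS (%g. \<pi> g X) GL"
   using lhom_fsum[OF VV_incl VVv Gv finG, of "%g. \<pi> g X"] \<pi>_cl[OF _ x(1)] cl_D1_VV[OF D1_L[OF dd_GL(1) x(1)]]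
   by(simp add: x(2))
  also have "... = finsum GS (%g. kap1 (L (dd g) x)) GL"
   by(rule fsum_cong[OF Gv refl])
    (use \<pi>_cl[OF _ x(1)] kap_vals(2)[OF L_F2[OF _ x2]] cl_L[OF _ x2] in \<open>auto simp: x(2)\<close>)
  also have "... = kap1 (finsum H (%g. L (dd g) x) GL)"
   by(rule lhom_fsum[OF kap1_lhom Hv Gv finG, symmetric]) (use L_closed[OF dd_GL(1) xc] in blast)
  also have "... = cl 1 (L (%u. \<Sum>g\<in>GL. dd g u) x)"
   unfolding L_sum(1)[OF xc, symmetric] by(rule kap_vals(2)[OF F_L'[OF L_sum(2)[OF xc] x2]])
  also have "... = cl 1 (L eps x)"
  proof(rule iffD2[OF cl_1_eq_iff[OF F_L'[OF L_sum(2)[OF xc] x2] F_L'[OF eps_lhom x2]] eqv_dual(1)[OF L_sum(2)[OF xc] eps_lhom _ x2]])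
   fix h assume h: "h : GL"
   have "(\<Sum>g\<in>GL. dd g h) = (\<Sum>g\<in>GL. if g = h then 1 else 0)" by(rule sum.cong[OF refl]) (rule dd_GL(2)[OF _ h])
   then show "(\<Sum>g\<in>GL. dd g h) = eps h" using finG h GL_eps[OF h] by(simp add: sum.delta)
  qed
  finally show "finsum VV (%g. \<pi> g X) GL = X" unfolding L_eps[OF xc] x(2) .
  fix g h assume g: "g : GL" and h: "h : GL"
  note gh = GL_mult[OF g h]
  have "gi (g \<otimes> h) = gi h \<otimes> gi g" using group.inv_mult_group[OF GL_group g h] by(simp only: G)
  then have "cj (g \<otimes> h) x = cj g (cj h x)"
   unfolding cj_def using xc GL_D(1)[OF g] GL_D(1)[OF h] GL_D(1)[OF GL_inv(1)[OF g]] GL_D(1)[OF GL_inv(1)[OF h]] H_closed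
   by(simp add: H_assoc)
  then show "sig (g \<otimes>[grouplikes H] h) X = sig g (sig h X)"
   unfolding G x(2) sig_cl[OF gh x(1)] sig_cl[OF h x(1)] sig_cl[OF g D1_cj[OF h x(1)]] by simp
  note dg = dd_GL(1)[OF g] and dh = dd_GL(1)[OF h]
  have zd: "(%_. 0) : duals" using lhom_0[OF cm_vs] by simp
  have "L (dd g) (L (dd h) x) = L (cv (dd h) (dd g)) x" by(rule L_L[OF dh dg xc])
  then have 1: "\<pi> g (\<pi> h X) = cl 1 (L (cv (dd h) (dd g)) x)"
   unfolding x(2) \<pi>_cl[OF h x(1)] \<pi>_cl[OF g D1_L[OF dh x(1)]] by simp
  note cd = cv_dual[OF dh dg]
  have cvk: "cv (dd h) (dd g) k = (if g = h then dd h k else 0)" if k: "k : GL" for k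
   unfolding cv_GL[OF dh dg k] using dd_GL(2)[OF h k] dd_GL(2)[OF g k] by simp
  show "\<pi> g (\<pi> h X) = (if g = h then \<pi> h X else \<zero>[VV])"
  proof(cases "g = h")
   case True
   have "eqv 1 (L (cv (dd h) (dd g)) x) (L (dd h) x)" by(rule eqv_dual(1)[OF cd dh _ x2]) (use cvk True in simp)
   then show ?thesis
    unfolding 1 using True cl_1_eq_iff[OF F_L'[OF cd x2] F_L'[OF dh x2]] by(simp only: x(2) \<pi>_cl[OF h x(1)] if_True simp_thms)
  next
   case False
   have e: "eqv 1 (L (cv (dd h) (dd g)) x) (L (%_. 0) x)" by(rule eqv_dual(1)[OF cd zd _ x2]) (use cvk False in simp)
   have "L (%_. 0) x : F 1" using F_L[of "%_. 0" x 1] zd x2 by(simp add: J_def numeral_2_eq_2)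
   then have "L (cv (dd h) (dd g)) x : F 1" using eqv_mem[OF e] by blast
   then show ?thesis unfolding 1 using False cl_1_zero_iff[OF F_L'[OF cd x2]] by(simp only: if_False diag_one_simps)
  qed
  note kc = cj_GL[OF h g]
  have "L (dd (cj h g)) (cj h x) = cj h (L (%u. dd (cj h g) (cj h u)) x)" by(rule L_cj[OF dd_GL(1)[OF kc] h xc])
  moreover have "eqv 1 (L (%u. dd (cj h g) (cj h u)) x) (L (dd g) x)"
  proof(rule eqv_dual(1)[OF cj_dual[OF h dd_GL(1)[OF kc]] dg _ x2])
   fix u assume u: "u : GL"
   show "dd (cj h g) (cj h u) = dd g u" unfolding dd_cj[OF h kc u] cj_cj(1)[OF h GL_D(1)[OF g]] ..
  qed
  ultimately have "eqv 1 (L (dd (cj h g)) (cj h x)) (cj h (L (dd g) x))" using eqv_cj[OF h] by simp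
  then have "cl 1 (cj h (L (dd g) x)) = cl 1 (L (dd (cj h g)) (cj h x))"
   using cl_D1_eq_iff[OF D1_L[OF dd_GL(1)[OF kc] D1_cj[OF h x(1)]] D1_cj[OF h D1_L[OF dg x(1)]]] by metis
  then show "sig h (\<pi> g X) = \<pi> (h \<otimes>[grouplikes H] g \<otimes>[grouplikes H] gi h) (sig h X)"
   unfolding G cj_def[symmetric] x(2) \<pi>_cl[OF g x(1)] sig_cl[OF h x(1)] sig_cl[OF h D1_L[OF dg x(1)]] \<pi>_cl[OF kc D1_cj[OF h x(1)]] .
 }
qed

text \<open>A nonzero eigenvector of \<open>s\<close> in degree \<open>s\<close> lifts to a skew
  element outside the coradical, and multiplication by \<open>s\<close> from the right turns its
  eigenvalue equation into the commutation rule of \<open>skew_eigenvalue\<close>.\<close>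

theorem minus_one_type_of_real:
 assumes real: "real_group (grouplikes H)"
 shows "minus_one_type H"
 unfolding minus_one_type_def
proof(rule graded_rep.minus_one_type_of_eigenvalues[OF VV_graded_rep real])
 fix s v q
 assume s: "s : GL" and v: "v : graded_rep.comp VV \<pi> s" and v0: "v ~= \<zero>[VV]" and q: "sig s v = q \<odot>[VV] v"
 have vc: "v : car VV" "\<pi> s v = v" using v unfolding graded_rep.comp_def[OF VV_graded_rep] by blast+
 from vc(1) obtain x where x: "x : D1" "v = cl 1 x" by(rule VV_E)
 note xc = D1_D(2)[OF x(1)] and x2 = D1_D(1)[OF x(1)]
 have xF: "x \<notin> F 1" using v0 cl_1_zero_iff[OF x2] unfolding x(2) diag_one_simps by blast
 have "skew s x"
 proof(rule D1_skew[OF x(1) s])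
  fix g assume g: "g : GL"
  have dF: "(if g = s then x else \<zero>) : F 2" using x2 F_D(2) by simp
  have "\<pi> g v = (if g = s then v else \<zero>[VV])"
   using graded_rep.\<pi>_\<pi>[OF VV_graded_rep g s vc(1)] vc(2) by simp
  then have "cl 1 (L (dd g) x) = cl 1 (if g = s then x else \<zero>)"
   unfolding x(2) \<pi>_cl[OF g x(1)] diag_one_simps using cl_1_zero_iff[OF F_D(2)] F_1_D(2) by simp
  then show "eqv 1 (L (dd g) x) (if g = s then x else \<zero>)" by(rule iffD1[OF cl_1_eq_iff[OF L_F2[OF g x2] dF]])
 qed
 note sc = GL_D(1)[OF s] and ic = GL_D(1)[OF GL_inv(1)[OF s]]
 have "cl 1 (cj s x) = cl 1 (q \<odot> x)"
  using q unfolding x(2) sig_cl[OF s x(1)] diag_one_simps cl_1_smult[OF x2] .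
 then have "eqv 1 (cj s x) (q \<odot> x)" by(rule iffD1[OF cl_1_eq_iff[OF cj_F[OF s x2] F_D(4)[OF x2]]])
 then have "eqv 1 (cj s x \<otimes> s) (q \<odot> x \<otimes> s)" by(rule eqv_GL_right[OF s])
 moreover have "cj s x \<otimes> s = s \<otimes> x"
  unfolding cj_def using H_assoc[OF H_closed[OF sc xc] ic sc] GL_inv(3)[OF s] H_r_one[OF H_closed[OF sc xc]] by simp
 moreover have "q \<odot> x \<otimes> s = q \<odot> (x \<otimes> s)" using lhomD(3)[OF m_lin1[OF sc] xc] .
 ultimately have "eqv 1 (s \<otimes> x) (q \<odot> (x \<otimes> s))" by simp
 then show "q = -1" by(rule skew_eigenvalue[OF real \<open>skew s x\<close> xF])
qed

end

text \<open>By contraposition: with finite dimension added, the hypotheses put \<open>H\<close> into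
  \<open>fd_pointed\<close>, where reality of the group yields the \<open>-1\<close>-type.\<close>

theorem proposition2p6:
  fixes H :: "'h hopf"
  assumes "hopf_algebra H"
    and "pointed H"
    and "finite (carrier (grouplikes H))"
    and "real_group (grouplikes H)"
    and "\<not> minus_one_type H"
  shows "\<not> vectorspace.fin_dim CC H"
  using fd_pointed.minus_one_type_of_real[OF fd_pointed.intro[OF assms(1-3)] assms(4)] assms(5) by blast

end
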